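(* Let $K$ be a field of prime characteristic $p>2$ with $[K:K^p]<\infty$, and let $f=x_1^{d_1}\cdots x_n^{d_n}$ be a monomial in $S=K[\![x_1,\dots,x_n]\!]$ where $d_j$ is a positive integer for each $1\le j\le n$. Then: 1) If $d_j=1$ for each $1\le j\le n$, then $\mathbb S(S[\![z]\!]/(f+z^2))=\frac{1}{2^{n-1}}$. 2) If $d=\max\{d_1,\dots,d_n\}\ge 2$, then $\mathbb S(S[\![z]\!]/(f+z^2))=0$.
   Context: $z$ is a new variable over $S$ and $\mathbb S$ denotes the F-signature. For a ring $A$ of characteristic $p$ and $e\ge1$, $F_*^e(A)$ is the $A$-module equal to $A$ as an abelian group (the element corresponding to $m$ is written $F_*^e(m)$) with $aF_*^e(m)=F_*^e(a^{p^e}m)$. F-signature: let $(A,\mathfrak m,k)$ be a Noetherian local ring of prime characteristic $p$ and dimension $D$ that is F-finite (i.e. $F_*^1(A)$ is a finitely generated $A$-module). Let $a_e(A)$ be the maximal rank of a free direct summand of $F_*^e(A)$, i.e. the unique nonnegative integer with $F_*^e(A)\cong A^{a_e(A)}\oplus M_e$ where $M_e$ has no nonzero free direct summand. With $\alpha(A)=\log_p[k:k^p]$, the F-signature is $\mathbb S(A)=\lim_{e\to\infty}a_e(A)/p^{e(D+\alpha(A))}$. *)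

theory Defs
  imports "HOL-Algebra.Algebra" "HOL-Library.Extended_Nat" Complex_Main
begin

section \<open>Formal power series rings over a ring record\<close>

definition exponents :: "'v set \<Rightarrow> ('v \<Rightarrow> nat) set" where
  "exponents I = {m. \<forall>i. i \<notin> I \<longrightarrow> m i = 0}"

text \<open>
  The ring of formal power series over \<open>R\<close> in the variables indexed by the (finite) set \<open>I\<close>. A
  power series is its coefficient function; \<open>k \<le> m\<close> and \<open>m - k\<close> below are pointwise. Since the
  coefficients may come from any ring record, the construction can be iterated.
\<close>

definition power_series_ring ::
    "('a, 'b) ring_scheme \<Rightarrow> 'v set \<Rightarrow> (('v \<Rightarrow> nat) \<Rightarrow> 'a) ring" where
  "power_series_ring R I =
    \<lparr> carrier = exponents I \<rightarrow>\<^sub>E carrier R,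
      monoid.mult = (\<lambda>f g. \<lambda>m\<in>exponents I. \<Oplus>\<^bsub>R\<^esub>k\<in>{k. k \<le> m}. f k \<otimes>\<^bsub>R\<^esub> g (m - k)),
      monoid.one = (\<lambda>m\<in>exponents I. if m = (\<lambda>_. 0) then \<one>\<^bsub>R\<^esub> else \<zero>\<^bsub>R\<^esub>),
      ring.zero = (\<lambda>m\<in>exponents I. \<zero>\<^bsub>R\<^esub>),
      ring.add = (\<lambda>f g. \<lambda>m\<in>exponents I. f m \<oplus>\<^bsub>R\<^esub> g m) \<rparr>"

definition ps_const :: "('a, 'b) ring_scheme \<Rightarrow> 'v set \<Rightarrow> 'a \<Rightarrow> (('v \<Rightarrow> nat) \<Rightarrow> 'a)" where
  "ps_const R I a = (\<lambda>m\<in>exponents I. if m = (\<lambda>_. 0) then a else \<zero>\<^bsub>R\<^esub>)"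

definition ps_var :: "('a, 'b) ring_scheme \<Rightarrow> 'v set \<Rightarrow> 'v \<Rightarrow> (('v \<Rightarrow> nat) \<Rightarrow> 'a)" where
  "ps_var R I j =
    (\<lambda>m\<in>exponents I. if m = (\<lambda>i. if i = j then 1 else 0) then \<one>\<^bsub>R\<^esub> else \<zero>\<^bsub>R\<^esub>)"


section \<open>Rings of prime characteristic\<close>

definition has_characteristic :: "('a, 'b) ring_scheme \<Rightarrow> nat \<Rightarrow> bool" where
  "has_characteristic R p \<longleftrightarrow> (\<forall>m::nat. [m] \<cdot>\<^bsub>R\<^esub> \<one>\<^bsub>R\<^esub> = \<zero>\<^bsub>R\<^esub> \<longleftrightarrow> p dvd m)"

definition pth_powers :: "nat \<Rightarrow> ('a, 'b) ring_scheme \<Rightarrow> 'a set" where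
  "pth_powers p k = (\<lambda>x. x [^]\<^bsub>k\<^esub> p) ` carrier k"

text \<open>
  The module \<open>F\<^sub>*\<^sup>e(A)\<close>. The multiplicative fields of the record play no role for its module
  structure.
\<close>

definition frobenius_pushforward ::
    "nat \<Rightarrow> nat \<Rightarrow> ('a, 'b) ring_scheme \<Rightarrow> ('a, 'a) module" where
  "frobenius_pushforward p e A =
    \<lparr> carrier = carrier A, monoid.mult = monoid.mult A, monoid.one = monoid.one A,
      ring.zero = ring.zero A, ring.add = ring.add A,
      smult = (\<lambda>a m. (a [^]\<^bsub>A\<^esub> (p ^ e)) \<otimes>\<^bsub>A\<^esub> m) \<rparr>"

definition finitely_generated_module ::
    "('a, 'b) ring_scheme \<Rightarrow> ('a, 'c, 'd) module_scheme \<Rightarrow> bool" where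
  "finitely_generated_module R M \<longleftrightarrow>
    (\<exists>B \<subseteq> carrier M. finite B \<and> (\<forall>H. submodule H R M \<and> B \<subseteq> H \<longrightarrow> H = carrier M))"

definition F_finite :: "nat \<Rightarrow> ('a, 'b) ring_scheme \<Rightarrow> bool" where
  "F_finite p A \<longleftrightarrow> finitely_generated_module A (frobenius_pushforward p 1 A)"


section \<open>Free direct summands\<close>

definition free_submodule ::
    "('a, 'b) ring_scheme \<Rightarrow> ('a, 'c, 'd) module_scheme \<Rightarrow> 'c set \<Rightarrow> nat \<Rightarrow> bool" where
  "free_submodule R M F r \<longleftrightarrow> submodule F R M \<and>
    (\<exists>b \<in> {..<r} \<rightarrow> F.
      bij_betw (\<lambda>c. \<Oplus>\<^bsub>M\<^esub>i\<in>{..<r}. c i \<odot>\<^bsub>M\<^esub> b i) ({..<r} \<rightarrow>\<^sub>E carrier R) F)"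

definition has_free_summand ::
    "('a, 'b) ring_scheme \<Rightarrow> ('a, 'c, 'd) module_scheme \<Rightarrow> nat \<Rightarrow> bool" where
  "has_free_summand R M r \<longleftrightarrow>
    (\<exists>F N. free_submodule R M F r \<and> submodule N R M \<and>
       F <+>\<^bsub>M\<^esub> N = carrier M \<and> F \<inter> N = {\<zero>\<^bsub>M\<^esub>})"

text \<open>
  The maximum exists for a finitely generated module over a nonzero commutative ring, which is the
  only situation in which it is used.
\<close>

definition max_free_rank ::
    "('a, 'b) ring_scheme \<Rightarrow> ('a, 'c, 'd) module_scheme \<Rightarrow> nat" where
  "max_free_rank R M = (GREATEST r. has_free_summand R M r)"


section \<open>The F-signature\<close>

definition krull_dim :: "('a, 'b) ring_scheme \<Rightarrow> enat" where
  "krull_dim R = Sup {enat l | l. \<exists>P :: nat \<Rightarrow> 'a set.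
     (\<forall>i\<le>l. primeideal (P i) R) \<and> (\<forall>i<l. P i \<subset> P (Suc i))}"

locale F_finite_local_ring = cring A + noetherian_ring A
  for p :: nat and A :: "('a, 'b) ring_scheme" (structure) +
  assumes prime_p: "Factorial_Ring.prime p"
    and char_p: "has_characteristic A p"
    and local: "\<exists>!\<mm>. maximalideal \<mm> A"
    and F_finite: "F_finite p A"

definition residue_field :: "('a, 'b) ring_scheme \<Rightarrow> 'a set ring" where
  "residue_field A = A Quot (THE \<mm>. maximalideal \<mm> A)"

definition F_alpha :: "nat \<Rightarrow> ('a, 'b) ring_scheme \<Rightarrow> real" where
  "F_alpha p A = (let k = residue_field A
     in log (real p) (real (ring.dim k (pth_powers p k) (carrier k))))"

text \<open>
  \<open>has_F_signature p A s\<close> says that the F-signature of \<open>A\<close> is defined (\<open>A\<close> belongs to the class of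
  rings considered and the limit exists) and equals \<open>s\<close>.
\<close>

definition has_F_signature :: "nat \<Rightarrow> ('a, 'b) ring_scheme \<Rightarrow> real \<Rightarrow> bool" where
  "has_F_signature p A s \<longleftrightarrow> F_finite_local_ring p A \<and>
    (\<exists>D::nat. krull_dim A = enat D \<and>
      (\<lambda>e. real (max_free_rank A (frobenius_pushforward p e A))
             / real p powr (real e * (real D + F_alpha p A))) \<longlonglongrightarrow> s)"

end

(*
  Write S = K[[x_1, ..., x_n]] and A = S[[z]]/(z^2 + f) = S + S z, and let q = p^e, h = (q - 1)/2. If the
  l_i form a basis of K over K^q, the elements l_i x^a and l_i x^a z with 0 <= a_j < q generate
  F^e_*(A) over S, and z acts on them by z^q = (-f)^h z, that is, up to sign by

    l_i x^a |-> l_i x^(a + h d) z   and   l_i x^a z |-> l_i x^(a + (h + 1) d).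

  A generator l_i x^a (resp. l_i x^a z) spans a free summand exactly when a_j + h d_j < q (resp.
  a_j + (h + 1) d_j < q) for all j: the dual functional is then built from a coordinate function of
  S over S^q, and otherwise z phi(l_i x^a) is divisible by some x_j, which forces every functional
  phi to map the generator into the maximal ideal. Hence, with truncated subtraction,

    a_e(A) = [K : K^p]^e (prod_j (q - h d_j) + prod_j (q - (h + 1) d_j)),

  and after division by q^n [K : K^p]^e each factor tends to max(0, 1 - d_j/2).

  The dimension of A is n because primes of A contract to primes of S without collisions, and a chain
  of primes of S has length at most n: by division with respect to a monomial order, S satisfies the
  Artin-Rees property, so the growth exponent of the Hilbert function drops along every proper inclusion
  of primes.
*)
theory Submission
  imports Defs "HOL-Library.Function_Algebras"
begin

section \<open>Rings of formal power series\<close>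

text \<open>Leading terms need a monomial order that is total, compatible with products and of order
  type omega. Weighting the variables by distinct primes gives one: the exponent \<open>m\<close>
  gets the integer \<open>nrm m\<close>, unique factorisation makes this injective, and division can
  run through the norms 0, 1, 2, ... with every coefficient settled after finitely many stages.
  Thresholds 2^k turn products of norms into sums of levels, and at most k^n monomials lie below
  2^k. \<open>A\<close> need not be a domain (z^2 + f splits when -f is a square), so the zero ideal
  may fail to be prime and cannot start a chain of primes. A prime maximal among the ideals that
  meet the base ring in zero takes its place. For the upper bound on the rank, dual functionals are
  tested modulo the maximal ideal: the coordinates that survive live in a K-space of dimension
  \<open>card (gidx e)\<close>. A linear dependence there, with its coefficients raised to q-th
  powers, would be sent by a dual functional to a nonzero constant inside the maximal ideal.\<close>

lemma (in comm_monoid) finprod_Sigma: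
  assumes "finite A" "\<And>a. a \<in> A \<Longrightarrow> finite (B a)"
    and "\<And>a b. a \<in> A \<Longrightarrow> b \<in> B a \<Longrightarrow> g a b \<in> carrier G"
  shows "(\<Otimes>a\<in>A. \<Otimes>b\<in>B a. g a b) = (\<Otimes>x\<in>Sigma A B. g (fst x) (snd x))"
proof -
  have "(\<Otimes>x\<in>Sigma A B. g (fst x) (snd x))
      = (\<Otimes>x\<in>(\<Union>a\<in>A. Pair a ` B a). g (fst x) (snd x))"
    by (rule arg_cong[where f = "finprod G _"]) auto
  also have "\<dots> = (\<Otimes>a\<in>A. \<Otimes>x\<in>Pair a ` B a. g (fst x) (snd x))"
    by (rule finprod_UN_disjoint) (use assms in \<open>auto simp: pairwise_def disjnt_def\<close>)
  also have "\<dots> = (\<Otimes>a\<in>A. \<Otimes>b\<in>B a. g a b)"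
  proof (rule finprod_cong')
    fix a assume a: "a \<in> A"
    show "(\<Otimes>x\<in>Pair a ` B a. g (fst x) (snd x)) = (\<Otimes>b\<in>B a. g a b)"
      by (subst finprod_reindex) (use assms a in \<open>auto simp: inj_on_def\<close>)
  qed (use assms in \<open>auto intro!: finprod_closed\<close>)
  finally show ?thesis by simp
qed

lemmas (in abelian_monoid) finsum_Sigma = add.finprod_Sigma

lemma (in abelian_monoid) finsum_all_zero:
  "(\<And>x. x \<in> T \<Longrightarrow> g x = \<zero>) \<Longrightarrow> finsum G g T = \<zero>"
  by (rule add.finprod_one_eqI)

lemma (in abelian_monoid) finsum_single_term:
  assumes "finite T" "i \<in> T" "g i \<in> carrier G" "\<And>j. j \<in> T \<Longrightarrow> j \<noteq> i \<Longrightarrow> g j = \<zero>"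
  shows "finsum G g T = g i"
proof -
  have "finsum G g T = finsum G (\<lambda>j. if i = j then (\<lambda>_. g i) j else \<zero>) T"
    by (rule finsum_cong') (use assms in auto)
  also have "\<dots> = g i"
    using finsum_singleton[OF assms(2,1), of "\<lambda>_. g i"] assms(3) by auto
  finally show ?thesis .
qed

section \<open>Exponent vectors and their pointwise order\<close>

lemma zero_in_exponents [simp]: "0 \<in> exponents I"
  by (simp add: exponents_def)

lemma add_in_exponents [intro]: "a \<in> exponents I \<Longrightarrow> b \<in> exponents I \<Longrightarrow> a + b \<in> exponents I"
  by (simp add: exponents_def)

lemma le_in_exponents: "m \<in> exponents I \<Longrightarrow> k \<le> m \<Longrightarrow> k \<in> exponents I"
  unfolding exponents_def le_fun_def by (simp, metis le_zero_eq)

lemma diff_in_exponents [intro]: "m \<in> exponents I \<Longrightarrow> m - k \<in> exponents I"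
  by (simp add: exponents_def fun_diff_def)

lemma finite_exponents_le:
  assumes "finite I" "m \<in> exponents I"
  shows "finite {k. k \<le> m}"
proof -
  have "{k. k \<le> m} \<subseteq> (\<lambda>f i. if i \<in> I then f i else 0) ` (Pi\<^sub>E I (\<lambda>i. {..m i}))"
  proof
    fix k assume "k \<in> {k. k \<le> m}"
    then have k: "k \<le> m" by simp
    then have "k = (\<lambda>i. if i \<in> I then restrict k I i else 0)"
      using le_in_exponents[OF assms(2) k] by (auto simp: exponents_def fun_eq_iff)
    moreover have "restrict k I \<in> Pi\<^sub>E I (\<lambda>i. {..m i})" using k by (auto simp: le_fun_def)
    ultimately show "k \<in> (\<lambda>f i. if i \<in> I then f i else 0) ` (Pi\<^sub>E I (\<lambda>i. {..m i}))" by blast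
  qed
  then show ?thesis
    by (rule finite_subset) (simp add: assms finite_PiE)
qed

lemma fun_diff_diff_nat: "(m :: 'v \<Rightarrow> nat) - j - i = m - (j + i)"
  by (auto simp: fun_eq_iff fun_diff_def)

lemma fun_add_diff_nat [simp]: "((a :: 'v \<Rightarrow> nat) + b) - a = b"
  by (auto simp: fun_eq_iff fun_diff_def)

lemma fun_le_add_nat [simp]: "(a :: 'v \<Rightarrow> nat) \<le> a + b" "b \<le> a + b"
  by (auto simp: le_fun_def)

lemma fun_le_diff_add_nat: "a \<le> m \<Longrightarrow> a + (m - a) = (m :: 'v \<Rightarrow> nat)"
  by (auto simp: le_fun_def fun_eq_iff fun_diff_def)

lemma fun_diff_self_nat [simp]: "m - m = (0 :: 'v \<Rightarrow> nat)"
  by (auto simp: fun_eq_iff fun_diff_def)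

text \<open>Finiteness of \<open>I\<close> keeps every convolution range
  \<open>{k. k \<le> m}\<close> finite; over an infinite range \<open>finsum\<close> has the default
  value zero and the product would lose its meaning. The coefficients are only a commutative ring
  because the construction is iterated: the variable \<open>z\<close> is adjoined to a ring that is
  already a power series ring.\<close>

locale power_series = R?: cring R for R :: "('a, 'b) ring_scheme" (structure) +
  fixes I :: "'v set"
  assumes finI: "finite I"
begin

abbreviation E where "E \<equiv> exponents I"
abbreviation P where "P \<equiv> power_series_ring R I"

lemma P_carrier: "carrier P = E \<rightarrow>\<^sub>E carrier R"
  by (simp add: power_series_ring_def)

lemma coeff_closed [simp, intro]: "f \<in> carrier P \<Longrightarrow> m \<in> E \<Longrightarrow> f m \<in> carrier R"
  by (auto simp: P_carrier)

lemma ps_eqI: "f \<in> carrier P \<Longrightarrow> g \<in> carrier P \<Longrightarrow> (\<And>m. m \<in> E \<Longrightarrow> f m = g m) \<Longrightarrow> f = g"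
  unfolding P_carrier by (rule PiE_ext)

lemma fin_le: "m \<in> E \<Longrightarrow> finite {k. k \<le> m}"
  by (rule finite_exponents_le[OF finI])

lemma coeff_mult:
  "m \<in> E \<Longrightarrow> (f \<otimes>\<^bsub>P\<^esub> g) m = (\<Oplus>k\<in>{k. k \<le> m}. f k \<otimes> g (m - k))"
  by (simp add: power_series_ring_def)

lemma coeff_add [simp]: "m \<in> E \<Longrightarrow> (f \<oplus>\<^bsub>P\<^esub> g) m = f m \<oplus> g m"
  by (simp add: power_series_ring_def)

lemma coeff_zero [simp]: "m \<in> E \<Longrightarrow> \<zero>\<^bsub>P\<^esub> m = \<zero>"
  by (simp add: power_series_ring_def)

lemma coeff_one: "m \<in> E \<Longrightarrow> \<one>\<^bsub>P\<^esub> m = (if m = 0 then \<one> else \<zero>)"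
  by (simp add: power_series_ring_def zero_fun_def)

lemma conv_summand [simp, intro]:
  "f \<in> carrier P \<Longrightarrow> g \<in> carrier P \<Longrightarrow> m \<in> E \<Longrightarrow> k \<le> m \<Longrightarrow> f k \<otimes> g (m - k) \<in> carrier R"
  using le_in_exponents diff_in_exponents by fast

lemma P_mult_closed: "f \<in> carrier P \<Longrightarrow> g \<in> carrier P \<Longrightarrow> f \<otimes>\<^bsub>P\<^esub> g \<in> carrier P"
  by (auto simp: power_series_ring_def intro!: finsum_closed conv_summand[unfolded P_carrier])

lemma P_add_closed: "f \<in> carrier P \<Longrightarrow> g \<in> carrier P \<Longrightarrow> f \<oplus>\<^bsub>P\<^esub> g \<in> carrier P"
  by (auto simp: power_series_ring_def)

lemma P_zero_closed: "\<zero>\<^bsub>P\<^esub> \<in> carrier P"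
  by (auto simp: power_series_ring_def)

lemma P_one_closed: "\<one>\<^bsub>P\<^esub> \<in> carrier P"
  by (auto simp: power_series_ring_def)

text \<open>Both sides run over the decompositions of \<open>m\<close> into three exponents; the map
  from (j, i) to (j + i, j) matches the two index sets. This is the rearrangement behind
  associativity.\<close>

lemma conv_reindex:
  assumes "m \<in> E" and F: "\<And>j i. j \<in> E \<Longrightarrow> i \<in> E \<Longrightarrow> F j i (m - (j + i)) \<in> carrier R"
  shows "(\<Oplus>k\<in>{k. k \<le> m}. \<Oplus>j\<in>{j. j \<le> k}. F j (k - j) (m - k))
       = (\<Oplus>j\<in>{j. j \<le> m}. \<Oplus>i\<in>{i. i \<le> m - j}. F j i (m - (j + i)))"
proof -
  let ?A = "Sigma {j. j \<le> m} (\<lambda>j. {i. i \<le> m - j})"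
  let ?B = "Sigma {k. k \<le> m} (\<lambda>k. {j. j \<le> k})"
  let ?h = "\<lambda>x :: ('v \<Rightarrow> nat) \<times> ('v \<Rightarrow> nat). (fst x + snd x, fst x)"
  let ?G = "\<lambda>x. F (snd x) (fst x - snd x) (m - fst x)"
  have le1: "j + i \<le> m" if "j \<le> m" "i \<le> m - j" for i j
    using that by (auto simp: le_fun_def fun_diff_def le_diff_conv2 add.commute)
  have le2: "k - j \<le> m - j" if "k \<le> m" for j k
    using that by (auto simp: le_fun_def fun_diff_def diff_le_mono)
  have inB: "?B = ?h ` ?A"
  proof (intro equalityI subsetI)
    fix x assume "x \<in> ?B"
    then obtain k j where x: "x = (k, j)" "k \<le> m" "j \<le> k" by auto
    then have "x = ?h (j, k - j)" "(j, k - j) \<in> ?A"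
      using le2 by (auto simp: fun_le_diff_add_nat intro: order_trans)
    then show "x \<in> ?h ` ?A" by blast
  qed (use le1 in auto)
  have inj: "inj_on ?h ?A" by (auto simp: inj_on_def)
  have Gc: "?G x \<in> carrier R" if xB: "x \<in> ?B" for x
  proof -
    obtain k j where x: "x = (k, j)" "k \<le> m" "j \<le> k" using xB by auto
    have "j + (k - j) = k" using x by (simp add: fun_le_diff_add_nat)
    moreover have "k \<in> E" using x assms(1) le_in_exponents by blast
    ultimately show ?thesis using F[of j "k - j"] x le_in_exponents[of k I j] by auto
  qed
  have "(\<Oplus>k\<in>{k. k \<le> m}. \<Oplus>j\<in>{j. j \<le> k}. F j (k - j) (m - k)) = finsum R ?G ?B"
    by (subst finsum_Sigma) (use Gc assms(1) fin_le le_in_exponents in \<open>fastforce+\<close>)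
  also have "\<dots> = finsum R (\<lambda>x. ?G (?h x)) ?A"
    unfolding inB by (rule finsum_reindex) (use Gc inj in \<open>auto simp: inB\<close>)
  also have "\<dots> = finsum R (\<lambda>x. F (fst x) (snd x) (m - (fst x + snd x))) ?A"
    by simp
  also have "\<dots> = (\<Oplus>j\<in>{j. j \<le> m}. \<Oplus>i\<in>{i. i \<le> m - j}. F j i (m - (j + i)))"
    by (rule finsum_Sigma[symmetric, where g = "\<lambda>j i. F j i (m - (j + i))"])
       (use fin_le F le_in_exponents[OF assms(1)] diff_in_exponents[OF assms(1)]
          le_in_exponents[OF diff_in_exponents[OF assms(1)]] assms(1) in \<open>simp_all add: F\<close>)
  finally show ?thesis .
qed

lemma P_assoc:
  assumes "f \<in> carrier P" "g \<in> carrier P" "h \<in> carrier P"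
  shows "(f \<otimes>\<^bsub>P\<^esub> g) \<otimes>\<^bsub>P\<^esub> h = f \<otimes>\<^bsub>P\<^esub> (g \<otimes>\<^bsub>P\<^esub> h)"
proof (rule ps_eqI)
  fix m assume m: "m \<in> E"
  have fin: "finite {k. k \<le> a}" if "a \<in> E" for a using that by (rule fin_le)
  have "((f \<otimes>\<^bsub>P\<^esub> g) \<otimes>\<^bsub>P\<^esub> h) m
      = (\<Oplus>k\<in>{k. k \<le> m}. (\<Oplus>j\<in>{j. j \<le> k}. f j \<otimes> g (k - j)) \<otimes> h (m - k))"
    unfolding coeff_mult[OF m]
    by (rule finsum_cong')
       (use m le_in_exponents[OF m] assms diff_in_exponents[OF m] in \<open>auto simp: coeff_mult intro!: m_closed finsum_closed\<close>)
  also have "\<dots> = (\<Oplus>k\<in>{k. k \<le> m}. \<Oplus>j\<in>{j. j \<le> k}. (f j \<otimes> g (k - j)) \<otimes> h (m - k))"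
    by (rule finsum_cong')
       (use m le_in_exponents[OF m] assms diff_in_exponents[OF m] fin in \<open>auto intro!: finsum_ldistr finsum_closed m_closed conv_summand\<close>)
  also have "\<dots> = (\<Oplus>j\<in>{j. j \<le> m}. \<Oplus>i\<in>{i. i \<le> m - j}. (f j \<otimes> g i) \<otimes> h (m - (j + i)))"
    by (rule conv_reindex[OF m, where F = "\<lambda>j i l. (f j \<otimes> g i) \<otimes> h l"])
       (intro m_closed coeff_closed diff_in_exponents; use assms m in simp)
  also have "\<dots> = (\<Oplus>j\<in>{j. j \<le> m}. f j \<otimes> (\<Oplus>i\<in>{i. i \<le> m - j}. g i \<otimes> h (m - j - i)))"
  proof (rule finsum_cong', goal_cases)
    case 2
    show ?case using le_in_exponents[OF m] assms diff_in_exponents[OF m] by (auto intro!: finsum_closed m_closed)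
  next
    case (3 j)
    then have jE: "j \<in> E" and mj: "m - j \<in> E" using m le_in_exponents diff_in_exponents by auto
    have "f j \<otimes> (\<Oplus>i\<in>{i. i \<le> m - j}. g i \<otimes> h (m - j - i))
        = (\<Oplus>i\<in>{i. i \<le> m - j}. f j \<otimes> (g i \<otimes> h (m - j - i)))"
      by (rule finsum_rdistr) (use jE mj assms fin in auto)
    also have "\<dots> = (\<Oplus>i\<in>{i. i \<le> m - j}. (f j \<otimes> g i) \<otimes> h (m - (j + i)))"
      by (rule finsum_cong')
         (use jE mj m assms le_in_exponents[OF mj] diff_in_exponents[OF m] in \<open>auto simp: m_assoc fun_diff_diff_nat\<close>)
    finally show ?case by simp
  qed simp
  also have "\<dots> = (f \<otimes>\<^bsub>P\<^esub> (g \<otimes>\<^bsub>P\<^esub> h)) m"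
    unfolding coeff_mult[OF m]
    by (rule finsum_cong')
       (use m le_in_exponents[OF m] assms diff_in_exponents[OF m] in \<open>auto simp: coeff_mult P_mult_closed intro!: m_closed finsum_closed\<close>)
  finally show "((f \<otimes>\<^bsub>P\<^esub> g) \<otimes>\<^bsub>P\<^esub> h) m = (f \<otimes>\<^bsub>P\<^esub> (g \<otimes>\<^bsub>P\<^esub> h)) m" .
qed (use assms P_mult_closed in auto)

lemma P_comm:
  assumes "f \<in> carrier P" "g \<in> carrier P"
  shows "f \<otimes>\<^bsub>P\<^esub> g = g \<otimes>\<^bsub>P\<^esub> f"
proof (rule ps_eqI)
  fix m assume m: "m \<in> E"
  have mm: "m - (m - k) = k" if "k \<le> m" for k
    using that by (auto simp: le_fun_def fun_diff_def fun_eq_iff)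
  have im: "(\<lambda>k. m - k) ` {k. k \<le> m} = {k. k \<le> m}"
    by (auto simp: image_iff) (auto simp: le_fun_def fun_diff_def, metis fun_diff_def mm le_fun_def diff_le_self)
  have inj: "inj_on (\<lambda>k. m - k) {k. k \<le> m}" by (rule inj_onI) (metis mm mem_Collect_eq)
  have "(f \<otimes>\<^bsub>P\<^esub> g) m = (\<Oplus>k\<in>(\<lambda>k. m - k) ` {k. k \<le> m}. f k \<otimes> g (m - k))"
    unfolding im coeff_mult[OF m] ..
  also have "\<dots> = (\<Oplus>k\<in>{k. k \<le> m}. f (m - k) \<otimes> g (m - (m - k)))"
    by (rule finsum_reindex) (use inj assms m in \<open>auto simp: im\<close>)
  also have "\<dots> = (\<Oplus>k\<in>{k. k \<le> m}. g k \<otimes> f (m - k))"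
    by (rule finsum_cong')
       (use assms m le_in_exponents[OF m] diff_in_exponents[OF m] in \<open>auto simp: mm intro: m_comm\<close>)
  finally show "(f \<otimes>\<^bsub>P\<^esub> g) m = (g \<otimes>\<^bsub>P\<^esub> f) m" unfolding coeff_mult[OF m] .
qed (use assms P_mult_closed in auto)

section \<open>Series with a single term: constants, variables and monomials\<close>

definition mon :: "('v \<Rightarrow> nat) \<Rightarrow> 'a \<Rightarrow> ('v \<Rightarrow> nat) \<Rightarrow> 'a" where
  "mon a c = (\<lambda>m\<in>E. if m = a then c else \<zero>)"

lemma coeff_mon: "m \<in> E \<Longrightarrow> mon a c m = (if m = a then c else \<zero>)"
  by (simp add: mon_def)

lemma mon_closed [simp, intro]: "c \<in> carrier R \<Longrightarrow> mon a c \<in> carrier P"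
  by (auto simp: mon_def P_carrier)

lemma ps_const_eq_mon: "ps_const R I c = mon 0 c"
  by (simp add: ps_const_def mon_def zero_fun_def)

lemma ps_var_eq_mon: "ps_var R I j = mon (\<lambda>i. if i = j then 1 else 0) \<one>"
  by (simp add: ps_var_def mon_def)

lemma one_eq_mon: "\<one>\<^bsub>P\<^esub> = mon 0 \<one>"
  by (rule ps_eqI) (simp_all add: P_one_closed coeff_one coeff_mon)

lemma coeff_mon_mult:
  assumes "c \<in> carrier R" "g \<in> carrier P" "a \<in> E" "m \<in> E"
  shows "(mon a c \<otimes>\<^bsub>P\<^esub> g) m = (if a \<le> m then c \<otimes> g (m - a) else \<zero>)"
proof (cases "a \<le> m")
  case True
  have "(mon a c \<otimes>\<^bsub>P\<^esub> g) m = (\<lambda>k. mon a c k \<otimes> g (m - k)) a"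
    unfolding coeff_mult[OF assms(4)]
    by (rule finsum_single_term)
       (use assms True le_in_exponents[OF assms(4)] diff_in_exponents[OF assms(4)] fin_le in \<open>auto simp: coeff_mon\<close>)
  then show ?thesis using True assms by (simp add: coeff_mon)
next
  case False
  then show ?thesis
    unfolding coeff_mult[OF assms(4)]
    by simp (rule finsum_all_zero, use assms le_in_exponents[OF assms(4)] diff_in_exponents[OF assms(4)] in \<open>auto simp: coeff_mon\<close>)
qed

lemma P_is_cring: "cring P"
proof (rule cringI)
  show "abelian_group P"
  proof (rule abelian_groupI)
    fix f assume f: "f \<in> carrier P"
    let ?g = "\<lambda>m\<in>E. \<ominus> (f m)"
    have "?g \<in> carrier P" using f by (auto simp: P_carrier)
    moreover have "?g \<oplus>\<^bsub>P\<^esub> f = \<zero>\<^bsub>P\<^esub>"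
      by (rule ps_eqI) (use f \<open>?g \<in> carrier P\<close> P_add_closed P_zero_closed in \<open>auto simp: l_neg\<close>)
    ultimately show "\<exists>y\<in>carrier P. y \<oplus>\<^bsub>P\<^esub> f = \<zero>\<^bsub>P\<^esub>" by blast
  qed (auto intro!: ps_eqI P_add_closed P_zero_closed simp: a_assoc intro: a_comm[OF coeff_closed coeff_closed])
  show "comm_monoid P"
  proof (rule comm_monoidI)
    fix f assume f: "f \<in> carrier P"
    show "\<one>\<^bsub>P\<^esub> \<otimes>\<^bsub>P\<^esub> f = f"
      unfolding one_eq_mon
      by (rule ps_eqI) (use f P_mult_closed in \<open>auto simp: coeff_mon_mult\<close>)
  qed (auto intro: P_mult_closed P_one_closed P_assoc P_comm)
  fix f g h assume fgh: "f \<in> carrier P" "g \<in> carrier P" "h \<in> carrier P"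
  show "(f \<oplus>\<^bsub>P\<^esub> g) \<otimes>\<^bsub>P\<^esub> h = f \<otimes>\<^bsub>P\<^esub> h \<oplus>\<^bsub>P\<^esub> g \<otimes>\<^bsub>P\<^esub> h"
  proof (rule ps_eqI)
    fix m assume m: "m \<in> E"
    have "((f \<oplus>\<^bsub>P\<^esub> g) \<otimes>\<^bsub>P\<^esub> h) m
       = (\<Oplus>k\<in>{k. k \<le> m}. f k \<otimes> h (m - k) \<oplus> g k \<otimes> h (m - k))"
      unfolding coeff_mult[OF m]
      by (rule finsum_cong')
         (use fgh m le_in_exponents[OF m] diff_in_exponents[OF m] in \<open>auto simp: l_distr\<close>)
    also have "\<dots> = (f \<otimes>\<^bsub>P\<^esub> h) m \<oplus> (g \<otimes>\<^bsub>P\<^esub> h) m"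
      unfolding coeff_mult[OF m] by (rule finsum_addf) (use fgh m in auto)
    finally show "((f \<oplus>\<^bsub>P\<^esub> g) \<otimes>\<^bsub>P\<^esub> h) m = (f \<otimes>\<^bsub>P\<^esub> h \<oplus>\<^bsub>P\<^esub> g \<otimes>\<^bsub>P\<^esub> h) m"
      using m by simp
  qed (use fgh in \<open>auto intro!: P_add_closed P_mult_closed\<close>)
qed

sublocale P: cring P by (rule P_is_cring)

lemma coeff_uminus [simp]:
  assumes "f \<in> carrier P" "m \<in> E" shows "(\<ominus>\<^bsub>P\<^esub> f) m = \<ominus> (f m)"
proof -
  have "(\<ominus>\<^bsub>P\<^esub> f \<oplus>\<^bsub>P\<^esub> f) m = \<zero>" using assms P.l_neg by simp
  then show ?thesis using assms by (simp add: minus_equality)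
qed

lemma coeff_minus [simp]:
  "f \<in> carrier P \<Longrightarrow> g \<in> carrier P \<Longrightarrow> m \<in> E \<Longrightarrow> (f \<ominus>\<^bsub>P\<^esub> g) m = f m \<ominus> g m"
  by (simp add: a_minus_def)

lemma coeff_finsum:
  assumes "finite T" "F \<in> T \<rightarrow> carrier P" "m \<in> E"
  shows "(finsum P F T) m = (\<Oplus>i\<in>T. F i m)"
  using assms
proof (induction T rule: finite_induct)
  case (insert x T)
  then have "F x \<in> carrier P" "F \<in> T \<rightarrow> carrier P" by auto
  moreover have "(\<lambda>i. F i m) \<in> T \<rightarrow> carrier R" using insert by (auto simp: Pi_iff)
  ultimately show ?case using insert by simp
qed simp

lemma mon_mult_mon:
  assumes "c \<in> carrier R" "d \<in> carrier R" "a \<in> E" "b \<in> E"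
  shows "mon a c \<otimes>\<^bsub>P\<^esub> mon b d = mon (a + b) (c \<otimes> d)"
proof (rule ps_eqI)
  fix m assume m: "m \<in> E"
  have "m - a = b \<longleftrightarrow> m = a + b" if "a \<le> m" using that by (metis fun_add_diff_nat fun_le_diff_add_nat)
  then show "(mon a c \<otimes>\<^bsub>P\<^esub> mon b d) m = mon (a + b) (c \<otimes> d) m"
    using assms m by (auto simp: coeff_mon_mult coeff_mon diff_in_exponents)
qed (use assms in auto)

lemma mon_add_mon:
  assumes "c \<in> carrier R" "d \<in> carrier R"
  shows "mon a c \<oplus>\<^bsub>P\<^esub> mon a d = mon a (c \<oplus> d)"
  by (rule ps_eqI) (use assms in \<open>auto simp: coeff_mon\<close>)

lemma mon_pow:
  assumes "c \<in> carrier R" "a \<in> E"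
  shows "mon a c [^]\<^bsub>P\<^esub> (k :: nat) = mon (\<lambda>i. k * a i) (c [^] k)"
proof (induction k)
  case 0
  show ?case by (simp add: one_eq_mon zero_fun_def)
next
  case (Suc k)
  have "(\<lambda>i. k * a i) \<in> E" using assms(2) by (simp add: exponents_def)
  moreover have "(\<lambda>i. k * a i) + a = (\<lambda>i. Suc k * a i)" by (auto simp: fun_eq_iff)
  ultimately show ?case using Suc assms by (simp add: mon_mult_mon)
qed

lemma mon_finprod:
  assumes "finite T" "\<And>j. j \<in> T \<Longrightarrow> a j \<in> E"
  shows "(\<Otimes>\<^bsub>P\<^esub>j\<in>T. mon (a j) \<one>) = mon (\<lambda>i. \<Sum>j\<in>T. a j i) \<one>"
  using assms
proof (induction T rule: finite_induct)
  case empty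
  show ?case by (simp add: one_eq_mon zero_fun_def)
next
  case (insert x T)
  have "(\<lambda>i. \<Sum>j\<in>T. a j i) \<in> E" using insert by (auto simp: exponents_def)
  moreover have "a x + (\<lambda>i. \<Sum>j\<in>T. a j i) = (\<lambda>i. \<Sum>j\<in>insert x T. a j i)"
    using insert by (auto simp: fun_eq_iff)
  ultimately show ?case using insert by (simp add: mon_mult_mon Pi_def)
qed

lemma mon_0_ring_hom: "mon 0 \<in> ring_hom R P"
  by (rule ring_hom_memI) (auto simp: mon_mult_mon mon_add_mon one_eq_mon)

end

section \<open>A monomial order\<close>

text \<open>A monotone subsequence always exists. If it is decreasing, it attains its least value
  and is constant from there on, so its tail is increasing.\<close>

lemma nat_seq_incseq_subseq:
  fixes f :: "nat \<Rightarrow> nat"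
  shows "\<exists>\<phi>. strict_mono \<phi> \<and> incseq (f \<circ> \<phi>)"
proof -
  obtain \<phi> where \<phi>: "strict_mono \<phi>" "monoseq (\<lambda>n. f (\<phi> n))"
    using seq_monosub by blast
  show ?thesis
  proof (cases "incseq (f \<circ> \<phi>)")
    case False
    then have dec: "decseq (\<lambda>n. f (\<phi> n))"
      using \<phi>(2) by (auto simp: monoseq_iff comp_def)
    define v where "v = (LEAST v. \<exists>n. f (\<phi> n) = v)"
    have "\<exists>n. f (\<phi> n) = v" unfolding v_def by (rule LeastI_ex) auto
    then obtain N where N: "f (\<phi> N) = v" by blast
    have "f (\<phi> (N + n)) = v" for n
    proof (rule antisym)
      show "f (\<phi> (N + n)) \<le> v" using decseqD[OF dec, of N "N + n"] N by simp
      show "v \<le> f (\<phi> (N + n))" unfolding v_def by (rule Least_le) blast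
    qed
    then have "incseq (f \<circ> (\<lambda>n. \<phi> (N + n)))" by (simp add: incseq_def)
    moreover have "strict_mono (\<lambda>n. \<phi> (N + n))" using \<phi>(1) by (simp add: strict_mono_def)
    ultimately show ?thesis by blast
  qed (use \<phi> in blast)
qed

text \<open>One coordinate is treated at a time: a further subsequence makes the new coordinate
  increasing and leaves the earlier ones increasing.\<close>

lemma fun_seq_incseq_subseq:
  fixes f :: "nat \<Rightarrow> 'v \<Rightarrow> nat"
  assumes "finite I"
  shows "\<exists>\<phi>. strict_mono \<phi> \<and> (\<forall>i\<in>I. incseq (\<lambda>n. f (\<phi> n) i))"
  using assms
proof (induction I rule: finite_induct)
  case empty
  show ?case using strict_mono_id by auto
next
  case (insert x I)
  then obtain \<phi> where \<phi>: "strict_mono \<phi>" "\<forall>i\<in>I. incseq (\<lambda>n. f (\<phi> n) i)" by blast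
  obtain \<psi> where \<psi>: "strict_mono \<psi>" "incseq ((\<lambda>n. f (\<phi> n) x) \<circ> \<psi>)"
    using nat_seq_incseq_subseq by blast
  have "strict_mono (\<phi> \<circ> \<psi>)" using \<phi>(1) \<psi>(1) by (rule strict_mono_o)
  moreover have "incseq (\<lambda>n. f (\<phi> (\<psi> n)) i)" if "i \<in> insert x I" for i
  proof (cases "i = x")
    case False
    then have "incseq (\<lambda>n. f (\<phi> n) i)" using that \<phi>(2) by blast
    then show ?thesis using \<psi>(1) by (simp add: incseq_def strict_mono_less_eq)
  qed (use \<psi>(2) in \<open>simp add: comp_def\<close>)
  ultimately show ?case by (intro exI[of _ "\<phi> \<circ> \<psi>"]) (simp add: comp_def)
qed

text \<open>The minimal elements of \<open>W\<close> do the job. Infinitely many of them would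
  contain an increasing sequence by \<open>fun_seq_incseq_subseq\<close>, hence two distinct
  comparable ones.\<close>

lemma Dickson:
  fixes W :: "('v \<Rightarrow> nat) set"
  assumes "finite I" "W \<subseteq> exponents I"
  shows "\<exists>F \<subseteq> W. finite F \<and> (\<forall>m\<in>W. \<exists>k\<in>F. k \<le> m)"
proof -
  define F where "F = {k \<in> W. \<forall>k'\<in>W. k' \<le> k \<longrightarrow> k' = k}"
  have "finite F"
  proof (rule ccontr)
    assume "infinite F"
    then obtain f :: "nat \<Rightarrow> 'v \<Rightarrow> nat" where f: "inj f" "range f \<subseteq> F"
      using infinite_countable_subset by blast
    obtain \<phi> where \<phi>: "strict_mono \<phi>" "\<forall>i\<in>I. incseq (\<lambda>n. f (\<phi> n) i)"
      using fun_seq_incseq_subseq[OF assms(1)] by blast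
    have "f (\<phi> 0) i \<le> f (\<phi> 1) i" for i
    proof (cases "i \<in> I")
      case True
      then show ?thesis using \<phi>(2) by (auto simp: incseq_def)
    next
      case False
      have "f n \<in> exponents I" for n using f(2) assms(2) by (auto simp: F_def)
      then show ?thesis using False by (auto simp: exponents_def)
    qed
    then have "f (\<phi> 0) \<le> f (\<phi> 1)" by (simp add: le_fun_def)
    moreover have "f (\<phi> 0) \<in> F" "f (\<phi> 1) \<in> F" using f(2) by auto
    ultimately have "f (\<phi> 0) = f (\<phi> 1)" by (auto simp: F_def)
    then have "\<phi> 0 = \<phi> 1" using f(1) by (simp add: inj_eq)
    then show False using \<phi>(1) by (simp add: strict_mono_eq)
  qed
  moreover have "\<exists>k\<in>F. k \<le> m" if m: "m \<in> W" for m
  proof -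
    \<comment> \<open>An element of \<open>W\<close> below \<open>m\<close> with least total degree
      is minimal, since anything strictly smaller would lower the sum over \<open>I\<close>.\<close>
    define k where "k = (ARG_MIN (\<lambda>k. \<Sum>i\<in>I. k i) k. k \<in> W \<and> k \<le> m)"
    have k: "k \<in> W \<and> k \<le> m" "\<And>y. y \<in> W \<and> y \<le> m \<Longrightarrow> (\<Sum>i\<in>I. k i) \<le> (\<Sum>i\<in>I. y i)"
      unfolding k_def
      using arg_min_nat_lemma[of "\<lambda>k. k \<in> W \<and> k \<le> m" m "\<lambda>k. \<Sum>i\<in>I. k i"] m by auto
    have "k' = k" if k': "k' \<in> W" "k' \<le> k" for k'
    proof (rule ccontr)
      assume "k' \<noteq> k"
      then obtain i where i: "k' i \<noteq> k i" by auto
      then have "k' i < k i" using k'(2) by (simp add: le_fun_def le_neq_implies_less)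
      moreover have "k \<in> exponents I" "k' \<in> exponents I" using k k' assms(2) by auto
      then have "i \<in> I" using i unfolding exponents_def by (metis (mono_tags, lifting) mem_Collect_eq)
      ultimately have "(\<Sum>i\<in>I. k' i) < (\<Sum>i\<in>I. k i)"
        using k'(2) assms(1) by (intro sum_strict_mono_ex1) (auto simp: le_fun_def)
      moreover have "k' \<le> m" using k' k by (meson order_trans)
      ultimately show False using k(2)[of k'] k' by auto
    qed
    then show ?thesis using k by (auto simp: F_def)
  qed
  moreover have "F \<subseteq> W" by (auto simp: F_def)
  ultimately show ?thesis by blast
qed

lemma (in cring) cring_idealI:
  assumes "J \<subseteq> carrier R" "\<zero> \<in> J" "\<And>a b. a \<in> J \<Longrightarrow> b \<in> J \<Longrightarrow> a \<oplus> b \<in> J"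
    and "\<And>a x. a \<in> J \<Longrightarrow> x \<in> carrier R \<Longrightarrow> x \<otimes> a \<in> J"
  shows "ideal J R"
proof (rule idealI)
  have "\<ominus> a \<in> J" if "a \<in> J" for a
  proof -
    have "\<ominus> \<one> \<otimes> a \<in> J" "a \<in> carrier R" using assms that by auto
    then show ?thesis by (simp add: l_minus)
  qed
  then show "subgroup J (add_monoid R)"
    using assms by (intro add.subgroupI) auto
  show "x \<otimes> a \<in> J" "a \<otimes> x \<in> J" if "a \<in> J" "x \<in> carrier R" for a x
    using assms that m_comm[of a x] by auto
qed (rule ring_axioms)

locale field_power_series = power_series R I + field R
  for R :: "('a, 'b) ring_scheme" (structure) and I :: "'v set" +
  fixes w :: "'v \<Rightarrow> nat"
  assumes w_inj: "inj_on w I" and w_prime: "\<And>i. i \<in> I \<Longrightarrow> Factorial_Ring.prime (w i)"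
begin

definition nrm :: "('v \<Rightarrow> nat) \<Rightarrow> nat" where
  "nrm m = (\<Prod>i\<in>I. w i ^ m i)"

lemma nrm_add: "nrm (a + b) = nrm a * nrm b"
  by (simp add: nrm_def power_add prod.distrib)

lemma nrm_zero [simp]: "nrm 0 = 1"
  by (simp add: nrm_def)

lemma nrm_pos [simp]: "0 < nrm m"
  unfolding nrm_def by (rule prod_pos) (use w_prime in \<open>auto simp: prime_gt_0_nat\<close>)

lemma nrm_diff: "a \<le> m \<Longrightarrow> nrm a * nrm (m - a) = nrm m"
  using nrm_add[of a "m - a"] by (simp add: fun_le_diff_add_nat)

text \<open>Unique factorisation recovers each exponent from the norm; this is what makes the order
  total.\<close>

lemma multiplicity_nrm:
  assumes "j \<in> I" shows "multiplicity (w j) (nrm m) = m j"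
proof -
  have "nrm m = (\<Prod>i\<in>I. (\<lambda>p. p ^ m (inv_into I w p)) (w i))"
    unfolding nrm_def by (rule prod.cong) (simp_all add: w_inj)
  also have "\<dots> = (\<Prod>p\<in>w ` I. p ^ m (inv_into I w p))"
    by (subst prod.reindex[OF w_inj]) simp
  finally have "multiplicity (w j) (nrm m) = multiplicity (w j) (\<Prod>p\<in>w ` I. p ^ m (inv_into I w p))"
    by simp
  also have "\<dots> = (if w j \<in> w ` I then m (inv_into I w (w j)) else 0)"
    by (rule multiplicity_prod_prime_powers) (use assms finI w_prime in auto)
  finally show ?thesis using assms w_inj by simp
qed

lemma nrm_inj: "a \<in> E \<Longrightarrow> b \<in> E \<Longrightarrow> nrm a = nrm b \<Longrightarrow> a = b"
proof (rule ext)
  fix i assume "a \<in> E" "b \<in> E" "nrm a = nrm b"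
  then show "a i = b i"
    using multiplicity_nrm[of i a] multiplicity_nrm[of i b] by (cases "i \<in> I") (auto simp: exponents_def)
qed

lemma exponent_less_nrm:
  assumes "m \<in> E" "nrm m < 2 ^ k" shows "i \<in> I \<Longrightarrow> m i < k"
proof -
  assume i: "i \<in> I"
  have "2 ^ m i \<le> w i ^ m i" using w_prime[OF i] by (simp add: power_mono prime_ge_2_nat)
  also have "\<dots> \<le> nrm m"
    unfolding nrm_def using finI i w_prime
    by (intro dvd_imp_le dvd_prodI prod_pos) (auto simp: prime_gt_0_nat)
  finally have "(2::nat) ^ m i < 2 ^ k" using assms(2) by linarith
  then show ?thesis by simp
qed

lemma finite_nrm_less: "finite {m \<in> E. nrm m < t}"
proof (rule finite_imageD)
  show "finite (nrm ` {m \<in> E. nrm m < t})" by (rule finite_subset[of _ "{..<t}"]) auto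
  show "inj_on nrm {m \<in> E. nrm m < t}" using nrm_inj by (auto simp: inj_on_def)
qed

text \<open>Each weight is at least 2, so a norm below 2^k leaves at most \<open>k\<close> choices
  per exponent. The degree \<open>card I\<close> of this bound is what finally limits the length of
  prime chains.\<close>

lemma card_nrm_less: "card {m \<in> E. nrm m < 2 ^ k} \<le> k ^ card I"
proof -
  have "{m \<in> E. nrm m < 2 ^ k} \<subseteq> (\<lambda>f i. if i \<in> I then f i else 0) ` (Pi\<^sub>E I (\<lambda>_. {..<k}))"
  proof
    fix m assume m: "m \<in> {m \<in> E. nrm m < 2 ^ k}"
    then have "m = (\<lambda>i. if i \<in> I then restrict m I i else 0)"
      by (auto simp: exponents_def fun_eq_iff)
    moreover have "restrict m I \<in> Pi\<^sub>E I (\<lambda>_. {..<k})" using m exponent_less_nrm by auto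
    ultimately show "m \<in> (\<lambda>f i. if i \<in> I then f i else 0) ` (Pi\<^sub>E I (\<lambda>_. {..<k}))" by blast
  qed
  then have "card {m \<in> E. nrm m < 2 ^ k} \<le> card (Pi\<^sub>E I (\<lambda>_. {..<k}))"
    using finI by (meson card_image_le card_mono finite_PiE finite_imageI finite_lessThan order_trans)
  also have "\<dots> = k ^ card I" by (simp add: card_PiE finI)
  finally show ?thesis .
qed

text \<open>The norms of \<open>k\<close> and of its complement in \<open>m + m'\<close> have the
  same product as those of \<open>m\<close> and \<open>m'\<close>. So for \<open>k\<close> different
  from \<open>m\<close>, either \<open>k\<close> is below \<open>m\<close> or the complement is
  below \<open>m'\<close>, and one factor vanishes. Vanishing is demanded only at exponents below
  \<open>m + m'\<close>, so that the lemma also covers the smallest term among monomials avoiding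
  some variables.\<close>

lemma coeff_mult_lead:
  assumes s: "s \<in> carrier P" and t: "t \<in> carrier P" and m: "m \<in> E" and m': "m' \<in> E"
    and s0: "\<And>k. k \<in> E \<Longrightarrow> k \<le> m + m' \<Longrightarrow> nrm k < nrm m \<Longrightarrow> s k = \<zero>"
    and t0: "\<And>k. k \<in> E \<Longrightarrow> k \<le> m + m' \<Longrightarrow> nrm k < nrm m' \<Longrightarrow> t k = \<zero>"
  shows "(s \<otimes>\<^bsub>P\<^esub> t) (m + m') = s m \<otimes> t m'"
proof -
  have mm: "m + m' \<in> E" using m m' by auto
  have "(s \<otimes>\<^bsub>P\<^esub> t) (m + m') = (\<lambda>k. s k \<otimes> t (m + m' - k)) m"
    unfolding coeff_mult[OF mm]
  proof (rule finsum_single_term)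
    fix k assume "k \<in> {k. k \<le> m + m'}" "k \<noteq> m"
    then have k: "k \<le> m + m'" "k \<in> E" "m + m' - k \<in> E" "k \<noteq> m"
      using mm le_in_exponents diff_in_exponents by auto
    have eq: "nrm k * nrm (m + m' - k) = nrm m * nrm m'" using nrm_diff[OF k(1)] by (simp add: nrm_add)
    consider "nrm k < nrm m" | "nrm (m + m' - k) < nrm m'"
    proof -
      have "nrm k \<noteq> nrm m" using nrm_inj k m by blast
      moreover have "nrm (m + m' - k) < nrm m'" if "nrm m < nrm k"
      proof (rule ccontr)
        assume "\<not> nrm (m + m' - k) < nrm m'"
        then have "nrm m * nrm m' < nrm k * nrm (m + m' - k)"
          using that by (simp add: mult_less_le_imp_less)
        then show False using eq by simp
      qed
      ultimately show ?thesis using that by linarith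
    qed
    then show "s k \<otimes> t (m + m' - k) = \<zero>"
    proof cases
      case 1
      then show ?thesis using s0 k s t by simp
    next
      case 2
      moreover have "m + m' - k \<le> m + m'" by (auto simp: le_fun_def fun_diff_def)
      ultimately show ?thesis using t0 k s t by simp
    qed
  qed (use mm fin_le s t m m' in auto)
  then show ?thesis by simp
qed

text \<open>For \<open>Z\<close> inside \<open>I\<close> this is the prime ideal generated by the
  variables in \<open>Z\<close>, described by the vanishing of all coefficients at monomials free of
  \<open>Z\<close>. The empty set gives the zero ideal, and \<open>Z = I\<close> the maximal
  ideal.\<close>

definition var_ideal :: "'v set \<Rightarrow> (('v \<Rightarrow> nat) \<Rightarrow> 'a) set" where
  "var_ideal Z = {s \<in> carrier P. \<forall>m\<in>E. (\<forall>i\<in>Z. m i = 0) \<longrightarrow> s m = \<zero>}"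

lemma var_ideal_prime:
  "primeideal (var_ideal Z) P"
proof (rule primeidealI)
  show "ideal (var_ideal Z) P"
  proof (rule P.cring_idealI)
    fix a x assume a: "a \<in> var_ideal Z" and x: "x \<in> carrier P"
    have "a \<otimes>\<^bsub>P\<^esub> x \<in> var_ideal Z"
    proof -
      have "(a \<otimes>\<^bsub>P\<^esub> x) m = \<zero>" if m: "m \<in> E" "\<forall>i\<in>Z. m i = 0" for m
        unfolding coeff_mult[OF m(1)]
      proof (rule finsum_all_zero)
        fix k assume "k \<in> {k. k \<le> m}"
        then have k: "k \<in> E" "k \<le> m" using m le_in_exponents by auto
        then have "\<forall>i\<in>Z. k i = 0" using m(2) by (metis le_fun_def le_zero_eq)
        then have "a k = \<zero>" using a k by (simp add: var_ideal_def)
        then show "a k \<otimes> x (m - k) = \<zero>" using x m diff_in_exponents by fastforce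
      qed
      then show ?thesis using a x by (auto simp: var_ideal_def)
    qed
    then show "x \<otimes>\<^bsub>P\<^esub> a \<in> var_ideal Z"
      using a x P.m_comm by (auto simp: var_ideal_def)
  qed (auto simp: var_ideal_def)
  show "cring P" by (rule P_is_cring)
  have "\<one>\<^bsub>P\<^esub> \<notin> var_ideal Z"
    by (auto simp: var_ideal_def coeff_one intro!: bexI[of _ 0])
  then show "carrier P \<noteq> var_ideal Z" by blast
  fix s t assume st: "s \<in> carrier P" "t \<in> carrier P" and prod: "s \<otimes>\<^bsub>P\<^esub> t \<in> var_ideal Z"
  \<comment> \<open>The term of least norm among those free of \<open>Z\<close>; other terms of
    \<open>s\<close> may well have smaller norm.\<close>
  have low: "\<exists>m\<in>E. (\<forall>i\<in>Z. m i = 0) \<and> s m \<noteq> \<zero> \<and>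
      (\<forall>k\<in>E. (\<forall>i\<in>Z. k i = 0) \<longrightarrow> nrm k < nrm m \<longrightarrow> s k = \<zero>)"
    if s: "s \<in> carrier P" "s \<notin> var_ideal Z" for s
  proof -
    define Q where "Q m \<longleftrightarrow> m \<in> E \<and> (\<forall>i\<in>Z. m i = 0) \<and> s m \<noteq> \<zero>" for m
    obtain m0 where m0: "Q m0" using s by (auto simp: var_ideal_def Q_def)
    define m where "m = (ARG_MIN nrm m. Q m)"
    have "Q m" "\<And>y. Q y \<Longrightarrow> nrm m \<le> nrm y"
      unfolding m_def using arg_min_nat_lemma[of Q, OF m0, of nrm] by blast+
    then show ?thesis unfolding Q_def by (metis not_le)
  qed
  show "s \<in> var_ideal Z \<or> t \<in> var_ideal Z"
  proof (rule ccontr)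
    assume "\<not> ?thesis"
    then have nin: "s \<notin> var_ideal Z" "t \<notin> var_ideal Z" by auto
    obtain m where m: "m \<in> E" "\<forall>i\<in>Z. m i = 0" "s m \<noteq> \<zero>"
        "\<forall>k\<in>E. (\<forall>i\<in>Z. k i = 0) \<longrightarrow> nrm k < nrm m \<longrightarrow> s k = \<zero>"
      using low[OF st(1) nin(1)] by blast
    obtain m' where m': "m' \<in> E" "\<forall>i\<in>Z. m' i = 0" "t m' \<noteq> \<zero>"
        "\<forall>k\<in>E. (\<forall>i\<in>Z. k i = 0) \<longrightarrow> nrm k < nrm m' \<longrightarrow> t k = \<zero>"
      using low[OF st(2) nin(2)] by blast
    \<comment> \<open>Every exponent below \<open>m + m'\<close> is again free of \<open>Z\<close>,
      which supplies the restricted vanishing that \<open>coeff_mult_lead\<close> asks for.\<close>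
    have Z0: "\<forall>i\<in>Z. k i = 0" if "k \<le> m + m'" for k
    proof
      fix i assume "i \<in> Z"
      then have "(m + m') i = 0" using m m' by simp
      then show "k i = 0" using that by (metis le_fun_def le_zero_eq)
    qed
    have "(s \<otimes>\<^bsub>P\<^esub> t) (m + m') = s m \<otimes> t m'"
      by (rule coeff_mult_lead) (use st m m' Z0 in auto)
    moreover have "(s \<otimes>\<^bsub>P\<^esub> t) (m + m') = \<zero>"
      using prod m m' by (auto simp: var_ideal_def add_in_exponents)
    ultimately show False using m m' st integral by (metis coeff_closed)
  qed
qed

lemma var_ideal_empty: "var_ideal {} = {\<zero>\<^bsub>P\<^esub>}"
  by (auto simp: var_ideal_def intro: ps_eqI)

lemma P_domain: "domain P"
  using P.zeroprimeideal_domainI var_ideal_prime[of "{}"] by (simp add: var_ideal_empty)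

sublocale P: domain P by (rule P_domain)

text \<open>The leading term has the smallest norm, as for a local order: a series leads at exponent
  0 exactly when it is a unit.\<close>

definition is_lead :: "(('v \<Rightarrow> nat) \<Rightarrow> 'a) \<Rightarrow> ('v \<Rightarrow> nat) \<Rightarrow> bool" where
  "is_lead s m \<longleftrightarrow> m \<in> E \<and> s m \<noteq> \<zero> \<and> (\<forall>k\<in>E. nrm k < nrm m \<longrightarrow> s k = \<zero>)"

lemma is_lead_exists:
  assumes "s \<in> carrier P" "s \<noteq> \<zero>\<^bsub>P\<^esub>"
  shows "\<exists>m. is_lead s m"
proof -
  define Q where "Q m \<longleftrightarrow> m \<in> E \<and> s m \<noteq> \<zero>" for m
  obtain m0 where m0: "Q m0" using assms ps_eqI[of s "\<zero>\<^bsub>P\<^esub>"] by (auto simp: Q_def)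
  define m where "m = (ARG_MIN nrm m. Q m)"
  have "Q m" "\<And>y. Q y \<Longrightarrow> nrm m \<le> nrm y"
    unfolding m_def using arg_min_nat_lemma[of Q, OF m0, of nrm] by blast+
  then show ?thesis unfolding Q_def is_lead_def by (metis not_le)
qed

text \<open>The order filtration by norm, used in place of the powers of the maximal ideal.\<close>

definition high :: "nat \<Rightarrow> (('v \<Rightarrow> nat) \<Rightarrow> 'a) set" where
  "high t = {s \<in> carrier P. \<forall>m\<in>E. nrm m < t \<longrightarrow> s m = \<zero>}"

end

section \<open>Standard bases\<close>

lemma (in cring) division_step_identity:
  "\<lbrakk>a \<in> carrier R; g \<in> carrier R; s \<in> carrier R; r \<in> carrier R; u \<in> carrier R\<rbrakk> \<Longrightarrow>
     a \<otimes> g \<oplus> s \<oplus> r = (a \<oplus> u) \<otimes> g \<oplus> s \<oplus> (r \<ominus> u \<otimes> g)"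
  by algebra

lemma (in cring) mult_split_identity:
  "\<lbrakk>a \<in> carrier R; b \<in> carrier R; g \<in> carrier R\<rbrakk> \<Longrightarrow> a \<otimes> g = (a \<ominus> b) \<otimes> g \<oplus> b \<otimes> g"
  by algebra

context field_power_series
begin

lemma high_closed:
  "s \<in> high t \<Longrightarrow> s \<in> carrier P"
  "s \<in> high t \<Longrightarrow> u \<in> high t \<Longrightarrow> s \<oplus>\<^bsub>P\<^esub> u \<in> high t"
  "s \<in> high t \<Longrightarrow> u \<in> high t \<Longrightarrow> s \<ominus>\<^bsub>P\<^esub> u \<in> high t"
  "\<zero>\<^bsub>P\<^esub> \<in> high t"
  by (auto simp: high_def)

lemma high_finsum:
  assumes "finite T" "\<And>x. x \<in> T \<Longrightarrow> F x \<in> high t"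
  shows "finsum P F T \<in> high t"
  using assms
proof (induction T rule: finite_induct)
  case (insert x T)
  then have "F x \<in> carrier P" "F \<in> T \<rightarrow> carrier P" by (auto dest: high_closed(1))
  then show ?case using insert by (simp add: high_closed)
qed (simp add: high_closed)

text \<open>Every term of \<open>g\<close> has norm at least \<open>nrm m\<close>, so only
  coefficients of \<open>h\<close> at exponents \<open>b\<close> with
  \<open>nrm b * nrm m < t\<close> can reach below norm \<open>t\<close>.\<close>

lemma high_mult_lead:
  assumes "is_lead g m" "g \<in> carrier P" "h \<in> carrier P"
    and h0: "\<And>b. b \<in> E \<Longrightarrow> nrm b * nrm m < t \<Longrightarrow> h b = \<zero>"
  shows "h \<otimes>\<^bsub>P\<^esub> g \<in> high t"
proof -
  have "(h \<otimes>\<^bsub>P\<^esub> g) k = \<zero>" if k: "k \<in> E" "nrm k < t" for k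
    unfolding coeff_mult[OF k(1)]
  proof (rule finsum_all_zero)
    fix b assume "b \<in> {b. b \<le> k}"
    then have b: "b \<le> k" "b \<in> E" "k - b \<in> E"
      using k le_in_exponents diff_in_exponents by auto
    show "h b \<otimes> g (k - b) = \<zero>"
    proof (cases "nrm (k - b) < nrm m")
      case True
      then show ?thesis using assms b by (simp add: is_lead_def)
    next
      case False
      then have "nrm b * nrm m \<le> nrm b * nrm (k - b)" by simp
      also have "\<dots> < t" using nrm_diff[OF b(1)] k by simp
      finally show ?thesis using h0 assms b by simp
    qed
  qed
  then show ?thesis using assms by (auto simp: high_def)
qed

text \<open>Norms are injective, so \<open>m\<close> is the only monomial of norm \<open>t\<close>,
  and cancelling this one coefficient clears the whole level. The leading coefficient of
  \<open>g\<close> is invertible because the coefficients form a field.\<close>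

lemma high_Suc_step:
  assumes r: "r \<in> high t" and g: "g \<in> carrier P" and lead: "is_lead g e"
    and m: "m \<in> E" "nrm m = t" "e \<le> m"
  defines "c \<equiv> r m \<otimes> inv (g e)"
  shows "c \<in> carrier R" "r \<ominus>\<^bsub>P\<^esub> mon (m - e) c \<otimes>\<^bsub>P\<^esub> g \<in> high (Suc t)"
proof -
  have rc: "r \<in> carrier P" using r high_closed by blast
  have eE: "e \<in> E" and ge: "g e \<in> Units R" using lead g by (auto simp: is_lead_def field_Units)
  show c: "c \<in> carrier R" unfolding c_def using rc m ge by simp
  have meE: "m - e \<in> E" using m diff_in_exponents by auto
  let ?r = "r \<ominus>\<^bsub>P\<^esub> mon (m - e) c \<otimes>\<^bsub>P\<^esub> g"
  have rcl: "?r \<in> carrier P" using rc g c by simp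
  have "?r k = \<zero>" if k: "k \<in> E" "nrm k < Suc t" for k
  proof -
    have val: "?r k = r k \<ominus> (if m - e \<le> k then c \<otimes> g (k - (m - e)) else \<zero>)"
      using rc g c k meE by (simp add: coeff_mon_mult)
    show ?thesis
    proof (cases "k = m")
      case True
      have "m - e \<le> m" "m - (m - e) = e" using m(3) by (auto simp: le_fun_def fun_diff_def fun_eq_iff)
      moreover have "c \<otimes> g e = r m" using ge rc m by (simp add: c_def m_assoc Units_closed)
      ultimately show ?thesis using val True rc m by simp
    next
      case False
      then have kt: "nrm k < t" using k m nrm_inj by (metis less_SucE)
      then have "r k = \<zero>" using r k by (simp add: high_def)
      moreover have "g (k - (m - e)) = \<zero>" if le: "m - e \<le> k"
      proof -
        have "nrm (m - e) * nrm (k - (m - e)) < nrm (m - e) * nrm e"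
          using nrm_diff[OF le] nrm_diff[OF m(3)] m kt by (simp add: mult.commute)
        then have "nrm (k - (m - e)) < nrm e" by simp
        then show ?thesis using lead k by (auto simp: is_lead_def diff_in_exponents)
      qed
      ultimately show ?thesis using val c by auto
    qed
  qed
  then show "?r \<in> high (Suc t)" using rcl by (simp add: high_def)
qed

lemma (in cring) ideal_minusI:
  assumes "ideal J R" "a \<in> J" "b \<in> J" shows "a \<ominus> b \<in> J"
  using assms unfolding a_minus_def
  by (meson additive_subgroup.a_closed additive_subgroup.a_inv_closed ideal.axioms(1))

text \<open>The division proceeds through the norms t = 0, 1, 2, .... Stage \<open>t\<close> cancels
  the single monomial of norm \<open>t\<close> and changes a quotient only at exponents
  \<open>b\<close> with \<open>nrm b * nrm (e g) = t\<close>. So each coefficient of a quotient is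
  touched at most once and the limit exists coefficientwise. The lower bound on the quotients in
  terms of \<open>t0\<close> is what later yields the Artin-Rees estimate.\<close>

theorem standard_basis_division:
  assumes J: "ideal J P" and finG: "finite G" and GJ: "G \<subseteq> J"
    and lead: "\<And>g. g \<in> G \<Longrightarrow> is_lead g (e g)"
    and gen: "\<And>s m. s \<in> J \<Longrightarrow> is_lead s m \<Longrightarrow> \<exists>g\<in>G. e g \<le> m"
    and f: "f \<in> J" "f \<in> high t0"
  shows "\<exists>H. (\<forall>g\<in>G. H g \<in> carrier P \<and> (\<forall>b\<in>E. nrm b * nrm (e g) < t0 \<longrightarrow> H g b = \<zero>)) \<and>
     f = (\<Oplus>\<^bsub>P\<^esub>g\<in>G. H g \<otimes>\<^bsub>P\<^esub> g)"
proof -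
  have JP: "J \<subseteq> carrier P" using J by (meson additive_subgroup.a_subset ideal.axioms(1))
  then have GP: "G \<subseteq> carrier P" using GJ by auto
  \<comment> \<open>Invariant before stage \<open>t\<close>: the remainder stays in
    \<open>J\<close>, is clear below norm \<open>t\<close>, and both it and the quotients respect
    the bound \<open>t0\<close>.\<close>
  define Q where "Q t x \<longleftrightarrow> (let (r, h) = x in r \<in> J \<and> r \<in> high t \<and> r \<in> high t0 \<and>
      (\<forall>g\<in>G. h g \<in> carrier P \<and> (\<forall>b\<in>E. nrm b * nrm (e g) < t0 \<longrightarrow> h g b = \<zero>)) \<and>
      f = (\<Oplus>\<^bsub>P\<^esub>g\<in>G. h g \<otimes>\<^bsub>P\<^esub> g) \<oplus>\<^bsub>P\<^esub> r)"
    for t and x :: "(('v \<Rightarrow> nat) \<Rightarrow> 'a) \<times> ((('v \<Rightarrow> nat) \<Rightarrow> 'a) \<Rightarrow> (('v \<Rightarrow> nat) \<Rightarrow> 'a))"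
  define T where "T t x y \<longleftrightarrow> (\<forall>g\<in>G. \<forall>b\<in>E. nrm b * nrm (e g) \<noteq> t \<longrightarrow> snd y g b = snd x g b)"
    for t and x y :: "(('v \<Rightarrow> nat) \<Rightarrow> 'a) \<times> ((('v \<Rightarrow> nat) \<Rightarrow> 'a) \<Rightarrow> (('v \<Rightarrow> nat) \<Rightarrow> 'a))"
  have "\<exists>F. \<forall>t. Q t (F t) \<and> T t (F t) (F (Suc t))"
  proof (rule dependent_nat_choice)
    have "(\<Oplus>\<^bsub>P\<^esub>g\<in>G. \<zero>\<^bsub>P\<^esub> \<otimes>\<^bsub>P\<^esub> g) = \<zero>\<^bsub>P\<^esub>"
      by (rule P.finsum_all_zero) (use GP in auto)
    then have "Q 0 (f, \<lambda>g. \<zero>\<^bsub>P\<^esub>)" using f JP by (auto simp: Q_def high_def)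
    then show "\<exists>x. Q 0 x" by blast
  next
    fix x t assume Qx: "Q t x"
    obtain r h where x: "x = (r, h)" by (cases x)
    have r: "r \<in> J" "r \<in> high t" "r \<in> high t0" "r \<in> carrier P"
      and h: "\<And>g. g \<in> G \<Longrightarrow> h g \<in> carrier P"
        "\<And>g b. g \<in> G \<Longrightarrow> b \<in> E \<Longrightarrow> nrm b * nrm (e g) < t0 \<Longrightarrow> h g b = \<zero>"
      and feq: "f = (\<Oplus>\<^bsub>P\<^esub>g\<in>G. h g \<otimes>\<^bsub>P\<^esub> g) \<oplus>\<^bsub>P\<^esub> r"
      using Qx JP by (auto simp: Q_def x)
    show "\<exists>y. Q (Suc t) y \<and> T t x y"
    proof (cases "r \<in> high (Suc t)")
      case True
      then have "Q (Suc t) x" using Qx by (auto simp: Q_def x)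
      moreover have "T t x x" by (simp add: T_def)
      ultimately show ?thesis by blast
    next
      case False
      then obtain m where m: "m \<in> E" "nrm m < Suc t" "r m \<noteq> \<zero>" using r by (auto simp: high_def)
      then have mt: "nrm m = t" using r(2) by (force simp: high_def less_Suc_eq)
      \<comment> \<open>The remainder is clear below \<open>t0\<close>, so a nonzero coefficient
        occurs only at norm at least \<open>t0\<close>; hence the new term respects the bound on the
        quotients.\<close>
      have tt0: "t0 \<le> t" using r(3) m mt by (force simp: high_def)
      have "is_lead r m" using m mt r(2) by (auto simp: is_lead_def high_def)
      then obtain g0 where g0: "g0 \<in> G" "e g0 \<le> m" using gen r(1) by blast
      define c where "c = r m \<otimes> inv (g0 (e g0))"
      define u where "u = mon (m - e g0) c"
      have g0P: "g0 \<in> carrier P" using g0 GP by auto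
      have c: "c \<in> carrier R" and hi: "r \<ominus>\<^bsub>P\<^esub> u \<otimes>\<^bsub>P\<^esub> g0 \<in> high (Suc t)"
        using high_Suc_step[OF r(2) g0P lead[OF g0(1)] m(1) mt g0(2)] by (auto simp: c_def u_def)
      have uP: "u \<in> carrier P" using c by (simp add: u_def)
      define h' where "h' = h(g0 := h g0 \<oplus>\<^bsub>P\<^esub> u)"
      have h'P: "h' g \<in> carrier P" if "g \<in> G" for g using that h uP g0 by (auto simp: h'_def)
      have u0: "u b = \<zero>" if "b \<in> E" "nrm b * nrm (e g0) \<noteq> t" for b
        using that nrm_diff[OF g0(2)] mt by (auto simp: u_def coeff_mon mult.commute)
      have "f = (\<Oplus>\<^bsub>P\<^esub>g\<in>G. h' g \<otimes>\<^bsub>P\<^esub> g) \<oplus>\<^bsub>P\<^esub> (r \<ominus>\<^bsub>P\<^esub> u \<otimes>\<^bsub>P\<^esub> g0)"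
      proof -
        let ?s = "\<Oplus>\<^bsub>P\<^esub>g\<in>G - {g0}. h g \<otimes>\<^bsub>P\<^esub> g"
        have G: "G = insert g0 (G - {g0})" using g0 by auto
        have sP: "?s \<in> carrier P" using h GP by (intro P.finsum_closed) auto
        have "(\<Oplus>\<^bsub>P\<^esub>g\<in>G. h g \<otimes>\<^bsub>P\<^esub> g) = h g0 \<otimes>\<^bsub>P\<^esub> g0 \<oplus>\<^bsub>P\<^esub> ?s"
          by (subst G, subst P.finsum_insert) (use finG h GP g0 in auto)
        moreover have "(\<Oplus>\<^bsub>P\<^esub>g\<in>G. h' g \<otimes>\<^bsub>P\<^esub> g) = h' g0 \<otimes>\<^bsub>P\<^esub> g0 \<oplus>\<^bsub>P\<^esub> (\<Oplus>\<^bsub>P\<^esub>g\<in>G - {g0}. h' g \<otimes>\<^bsub>P\<^esub> g)"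
          by (subst G, subst P.finsum_insert) (use finG h'P GP g0 in auto)
        moreover have "(\<Oplus>\<^bsub>P\<^esub>g\<in>G - {g0}. h' g \<otimes>\<^bsub>P\<^esub> g) = ?s"
          by (rule P.finsum_cong') (use h GP in \<open>auto simp: h'_def\<close>)
        moreover have "h g0 \<otimes>\<^bsub>P\<^esub> g0 \<oplus>\<^bsub>P\<^esub> ?s \<oplus>\<^bsub>P\<^esub> r
           = (h g0 \<oplus>\<^bsub>P\<^esub> u) \<otimes>\<^bsub>P\<^esub> g0 \<oplus>\<^bsub>P\<^esub> ?s \<oplus>\<^bsub>P\<^esub> (r \<ominus>\<^bsub>P\<^esub> u \<otimes>\<^bsub>P\<^esub> g0)"
          by (rule P.division_step_identity) (use h(1)[OF g0(1)] g0P sP r(4) uP in auto)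
        ultimately show ?thesis using feq by (simp add: h'_def)
      qed
      moreover have "r \<ominus>\<^bsub>P\<^esub> u \<otimes>\<^bsub>P\<^esub> g0 \<in> J"
        using P.ideal_minusI[OF J r(1)] ideal.I_l_closed[OF J _ uP] GJ g0 by blast
      moreover have "r \<ominus>\<^bsub>P\<^esub> u \<otimes>\<^bsub>P\<^esub> g0 \<in> high t0"
        using hi tt0 by (auto simp: high_def)
      moreover have "h' g b = \<zero>" if "g \<in> G" "b \<in> E" "nrm b * nrm (e g) < t0" for g b
        using that h u0 uP tt0 by (auto simp: h'_def)
      ultimately have "Q (Suc t) (r \<ominus>\<^bsub>P\<^esub> u \<otimes>\<^bsub>P\<^esub> g0, h')"
        using hi h'P by (simp add: Q_def)
      moreover have "T t x (r \<ominus>\<^bsub>P\<^esub> u \<otimes>\<^bsub>P\<^esub> g0, h')"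
        using h u0 uP g0 by (auto simp: T_def x h'_def)
      ultimately show ?thesis by blast
    qed
  qed
  then obtain F where F: "\<And>t. Q t (F t)" "\<And>t. T t (F t) (F (Suc t))" by blast
  define h where "h t = snd (F t)" for t
  have h: "h t g \<in> carrier P" "b \<in> E \<Longrightarrow> nrm b * nrm (e g) < t0 \<Longrightarrow> h t g b = \<zero>"
    if "g \<in> G" for t g b using that F(1)[of t] by (auto simp: Q_def h_def split: prod.splits)
  have stable: "h t g b = h (Suc (nrm b * nrm (e g))) g b"
    if "nrm b * nrm (e g) < t" "g \<in> G" "b \<in> E" for t g b
    using that(1)
  proof (induction t)
    case (Suc t)
    show ?case
    proof (cases "nrm b * nrm (e g) = t")
      case False
      then have "h (Suc t) g b = h t g b" using F(2)[of t] that by (auto simp: T_def h_def)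
      then show ?thesis using Suc False by simp
    qed simp
  qed simp
  define H where "H g = (\<lambda>b\<in>E. h (Suc (nrm b * nrm (e g))) g b)" for g
  have HP: "H g \<in> carrier P" if "g \<in> G" for g
    using h(1)[OF that] by (auto simp: H_def P_carrier)
  have H0: "H g b = \<zero>" if "g \<in> G" "b \<in> E" "nrm b * nrm (e g) < t0" for g b
    using h(2) that by (simp add: H_def)
  let ?S = "\<Oplus>\<^bsub>P\<^esub>g\<in>G. H g \<otimes>\<^bsub>P\<^esub> g"
  have SP: "?S \<in> carrier P" using HP GP by (intro P.finsum_closed) auto
  have "f = ?S"
  proof (rule ps_eqI)
    fix m assume m: "m \<in> E"
    \<comment> \<open>After the stage of norm \<open>nrm m\<close> neither the remainder nor later
      corrections of the quotients reach the coefficient at \<open>m\<close>.\<close>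
    define t where "t = Suc (nrm m)"
    obtain r where r: "r \<in> high t" "f = (\<Oplus>\<^bsub>P\<^esub>g\<in>G. h t g \<otimes>\<^bsub>P\<^esub> g) \<oplus>\<^bsub>P\<^esub> r"
      using F(1)[of t] by (auto simp: Q_def h_def split: prod.splits)
    have diff: "(h t g \<ominus>\<^bsub>P\<^esub> H g) \<otimes>\<^bsub>P\<^esub> g \<in> high t" if g: "g \<in> G" for g
    proof (rule high_mult_lead[OF lead[OF g]])
      fix b assume b: "b \<in> E" "nrm b * nrm (e g) < t"
      have "H g b = h t g b" using stable[OF b(2) g b(1)] b(1) by (simp only: H_def restrict_apply')
      then show "(h t g \<ominus>\<^bsub>P\<^esub> H g) b = \<zero>" using b(1) h(1)[OF g] HP[OF g] by simp
    qed (use g GP h HP in auto)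
    have dP: "(h t g \<ominus>\<^bsub>P\<^esub> H g) \<otimes>\<^bsub>P\<^esub> g \<in> carrier P" if "g \<in> G" for g
      using that GP h HP by auto
    have "(\<Oplus>\<^bsub>P\<^esub>g\<in>G. h t g \<otimes>\<^bsub>P\<^esub> g) = (\<Oplus>\<^bsub>P\<^esub>g\<in>G. (h t g \<ominus>\<^bsub>P\<^esub> H g) \<otimes>\<^bsub>P\<^esub> g \<oplus>\<^bsub>P\<^esub> H g \<otimes>\<^bsub>P\<^esub> g)"
    proof (rule P.finsum_cong')
      fix g assume g: "g \<in> G"
      then have "h t g \<in> carrier P" "H g \<in> carrier P" "g \<in> carrier P" using GP h HP by auto
      then show "h t g \<otimes>\<^bsub>P\<^esub> g = (h t g \<ominus>\<^bsub>P\<^esub> H g) \<otimes>\<^bsub>P\<^esub> g \<oplus>\<^bsub>P\<^esub> H g \<otimes>\<^bsub>P\<^esub> g"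
        by (rule P.mult_split_identity)
    qed (use h HP GP in auto)
    also have "\<dots> = (\<Oplus>\<^bsub>P\<^esub>g\<in>G. (h t g \<ominus>\<^bsub>P\<^esub> H g) \<otimes>\<^bsub>P\<^esub> g) \<oplus>\<^bsub>P\<^esub> ?S"
      by (rule P.finsum_addf) (use h HP GP in auto)
    finally have feq: "f = (\<Oplus>\<^bsub>P\<^esub>g\<in>G. (h t g \<ominus>\<^bsub>P\<^esub> H g) \<otimes>\<^bsub>P\<^esub> g) \<oplus>\<^bsub>P\<^esub> ?S \<oplus>\<^bsub>P\<^esub> r"
      using r by simp
    moreover have "(\<Oplus>\<^bsub>P\<^esub>g\<in>G. (h t g \<ominus>\<^bsub>P\<^esub> H g) \<otimes>\<^bsub>P\<^esub> g) \<in> high t"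
      using diff finG by (rule high_finsum[rotated])
    ultimately show "f m = ?S m" using r(1) m SP by (simp add: high_def t_def)
  qed (use f JP SP in auto)
  then show ?thesis using HP H0 by blast
qed

text \<open>Dickson's lemma is applied to the leading exponents of the elements of \<open>J\<close>,
  and one series is chosen for each of the finitely many exponents it returns.\<close>

lemma exists_standard_basis:
  assumes J: "ideal J P"
  shows "\<exists>G e. finite G \<and> G \<subseteq> J \<and> (\<forall>g\<in>G. is_lead g (e g)) \<and>
     (\<forall>s m. s \<in> J \<longrightarrow> is_lead s m \<longrightarrow> (\<exists>g\<in>G. e g \<le> m))"
proof -
  define W where "W = {m. \<exists>s\<in>J. is_lead s m}"
  have "W \<subseteq> E" by (auto simp: W_def is_lead_def)
  then obtain F where F: "F \<subseteq> W" "finite F" "\<forall>m\<in>W. \<exists>k\<in>F. k \<le> m"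
    using Dickson[OF finI] by blast
  have "\<forall>k\<in>F. \<exists>s. s \<in> J \<and> is_lead s k" using F(1) unfolding W_def by blast
  then obtain s where "\<forall>k\<in>F. s k \<in> J \<and> is_lead (s k) k" by (rule bchoice[THEN exE])
  then have s: "\<And>k. k \<in> F \<Longrightarrow> s k \<in> J \<and> is_lead (s k) k" by blast
  have uniq: "k = k'" if "is_lead g k" "is_lead g k'" for g k k'
  proof (rule nrm_inj)
    show "nrm k = nrm k'"
      using that unfolding is_lead_def by (metis nat_neq_iff)
  qed (use that in \<open>auto simp: is_lead_def\<close>)
  \<comment> \<open>Leading exponents are unique, so \<open>e\<close> can be a function of the
    series rather than of the index \<open>k\<close>.\<close>
  define e where "e g = (THE k. is_lead g k)" for g
  have e: "e g = k" if "is_lead g k" for g k unfolding e_def using that uniq by blast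
  have "finite (s ` F)" "s ` F \<subseteq> J" using F s by auto
  moreover have "\<forall>g\<in>s ` F. is_lead g (e g)" using s e by (metis imageE)
  moreover have "\<exists>g\<in>s ` F. e g \<le> m" if "v \<in> J" "is_lead v m" for v m
  proof -
    have "m \<in> W" using that by (auto simp: W_def)
    then obtain k where "k \<in> F" "k \<le> m" using F by blast
    moreover from this have "e (s k) = k" using s e by blast
    ultimately show ?thesis by (intro bexI[of _ "s k"]) auto
  qed
  ultimately show ?thesis by (intro exI[of _ "s ` F"] exI[of _ e] conjI allI impI)
qed

text \<open>Division with the empty bound \<open>t0 = 0\<close> shows that a standard basis
  generates its ideal.\<close>

lemma P_noetherian: "noetherian_ring P"
proof (rule P.noetherian_ringI)
  fix J assume J: "ideal J P"
  obtain G e where G: "finite G" "G \<subseteq> J" "\<And>g. g \<in> G \<Longrightarrow> is_lead g (e g)"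
      "\<And>s m. s \<in> J \<Longrightarrow> is_lead s m \<Longrightarrow> \<exists>g\<in>G. e g \<le> m"
    using exists_standard_basis[OF J] by blast
  have GP: "G \<subseteq> carrier P" using G J by (meson additive_subgroup.a_subset ideal.axioms(1) order_trans)
  interpret GI: ideal "Idl\<^bsub>P\<^esub> G" P by (rule P.genideal_ideal[OF GP])
  have sum: "finsum P F T \<in> Idl\<^bsub>P\<^esub> G"
    if "finite T" "\<And>x. x \<in> T \<Longrightarrow> F x \<in> Idl\<^bsub>P\<^esub> G" for F and T :: "(('v \<Rightarrow> nat) \<Rightarrow> 'a) set"
    using that
  proof (induction T rule: finite_induct)
    case (insert x T)
    then have "F x \<in> carrier P" "F \<in> T \<rightarrow> carrier P" using GI.Icarr by auto
    then show ?case using insert by simp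
  qed simp
  have "J \<subseteq> Idl\<^bsub>P\<^esub> G"
  proof
    fix f assume f: "f \<in> J"
    then have "f \<in> carrier P" using J by (meson ideal.Icarr)
    then have "f \<in> high 0" by (simp add: high_def)
    then have "\<exists>H. (\<forall>g\<in>G. H g \<in> carrier P \<and>
        (\<forall>b\<in>E. nrm b * nrm (e g) < 0 \<longrightarrow> H g b = \<zero>)) \<and> f = (\<Oplus>\<^bsub>P\<^esub>g\<in>G. H g \<otimes>\<^bsub>P\<^esub> g)"
      by (intro standard_basis_division[OF J G(1,2)] G(3,4) f) assumption+
    then obtain H where H': "\<forall>g\<in>G. H g \<in> carrier P \<and> (\<forall>b\<in>E. nrm b * nrm (e g) < 0 \<longrightarrow> H g b = \<zero>)"
      and H: "f = (\<Oplus>\<^bsub>P\<^esub>g\<in>G. H g \<otimes>\<^bsub>P\<^esub> g)" by (elim exE conjE)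
    show "f \<in> Idl\<^bsub>P\<^esub> G"
      unfolding H
    proof (rule sum[OF G(1)])
      fix g assume "g \<in> G"
      then have "g \<in> Idl\<^bsub>P\<^esub> G" "H g \<in> carrier P" using P.genideal_self[OF GP] H' by auto
      then show "H g \<otimes>\<^bsub>P\<^esub> g \<in> Idl\<^bsub>P\<^esub> G" by (rule GI.I_l_closed)
    qed
  qed
  moreover have "Idl\<^bsub>P\<^esub> G \<subseteq> J" using G(2) J by (rule P.genideal_minimal[rotated])
  ultimately show "\<exists>G\<subseteq>carrier P. finite G \<and> J = Idl\<^bsub>P\<^esub> G" using G GP by blast
qed

text \<open>If the constant term is nonzero, \<open>s\<close> leads at exponent 0, which lies below
  all exponents. Thus \<open>{s}\<close> is a standard basis of the unit ideal, and dividing 1 by it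
  yields the inverse.\<close>

lemma unit_iff:
  assumes s: "s \<in> carrier P" shows "s \<in> Units P \<longleftrightarrow> s 0 \<noteq> \<zero>"
proof
  have mult0: "(a \<otimes>\<^bsub>P\<^esub> b) 0 = a 0 \<otimes> b 0" if "a \<in> carrier P" "b \<in> carrier P" for a b
    using coeff_mult_lead[OF that, of 0 0] by simp
  {
    assume "s \<in> Units P"
    then obtain u where "u \<in> carrier P" "u \<otimes>\<^bsub>P\<^esub> s = \<one>\<^bsub>P\<^esub>" by (auto simp: Units_def)
    then show "s 0 \<noteq> \<zero>" using mult0[of u s] s by (auto simp: coeff_one)
  next
    assume s0: "s 0 \<noteq> \<zero>"
    moreover have "nrm k \<noteq> 0" for k using nrm_pos[of k] by simp
    ultimately have lead: "is_lead s 0" unfolding is_lead_def by (metis less_one nrm_zero zero_in_exponents)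
    have "\<one>\<^bsub>P\<^esub> \<in> high 0" by (simp add: high_def)
    have "\<exists>H. (\<forall>g\<in>{s}. H g \<in> carrier P \<and> (\<forall>b\<in>E. nrm b * nrm 0 < 0 \<longrightarrow> H g b = \<zero>)) \<and>
       \<one>\<^bsub>P\<^esub> = (\<Oplus>\<^bsub>P\<^esub>g\<in>{s}. H g \<otimes>\<^bsub>P\<^esub> g)"
      by (rule standard_basis_division[OF P.oneideal, where e = "\<lambda>_. 0"])
         (use s lead \<open>\<one>\<^bsub>P\<^esub> \<in> high 0\<close> in auto)
    then obtain u where "u \<in> carrier P" "\<one>\<^bsub>P\<^esub> = u \<otimes>\<^bsub>P\<^esub> s"
      using s by auto
    then show "s \<in> Units P" using s P.m_comm by (fastforce simp: Units_def)
  }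
qed

end

section \<open>Hilbert functions and chains of primes\<close>

context field_power_series
begin

section \<open>Counting leading exponents\<close>

definition leads :: "(('v \<Rightarrow> nat) \<Rightarrow> 'a) set \<Rightarrow> ('v \<Rightarrow> nat) set" where
  "leads V = {m. \<exists>s\<in>V. is_lead s m}"

lemma leads_subset: "leads V \<subseteq> E"
  by (auto simp: leads_def is_lead_def)

lemma leads_mono: "V \<subseteq> V' \<Longrightarrow> leads V \<subseteq> leads V'"
  by (auto simp: leads_def)

text \<open>One step of Gaussian elimination: reduce \<open>e\<close> modulo \<open>V\<close> until its leading exponent is new.\<close>

lemma exists_new_lead:
  assumes V: "V \<subseteq> carrier P" "\<zero>\<^bsub>P\<^esub> \<in> V"
    and Vadd: "\<And>u v c. u \<in> V \<Longrightarrow> v \<in> V \<Longrightarrow> c \<in> carrier R \<Longrightarrow> u \<oplus>\<^bsub>P\<^esub> mon 0 c \<otimes>\<^bsub>P\<^esub> v \<in> V"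
    and e: "e \<in> carrier P" and notin: "\<And>v. v \<in> V \<Longrightarrow> e \<ominus>\<^bsub>P\<^esub> v \<notin> high t"
  shows "\<exists>v\<in>V. \<exists>m. is_lead (e \<ominus>\<^bsub>P\<^esub> v) m \<and> nrm m < t \<and> m \<notin> leads V"
proof -
  have lead: "\<exists>m. is_lead (e \<ominus>\<^bsub>P\<^esub> v) m \<and> nrm m < t" if v: "v \<in> V" for v
  proof -
    have vP: "v \<in> carrier P" using v V by auto
    obtain k where k: "k \<in> E" "nrm k < t" "(e \<ominus>\<^bsub>P\<^esub> v) k \<noteq> \<zero>"
      using notin[OF v] e vP by (auto simp: high_def)
    then have "e \<ominus>\<^bsub>P\<^esub> v \<noteq> \<zero>\<^bsub>P\<^esub>" by auto
    then obtain m where m: "is_lead (e \<ominus>\<^bsub>P\<^esub> v) m" using is_lead_exists e vP by blast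
    then have "nrm m \<le> nrm k" using k unfolding is_lead_def by (metis not_le)
    then show ?thesis using m k by (meson le_less_trans)
  qed
  \<comment> \<open>Among all reductions of \<open>e\<close> one with the largest leading norm is
    taken. If its leading exponent occurred in \<open>leads V\<close>, a multiple of an element of
    \<open>V\<close> would cancel it and push the norm higher. The bound \<open>t\<close> keeps the
    set of norms finite.\<close>
  define A where "A = {nrm m | m v. v \<in> V \<and> is_lead (e \<ominus>\<^bsub>P\<^esub> v) m \<and> nrm m < t}"
  have "finite A" by (rule finite_subset[of _ "{..<t}"]) (auto simp: A_def)
  moreover have "A \<noteq> {}" using lead[OF V(2)] V(2) unfolding A_def by blast
  ultimately have "Max A \<in> A" "\<And>a. a \<in> A \<Longrightarrow> a \<le> Max A" by auto
  then obtain m v where mv: "v \<in> V" "is_lead (e \<ominus>\<^bsub>P\<^esub> v) m" "nrm m < t" "nrm m = Max A"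
    unfolding A_def by auto
  have "m \<notin> leads V"
  proof
    assume "m \<in> leads V"
    then obtain s where s: "s \<in> V" "is_lead s m" by (auto simp: leads_def)
    have vP: "v \<in> carrier P" and sP: "s \<in> carrier P" using mv s V by auto
    have mE: "m \<in> E" using s by (simp add: is_lead_def)
    define c where "c = (e \<ominus>\<^bsub>P\<^esub> v) m \<otimes> inv (s m)"
    have sm: "s m \<in> Units R" using s sP mE by (auto simp: is_lead_def field_Units)
    have c: "c \<in> carrier R" "c \<otimes> s m = (e \<ominus>\<^bsub>P\<^esub> v) m"
      using sm mE e vP by (auto simp: c_def m_assoc Units_closed)
    define v' where "v' = v \<oplus>\<^bsub>P\<^esub> mon 0 c \<otimes>\<^bsub>P\<^esub> s"
    have v'V: "v' \<in> V" unfolding v'_def using Vadd mv s c by blast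
    then have v'P: "v' \<in> carrier P" using V by auto
    have val: "(e \<ominus>\<^bsub>P\<^esub> v') k = (e \<ominus>\<^bsub>P\<^esub> v) k \<ominus> c \<otimes> s k" if k: "k \<in> E" for k
    proof -
      have "(mon 0 c \<otimes>\<^bsub>P\<^esub> s) k = c \<otimes> s k" using c sP k by (simp add: coeff_mon_mult)
      then have "(e \<ominus>\<^bsub>P\<^esub> v') k = e k \<ominus> (v k \<oplus> c \<otimes> s k)"
        using e v'P vP sP c k by (simp add: v'_def)
      also have "\<dots> = e k \<ominus> v k \<ominus> c \<otimes> s k"
        using e vP sP c k by (simp add: a_minus_def minus_add a_assoc)
      finally show ?thesis using e vP k by simp
    qed
    obtain m' where m': "is_lead (e \<ominus>\<^bsub>P\<^esub> v') m'" "nrm m' < t" using lead[OF v'V] by blast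
    have m'E: "m' \<in> E" using m' by (simp add: is_lead_def)
    have "nrm m < nrm m'"
    proof (rule ccontr)
      assume "\<not> nrm m < nrm m'"
      then consider "m' = m" | "nrm m' < nrm m" using nrm_inj[OF m'E mE] by linarith
      then have "(e \<ominus>\<^bsub>P\<^esub> v') m' = \<zero>"
      proof cases
        case 1
        then show ?thesis using val[OF mE] c e vP mE by (simp add: a_minus_def r_neg)
      next
        case 2
        then have "(e \<ominus>\<^bsub>P\<^esub> v) m' = \<zero>" "s m' = \<zero>" using mv s m'E by (auto simp: is_lead_def)
        then show ?thesis using val[OF m'E] c by simp
      qed
      then show False using m' by (simp add: is_lead_def)
    qed
    moreover have "nrm m' \<in> A" using m' v'V unfolding A_def by blast
    ultimately show False using mv(4) \<open>\<And>a. a \<in> A \<Longrightarrow> a \<le> Max A\<close> by (metis not_le)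
  qed
  then show ?thesis using mv by blast
qed

text \<open>For finite \<open>B\<close> inside \<open>E\<close> this is the span of the monomials
  with exponent in \<open>B\<close> over the coefficient field.\<close>

definition supp_in :: "('v \<Rightarrow> nat) set \<Rightarrow> (('v \<Rightarrow> nat) \<Rightarrow> 'a) set" where
  "supp_in B = {u \<in> carrier P. \<forall>m\<in>E. m \<notin> B \<longrightarrow> u m = \<zero>}"

lemma supp_in_closed:
  "u \<in> supp_in B \<Longrightarrow> u \<in> carrier P"
  "u \<in> supp_in B \<Longrightarrow> v \<in> supp_in B \<Longrightarrow> u \<oplus>\<^bsub>P\<^esub> v \<in> supp_in B"
  "u \<in> supp_in B \<Longrightarrow> v \<in> supp_in B \<Longrightarrow> u \<ominus>\<^bsub>P\<^esub> v \<in> supp_in B"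
  "u \<in> supp_in B \<Longrightarrow> c \<in> carrier R \<Longrightarrow> mon 0 c \<otimes>\<^bsub>P\<^esub> u \<in> supp_in B"
  "\<zero>\<^bsub>P\<^esub> \<in> supp_in B"
  "u \<in> supp_in B \<Longrightarrow> B \<subseteq> B' \<Longrightarrow> u \<in> supp_in B'"
  by (auto simp: supp_in_def coeff_mon_mult)

lemma (in cring) gauss_identities:
  "\<lbrakk>v \<in> carrier R; v' \<in> carrier R; c \<in> carrier R; g \<in> carrier R; u \<in> carrier R; u' \<in> carrier R\<rbrakk> \<Longrightarrow>
     (v \<oplus> g \<otimes> u) \<oplus> c \<otimes> (v' \<oplus> g \<otimes> u') = (v \<oplus> c \<otimes> v') \<oplus> g \<otimes> (u \<oplus> c \<otimes> u')"
  "\<lbrakk>v \<in> carrier R; g \<in> carrier R; u \<in> carrier R; u' \<in> carrier R\<rbrakk> \<Longrightarrow>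
     g \<otimes> u' \<ominus> (v \<oplus> g \<otimes> u) = g \<otimes> (u' \<ominus> u) \<ominus> v"
  "\<lbrakk>v \<in> carrier R; g \<in> carrier R; u \<in> carrier R; u' \<in> carrier R\<rbrakk> \<Longrightarrow>
     g \<otimes> u' \<ominus> (v \<oplus> g \<otimes> u) = \<ominus> v \<oplus> g \<otimes> (u' \<ominus> u)"
  by (simp_all add: a_minus_def minus_add r_distr r_minus a_ac m_ac)

text \<open>The hypothesis says that \<open>g\<close> times the span of \<open>B\<close> is
  independent modulo \<open>p\<close> and \<open>high t\<close>. Hence each monomial of
  \<open>B\<close>, multiplied by \<open>g\<close> and reduced by \<open>exists_new_lead\<close>,
  contributes one further leading exponent.\<close>

lemma card_leads_add:
  assumes p: "ideal p P" and g: "g \<in> carrier P" and finB: "finite B" and BE: "B \<subseteq> E"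
    and indep: "\<And>u v. u \<in> supp_in B \<Longrightarrow> u \<noteq> \<zero>\<^bsub>P\<^esub> \<Longrightarrow> v \<in> p \<Longrightarrow> g \<otimes>\<^bsub>P\<^esub> u \<ominus>\<^bsub>P\<^esub> v \<notin> high t"
  shows "card (leads p \<inter> {m. nrm m < t}) + card B
    \<le> card (leads {v \<oplus>\<^bsub>P\<^esub> g \<otimes>\<^bsub>P\<^esub> u | v u. v \<in> p \<and> u \<in> supp_in B} \<inter> {m. nrm m < t})"
proof -
  define W where "W B' = {v \<oplus>\<^bsub>P\<^esub> g \<otimes>\<^bsub>P\<^esub> u | v u. v \<in> p \<and> u \<in> supp_in B'}" for B'
  have pP: "v \<in> carrier P" if "v \<in> p" for v using that p by (meson ideal.Icarr)
  have fin: "finite (leads V \<inter> {m. nrm m < t})" for V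
    by (rule finite_subset[OF _ finite_nrm_less[of t]]) (use leads_subset in auto)
  have p0: "\<zero>\<^bsub>P\<^esub> \<in> p" using p by (meson additive_subgroup.zero_closed ideal.axioms(1))
  have padd: "v \<oplus>\<^bsub>P\<^esub> v' \<in> p" if "v \<in> p" "v' \<in> p" for v v'
    using that p by (meson additive_subgroup.a_closed ideal.axioms(1))
  have "B' \<subseteq> B \<Longrightarrow> card (leads p \<inter> {m. nrm m < t}) + card B' \<le> card (leads (W B') \<inter> {m. nrm m < t})"
    if "finite B'" for B'
    using that
  proof (induction B' rule: finite_induct)
    case empty
    have "p \<subseteq> W {}"
    proof
      fix v assume "v \<in> p"
      then have "v = v \<oplus>\<^bsub>P\<^esub> g \<otimes>\<^bsub>P\<^esub> \<zero>\<^bsub>P\<^esub>" using g pP by simp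
      then show "v \<in> W {}" using \<open>v \<in> p\<close> supp_in_closed(5) unfolding W_def by blast
    qed
    then have "leads p \<inter> {m. nrm m < t} \<subseteq> leads (W {}) \<inter> {m. nrm m < t}" using leads_mono by blast
    then show ?case using fin by (simp add: card_mono)
  next
    case (insert b B')
    let ?e = "g \<otimes>\<^bsub>P\<^esub> mon b \<one>"
    have bE: "b \<in> E" using insert BE by auto
    have WP: "W B' \<subseteq> carrier P" using g pP supp_in_closed(1) by (auto simp: W_def)
    have monb: "mon b \<one> \<ominus>\<^bsub>P\<^esub> u \<in> supp_in (insert b B')" if "u \<in> supp_in B'" for u
      using that by (auto simp: supp_in_def coeff_mon)
    have "\<exists>v\<in>W B'. \<exists>m. is_lead (?e \<ominus>\<^bsub>P\<^esub> v) m \<and> nrm m < t \<and> m \<notin> leads (W B')"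
    proof (rule exists_new_lead[OF WP])
      have "\<zero>\<^bsub>P\<^esub> = \<zero>\<^bsub>P\<^esub> \<oplus>\<^bsub>P\<^esub> g \<otimes>\<^bsub>P\<^esub> \<zero>\<^bsub>P\<^esub>" using g by simp
      then show "\<zero>\<^bsub>P\<^esub> \<in> W B'" using p0 supp_in_closed(5) unfolding W_def by blast
    next
      fix x y c assume "x \<in> W B'" "y \<in> W B'" and c: "c \<in> carrier R"
      then obtain v u v' u' where x: "x = v \<oplus>\<^bsub>P\<^esub> g \<otimes>\<^bsub>P\<^esub> u" "v \<in> p" "u \<in> supp_in B'"
        and y: "y = v' \<oplus>\<^bsub>P\<^esub> g \<otimes>\<^bsub>P\<^esub> u'" "v' \<in> p" "u' \<in> supp_in B'" unfolding W_def by blast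
      have "x \<oplus>\<^bsub>P\<^esub> mon 0 c \<otimes>\<^bsub>P\<^esub> y
         = (v \<oplus>\<^bsub>P\<^esub> mon 0 c \<otimes>\<^bsub>P\<^esub> v') \<oplus>\<^bsub>P\<^esub> g \<otimes>\<^bsub>P\<^esub> (u \<oplus>\<^bsub>P\<^esub> mon 0 c \<otimes>\<^bsub>P\<^esub> u')"
        unfolding x(1) y(1)
        by (rule P.gauss_identities(1)) (use x y c g pP supp_in_closed(1) in auto)
      moreover have "v \<oplus>\<^bsub>P\<^esub> mon 0 c \<otimes>\<^bsub>P\<^esub> v' \<in> p" using x y c p by (intro padd ideal.I_l_closed[OF p]) auto
      moreover have "u \<oplus>\<^bsub>P\<^esub> mon 0 c \<otimes>\<^bsub>P\<^esub> u' \<in> supp_in B'"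
        by (intro supp_in_closed(2,4) x y c)
      ultimately show "x \<oplus>\<^bsub>P\<^esub> mon 0 c \<otimes>\<^bsub>P\<^esub> y \<in> W B'" unfolding W_def by blast
    next
      show "?e \<in> carrier P" using g by simp
    next
      fix x assume "x \<in> W B'"
      then obtain v u where x: "x = v \<oplus>\<^bsub>P\<^esub> g \<otimes>\<^bsub>P\<^esub> u" "v \<in> p" "u \<in> supp_in B'" unfolding W_def by blast
      have "?e \<ominus>\<^bsub>P\<^esub> x = g \<otimes>\<^bsub>P\<^esub> (mon b \<one> \<ominus>\<^bsub>P\<^esub> u) \<ominus>\<^bsub>P\<^esub> v"
        unfolding x(1) by (rule P.gauss_identities(2)) (use x g pP supp_in_closed(1) in auto)
      moreover have "(mon b \<one> \<ominus>\<^bsub>P\<^esub> u) b \<noteq> \<zero>"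
        using x(3) insert bE by (simp add: coeff_mon supp_in_def)
      then have "mon b \<one> \<ominus>\<^bsub>P\<^esub> u \<noteq> \<zero>\<^bsub>P\<^esub>" using bE by auto
      moreover have "mon b \<one> \<ominus>\<^bsub>P\<^esub> u \<in> supp_in B"
        using monb[OF x(3)] insert(4) supp_in_closed(6) by blast
      ultimately show "?e \<ominus>\<^bsub>P\<^esub> x \<notin> high t" using indep x(2) by simp
    qed
    then obtain x m where x: "x \<in> W B'" "is_lead (?e \<ominus>\<^bsub>P\<^esub> x) m" "nrm m < t" "m \<notin> leads (W B')"
      by blast
    obtain v u where xv: "x = v \<oplus>\<^bsub>P\<^esub> g \<otimes>\<^bsub>P\<^esub> u" "v \<in> p" "u \<in> supp_in B'"
      using x(1) unfolding W_def by blast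
    have "?e \<ominus>\<^bsub>P\<^esub> x = \<ominus>\<^bsub>P\<^esub> v \<oplus>\<^bsub>P\<^esub> g \<otimes>\<^bsub>P\<^esub> (mon b \<one> \<ominus>\<^bsub>P\<^esub> u)"
      unfolding xv(1) by (rule P.gauss_identities(3)) (use xv g pP supp_in_closed(1) in auto)
    moreover have "\<ominus>\<^bsub>P\<^esub> v \<in> p" using xv p by (meson additive_subgroup.a_inv_closed ideal.axioms(1))
    ultimately have "?e \<ominus>\<^bsub>P\<^esub> x \<in> W (insert b B')" using monb[OF xv(3)] unfolding W_def by blast
    then have "m \<in> leads (W (insert b B'))" using x(2) by (auto simp: leads_def)
    moreover have "W B' \<subseteq> W (insert b B')"
      unfolding W_def using supp_in_closed(6)[of _ B' "insert b B'"] by blast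
    then have "leads (W B') \<subseteq> leads (W (insert b B'))" by (rule leads_mono)
    ultimately have "insert m (leads (W B') \<inter> {m. nrm m < t}) \<subseteq> leads (W (insert b B')) \<inter> {m. nrm m < t}"
      using x(3) by auto
    then have "card (insert m (leads (W B') \<inter> {m. nrm m < t})) \<le> card (leads (W (insert b B')) \<inter> {m. nrm m < t})"
      by (rule card_mono[OF fin])
    moreover have "card (insert m (leads (W B') \<inter> {m. nrm m < t})) = Suc (card (leads (W B') \<inter> {m. nrm m < t}))"
      using x(4) fin by simp
    ultimately show ?case using insert by simp
  qed
  from this[OF finB order_refl] show ?thesis by (simp add: W_def)
qed

text \<open>For an ideal \<open>p\<close> this is the dimension over the coefficient field of the
  quotient by \<open>p\<close> and \<open>high (2 ^ k)\<close>, counted by standard monomials. It is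
  a Hilbert function with exponential thresholds, so that a factor of bounded norm shifts
  \<open>k\<close> by a constant.\<close>

definition hilb :: "(('v \<Rightarrow> nat) \<Rightarrow> 'a) set \<Rightarrow> nat \<Rightarrow> nat" where
  "hilb p k = card ({m \<in> E. nrm m < 2 ^ k} - leads p)"

lemma hilb_mono: "k \<le> l \<Longrightarrow> hilb p k \<le> hilb p l"
  unfolding hilb_def
proof (rule card_mono)
  assume "k \<le> l"
  then have "(2::nat) ^ k \<le> 2 ^ l" by simp
  then show "{m \<in> E. nrm m < 2 ^ k} - leads p \<subseteq> {m \<in> E. nrm m < 2 ^ l} - leads p"
    by (auto intro: less_le_trans)
qed (simp add: finite_nrm_less)

lemma hilb_le: "hilb p k \<le> k ^ card I"
  unfolding hilb_def
  by (rule order_trans[OF card_mono card_nrm_less]) (auto simp: finite_nrm_less)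

lemma hilb_add: "hilb p k + card (leads p \<inter> {m. nrm m < 2 ^ k}) = card {m \<in> E. nrm m < 2 ^ k}"
proof -
  let ?A = "{m \<in> E. nrm m < 2 ^ k} - leads p" and ?B = "leads p \<inter> {m. nrm m < 2 ^ k}"
  have "{m \<in> E. nrm m < 2 ^ k} = ?A \<union> ?B"
    using leads_subset by auto
  moreover have "finite ?B"
    by (rule finite_subset[OF _ finite_nrm_less[of "2 ^ k"]]) (use leads_subset in auto)
  then have "card (?A \<union> ?B) = card ?A + card ?B"
    by (intro card_Un_disjoint finite_Diff finite_nrm_less) auto
  ultimately show ?thesis unfolding hilb_def by simp
qed

text \<open>A proper ideal contains no unit, so exponent 0 is never a leading one and always
  counts.\<close>

lemma hilb_pos:
  assumes p: "ideal p P" "p \<noteq> carrier P" and k: "k \<ge> 1"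
  shows "hilb p k \<ge> 1"
proof -
  have "0 \<notin> leads p"
  proof
    assume "0 \<in> leads p"
    then obtain s where s: "s \<in> p" "s 0 \<noteq> \<zero>" by (auto simp: leads_def is_lead_def)
    then have "s \<in> Units P" using unit_iff p by (meson ideal.Icarr)
    then have "\<one>\<^bsub>P\<^esub> \<in> p" using s p(1) by (metis P.Units_l_inv_ex ideal.I_l_closed)
    then show False using p ideal.one_imp_carrier by blast
  qed
  moreover have "nrm 0 < 2 ^ k" using k one_less_power[of "2::nat" k] by simp
  ultimately have "{0} \<subseteq> {m \<in> E. nrm m < 2 ^ k} - leads p" by auto
  then have "card {0 :: 'v \<Rightarrow> nat} \<le> hilb p k"
    unfolding hilb_def by (intro card_mono) (simp_all add: finite_nrm_less)
  then show ?thesis by simp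
qed

end

section \<open>An Artin-Rees estimate and the growth of Hilbert functions along prime chains\<close>

lemma (in cring) artin_rees_identities:
  "\<lbrakk>a \<in> carrier R; v \<in> carrier R; u \<in> carrier R; g \<in> carrier R\<rbrakk> \<Longrightarrow>
     a \<otimes> (v \<oplus> g \<otimes> u) = a \<otimes> v \<oplus> g \<otimes> (a \<otimes> u)"
  "\<lbrakk>v \<in> carrier R; u \<in> carrier R; v' \<in> carrier R; u' \<in> carrier R; g \<in> carrier R\<rbrakk> \<Longrightarrow>
     (v \<oplus> g \<otimes> u) \<oplus> (v' \<oplus> g \<otimes> u') = (v \<oplus> v') \<oplus> g \<otimes> (u \<oplus> u')"
  "\<lbrakk>v \<in> carrier R; u \<in> carrier R; v' \<in> carrier R; u' \<in> carrier R; g \<in> carrier R;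
     g \<otimes> u \<ominus> v = v' \<oplus> g \<otimes> u'\<rbrakk> \<Longrightarrow> g \<otimes> (u \<ominus> u') = v \<oplus> v'"
proof -
  assume c: "v \<in> carrier R" "u \<in> carrier R" "v' \<in> carrier R" "u' \<in> carrier R" "g \<in> carrier R"
    and eq: "g \<otimes> u \<ominus> v = v' \<oplus> g \<otimes> u'"
  have "g \<otimes> (u \<ominus> u') = (g \<otimes> u \<ominus> v) \<ominus> (v' \<oplus> g \<otimes> u') \<oplus> (v \<oplus> v')" using c by algebra
  then show "g \<otimes> (u \<ominus> u') = v \<oplus> v'" unfolding eq using c by (simp add: a_minus_def r_neg)
qed (simp_all add: r_distr m_ac a_ac)

context field_power_series
begin

lemma high_mult:
  assumes "h \<in> high t" "u \<in> carrier P" shows "h \<otimes>\<^bsub>P\<^esub> u \<in> high t"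
proof -
  have "(h \<otimes>\<^bsub>P\<^esub> u) m = \<zero>" if m: "m \<in> E" "nrm m < t" for m
    unfolding coeff_mult[OF m(1)]
  proof (rule finsum_all_zero)
    fix k assume "k \<in> {k. k \<le> m}"
    then have k: "k \<le> m" "k \<in> E" "m - k \<in> E" using m le_in_exponents diff_in_exponents by auto
    have "nrm k * 1 \<le> nrm k * nrm (m - k)" using nrm_pos[of "m - k"] by (intro mult_le_mono2) linarith
    then have "nrm k < t" using nrm_diff[OF k(1)] m by linarith
    then show "h k \<otimes> u (m - k) = \<zero>" using assms k by (simp add: high_def)
  qed
  then show ?thesis using assms by (auto simp: high_def)
qed

text \<open>Let \<open>J\<close> be generated by \<open>p\<close> and \<open>g\<close>. An element
  of \<open>J\<close> in \<open>high (2 ^ k)\<close> is divided by a standard basis of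
  \<open>J\<close>; each quotient starts at norm 2^k divided by the norm of the leading exponent,
  hence lies in \<open>high (2 ^ (k - c))\<close>. Writing each basis element as an element of
  \<open>p\<close> plus a multiple of \<open>g\<close> transfers this to \<open>u'\<close>.\<close>

lemma artin_rees_prime:
  assumes p: "ideal p P" and g: "g \<in> carrier P"
  shows "\<exists>c. \<forall>k\<ge>c. \<forall>v\<in>p. \<forall>u\<in>carrier P. v \<oplus>\<^bsub>P\<^esub> g \<otimes>\<^bsub>P\<^esub> u \<in> high (2 ^ k) \<longrightarrow>
    (\<exists>v'\<in>p. \<exists>u'\<in>high (2 ^ (k - c)). v \<oplus>\<^bsub>P\<^esub> g \<otimes>\<^bsub>P\<^esub> u = v' \<oplus>\<^bsub>P\<^esub> g \<otimes>\<^bsub>P\<^esub> u')"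
proof -
  have pP: "v \<in> carrier P" if "v \<in> p" for v using that p by (meson ideal.Icarr)
  have p0: "\<zero>\<^bsub>P\<^esub> \<in> p" using p by (meson additive_subgroup.zero_closed ideal.axioms(1))
  have padd: "v \<oplus>\<^bsub>P\<^esub> v' \<in> p" if "v \<in> p" "v' \<in> p" for v v'
    using that p by (meson additive_subgroup.a_closed ideal.axioms(1))
  define Z where "Z U = {v \<oplus>\<^bsub>P\<^esub> g \<otimes>\<^bsub>P\<^esub> u | v u. v \<in> p \<and> u \<in> U}" for U
  have Z0: "\<zero>\<^bsub>P\<^esub> \<in> Z U" if "\<zero>\<^bsub>P\<^esub> \<in> U" for U
  proof -
    have "\<zero>\<^bsub>P\<^esub> = \<zero>\<^bsub>P\<^esub> \<oplus>\<^bsub>P\<^esub> g \<otimes>\<^bsub>P\<^esub> \<zero>\<^bsub>P\<^esub>" using g by simp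
    then show ?thesis using p0 that unfolding Z_def by blast
  qed
  have Zadd: "x \<oplus>\<^bsub>P\<^esub> y \<in> Z U"
    if xy: "x \<in> Z U" "y \<in> Z U" and U: "U \<subseteq> carrier P" "\<And>a b. a \<in> U \<Longrightarrow> b \<in> U \<Longrightarrow> a \<oplus>\<^bsub>P\<^esub> b \<in> U" for x y U
  proof -
    obtain v u v' u' where x: "x = v \<oplus>\<^bsub>P\<^esub> g \<otimes>\<^bsub>P\<^esub> u" "v \<in> p" "u \<in> U"
      and y: "y = v' \<oplus>\<^bsub>P\<^esub> g \<otimes>\<^bsub>P\<^esub> u'" "v' \<in> p" "u' \<in> U" using xy unfolding Z_def by blast
    have "x \<oplus>\<^bsub>P\<^esub> y = (v \<oplus>\<^bsub>P\<^esub> v') \<oplus>\<^bsub>P\<^esub> g \<otimes>\<^bsub>P\<^esub> (u \<oplus>\<^bsub>P\<^esub> u')"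
      unfolding x(1) y(1) by (rule P.artin_rees_identities(2)) (use x y g U pP in auto)
    moreover have "v \<oplus>\<^bsub>P\<^esub> v' \<in> p" "u \<oplus>\<^bsub>P\<^esub> u' \<in> U" using padd x y U(2) by auto
    ultimately show ?thesis unfolding Z_def by blast
  qed
  define J where "J = Z (carrier P)"
  have J: "ideal J P"
  proof (rule P.cring_idealI)
    show "J \<subseteq> carrier P" using pP g by (auto simp: J_def Z_def)
    show "\<zero>\<^bsub>P\<^esub> \<in> J" unfolding J_def by (rule Z0) simp
    show "a \<oplus>\<^bsub>P\<^esub> b \<in> J" if "a \<in> J" "b \<in> J" for a b
      using that unfolding J_def by (rule Zadd) auto
    fix a x assume "a \<in> J" and x: "x \<in> carrier P"
    then obtain v u where a: "a = v \<oplus>\<^bsub>P\<^esub> g \<otimes>\<^bsub>P\<^esub> u" "v \<in> p" "u \<in> carrier P" unfolding J_def Z_def by blast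
    have "x \<otimes>\<^bsub>P\<^esub> a = x \<otimes>\<^bsub>P\<^esub> v \<oplus>\<^bsub>P\<^esub> g \<otimes>\<^bsub>P\<^esub> (x \<otimes>\<^bsub>P\<^esub> u)"
      unfolding a(1) by (rule P.artin_rees_identities(1)) (use a x g pP in auto)
    moreover have "x \<otimes>\<^bsub>P\<^esub> v \<in> p" "x \<otimes>\<^bsub>P\<^esub> u \<in> carrier P" using ideal.I_l_closed[OF p a(2) x] x a by auto
    ultimately show "x \<otimes>\<^bsub>P\<^esub> a \<in> J" unfolding J_def Z_def by blast
  qed
  obtain G e where G: "finite G" "G \<subseteq> J" "\<forall>x\<in>G. is_lead x (e x)"
      "\<forall>s m. s \<in> J \<longrightarrow> is_lead s m \<longrightarrow> (\<exists>x\<in>G. e x \<le> m)"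
    using exists_standard_basis[OF J] by blast
  \<comment> \<open>Any \<open>c\<close> for which all \<open>nrm (e x)\<close> are at most 2^c
    serves. The sum of these norms is one, being smaller than its own power of 2.\<close>
  define c where "c = (\<Sum>x\<in>G. nrm (e x))"
  have c: "nrm (e x) \<le> 2 ^ c" if "x \<in> G" for x
  proof -
    have "nrm (e x) \<le> c" unfolding c_def using that G(1) by (intro member_le_sum) auto
    also have "c \<le> 2 ^ c" using less_exp[of c] by linarith
    finally show ?thesis .
  qed
  have "\<exists>v'\<in>p. \<exists>u'\<in>high (2 ^ (k - c)). y = v' \<oplus>\<^bsub>P\<^esub> g \<otimes>\<^bsub>P\<^esub> u'"
    if k: "k \<ge> c" and y: "y \<in> J" "y \<in> high (2 ^ k)" for k y
  proof -
    have "\<exists>H. (\<forall>x\<in>G. H x \<in> carrier P \<and> (\<forall>b\<in>E. nrm b * nrm (e x) < 2 ^ k \<longrightarrow> H x b = \<zero>)) \<and>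
       y = (\<Oplus>\<^bsub>P\<^esub>x\<in>G. H x \<otimes>\<^bsub>P\<^esub> x)"
      by (rule standard_basis_division[OF J G(1,2)]) (use G y in blast)+
    then obtain H where H: "\<forall>x\<in>G. H x \<in> carrier P \<and> (\<forall>b\<in>E. nrm b * nrm (e x) < 2 ^ k \<longrightarrow> H x b = \<zero>)"
      and yH: "y = (\<Oplus>\<^bsub>P\<^esub>x\<in>G. H x \<otimes>\<^bsub>P\<^esub> x)" by (elim exE conjE)
    let ?U = "high (2 ^ (k - c))"
    have UP: "?U \<subseteq> carrier P" using high_closed(1) by auto
    have ZP: "Z ?U \<subseteq> carrier P" using UP pP g by (auto simp: Z_def)
    have summand: "H x \<otimes>\<^bsub>P\<^esub> x \<in> Z ?U" if x: "x \<in> G" for x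
    proof -
      have HP: "H x \<in> carrier P" using H x by blast
      have "H x b = \<zero>" if b: "b \<in> E" "nrm b < 2 ^ (k - c)" for b
      proof -
        have "nrm b * nrm (e x) \<le> nrm b * 2 ^ c" using c[OF x] by simp
        also have "\<dots> < 2 ^ (k - c) * 2 ^ c" using b by simp
        also have "\<dots> = 2 ^ k" using k by (simp flip: power_add)
        finally show ?thesis using H x b by blast
      qed
      then have Hh: "H x \<in> ?U" using HP by (simp add: high_def)
      have "x \<in> J" using x G(2) by auto
      then obtain v u where a: "x = v \<oplus>\<^bsub>P\<^esub> g \<otimes>\<^bsub>P\<^esub> u" "v \<in> p" "u \<in> carrier P" unfolding J_def Z_def by blast
      have "H x \<otimes>\<^bsub>P\<^esub> x = H x \<otimes>\<^bsub>P\<^esub> v \<oplus>\<^bsub>P\<^esub> g \<otimes>\<^bsub>P\<^esub> (H x \<otimes>\<^bsub>P\<^esub> u)"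
        by (subst (2) a(1), rule P.artin_rees_identities(1)) (use a HP g pP in auto)
      moreover have "H x \<otimes>\<^bsub>P\<^esub> v \<in> p" using ideal.I_l_closed[OF p a(2) HP] .
      moreover have "H x \<otimes>\<^bsub>P\<^esub> u \<in> ?U" using high_mult[OF Hh a(3)] .
      ultimately show ?thesis unfolding Z_def by blast
    qed
    have "finsum P F T \<in> Z ?U" if "finite T" "\<And>x. x \<in> T \<Longrightarrow> F x \<in> Z ?U"
      for F and T :: "(('v \<Rightarrow> nat) \<Rightarrow> 'a) set"
      using that
    proof (induction T rule: finite_induct)
      case empty
      show ?case using Z0[OF high_closed(4)] by simp
    next
      case (insert x T)
      then have "F x \<in> carrier P" "F \<in> T \<rightarrow> carrier P" using ZP by auto
      then show ?case using insert Zadd[OF _ _ UP high_closed(2)] by simp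
    qed
    from this[OF G(1) summand] have "y \<in> Z ?U" unfolding yH .
    then show ?thesis unfolding Z_def by blast
  qed
  moreover have "v \<oplus>\<^bsub>P\<^esub> g \<otimes>\<^bsub>P\<^esub> u \<in> J" if "v \<in> p" "u \<in> carrier P" for v u
    using that unfolding J_def Z_def by blast
  ultimately show ?thesis by blast
qed

text \<open>Take \<open>g\<close> in \<open>q\<close> but not in \<open>p\<close>. If
  \<open>g\<close> times \<open>u\<close> agreed modulo \<open>p\<close> with an element of
  \<open>high (2 ^ k)\<close>, Artin-Rees and primality would put the difference of \<open>u\<close>
  and some \<open>u'\<close> into \<open>p\<close>, although its leading exponent is standard for
  \<open>p\<close>. So \<open>g\<close> times the standard monomials of level \<open>k - c\<close>
  adds that many leading exponents to those of \<open>p\<close>, all of them inside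
  \<open>q\<close>.\<close>

lemma hilb_prime_step:
  assumes p: "primeideal p P" and q: "ideal q P" and pq: "p \<subset> q"
  shows "\<exists>c. \<forall>k\<ge>c. hilb q k + hilb p (k - c) \<le> hilb p k"
proof -
  have pid: "ideal p P" using p by (rule primeideal.axioms(1))
  have pP: "v \<in> carrier P" if "v \<in> p" for v using that pid by (meson ideal.Icarr)
  obtain g where g: "g \<in> q" "g \<notin> p" using pq by blast
  have gP: "g \<in> carrier P" using g q by (meson ideal.Icarr)
  obtain c where c: "\<And>k v u. k \<ge> c \<Longrightarrow> v \<in> p \<Longrightarrow> u \<in> carrier P \<Longrightarrow> v \<oplus>\<^bsub>P\<^esub> g \<otimes>\<^bsub>P\<^esub> u \<in> high (2 ^ k) \<Longrightarrow>
      \<exists>v'\<in>p. \<exists>u'\<in>high (2 ^ (k - c)). v \<oplus>\<^bsub>P\<^esub> g \<otimes>\<^bsub>P\<^esub> u = v' \<oplus>\<^bsub>P\<^esub> g \<otimes>\<^bsub>P\<^esub> u'"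
    using artin_rees_prime[OF pid gP] by blast
  have "hilb q k + hilb p (k - c) \<le> hilb p k" if k: "k \<ge> c" for k
  proof -
    define B where "B = {m \<in> E. nrm m < 2 ^ (k - c)} - leads p"
    have finB: "finite B" and BE: "B \<subseteq> E" by (auto simp: B_def finite_nrm_less)
    let ?W = "{v \<oplus>\<^bsub>P\<^esub> g \<otimes>\<^bsub>P\<^esub> u | v u. v \<in> p \<and> u \<in> supp_in B}"
    have "card (leads p \<inter> {m. nrm m < 2 ^ k}) + card B \<le> card (leads ?W \<inter> {m. nrm m < 2 ^ k})"
    proof (rule card_leads_add[OF pid gP finB BE])
      fix u v assume u: "u \<in> supp_in B" "u \<noteq> \<zero>\<^bsub>P\<^esub>" and v: "v \<in> p"
      have uP: "u \<in> carrier P" using u supp_in_closed by blast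
      show "g \<otimes>\<^bsub>P\<^esub> u \<ominus>\<^bsub>P\<^esub> v \<notin> high (2 ^ k)"
      proof
        assume hi: "g \<otimes>\<^bsub>P\<^esub> u \<ominus>\<^bsub>P\<^esub> v \<in> high (2 ^ k)"
        have eq: "g \<otimes>\<^bsub>P\<^esub> u \<ominus>\<^bsub>P\<^esub> v = \<ominus>\<^bsub>P\<^esub> v \<oplus>\<^bsub>P\<^esub> g \<otimes>\<^bsub>P\<^esub> u"
          using uP gP pP[OF v] by (simp add: a_minus_def P.a_comm)
        have "\<ominus>\<^bsub>P\<^esub> v \<in> p" using v pid by (meson additive_subgroup.a_inv_closed ideal.axioms(1))
        then obtain v' u' where v'u': "v' \<in> p" "u' \<in> high (2 ^ (k - c))"
            "g \<otimes>\<^bsub>P\<^esub> u \<ominus>\<^bsub>P\<^esub> v = v' \<oplus>\<^bsub>P\<^esub> g \<otimes>\<^bsub>P\<^esub> u'"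
          using c[OF k _ uP] hi unfolding eq by blast
        have u'P: "u' \<in> carrier P" using v'u' high_closed(1) by blast
        have "g \<otimes>\<^bsub>P\<^esub> (u \<ominus>\<^bsub>P\<^esub> u') = v \<oplus>\<^bsub>P\<^esub> v'"
          by (rule P.artin_rees_identities(3)) (use uP u'P v v'u' gP pP in auto)
        also have "\<dots> \<in> p" using v v'u' pid by (meson additive_subgroup.a_closed ideal.axioms(1))
        finally have "u \<ominus>\<^bsub>P\<^esub> u' \<in> p"
          using primeideal.I_prime[OF p gP, of "u \<ominus>\<^bsub>P\<^esub> u'"] g uP u'P by auto
        moreover obtain m where m: "is_lead u m" using is_lead_exists[OF uP u(2)] by blast
        have mB: "m \<in> B" using m u(1) by (auto simp: is_lead_def supp_in_def)
        \<comment> \<open>\<open>u'\<close> begins at norm 2^(k - c), beyond the norm of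
          \<open>m\<close>, and so does not disturb the leading term of \<open>u\<close>.\<close>
        have "is_lead (u \<ominus>\<^bsub>P\<^esub> u') m"
          using m mB v'u'(2) uP u'P by (auto simp: is_lead_def high_def B_def)
        ultimately show False using mB by (auto simp: B_def leads_def)
      qed
    qed
    moreover have "?W \<subseteq> q"
    proof
      fix x assume "x \<in> ?W"
      then obtain v u where x: "x = v \<oplus>\<^bsub>P\<^esub> g \<otimes>\<^bsub>P\<^esub> u" "v \<in> p" "u \<in> supp_in B" by blast
      have "g \<otimes>\<^bsub>P\<^esub> u \<in> q" using ideal.I_r_closed[OF q g(1)] x supp_in_closed(1) by blast
      moreover have "v \<in> q" using x pq by blast
      ultimately show "x \<in> q" unfolding x(1) using q by (meson additive_subgroup.a_closed ideal.axioms(1))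
    qed
    then have "card (leads ?W \<inter> {m. nrm m < 2 ^ k}) \<le> card (leads q \<inter> {m. nrm m < 2 ^ k})"
      using leads_mono[of ?W q] leads_subset[of q]
      by (intro card_mono finite_subset[OF _ finite_nrm_less[of "2 ^ k"]]) auto
    moreover have "card B = hilb p (k - c)" by (simp add: B_def hilb_def)
    ultimately show ?thesis using hilb_add[of p k] hilb_add[of q k] by linarith
  qed
  then show ?thesis by blast
qed

text \<open>The inequality of \<open>hilb_prime_step\<close> has the shape of Pascal's rule, so each
  prime of the chain raises the degree of growth by one.\<close>

lemma hilb_chain:
  assumes "\<And>i. i \<le> l \<Longrightarrow> primeideal (Q i) P" "\<And>i. i < l \<Longrightarrow> Q i \<subset> Q (Suc i)"
  shows "\<exists>C. \<forall>j. j choose l \<le> hilb (Q 0) (C * (j + 1))"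
  using assms
proof (induction l arbitrary: Q)
  case 0
  have "ideal (Q 0) P" "Q 0 \<noteq> carrier P"
    using 0(1)[of 0] primeideal.axioms(1) primeideal.I_notcarr by (blast, metis order_refl)
  then have "hilb (Q 0) (1 * (j + 1)) \<ge> 1" for j by (intro hilb_pos) auto
  then show ?case by (intro exI[of _ 1]) simp
next
  case (Suc l)
  have "\<exists>C. \<forall>j. j choose l \<le> hilb (Q (Suc 0)) (C * (j + 1))"
    using Suc.IH[of "\<lambda>i. Q (Suc i)"] Suc.prems by simp
  then obtain C1 where C1: "\<And>j. j choose l \<le> hilb (Q 1) (C1 * (j + 1))" by auto
  obtain c where c: "\<And>k. k \<ge> c \<Longrightarrow> hilb (Q 1) k + hilb (Q 0) (k - c) \<le> hilb (Q 0) k"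
    using hilb_prime_step[of "Q 0" "Q 1"] Suc.prems(1)[of 0] Suc.prems(1)[of 1] Suc.prems(2)[of 0]
      primeideal.axioms(1) by auto
  \<comment> \<open>One step in \<open>j\<close> moves the argument by \<open>C\<close>, so
    \<open>C\<close> has to cover the shift \<open>c\<close>; it also has to dominate the constant
    \<open>C1\<close> of the shorter chain.\<close>
  define C where "C = max C1 c"
  have "j choose Suc l \<le> hilb (Q 0) (C * (j + 1))" for j
  proof (induction j)
    case (Suc j)
    let ?k = "C * (Suc j + 1)"
    have "C1 * (j + 1) \<le> ?k" unfolding C_def by (intro mult_le_mono) auto
    then have "j choose l \<le> hilb (Q 1) ?k" using C1[of j] hilb_mono order_trans by blast
    moreover have "C * (j + 1) \<le> ?k - c" by (simp add: C_def)
    then have "j choose Suc l \<le> hilb (Q 0) (?k - c)" using Suc hilb_mono order_trans by blast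
    moreover have "c \<le> ?k" by (simp add: C_def trans_le_add1 max.coboundedI2)
    ultimately show ?case using c[of ?k] by (simp add: add_mono)
  qed simp
  then show ?case by blast
qed

text \<open>A chain of length \<open>l\<close> forces growth of degree \<open>l\<close>, while
  \<open>hilb_le\<close> allows at most degree \<open>card I\<close>.\<close>

theorem prime_chain_length_le:
  assumes "\<And>i. i \<le> l \<Longrightarrow> primeideal (Q i) P" "\<And>i. i < l \<Longrightarrow> Q i \<subset> Q (Suc i)"
  shows "l \<le> card I"
proof (rule ccontr)
  assume "\<not> l \<le> card I"
  then have l: "card I < l" by simp
  let ?n = "card I"
  obtain C where C: "\<And>j. j choose l \<le> hilb (Q 0) (C * (j + 1))"
    using hilb_chain[of l Q] assms by blast
  \<comment> \<open>\<open>D * M\<close> bounds the argument of the Hilbert function at j = l M, and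
    the binomial coefficient there is at least M^l. As M exceeds D^n for n = \<open>card I\<close>,
    the upper bound (D M)^n is less than M^(n + 1), which is at most M^l.\<close>
  define D where "D = C * (l + 1)"
  define M where "M = D ^ ?n + 1"
  have "M ^ l \<le> (l * M) choose l"
  proof -
    have "(real (l * M) / real l) ^ l \<le> real ((l * M) choose l)"
      by (rule binomial_ge_n_over_k_pow_k) (simp add: M_def)
    then have "real M ^ l \<le> real ((l * M) choose l)" using l by simp
    then show ?thesis by (metis of_nat_le_iff of_nat_power)
  qed
  also have "\<dots> \<le> (C * (l * M + 1)) ^ ?n"
    using C[of "l * M"] hilb_le order_trans by blast
  also have "\<dots> \<le> (D * M) ^ ?n"
  proof (rule power_mono)
    have "l * M + 1 \<le> (l + 1) * M" by (simp add: M_def)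
    then show "C * (l * M + 1) \<le> D * M" unfolding D_def mult.assoc by (rule mult_le_mono2)
  qed simp
  also have "\<dots> = D ^ ?n * M ^ ?n" by (rule power_mult_distrib)
  also have "\<dots> < M * M ^ ?n" by (rule mult_less_mono1) (simp_all add: M_def)
  also have "\<dots> = M ^ Suc ?n" by simp
  also have "\<dots> \<le> M ^ l" using l by (intro power_increasing) (simp_all add: M_def)
  finally show False by simp
qed

end

section \<open>Quadratic extensions\<close>

text \<open>\<open>A\<close> is free over \<open>R\<close> on 1 and \<open>z\<close>, with z^2 = -f.
  The later arguments about \<open>A\<close> use only this description; the concrete quotient
  matters where the locale is instantiated.\<close>

locale quadratic_extension = R?: cring R + A: cring A
  for R :: "('a, 'b) ring_scheme" (structure) and A :: "('c, 'd) ring_scheme" (structure) +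
  fixes \<iota> :: "'a \<Rightarrow> 'c" and z :: 'c and f :: 'a
  assumes hom: "\<iota> \<in> ring_hom R A" and z_closed: "z \<in> carrier A" and f_closed: "f \<in> carrier R"
    and z_square: "z \<otimes>\<^bsub>A\<^esub> z = \<ominus>\<^bsub>A\<^esub> \<iota> f"
    and spanning: "\<And>a. a \<in> carrier A \<Longrightarrow> \<exists>s\<in>carrier R. \<exists>t\<in>carrier R. a = \<iota> s \<oplus>\<^bsub>A\<^esub> \<iota> t \<otimes>\<^bsub>A\<^esub> z"
    and free: "\<And>s t. s \<in> carrier R \<Longrightarrow> t \<in> carrier R \<Longrightarrow> \<iota> s \<oplus>\<^bsub>A\<^esub> \<iota> t \<otimes>\<^bsub>A\<^esub> z = \<zero>\<^bsub>A\<^esub> \<Longrightarrow> s = \<zero> \<and> t = \<zero>"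
begin

sublocale hom: ring_hom_cring R A \<iota>
  by (rule ring_hom_cringI[OF R.is_cring A.is_cring hom])

section \<open>Arithmetic of pairs\<close>

definition el :: "'a \<Rightarrow> 'a \<Rightarrow> 'c" where "el s t = \<iota> s \<oplus>\<^bsub>A\<^esub> \<iota> t \<otimes>\<^bsub>A\<^esub> z"

lemma el_closed [simp, intro]: "s \<in> carrier R \<Longrightarrow> t \<in> carrier R \<Longrightarrow> el s t \<in> carrier A"
  using z_closed by (simp add: el_def)

lemma el_cases:
  assumes "a \<in> carrier A"
  obtains s t where "s \<in> carrier R" "t \<in> carrier R" "a = el s t"
  using spanning[OF assms] by (auto simp: el_def)

lemma iota_el: "s \<in> carrier R \<Longrightarrow> \<iota> s = el s \<zero>"
  using z_closed by (simp add: el_def)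

lemma zero_el: "\<zero>\<^bsub>A\<^esub> = el \<zero> \<zero>" and one_el: "\<one>\<^bsub>A\<^esub> = el \<one> \<zero>" and z_el: "z = el \<zero> \<one>"
  using z_closed by (simp_all add: el_def)

lemma el_add:
  assumes "s \<in> carrier R" "t \<in> carrier R" "s' \<in> carrier R" "t' \<in> carrier R"
  shows "el s t \<oplus>\<^bsub>A\<^esub> el s' t' = el (s \<oplus> s') (t \<oplus> t')"
proof -
  have "\<iota> s \<in> carrier A" "\<iota> t \<in> carrier A" "\<iota> s' \<in> carrier A" "\<iota> t' \<in> carrier A" using assms by auto
  then have "\<iota> s \<oplus>\<^bsub>A\<^esub> \<iota> t \<otimes>\<^bsub>A\<^esub> z \<oplus>\<^bsub>A\<^esub> (\<iota> s' \<oplus>\<^bsub>A\<^esub> \<iota> t' \<otimes>\<^bsub>A\<^esub> z)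
      = (\<iota> s \<oplus>\<^bsub>A\<^esub> \<iota> s') \<oplus>\<^bsub>A\<^esub> (\<iota> t \<oplus>\<^bsub>A\<^esub> \<iota> t') \<otimes>\<^bsub>A\<^esub> z"
    using z_closed by algebra
  then show ?thesis using assms by (simp add: el_def)
qed

lemma el_uminus:
  assumes "s \<in> carrier R" "t \<in> carrier R"
  shows "\<ominus>\<^bsub>A\<^esub> el s t = el (\<ominus> s) (\<ominus> t)"
proof -
  have "el (\<ominus> s) (\<ominus> t) \<oplus>\<^bsub>A\<^esub> el s t = \<zero>\<^bsub>A\<^esub>"
    using assms by (simp add: el_add l_neg zero_el)
  then show ?thesis using assms by (simp add: A.minus_equality)
qed

lemma el_minus:
  assumes "s \<in> carrier R" "t \<in> carrier R" "s' \<in> carrier R" "t' \<in> carrier R"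
  shows "el s t \<ominus>\<^bsub>A\<^esub> el s' t' = el (s \<ominus> s') (t \<ominus> t')"
  using assms by (simp add: a_minus_def el_uminus el_add)

lemma el_inj:
  assumes "s \<in> carrier R" "t \<in> carrier R" "s' \<in> carrier R" "t' \<in> carrier R"
  shows "el s t = el s' t' \<longleftrightarrow> s = s' \<and> t = t'"
proof
  assume "el s t = el s' t'"
  then have "el (s \<ominus> s') (t \<ominus> t') = \<zero>\<^bsub>A\<^esub>"
    using assms by (simp flip: el_minus)
  then have "s \<ominus> s' = \<zero> \<and> t \<ominus> t' = \<zero>" using assms by (intro free) (auto simp: el_def)
  then show "s = s' \<and> t = t'" using assms by (simp add: r_right_minus_eq)
qed simp

lemma el_mult:
  assumes "s \<in> carrier R" "t \<in> carrier R" "s' \<in> carrier R" "t' \<in> carrier R"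
  shows "el s t \<otimes>\<^bsub>A\<^esub> el s' t' = el (s \<otimes> s' \<ominus> f \<otimes> (t \<otimes> t')) (s \<otimes> t' \<oplus> t \<otimes> s')"
proof -
  have c: "\<iota> s \<in> carrier A" "\<iota> t \<in> carrier A" "\<iota> s' \<in> carrier A" "\<iota> t' \<in> carrier A" "\<iota> f \<in> carrier A"
    using assms f_closed by auto
  have "(\<iota> s \<oplus>\<^bsub>A\<^esub> \<iota> t \<otimes>\<^bsub>A\<^esub> z) \<otimes>\<^bsub>A\<^esub> (\<iota> s' \<oplus>\<^bsub>A\<^esub> \<iota> t' \<otimes>\<^bsub>A\<^esub> z)
     = (\<iota> s \<otimes>\<^bsub>A\<^esub> \<iota> s' \<oplus>\<^bsub>A\<^esub> (\<iota> t \<otimes>\<^bsub>A\<^esub> \<iota> t') \<otimes>\<^bsub>A\<^esub> (z \<otimes>\<^bsub>A\<^esub> z)) \<oplus>\<^bsub>A\<^esub> (\<iota> s \<otimes>\<^bsub>A\<^esub> \<iota> t' \<oplus>\<^bsub>A\<^esub> \<iota> t \<otimes>\<^bsub>A\<^esub> \<iota> s') \<otimes>\<^bsub>A\<^esub> z"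
    using c z_closed by algebra
  also have "(\<iota> t \<otimes>\<^bsub>A\<^esub> \<iota> t') \<otimes>\<^bsub>A\<^esub> (z \<otimes>\<^bsub>A\<^esub> z) = \<ominus>\<^bsub>A\<^esub> (\<iota> f \<otimes>\<^bsub>A\<^esub> (\<iota> t \<otimes>\<^bsub>A\<^esub> \<iota> t'))"
    unfolding z_square using c by algebra
  finally show ?thesis using assms f_closed by (simp add: el_def a_minus_def)
qed

lemma iota_mult_el:
  "a \<in> carrier R \<Longrightarrow> s \<in> carrier R \<Longrightarrow> t \<in> carrier R \<Longrightarrow> \<iota> a \<otimes>\<^bsub>A\<^esub> el s t = el (a \<otimes> s) (a \<otimes> t)"
  using f_closed by (simp add: iota_el el_mult a_minus_def)

lemma z_mult_el:
  "s \<in> carrier R \<Longrightarrow> t \<in> carrier R \<Longrightarrow> z \<otimes>\<^bsub>A\<^esub> el s t = el (\<ominus> (f \<otimes> t)) s"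
  unfolding z_el[THEN arg_cong[where f = "\<lambda>u. u \<otimes>\<^bsub>A\<^esub> el s t"]]
  using f_closed by (simp add: el_mult a_minus_def)

text \<open>The conjugate of s + t z is s - t z, and the product is the norm, which lies in the base
  ring. It drives incomparability, the criterion for units and the comparison with primes over
  zero.\<close>

lemma el_mult_conj:
  assumes "s \<in> carrier R" "t \<in> carrier R"
  shows "el s t \<otimes>\<^bsub>A\<^esub> el s (\<ominus> t) = \<iota> (s \<otimes> s \<oplus> f \<otimes> (t \<otimes> t))"
proof -
  have "s \<otimes> \<ominus> t \<oplus> t \<otimes> s = \<zero>" "s \<otimes> s \<ominus> f \<otimes> (t \<otimes> \<ominus> t) = s \<otimes> s \<oplus> f \<otimes> (t \<otimes> t)"
    using assms f_closed by algebra+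
  then show ?thesis using assms f_closed by (simp add: el_mult iota_el)
qed

lemma iota_inj: "s \<in> carrier R \<Longrightarrow> t \<in> carrier R \<Longrightarrow> \<iota> s = \<iota> t \<longleftrightarrow> s = t"
  by (simp add: iota_el el_inj)

section \<open>Contraction, coefficient ideals and extension of primes\<close>

definition contr :: "'c set \<Rightarrow> 'a set" where
  "contr J = {s \<in> carrier R. \<iota> s \<in> J}"

text \<open>The ideal of \<open>z\<close>-coefficients, the analogue of the leading-coefficient
  ideal in Hilbert's basis theorem.\<close>

definition top :: "'c set \<Rightarrow> 'a set" where
  "top J = {t \<in> carrier R. \<exists>s\<in>carrier R. el s t \<in> J}"

lemma (in ideal) ideal_simps:
  "a \<in> I \<Longrightarrow> b \<in> I \<Longrightarrow> a \<oplus> b \<in> I" "a \<in> I \<Longrightarrow> b \<in> I \<Longrightarrow> a \<ominus> b \<in> I" "\<zero> \<in> I"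
  by (auto simp: a_minus_def)

lemma contr_ideal:
  assumes "ideal J A" shows "ideal (contr J) R"
proof -
  interpret J: ideal J A by fact
  show ?thesis
    by (rule cring_idealI) (auto simp: contr_def J.I_l_closed)
qed

lemma top_ideal:
  assumes "ideal J A" shows "ideal (top J) R"
proof -
  interpret J: ideal J A by fact
  show ?thesis
  proof (rule cring_idealI)
    show "\<zero> \<in> top J" using J.ideal_simps(3) by (auto simp: top_def zero_el)
    fix a b assume "a \<in> top J" "b \<in> top J"
    then obtain s s' where "s \<in> carrier R" "s' \<in> carrier R" "el s a \<in> J" "el s' b \<in> J"
      and ab: "a \<in> carrier R" "b \<in> carrier R" by (auto simp: top_def)
    then have "el (s \<oplus> s') (a \<oplus> b) \<in> J" "s \<oplus> s' \<in> carrier R"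
      using J.ideal_simps(1)[of "el s a" "el s' b"] by (auto simp: el_add)
    then show "a \<oplus> b \<in> top J" using ab by (auto simp: top_def)
  next
    fix a x assume "a \<in> top J" and x: "x \<in> carrier R"
    then obtain s where s: "s \<in> carrier R" "el s a \<in> J" and a: "a \<in> carrier R" by (auto simp: top_def)
    have "\<iota> x \<otimes>\<^bsub>A\<^esub> el s a \<in> J" using J.I_l_closed s x by auto
    then have "el (x \<otimes> s) (x \<otimes> a) \<in> J" using s a x by (simp add: iota_mult_el)
    then show "x \<otimes> a \<in> top J" using s a x by (auto simp: top_def)
  qed (auto simp: top_def)
qed

text \<open>Generators of \<open>contr J\<close> and of \<open>top J\<close> are lifted to
  \<open>J\<close>. The lifts generate: the \<open>z\<close>-coefficient of an element of
  \<open>J\<close> is matched first, and the remaining difference lies in the contraction.\<close>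

lemma A_noetherian:
  assumes "noetherian_ring R" shows "noetherian_ring A"
proof (rule A.noetherian_ringI)
  interpret N: noetherian_ring R by fact
  fix J assume J: "ideal J A"
  interpret J: ideal J A by fact
  obtain B0 where B0: "B0 \<subseteq> carrier R" "finite B0" "contr J = Idl B0"
    using N.finetely_gen[OF contr_ideal[OF J]] by blast
  obtain B1 where B1: "B1 \<subseteq> carrier R" "finite B1" "top J = Idl B1"
    using N.finetely_gen[OF top_ideal[OF J]] by blast
  have "B1 \<subseteq> top J" using B1 genideal_self by simp
  then have "\<forall>t\<in>B1. \<exists>s. s \<in> carrier R \<and> el s t \<in> J" by (auto simp: top_def)
  then obtain \<sigma> where \<sigma>: "\<forall>t\<in>B1. \<sigma> t \<in> carrier R \<and> el (\<sigma> t) t \<in> J" by (rule bchoice[THEN exE])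
  define G where "G = \<iota> ` B0 \<union> (\<lambda>t. el (\<sigma> t) t) ` B1"
  have "B0 \<subseteq> contr J" using B0 genideal_self by simp
  then have GJ: "G \<subseteq> J" using \<sigma> by (auto simp: G_def contr_def)
  then have GA: "G \<subseteq> carrier A" using J.a_subset by auto
  interpret GI: ideal "Idl\<^bsub>A\<^esub> G" A by (rule A.genideal_ideal[OF GA])
  have Gin: "G \<subseteq> Idl\<^bsub>A\<^esub> G" by (rule A.genideal_self[OF GA])
  have "B0 \<subseteq> contr (Idl\<^bsub>A\<^esub> G)" using B0 Gin by (auto simp: contr_def G_def)
  then have c: "contr J \<subseteq> contr (Idl\<^bsub>A\<^esub> G)"
    unfolding B0(3) by (rule genideal_minimal[OF contr_ideal[OF GI.ideal_axioms]])
  have "t \<in> top (Idl\<^bsub>A\<^esub> G)" if "t \<in> B1" for t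
  proof -
    have "el (\<sigma> t) t \<in> Idl\<^bsub>A\<^esub> G" using Gin that by (auto simp: G_def)
    then show ?thesis using \<sigma> that B1 by (auto simp: top_def)
  qed
  then have "B1 \<subseteq> top (Idl\<^bsub>A\<^esub> G)" by blast
  then have t: "top J \<subseteq> top (Idl\<^bsub>A\<^esub> G)"
    unfolding B1(3) by (rule genideal_minimal[OF top_ideal[OF GI.ideal_axioms]])
  have le: "Idl\<^bsub>A\<^esub> G \<subseteq> J" by (rule A.genideal_minimal[OF J GJ])
  have "J \<subseteq> Idl\<^bsub>A\<^esub> G"
  proof
    fix a assume a: "a \<in> J"
    then obtain s u where su: "s \<in> carrier R" "u \<in> carrier R" "a = el s u" using J.Icarr el_cases by metis
    then have "u \<in> top (Idl\<^bsub>A\<^esub> G)" using a t by (auto simp: top_def)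
    then obtain s' where s': "s' \<in> carrier R" "el s' u \<in> Idl\<^bsub>A\<^esub> G" by (auto simp: top_def)
    have [simp]: "u \<ominus> u = \<zero>" using su by (simp add: a_minus_def r_neg)
    have "el s u \<ominus>\<^bsub>A\<^esub> el s' u \<in> J" using J.ideal_simps(2) a su s' le by blast
    then have "\<iota> (s \<ominus> s') \<in> J" using su s' by (simp add: el_minus iota_el)
    then have "s \<ominus> s' \<in> contr (Idl\<^bsub>A\<^esub> G)" using c su s' by (auto simp: contr_def)
    then have "\<iota> (s \<ominus> s') \<oplus>\<^bsub>A\<^esub> el s' u \<in> Idl\<^bsub>A\<^esub> G" using s' GI.ideal_simps(1) by (simp add: contr_def)
    moreover have "\<iota> (s \<ominus> s') \<oplus>\<^bsub>A\<^esub> el s' u = el s u"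
    proof -
      have "s \<ominus> s' \<oplus> s' = s" using su s' by algebra
      then show ?thesis using su s' by (simp add: iota_el el_add)
    qed
    ultimately show "a \<in> Idl\<^bsub>A\<^esub> G" using su by simp
  qed
  then have "J = Idl\<^bsub>A\<^esub> G" using le by blast
  moreover have "finite G" using B0 B1 by (simp add: G_def)
  ultimately show "\<exists>G\<subseteq>carrier A. finite G \<and> J = Idl\<^bsub>A\<^esub> G" using GA by blast
qed

lemma contr_prime:
  assumes "primeideal p A" shows "primeideal (contr p) R"
proof -
  interpret p: primeideal p A by fact
  show ?thesis
  proof (rule primeidealI[OF contr_ideal[OF p.ideal_axioms] R.is_cring])
    have "\<one>\<^bsub>A\<^esub> \<notin> p" using p.I_notcarr p.one_imp_carrier by auto
    then have "\<one> \<notin> contr p" by (simp add: contr_def)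
    then show "carrier R \<noteq> contr p" by blast
    show "a \<in> contr p \<or> b \<in> contr p" if "a \<in> carrier R" "b \<in> carrier R" "a \<otimes> b \<in> contr p" for a b
      using p.I_prime[of "\<iota> a" "\<iota> b"] that by (auto simp: contr_def)
  qed
qed

text \<open>Incomparability: an element and its conjugate have norm and trace in the base ring.\<close>

lemma contr_strict:
  assumes p: "primeideal p A" and q: "primeideal q A" and pq: "p \<subset> q"
  shows "contr p \<subset> contr q"
proof -
  interpret p: primeideal p A by fact
  interpret q: primeideal q A by fact
  have sub: "contr p \<subseteq> contr q" using pq by (auto simp: contr_def)
  have "contr p \<noteq> contr q"
  proof
    assume eq: "contr p = contr q"
    obtain y where y: "y \<in> q" "y \<notin> p" using pq by blast
    then obtain s t where st: "s \<in> carrier R" "t \<in> carrier R" "y = el s t" using q.Icarr el_cases by metis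
    let ?y = "el s (\<ominus> t)"
    have yA: "?y \<in> carrier A" "y \<in> carrier A" using st by auto
    have prod: "y \<otimes>\<^bsub>A\<^esub> ?y = \<iota> (s \<otimes> s \<oplus> f \<otimes> (t \<otimes> t))" using st el_mult_conj by simp
    have "y \<otimes>\<^bsub>A\<^esub> ?y \<in> q" using q.I_r_closed y yA by blast
    then have "s \<otimes> s \<oplus> f \<otimes> (t \<otimes> t) \<in> contr p"
      unfolding eq using prod st f_closed by (simp add: contr_def)
    then have "y \<otimes>\<^bsub>A\<^esub> ?y \<in> p" unfolding prod by (simp add: contr_def)
    \<comment> \<open>Since \<open>y\<close> is not in \<open>p\<close>, primality puts the
      conjugate there; the trace then brings \<open>y\<close> itself into \<open>p\<close>.\<close>
    then have yp: "?y \<in> p" using p.I_prime y yA by blast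
    have sum: "y \<oplus>\<^bsub>A\<^esub> ?y = \<iota> (s \<oplus> s)" using st by (simp add: el_add r_neg iota_el)
    have "y \<oplus>\<^bsub>A\<^esub> ?y \<in> q" using q.ideal_simps(1) y yp pq by blast
    then have "s \<oplus> s \<in> contr p" unfolding eq using sum st by (simp add: contr_def)
    then have "y \<oplus>\<^bsub>A\<^esub> ?y \<in> p" unfolding sum by (simp add: contr_def)
    then have "y \<oplus>\<^bsub>A\<^esub> ?y \<ominus>\<^bsub>A\<^esub> ?y \<in> p" using p.ideal_simps(2) yp by blast
    moreover have "y \<oplus>\<^bsub>A\<^esub> ?y \<ominus>\<^bsub>A\<^esub> ?y = y" using yA by algebra
    ultimately show False using y by simp
  qed
  then show ?thesis using sub by blast
qed

text \<open>For \<open>f\<close> in \<open>p\<close> this is the kernel of the map from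
  \<open>A\<close> to the quotient of \<open>R\<close> by \<open>p\<close> that sends
  \<open>z\<close> to 0. The condition on \<open>f\<close> is forced by z^2 = -f.\<close>

definition extend :: "'a set \<Rightarrow> 'c set" where
  "extend p = {el s t | s t. s \<in> p \<and> t \<in> carrier R}"

lemma el_in_extend:
  assumes "p \<subseteq> carrier R" "s \<in> carrier R" "t \<in> carrier R"
  shows "el s t \<in> extend p \<longleftrightarrow> s \<in> p"
proof
  assume "el s t \<in> extend p"
  then obtain s' t' where "el s t = el s' t'" "s' \<in> p" "t' \<in> carrier R" unfolding extend_def by blast
  then show "s \<in> p" using el_inj assms by (metis subsetD)
qed (use assms in \<open>auto simp: extend_def\<close>)

lemma extend_ideal:
  assumes "ideal p R" "f \<in> p" shows "ideal (extend p) A"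
proof -
  interpret p: ideal p R by fact
  have pR: "p \<subseteq> carrier R" by (rule p.a_subset)
  show ?thesis
  proof (rule A.cring_idealI)
    show "extend p \<subseteq> carrier A" using pR by (auto simp: extend_def)
    show "\<zero>\<^bsub>A\<^esub> \<in> extend p" using p.ideal_simps(3) pR by (simp add: zero_el el_in_extend)
    fix a b assume "a \<in> extend p" "b \<in> extend p"
    then obtain s t s' t' where "a = el s t" "b = el s' t'" "s \<in> p" "s' \<in> p" "t \<in> carrier R" "t' \<in> carrier R"
      by (auto simp: extend_def)
    then show "a \<oplus>\<^bsub>A\<^esub> b \<in> extend p" using pR p.ideal_simps(1) by (auto simp: el_add el_in_extend p.Icarr)
  next
    fix a x assume "a \<in> extend p" and x: "x \<in> carrier A"
    then obtain s t where st: "a = el s t" "s \<in> p" "t \<in> carrier R" by (auto simp: extend_def)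
    obtain u v where uv: "x = el u v" "u \<in> carrier R" "v \<in> carrier R" using x el_cases by metis
    have "u \<otimes> s \<ominus> f \<otimes> (v \<otimes> t) \<in> p"
      using st uv assms(2) by (intro p.ideal_simps(2) p.I_l_closed p.I_r_closed) auto
    then show "x \<otimes>\<^bsub>A\<^esub> a \<in> extend p" using st uv pR p.Icarr f_closed by (auto simp: el_mult el_in_extend)
  qed
qed

text \<open>Because \<open>f\<close> is in \<open>p\<close>, the base part of a product is modulo
  \<open>p\<close> the product of the base parts, so primality is inherited from
  \<open>p\<close>.\<close>

lemma extend_prime:
  assumes p: "primeideal p R" and f: "f \<in> p" shows "primeideal (extend p) A"
proof -
  interpret p: primeideal p R by fact
  have pR: "p \<subseteq> carrier R" by (rule p.a_subset)
  show ?thesis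
  proof (rule primeidealI[OF extend_ideal[OF p.ideal_axioms f] A.is_cring])
    have "\<one> \<notin> p" using p.I_notcarr p.one_imp_carrier by auto
    then have "\<one>\<^bsub>A\<^esub> \<notin> extend p" using pR by (simp add: one_el el_in_extend)
    then show "carrier A \<noteq> extend p" by auto
    fix a b assume "a \<in> carrier A" "b \<in> carrier A" and ab: "a \<otimes>\<^bsub>A\<^esub> b \<in> extend p"
    then obtain s t u v where st: "s \<in> carrier R" "t \<in> carrier R" "a = el s t"
      and uv: "u \<in> carrier R" "v \<in> carrier R" "b = el u v" using el_cases by metis
    have *: "s \<otimes> u \<ominus> f \<otimes> (t \<otimes> v) \<in> p" using ab st uv pR f_closed by (simp add: el_mult el_in_extend)
    have ftv: "f \<otimes> (t \<otimes> v) \<in> p" using p.I_r_closed[OF f] st uv by simp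
    have "s \<otimes> u \<ominus> f \<otimes> (t \<otimes> v) \<oplus> f \<otimes> (t \<otimes> v) \<in> p" using p.ideal_simps(1)[OF * ftv] .
    moreover have "s \<otimes> u \<ominus> f \<otimes> (t \<otimes> v) \<oplus> f \<otimes> (t \<otimes> v) = s \<otimes> u" using st uv f_closed by algebra
    ultimately have "s \<in> p \<or> u \<in> p" using p.I_prime st uv by simp
    then show "a \<in> extend p \<or> b \<in> extend p" using st uv pR by (simp add: el_in_extend)
  qed
qed

text \<open>The nonzero elements of the domain \<open>R\<close> form a multiplicative set, and an
  ideal maximal among those avoiding its image is prime. The zero ideal also has contraction zero
  but need not be prime, as \<open>A\<close> may have zero divisors.\<close>

lemma exists_prime_contr_zero:
  assumes "domain R" "noetherian_ring A"
  shows "\<exists>p. primeideal p A \<and> contr p = {\<zero>}"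
proof -
  interpret D: domain R by fact
  interpret N: noetherian_ring A by fact
  define F0 where "F0 = {J. ideal J A \<and> contr J = {\<zero>}}"
  have "\<exists>m\<in>F0. \<forall>x\<in>F0. m \<subseteq> x \<longrightarrow> x = m"
  proof (rule subset_Zorn)
    fix C assume C: "subset.chain F0 C"
    show "\<exists>u\<in>F0. \<forall>x\<in>C. x \<subseteq> u"
    proof (cases "C = {}")
      case True
      have "{\<zero>\<^bsub>A\<^esub>} \<in> F0"
        using A.zeroideal iota_inj[of _ \<zero>] by (auto simp: F0_def contr_def)
      then show ?thesis using True by blast
    next
      case False
      \<comment> \<open>By the Noetherian condition the union of a chain is one of its members and
        so keeps zero contraction.\<close>
      have "subset.chain {I. ideal I A} C" using C by (auto simp: F0_def pred_on.chain_def)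
      then have "\<Union>C \<in> C" by (rule N.ideal_chain_is_trivial[OF False])
      moreover have "C \<subseteq> F0" using C by (auto simp: pred_on.chain_def)
      ultimately show ?thesis by blast
    qed
  qed
  then obtain M where MF: "M \<in> F0" "\<forall>x\<in>F0. M \<subseteq> x \<longrightarrow> x = M" by (elim bexE)
  have M: "ideal M A" "contr M = {\<zero>}" using MF(1) by (auto simp: F0_def)
  have max: "Y = M" if "ideal Y A" "contr Y = {\<zero>}" "M \<subseteq> Y" for Y
    using MF(2) that by (simp add: F0_def)
  interpret M: ideal M A by fact
  \<comment> \<open>By maximality, adjoining an element outside \<open>M\<close> produces a nonzero
    element of the base ring.\<close>
  have hit: "\<exists>r\<in>carrier R. r \<noteq> \<zero> \<and> (\<exists>m\<in>M. \<exists>x\<in>carrier A. \<iota> r = m \<oplus>\<^bsub>A\<^esub> x \<otimes>\<^bsub>A\<^esub> a)"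
    if a: "a \<in> carrier A" "a \<notin> M" for a
  proof -
    define Y where "Y = {m \<oplus>\<^bsub>A\<^esub> x \<otimes>\<^bsub>A\<^esub> a | m x. m \<in> M \<and> x \<in> carrier A}"
    have Y: "ideal Y A"
    proof (rule A.cring_idealI)
      show "Y \<subseteq> carrier A" using a M.Icarr by (auto simp: Y_def)
      have "\<zero>\<^bsub>A\<^esub> = \<zero>\<^bsub>A\<^esub> \<oplus>\<^bsub>A\<^esub> \<zero>\<^bsub>A\<^esub> \<otimes>\<^bsub>A\<^esub> a" using a by simp
      then show "\<zero>\<^bsub>A\<^esub> \<in> Y" using M.ideal_simps(3) unfolding Y_def by blast
      fix u v assume "u \<in> Y" "v \<in> Y"
      then obtain m x m' x' where u: "u = m \<oplus>\<^bsub>A\<^esub> x \<otimes>\<^bsub>A\<^esub> a" "m \<in> M" "x \<in> carrier A"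
        and v: "v = m' \<oplus>\<^bsub>A\<^esub> x' \<otimes>\<^bsub>A\<^esub> a" "m' \<in> M" "x' \<in> carrier A" unfolding Y_def by blast
      have "m \<in> carrier A" "m' \<in> carrier A" using u v M.Icarr by auto
      then have "u \<oplus>\<^bsub>A\<^esub> v = (m \<oplus>\<^bsub>A\<^esub> m') \<oplus>\<^bsub>A\<^esub> (x \<oplus>\<^bsub>A\<^esub> x') \<otimes>\<^bsub>A\<^esub> a"
        unfolding u(1) v(1) using u(3) v(3) a(1) by algebra
      moreover have "m \<oplus>\<^bsub>A\<^esub> m' \<in> M" "x \<oplus>\<^bsub>A\<^esub> x' \<in> carrier A" using u v M.ideal_simps(1) by auto
      ultimately show "u \<oplus>\<^bsub>A\<^esub> v \<in> Y" unfolding Y_def by blast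
    next
      fix u y assume "u \<in> Y" and y: "y \<in> carrier A"
      then obtain m x where u: "u = m \<oplus>\<^bsub>A\<^esub> x \<otimes>\<^bsub>A\<^esub> a" "m \<in> M" "x \<in> carrier A" unfolding Y_def by blast
      have "m \<in> carrier A" using u M.Icarr by auto
      then have "y \<otimes>\<^bsub>A\<^esub> u = y \<otimes>\<^bsub>A\<^esub> m \<oplus>\<^bsub>A\<^esub> (y \<otimes>\<^bsub>A\<^esub> x) \<otimes>\<^bsub>A\<^esub> a"
        unfolding u(1) using u(3) y a(1) by algebra
      moreover have "y \<otimes>\<^bsub>A\<^esub> m \<in> M" "y \<otimes>\<^bsub>A\<^esub> x \<in> carrier A" using u y M.I_l_closed by auto
      ultimately show "y \<otimes>\<^bsub>A\<^esub> u \<in> Y" unfolding Y_def by blast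
    qed
    have MX: "M \<subseteq> Y"
    proof
      fix m assume m: "m \<in> M"
      then have "m = m \<oplus>\<^bsub>A\<^esub> \<zero>\<^bsub>A\<^esub> \<otimes>\<^bsub>A\<^esub> a" using a M.Icarr by simp
      then show "m \<in> Y" using m unfolding Y_def by blast
    qed
    have "a = \<zero>\<^bsub>A\<^esub> \<oplus>\<^bsub>A\<^esub> \<one>\<^bsub>A\<^esub> \<otimes>\<^bsub>A\<^esub> a" using a by simp
    then have "a \<in> Y" using M.ideal_simps(3) unfolding Y_def by blast
    then have "contr Y \<noteq> {\<zero>}" using max[OF Y _ MX] a by blast
    moreover have "\<zero> \<in> contr Y" using Y by (auto simp: contr_def ideal.ideal_simps(3))
    ultimately obtain r where "r \<in> contr Y" "r \<noteq> \<zero>" by blast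
    then show ?thesis unfolding contr_def Y_def by blast
  qed
  have "primeideal M A"
  proof (rule primeidealI[OF M(1) A.is_cring])
    have "\<one> \<notin> contr M" using M(2) D.one_not_zero by simp
    then show "carrier A \<noteq> M" by (auto simp: contr_def)
    fix a b assume ab: "a \<in> carrier A" "b \<in> carrier A" "a \<otimes>\<^bsub>A\<^esub> b \<in> M"
    show "a \<in> M \<or> b \<in> M"
    proof (rule ccontr)
      assume "\<not> ?thesis"
      then have n: "a \<notin> M" "b \<notin> M" by auto
      obtain r m x where r: "r \<in> carrier R" "r \<noteq> \<zero>" "m \<in> M" "x \<in> carrier A" "\<iota> r = m \<oplus>\<^bsub>A\<^esub> x \<otimes>\<^bsub>A\<^esub> a"
        using hit[OF ab(1) n(1)] by blast
      obtain r' m' x' where r': "r' \<in> carrier R" "r' \<noteq> \<zero>" "m' \<in> M" "x' \<in> carrier A" "\<iota> r' = m' \<oplus>\<^bsub>A\<^esub> x' \<otimes>\<^bsub>A\<^esub> b"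
        using hit[OF ab(2) n(2)] by blast
      have mm: "m \<in> carrier A" "m' \<in> carrier A" using r r' M.Icarr by auto
      \<comment> \<open>If the product of \<open>a\<close> and \<open>b\<close> is in
        \<open>M\<close>, the product of the two base elements lies in \<open>M\<close> as well, yet
        it is nonzero because \<open>R\<close> is a domain.\<close>
      have "\<iota> (r \<otimes> r') = \<iota> r' \<otimes>\<^bsub>A\<^esub> m \<oplus>\<^bsub>A\<^esub> (x \<otimes>\<^bsub>A\<^esub> a) \<otimes>\<^bsub>A\<^esub> m' \<oplus>\<^bsub>A\<^esub> (x \<otimes>\<^bsub>A\<^esub> x') \<otimes>\<^bsub>A\<^esub> (a \<otimes>\<^bsub>A\<^esub> b)"
      proof -
        have "\<iota> (r \<otimes> r') = \<iota> r \<otimes>\<^bsub>A\<^esub> \<iota> r'" using r r' by simp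
        also have "\<dots> = (m \<oplus>\<^bsub>A\<^esub> x \<otimes>\<^bsub>A\<^esub> a) \<otimes>\<^bsub>A\<^esub> (m' \<oplus>\<^bsub>A\<^esub> x' \<otimes>\<^bsub>A\<^esub> b)" using r r' by simp
        also have "\<dots> = (m' \<oplus>\<^bsub>A\<^esub> x' \<otimes>\<^bsub>A\<^esub> b) \<otimes>\<^bsub>A\<^esub> m \<oplus>\<^bsub>A\<^esub> (x \<otimes>\<^bsub>A\<^esub> a) \<otimes>\<^bsub>A\<^esub> m' \<oplus>\<^bsub>A\<^esub> (x \<otimes>\<^bsub>A\<^esub> x') \<otimes>\<^bsub>A\<^esub> (a \<otimes>\<^bsub>A\<^esub> b)"
          using mm r(4) r'(4) ab(1,2) by algebra
        finally show ?thesis using r' by simp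
      qed
      also have "\<dots> \<in> M"
      proof (intro M.ideal_simps(1))
        show "\<iota> r' \<otimes>\<^bsub>A\<^esub> m \<in> M" by (rule M.I_l_closed[OF r(3) hom.hom_closed[OF r'(1)]])
        show "(x \<otimes>\<^bsub>A\<^esub> a) \<otimes>\<^bsub>A\<^esub> m' \<in> M" by (rule M.I_l_closed[OF r'(3) A.m_closed[OF r(4) ab(1)]])
        show "(x \<otimes>\<^bsub>A\<^esub> x') \<otimes>\<^bsub>A\<^esub> (a \<otimes>\<^bsub>A\<^esub> b) \<in> M" by (rule M.I_l_closed[OF ab(3) A.m_closed[OF r(4) r'(4)]])
      qed
      finally have "r \<otimes> r' \<in> contr M" using r r' by (simp add: contr_def)
      then show False using M(2) r r' D.integral by blast
    qed
  qed
  then show ?thesis using M(2) by blast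
qed

text \<open>The norm of an element of \<open>P\<close> lies in the zero contraction, so s^2 = -f t^2
  belongs to \<open>p\<close>, and with it \<open>s\<close>. Thus an ideal over zero lies below
  every extended prime and can start the chain.\<close>

lemma contr_zero_subset_extend:
  assumes "ideal P A" "contr P = {\<zero>}" "primeideal p R" "f \<in> p"
  shows "P \<subseteq> extend p"
proof
  interpret P: ideal P A by fact
  interpret p: primeideal p R by fact
  fix y assume y: "y \<in> P"
  then obtain s t where st: "s \<in> carrier R" "t \<in> carrier R" "y = el s t" using P.Icarr el_cases by metis
  have "y \<otimes>\<^bsub>A\<^esub> el s (\<ominus> t) \<in> P" using y st P.I_r_closed by simp
  then have "s \<otimes> s \<oplus> f \<otimes> (t \<otimes> t) \<in> contr P" using st f_closed el_mult_conj by (simp add: contr_def)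
  then have "s \<otimes> s \<oplus> f \<otimes> (t \<otimes> t) = \<zero>" using assms(2) by simp
  moreover have "s \<otimes> s = (s \<otimes> s \<oplus> f \<otimes> (t \<otimes> t)) \<ominus> f \<otimes> (t \<otimes> t)" using st f_closed by algebra
  ultimately have "s \<otimes> s = \<zero> \<ominus> f \<otimes> (t \<otimes> t)" by simp
  also have "\<dots> \<in> p" using p.I_r_closed[OF assms(4)] st by (intro p.ideal_simps) auto
  finally have "s \<in> p" using p.I_prime st by blast
  then show "y \<in> extend p" using st p.a_subset by (simp add: el_in_extend)
qed

text \<open>Modulo \<open>m\<close> the norm is s^2, so it is a unit of the base ring, and the
  conjugate divided by the norm is the inverse.\<close>

lemma el_unit:
  assumes m: "ideal m R" "f \<in> m" and units: "\<And>s. s \<in> carrier R \<Longrightarrow> s \<notin> m \<Longrightarrow> s \<in> Units R"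
    and prime: "primeideal m R"
    and st: "s \<in> carrier R" "t \<in> carrier R" "s \<notin> m"
  shows "el s t \<in> Units A"
proof -
  interpret m: primeideal m R by fact
  let ?N = "s \<otimes> s \<oplus> f \<otimes> (t \<otimes> t)"
  have "?N \<notin> m"
  proof
    assume N: "?N \<in> m"
    have "f \<otimes> (t \<otimes> t) \<in> m" using m.I_r_closed[OF m(2)] st by simp
    then have "?N \<ominus> f \<otimes> (t \<otimes> t) \<in> m" using N m.ideal_simps(2) by blast
    moreover have "?N \<ominus> f \<otimes> (t \<otimes> t) = s \<otimes> s" using st f_closed by algebra
    ultimately show False using m.I_prime st by auto
  qed
  then have "?N \<in> Units R" using units st f_closed by simp
  then obtain u where u: "u \<in> carrier R" "?N \<otimes> u = \<one>" using Units_r_inv_ex by blast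
  have "el s t \<otimes>\<^bsub>A\<^esub> (el s (\<ominus> t) \<otimes>\<^bsub>A\<^esub> \<iota> u) = \<iota> ?N \<otimes>\<^bsub>A\<^esub> \<iota> u"
    using st u by (simp flip: A.m_assoc add: el_mult_conj)
  also have "\<dots> = \<one>\<^bsub>A\<^esub>" using u st f_closed hom.hom_mult[of ?N u] by simp
  finally have "el s t \<otimes>\<^bsub>A\<^esub> (el s (\<ominus> t) \<otimes>\<^bsub>A\<^esub> \<iota> u) = \<one>\<^bsub>A\<^esub>" .
  moreover have "el s (\<ominus> t) \<otimes>\<^bsub>A\<^esub> \<iota> u \<in> carrier A" using st u by simp
  ultimately have "(el s (\<ominus> t) \<otimes>\<^bsub>A\<^esub> \<iota> u) \<otimes>\<^bsub>A\<^esub> el s t = \<one>\<^bsub>A\<^esub>" "el s (\<ominus> t) \<otimes>\<^bsub>A\<^esub> \<iota> u \<in> carrier A"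
    using A.m_comm[of "el s t" "el s (\<ominus> t) \<otimes>\<^bsub>A\<^esub> \<iota> u"] st by auto
  then show ?thesis using st \<open>el s t \<otimes>\<^bsub>A\<^esub> (el s (\<ominus> t) \<otimes>\<^bsub>A\<^esub> \<iota> u) = \<one>\<^bsub>A\<^esub>\<close> unfolding Units_def by blast
qed

text \<open>By \<open>el_unit\<close> an ideal with an element outside \<open>extend m\<close>
  contains a unit, so every proper ideal lies in \<open>extend m\<close>.\<close>

lemma A_local:
  assumes prime: "primeideal m R" and f: "f \<in> m"
    and units: "\<And>s. s \<in> carrier R \<Longrightarrow> s \<notin> m \<Longrightarrow> s \<in> Units R"
  shows "maximalideal J A \<longleftrightarrow> J = extend m"
proof -
  interpret m: primeideal m R by fact
  have full: "J = carrier A" if J: "ideal J A" "\<not> J \<subseteq> extend m" for J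
  proof -
    interpret J: ideal J A by fact
    obtain y where y: "y \<in> J" "y \<notin> extend m" using J by blast
    then obtain s t where st: "s \<in> carrier R" "t \<in> carrier R" "y = el s t" using J.Icarr el_cases by metis
    then have "s \<notin> m" using y m.a_subset by (simp add: el_in_extend)
    then have "y \<in> Units A" using el_unit[OF m.ideal_axioms f units prime] st by simp
    then have "\<one>\<^bsub>A\<^esub> \<in> J" using y J.I_l_closed by (metis A.Units_l_inv_ex)
    then show ?thesis by (rule J.one_imp_carrier)
  qed
  have ext: "ideal (extend m) A" "extend m \<noteq> carrier A"
    using extend_prime[OF prime f] primeideal.axioms(1) primeideal.I_notcarr by (blast, metis)
  show ?thesis
  proof
    assume J: "maximalideal J A"
    interpret J: maximalideal J A by fact
    have "J \<subseteq> extend m" using full J.ideal_axioms J.I_notcarr by metis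
    then show "J = extend m"
      using J.I_maximal[OF ext(1)] ext ideal.Icarr[OF ext(1)] by blast
  next
    assume "J = extend m"
    moreover have "maximalideal (extend m) A"
      by (rule maximalidealI[OF ext(1)]) (use ext full in \<open>auto dest: equalityI\<close>)
    ultimately show "maximalideal J A" by simp
  qed
qed

end

section \<open>Frobenius pushforwards and free summands\<close>

lemma (in cring) binomial_ring:
  assumes a: "a \<in> carrier R" and b: "b \<in> carrier R"
  shows "(a \<oplus> b) [^] (n :: nat) = (\<Oplus>k\<in>{..n}. [(n choose k)] \<cdot> (a [^] k \<otimes> b [^] (n - k)))"
proof (induction n)
  case 0
  show ?case by simp
next
  case (Suc n)
  let ?t = "\<lambda>k. [(n choose k)] \<cdot> (a [^] k \<otimes> b [^] (n - k))"
  let ?u = "\<lambda>k. [(n choose k)] \<cdot> (a [^] Suc k \<otimes> b [^] (n - k))"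
  let ?v = "\<lambda>k. [(n choose Suc k)] \<cdot> (a [^] Suc k \<otimes> b [^] (n - k))"
  let ?w = "\<lambda>k. [(n choose k)] \<cdot> (a [^] k \<otimes> b [^] (Suc n - k))"
  have pc: "a [^] (k :: nat) \<in> carrier R" "b [^] (k :: nat) \<in> carrier R" for k using a b by auto
  have "(a \<oplus> b) [^] Suc n = finsum R ?t {..n} \<otimes> (a \<oplus> b)" using Suc by simp
  also have "\<dots> = finsum R ?t {..n} \<otimes> a \<oplus> finsum R ?t {..n} \<otimes> b"
    using a b by (intro r_distr finsum_closed) auto
  also have "finsum R ?t {..n} \<otimes> a = (\<Oplus>k\<in>{..n}. ?t k \<otimes> a)"
    using a b by (intro finsum_ldistr) auto
  also have "\<dots> = finsum R ?u {..n}"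
  proof (rule finsum_cong')
    fix k
    have "(a [^] k \<otimes> b [^] (n - k)) \<otimes> a = a [^] Suc k \<otimes> b [^] (n - k)"
      using a pc by (simp add: m_ac)
    then show "?t k \<otimes> a = ?u k" using a pc by (simp add: add_pow_ldistr del: nat_pow_Suc)
  qed (use a b in auto)
  also have "finsum R ?t {..n} \<otimes> b = (\<Oplus>k\<in>{..n}. ?t k \<otimes> b)"
    using a b by (intro finsum_ldistr) auto
  also have "\<dots> = finsum R ?w {..n}"
  proof (rule finsum_cong')
    fix k assume "k \<in> {..n}"
    then have "b [^] (Suc n - k) = b [^] (n - k) \<otimes> b" by (simp add: Suc_diff_le)
    then have "(a [^] k \<otimes> b [^] (n - k)) \<otimes> b = a [^] k \<otimes> b [^] (Suc n - k)"
      using b pc by (simp add: m_assoc)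
    then show "?t k \<otimes> b = ?w k" using b pc by (simp add: add_pow_ldistr del: nat_pow_Suc)
  qed (use a b in auto)
  also have "finsum R ?w {..n} = finsum R ?w {..Suc n}"
  proof -
    have "finsum R ?w {..Suc n} = ?w (Suc n) \<oplus> finsum R ?w {..n}"
      using a b by (intro finsum_Suc) auto
    then show ?thesis using a b by (simp add: binomial_eq_0 finsum_closed)
  qed
  also have "\<dots> = finsum R ?v {..n} \<oplus> ?w 0"
    using a b by (subst finsum_Suc2) (auto simp del: nat_pow_Suc)
  also have "finsum R ?u {..n} \<oplus> (finsum R ?v {..n} \<oplus> ?w 0)
     = finsum R (\<lambda>k. ?u k \<oplus> ?v k) {..n} \<oplus> ?w 0"
    using a b pc by (subst finsum_addf) (auto simp: a_assoc finsum_closed Pi_def)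
  also have "finsum R (\<lambda>k. ?u k \<oplus> ?v k) {..n}
     = (\<Oplus>k\<in>{..n}. [(Suc n choose Suc k)] \<cdot> (a [^] Suc k \<otimes> b [^] (Suc n - Suc k)))"
    using a b pc by (intro finsum_cong') (auto simp: add.nat_pow_mult simp del: nat_pow_Suc)
  also have "\<dots> \<oplus> ?w 0 = (\<Oplus>k\<in>{..Suc n}. [(Suc n choose k)] \<cdot> (a [^] k \<otimes> b [^] (Suc n - k)))"
    using a b by (subst finsum_Suc2) (auto simp del: nat_pow_Suc)
  finally show ?case .
qed

locale char_cring = cring +
  fixes p :: nat
  assumes p_prime: "Factorial_Ring.prime p" and char_p: "has_characteristic R p"
begin

lemma add_pow_dvd_char:
  assumes "p dvd m" "x \<in> carrier R" shows "[m] \<cdot> x = \<zero>"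
proof -
  have "[m] \<cdot> x = ([m] \<cdot> \<one>) \<otimes> x" using assms by (simp add: add_pow_ldistr)
  moreover have "[m] \<cdot> \<one> = \<zero>" using assms char_p by (simp add: has_characteristic_def)
  ultimately show ?thesis using assms by simp
qed

lemma frobenius_add:
  assumes "a \<in> carrier R" "b \<in> carrier R"
  shows "(a \<oplus> b) [^] p = a [^] p \<oplus> b [^] p"
proof -
  obtain p' where p': "p = Suc p'" using p_prime by (metis not0_implies_Suc not_prime_0)
  let ?t = "\<lambda>k. [(p choose k)] \<cdot> (a [^] k \<otimes> b [^] (p - k))"
  have "(a \<oplus> b) [^] p = finsum R ?t {..p}" by (rule binomial_ring[OF assms])
  also have "\<dots> = ?t p \<oplus> finsum R ?t {..p'}"
    using assms unfolding p' by (intro finsum_Suc) auto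
  also have "finsum R ?t {..p'} = ?t 0"
  proof (rule finsum_single_term)
    fix k assume "k \<in> {..p'}" "k \<noteq> 0"
    then have "p dvd (p choose k)" using p_prime p' by (intro dvd_choose_prime) auto
    then show "?t k = \<zero>" using assms by (intro add_pow_dvd_char) auto
  qed (use assms in auto)
  finally show ?thesis using assms by simp
qed

lemma frobenius_power_add:
  assumes "a \<in> carrier R" "b \<in> carrier R"
  shows "(a \<oplus> b) [^] (p ^ e) = a [^] (p ^ e) \<oplus> b [^] (p ^ e)"
proof (induction e)
  case (Suc e)
  have "x [^] (p ^ Suc e) = (x [^] (p ^ e)) [^] p" if "x \<in> carrier R" for x
    using that by (simp add: nat_pow_pow mult.commute)
  then show ?case using Suc assms by (simp add: frobenius_add)
qed (use assms in simp)

lemma frobenius_power_zero: "\<zero> [^] (p ^ e) = \<zero>"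
  using p_prime by (simp add: nat_pow_zero)

lemma frobenius_power_finsum:
  assumes "finite T" "F \<in> T \<rightarrow> carrier R"
  shows "(finsum R F T) [^] (p ^ e) = (\<Oplus>i\<in>T. F i [^] (p ^ e))"
  using assms
proof (induction T rule: finite_induct)
  case (insert x T)
  then have "F x \<in> carrier R" "F \<in> T \<rightarrow> carrier R" by auto
  moreover from this have "(\<lambda>i. F i [^] (p ^ e)) \<in> T \<rightarrow> carrier R" by (auto simp: Pi_iff)
  ultimately show ?case using insert by (simp add: frobenius_power_add finsum_closed)
qed (simp add: frobenius_power_zero)

lemma frobenius_power_uminus:
  assumes "a \<in> carrier R" shows "(\<ominus> a) [^] (p ^ e) = \<ominus> (a [^] (p ^ e))"
proof -
  have "(\<ominus> a) [^] (p ^ e) \<oplus> a [^] (p ^ e) = \<zero>"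
    using assms by (simp flip: frobenius_power_add add: l_neg frobenius_power_zero)
  then show ?thesis using assms by (simp add: minus_equality)
qed

text \<open>Distributivity over sums of scalars is the additivity of the p^e-th power.\<close>

lemma frobenius_module: "module R (frobenius_pushforward p e R)"
proof (rule moduleI[OF is_cring])
  show "abelian_group (frobenius_pushforward p e R)"
    by (rule abelian_groupI)
       (auto simp: frobenius_pushforward_def a_ac intro: l_neg)
qed (auto simp: frobenius_pushforward_def frobenius_power_add l_distr r_distr nat_pow_distrib m_assoc)

end

lemma frobenius_pushforward_simps [simp]:
  "carrier (frobenius_pushforward p e A) = carrier A"
  "ring.add (frobenius_pushforward p e A) = ring.add A"
  "ring.zero (frobenius_pushforward p e A) = ring.zero A"
  "x \<odot>\<^bsub>frobenius_pushforward p e A\<^esub> y = (x [^]\<^bsub>A\<^esub> (p ^ e)) \<otimes>\<^bsub>A\<^esub> y"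
  "finsum (frobenius_pushforward p e A) = finsum A"
  by (auto simp: frobenius_pushforward_def finsum_def finprod_def fun_eq_iff)

lemma (in ring_hom_ring) hom_add_pow:
  "x \<in> carrier R \<Longrightarrow> h ([(n :: nat)] \<cdot>\<^bsub>R\<^esub> x) = [n] \<cdot>\<^bsub>S\<^esub> h x"
  by (induction n) auto

lemma (in ring_hom_ring) has_characteristic_inj:
  assumes "has_characteristic R p" "\<And>x. x \<in> carrier R \<Longrightarrow> h x = \<zero>\<^bsub>S\<^esub> \<Longrightarrow> x = \<zero>\<^bsub>R\<^esub>"
  shows "has_characteristic S p"
  unfolding has_characteristic_def
proof
  fix n :: nat
  have "[n] \<cdot>\<^bsub>S\<^esub> \<one>\<^bsub>S\<^esub> = h ([n] \<cdot>\<^bsub>R\<^esub> \<one>\<^bsub>R\<^esub>)" by (simp add: hom_add_pow)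
  moreover have "h ([n] \<cdot>\<^bsub>R\<^esub> \<one>\<^bsub>R\<^esub>) = \<zero>\<^bsub>S\<^esub> \<longleftrightarrow> [n] \<cdot>\<^bsub>R\<^esub> \<one>\<^bsub>R\<^esub> = \<zero>\<^bsub>R\<^esub>" using assms(2) by auto
  ultimately show "[n] \<cdot>\<^bsub>S\<^esub> \<one>\<^bsub>S\<^esub> = \<zero>\<^bsub>S\<^esub> \<longleftrightarrow> p dvd n"
    using assms(1) by (simp add: has_characteristic_def)
qed

lemma (in abelian_group) minus_eq_minus_of_add_eq_add:
  assumes c: "a \<in> carrier G" "a' \<in> carrier G" "n \<in> carrier G" "n' \<in> carrier G"
    and eq: "a \<oplus> n = a' \<oplus> n'"
  shows "a \<oplus> \<ominus> a' = n' \<oplus> \<ominus> n"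
proof -
  have "a = (a \<oplus> n) \<oplus> \<ominus> n" using c by (simp add: a_assoc r_neg)
  also have "\<dots> = (n' \<oplus> \<ominus> n) \<oplus> a'" unfolding eq using c by (simp add: a_ac)
  finally have "a \<oplus> \<ominus> a' = (n' \<oplus> \<ominus> n) \<oplus> a' \<oplus> \<ominus> a'" by simp
  then show ?thesis using c by (simp add: a_assoc r_neg)
qed

section \<open>Free summands as dual families of vectors and functionals\<close>

definition module_functional :: "('a, 'b) ring_scheme \<Rightarrow> ('a, 'c, 'd) module_scheme \<Rightarrow> ('c \<Rightarrow> 'a) \<Rightarrow> bool" where
  "module_functional R M \<phi> \<longleftrightarrow> \<phi> \<in> carrier M \<rightarrow> carrier R \<and>
     (\<forall>x\<in>carrier M. \<forall>y\<in>carrier M. \<phi> (x \<oplus>\<^bsub>M\<^esub> y) = \<phi> x \<oplus>\<^bsub>R\<^esub> \<phi> y) \<and>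
     (\<forall>a\<in>carrier R. \<forall>x\<in>carrier M. \<phi> (a \<odot>\<^bsub>M\<^esub> x) = a \<otimes>\<^bsub>R\<^esub> \<phi> x)"

lemma (in module) functional_finsum:
  assumes "module_functional R M \<phi>" "finite T" "F \<in> T \<rightarrow> carrier M"
  shows "\<phi> (finsum M F T) = (\<Oplus>i\<in>T. \<phi> (F i))"
  using assms(2,3)
proof (induction T rule: finite_induct)
  case empty
  have "\<phi> (\<zero> \<odot>\<^bsub>M\<^esub> \<zero>\<^bsub>M\<^esub>) = \<zero> \<otimes> \<phi> \<zero>\<^bsub>M\<^esub>" "\<phi> \<zero>\<^bsub>M\<^esub> \<in> carrier R"
    using assms(1) R.zero_closed M.zero_closed unfolding module_functional_def by blast+
  then show ?case by simp
next
  case (insert x T)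
  then have "F x \<in> carrier M" "F \<in> T \<rightarrow> carrier M" by auto
  moreover from this have "finsum M F T \<in> carrier M" by simp
  moreover have "\<phi> (F x) \<in> carrier R" "(\<lambda>i. \<phi> (F i)) \<in> T \<rightarrow> carrier R"
    using assms(1) calculation by (auto simp: module_functional_def)
  ultimately show ?case using insert assms(1) by (simp add: module_functional_def)
qed

lemma (in module) functional_combination:
  assumes \<phi>: "module_functional R M \<phi>" and T: "finite T" and b: "b \<in> T \<rightarrow> carrier M"
    and c: "c \<in> T \<rightarrow> carrier R" and j: "j \<in> T"
    and \<phi>b: "\<And>i. i \<in> T \<Longrightarrow> \<phi> (b i) = (if i = j then \<one> else \<zero>)"
  shows "\<phi> (\<Oplus>\<^bsub>M\<^esub>i\<in>T. c i \<odot>\<^bsub>M\<^esub> b i) = c j"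
proof -
  have cb: "b i \<in> carrier M" "c i \<in> carrier R" if "i \<in> T" for i using b c that by auto
  have "\<phi> (\<Oplus>\<^bsub>M\<^esub>i\<in>T. c i \<odot>\<^bsub>M\<^esub> b i) = (\<Oplus>i\<in>T. \<phi> (c i \<odot>\<^bsub>M\<^esub> b i))"
    by (rule functional_finsum[OF \<phi> T]) (use cb in auto)
  also have "\<dots> = (\<Oplus>i\<in>T. c i \<otimes> (if i = j then \<one> else \<zero>))"
    by (rule R.finsum_cong') (use \<phi> \<phi>b cb in \<open>auto simp: module_functional_def\<close>)
  also have "\<dots> = c j \<otimes> (if j = j then \<one> else \<zero>)"
    by (rule R.finsum_single_term) (use T j cb in auto)
  finally show ?thesis using cb j by simp
qed

text \<open>A dual family gives the projection sending \<open>m\<close> to the sum of the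
  \<open>\<phi> i m\<close> times \<open>b i\<close>; \<open>F\<close> is its image and
  \<open>N\<close> its kernel. Together with \<open>has_free_summandE\<close> this trades submodules
  for vectors and functionals.\<close>

lemma (in module) has_free_summandI:
  assumes b: "\<And>i. i < r \<Longrightarrow> b i \<in> carrier M"
    and \<phi>: "\<And>i. i < r \<Longrightarrow> module_functional R M (\<phi> i)"
    and \<phi>b: "\<And>i j. i < r \<Longrightarrow> j < r \<Longrightarrow> \<phi> i (b j) = (if j = i then \<one> else \<zero>)"
  shows "has_free_summand R M r"
proof -
  let ?g = "\<lambda>c. \<Oplus>\<^bsub>M\<^esub>i\<in>{..<r}. c i \<odot>\<^bsub>M\<^esub> b i"
  let ?C = "{..<r} \<rightarrow>\<^sub>E carrier R"
  define F where "F = ?g ` ?C"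
  define N where "N = {m \<in> carrier M. \<forall>i<r. \<phi> i m = \<zero>}"
  have \<phi>c: "\<phi> i m \<in> carrier R" if "i < r" "m \<in> carrier M" for i m
    using \<phi>[OF that(1)] that by (auto simp: module_functional_def)
  have \<phi>add: "\<phi> i (x \<oplus>\<^bsub>M\<^esub> y) = \<phi> i x \<oplus> \<phi> i y" if "i < r" "x \<in> carrier M" "y \<in> carrier M" for i x y
    using \<phi>[OF that(1)] that by (auto simp: module_functional_def)
  have \<phi>smult: "\<phi> i (a \<odot>\<^bsub>M\<^esub> x) = a \<otimes> \<phi> i x" if "i < r" "a \<in> carrier R" "x \<in> carrier M" for i a x
    using \<phi>[OF that(1)] that by (auto simp: module_functional_def)
  have gM: "?g c \<in> carrier M" if "c \<in> ?C" for c using that b by (intro M.finsum_closed) auto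
  have coord: "\<phi> j (?g c) = c j" if "c \<in> ?C" "j < r" for c j
    by (rule functional_combination[OF \<phi>]) (use that b \<phi>b in auto)
  have minus: "\<ominus>\<^bsub>M\<^esub> x = (\<ominus> \<one>) \<odot>\<^bsub>M\<^esub> x" if "x \<in> carrier M" for x
    using that by (simp add: smult_l_minus)
  have gadd: "?g c \<oplus>\<^bsub>M\<^esub> ?g c' = ?g (\<lambda>i\<in>{..<r}. c i \<oplus> c' i)" if "c \<in> ?C" "c' \<in> ?C" for c c'
  proof -
    have cc: "c i \<in> carrier R" "c' i \<in> carrier R" if "i < r" for i
      using \<open>c \<in> ?C\<close> \<open>c' \<in> ?C\<close> that by auto
    have "?g (\<lambda>i\<in>{..<r}. c i \<oplus> c' i) = (\<Oplus>\<^bsub>M\<^esub>i\<in>{..<r}. c i \<odot>\<^bsub>M\<^esub> b i \<oplus>\<^bsub>M\<^esub> c' i \<odot>\<^bsub>M\<^esub> b i)"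
      by (rule M.finsum_cong') (use cc b in \<open>auto simp: smult_l_distr\<close>)
    also have "\<dots> = ?g c \<oplus>\<^bsub>M\<^esub> ?g c'" by (rule M.finsum_addf) (use cc b in auto)
    finally show ?thesis by simp
  qed
  have gsmult: "a \<odot>\<^bsub>M\<^esub> ?g c = ?g (\<lambda>i\<in>{..<r}. a \<otimes> c i)" if "c \<in> ?C" "a \<in> carrier R" for c a
  proof -
    have cc: "c i \<in> carrier R" if "i < r" for i using \<open>c \<in> ?C\<close> that by auto
    have "a \<odot>\<^bsub>M\<^esub> ?g c = (\<Oplus>\<^bsub>M\<^esub>i\<in>{..<r}. a \<odot>\<^bsub>M\<^esub> (c i \<odot>\<^bsub>M\<^esub> b i))"
      by (rule finsum_smult_ldistr) (use cc b that in auto)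
    also have "\<dots> = ?g (\<lambda>i\<in>{..<r}. a \<otimes> c i)"
      by (rule M.finsum_cong') (use cc b that in \<open>auto simp: smult_assoc1\<close>)
    finally show ?thesis .
  qed
  have F_smult: "a \<odot>\<^bsub>M\<^esub> x \<in> F" if ax: "a \<in> carrier R" "x \<in> F" for a x
  proof -
    obtain c where c: "c \<in> ?C" "x = ?g c" using ax by (auto simp: F_def)
    moreover have "(\<lambda>i\<in>{..<r}. a \<otimes> c i) \<in> ?C" using c ax by auto
    ultimately show ?thesis unfolding F_def using gsmult[OF c(1) ax(1)] by blast
  qed
  have FM: "F \<subseteq> carrier M" using gM by (auto simp: F_def)
  have F: "submodule F R M"
  proof (rule submoduleI)
    have "?g (\<lambda>i\<in>{..<r}. \<zero>) = \<zero>\<^bsub>M\<^esub>"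
      by (rule M.finsum_all_zero) (use b in auto)
    moreover have "(\<lambda>i\<in>{..<r}. \<zero>) \<in> ?C" by auto
    ultimately show "\<zero>\<^bsub>M\<^esub> \<in> F" unfolding F_def by (rule image_eqI[OF sym])
    show "x \<oplus>\<^bsub>M\<^esub> y \<in> F" if xy: "x \<in> F" "y \<in> F" for x y
    proof -
      obtain c c' where c: "c \<in> ?C" "x = ?g c" "c' \<in> ?C" "y = ?g c'" using xy by (auto simp: F_def)
      moreover have "(\<lambda>i\<in>{..<r}. c i \<oplus> c' i) \<in> ?C" using c by auto
      ultimately show ?thesis unfolding F_def using gadd[OF c(1,3)] by blast
    qed
    show "\<ominus>\<^bsub>M\<^esub> x \<in> F" if "x \<in> F" for x
      using F_smult[OF _ that, of "\<ominus> \<one>"] minus[of x] that FM by auto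
  qed (use F_smult FM in auto)
  have free: "free_submodule R M F r"
    unfolding free_submodule_def
  proof (intro conjI F bexI)
    have "inj_on ?g ?C"
    proof (rule inj_onI)
      fix c c' assume cc: "c \<in> ?C" "c' \<in> ?C" "?g c = ?g c'"
      show "c = c'"
      proof (rule PiE_ext[OF cc(1,2)])
        fix i assume "i \<in> {..<r}"
        then show "c i = c' i" using coord[OF cc(1), of i] coord[OF cc(2), of i] cc(3) by simp
      qed
    qed
    then show "bij_betw ?g ?C F" by (simp add: F_def bij_betw_def)
    show "b \<in> {..<r} \<rightarrow> F"
    proof
      fix j assume j: "j \<in> {..<r}"
      let ?c = "\<lambda>i\<in>{..<r}. if i = j then \<one> else \<zero>"
      have "?g ?c = ?c j \<odot>\<^bsub>M\<^esub> b j"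
        by (rule M.finsum_single_term) (use j b in auto)
      then have "?g ?c = b j" using j b by simp
      moreover have "?c \<in> ?C" by auto
      ultimately show "b j \<in> F" unfolding F_def by (rule image_eqI[OF sym])
    qed
  qed
  have N: "submodule N R M"
  proof (rule submoduleI)
    have "\<phi> i \<zero>\<^bsub>M\<^esub> = \<zero>" if "i < r" for i
      using functional_finsum[OF \<phi>[OF that], of "{}"] by simp
    then show "\<zero>\<^bsub>M\<^esub> \<in> N" by (simp add: N_def)
    show "\<ominus>\<^bsub>M\<^esub> x \<in> N" if "x \<in> N" for x
      using that by (auto simp: N_def minus \<phi>smult)
  qed (auto simp: N_def \<phi>add \<phi>smult)
  have "F <+>\<^bsub>M\<^esub> N = carrier M"
  proof
    show "F <+>\<^bsub>M\<^esub> N \<subseteq> carrier M" using FM by (auto simp: set_add_def' N_def)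
    show "carrier M \<subseteq> F <+>\<^bsub>M\<^esub> N"
    proof
      fix m assume m: "m \<in> carrier M"
      let ?c = "\<lambda>i\<in>{..<r}. \<phi> i m"
      have c: "?c \<in> ?C" using \<phi>c m by auto
      have "\<phi> i (m \<ominus>\<^bsub>M\<^esub> ?g ?c) = \<zero>" if "i < r" for i
        using that coord[OF c that] gM[OF c] m \<phi>c by (simp add: a_minus_def minus \<phi>add \<phi>smult l_minus R.r_neg)
      then have "m \<ominus>\<^bsub>M\<^esub> ?g ?c \<in> N" using m gM[OF c] by (simp add: N_def)
      moreover have "?g ?c \<oplus>\<^bsub>M\<^esub> (m \<ominus>\<^bsub>M\<^esub> ?g ?c) = m"
      proof -
        have "?g ?c \<oplus>\<^bsub>M\<^esub> (m \<ominus>\<^bsub>M\<^esub> ?g ?c) = m \<oplus>\<^bsub>M\<^esub> (?g ?c \<oplus>\<^bsub>M\<^esub> \<ominus>\<^bsub>M\<^esub> ?g ?c)"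
          unfolding a_minus_def using gM[OF c] m by (intro M.a_lcomm) simp_all
        then show ?thesis using gM[OF c] m by (simp add: M.r_neg)
      qed
      moreover have "?g ?c \<in> F" unfolding F_def using c by (rule imageI)
      ultimately show "m \<in> F <+>\<^bsub>M\<^esub> N" by (force simp: set_add_def')
    qed
  qed
  moreover have "F \<inter> N = {\<zero>\<^bsub>M\<^esub>}"
  proof
    show "{\<zero>\<^bsub>M\<^esub>} \<subseteq> F \<inter> N"
      using submoduleE(2,4)[OF F] submodule.axioms(1)[OF F] submodule.axioms(1)[OF N] subgroup.one_closed by fastforce
    show "F \<inter> N \<subseteq> {\<zero>\<^bsub>M\<^esub>}"
    proof
      fix x assume "x \<in> F \<inter> N"
      then obtain c where c: "c \<in> ?C" "x = ?g c" "x \<in> N" by (auto simp: F_def)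
      then have "c i = \<zero>" if "i < r" for i using coord[OF c(1) that] that by (simp add: N_def)
      then have "?g c = \<zero>\<^bsub>M\<^esub>" using b by (intro M.finsum_all_zero) simp
      then show "x \<in> {\<zero>\<^bsub>M\<^esub>}" using c by simp
    qed
  qed
  ultimately show ?thesis using free N unfolding has_free_summand_def by blast
qed

text \<open>The coordinates of the \<open>F\<close>-component along \<open>N\<close> are linear and
  dual to the basis of \<open>F\<close>.\<close>

lemma (in module) has_free_summandE:
  assumes "has_free_summand R M r"
  obtains b \<phi> where "\<And>i. i < r \<Longrightarrow> b i \<in> carrier M"
    "\<And>i. i < r \<Longrightarrow> module_functional R M (\<phi> i)"
    "\<And>i j. i < r \<Longrightarrow> j < r \<Longrightarrow> \<phi> i (b j) = (if j = i then \<one> else \<zero>)"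
proof -
  obtain F N where free: "free_submodule R M F r" and N: "submodule N R M"
    and sum: "F <+>\<^bsub>M\<^esub> N = carrier M" and int: "F \<inter> N = {\<zero>\<^bsub>M\<^esub>}"
    using assms unfolding has_free_summand_def by blast
  let ?C = "{..<r} \<rightarrow>\<^sub>E carrier R"
  obtain b where F: "submodule F R M" and bF: "b \<in> {..<r} \<rightarrow> F"
    and bij: "bij_betw (\<lambda>c. \<Oplus>\<^bsub>M\<^esub>i\<in>{..<r}. c i \<odot>\<^bsub>M\<^esub> b i) ?C F"
    using free unfolding free_submodule_def by blast
  let ?g = "\<lambda>c. \<Oplus>\<^bsub>M\<^esub>i\<in>{..<r}. c i \<odot>\<^bsub>M\<^esub> b i"
  note FE = submoduleE[OF F] and NE = submoduleE[OF N]
  have b: "b i \<in> carrier M" if "i < r" for i using bF FE(1) that by auto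
  have gF: "?g c \<in> F" if "c \<in> ?C" for c using bij that by (auto simp: bij_betw_def)
  have ex: "\<exists>c\<in>?C. \<exists>n\<in>N. m = ?g c \<oplus>\<^bsub>M\<^esub> n" if m: "m \<in> carrier M" for m
  proof -
    obtain x n where "x \<in> F" "n \<in> N" "m = x \<oplus>\<^bsub>M\<^esub> n"
      using m unfolding sum[symmetric] set_add_def' by blast
    then show ?thesis using bij by (auto simp: bij_betw_def)
  qed
  have uniq: "c = c'" if c: "c \<in> ?C" "c' \<in> ?C" "n \<in> N" "n' \<in> N" "?g c \<oplus>\<^bsub>M\<^esub> n = ?g c' \<oplus>\<^bsub>M\<^esub> n'" for c c' n n'
  proof -
    have carr: "?g c \<in> carrier M" "?g c' \<in> carrier M" "n \<in> carrier M" "n' \<in> carrier M"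
      using gF c FE(1) NE(1) by auto
    have "?g c \<oplus>\<^bsub>M\<^esub> \<ominus>\<^bsub>M\<^esub> ?g c' = n' \<oplus>\<^bsub>M\<^esub> \<ominus>\<^bsub>M\<^esub> n"
      using c(5) by (rule M.minus_eq_minus_of_add_eq_add[OF carr(1,2,3,4)])
    moreover have "?g c \<oplus>\<^bsub>M\<^esub> \<ominus>\<^bsub>M\<^esub> ?g c' \<in> F" using gF c FE by simp
    moreover have "n' \<oplus>\<^bsub>M\<^esub> \<ominus>\<^bsub>M\<^esub> n \<in> N" using c NE by simp
    ultimately have "?g c \<oplus>\<^bsub>M\<^esub> \<ominus>\<^bsub>M\<^esub> ?g c' = \<zero>\<^bsub>M\<^esub>" using int by auto
    then have "?g c = ?g c'" using carr by (simp add: M.add.inv_solve_right')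
    then show ?thesis using bij c by (auto simp: bij_betw_def dest: inj_onD)
  qed
  define Q where "Q m c \<longleftrightarrow> c \<in> ?C \<and> (\<exists>n\<in>N. m = ?g c \<oplus>\<^bsub>M\<^esub> n)" for m c
  \<comment> \<open>The choice is harmless: \<open>uniq\<close> shows that the coordinate vector of
    \<open>m\<close> is determined, and linearity follows from the same uniqueness.\<close>
  define k where "k m = (SOME c. Q m c)" for m
  have k: "k m \<in> ?C \<and> (\<exists>n\<in>N. m = ?g (k m) \<oplus>\<^bsub>M\<^esub> n)" if "m \<in> carrier M" for m
  proof -
    have "\<exists>c. Q m c" using ex[OF that] by (auto simp: Q_def)
    then have "Q m (k m)" unfolding k_def by (rule someI_ex)
    then show ?thesis by (simp only: Q_def)
  qed
  have keq: "k m = c" if mc: "m \<in> carrier M" "c \<in> ?C" "n \<in> N" "m = ?g c \<oplus>\<^bsub>M\<^esub> n" for m c n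
  proof -
    obtain n' where "n' \<in> N" "m = ?g (k m) \<oplus>\<^bsub>M\<^esub> n'" using k[OF mc(1)] by (elim conjE bexE)
    then show ?thesis using uniq[of "k m" c n' n] k[OF mc(1)] mc by simp
  qed
  have kr: "k m i \<in> carrier R" if "m \<in> carrier M" "i < r" for m i
    using k[OF that(1)] that(2) by auto
  have func: "module_functional R M (\<lambda>m. k m i)" if i: "i < r" for i
    unfolding module_functional_def
  proof (intro conjI ballI)
    show "(\<lambda>m. k m i) \<in> carrier M \<rightarrow> carrier R" using kr i by auto
  next
    fix x y assume x: "x \<in> carrier M" and y: "y \<in> carrier M"
    obtain n where n: "n \<in> N" "x = ?g (k x) \<oplus>\<^bsub>M\<^esub> n" using k[OF x] by blast
    obtain n' where n': "n' \<in> N" "y = ?g (k y) \<oplus>\<^bsub>M\<^esub> n'" using k[OF y] by blast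
    let ?c = "\<lambda>i\<in>{..<r}. k x i \<oplus> k y i"
    have carr: "?g (k x) \<in> carrier M" "?g (k y) \<in> carrier M" "n \<in> carrier M" "n' \<in> carrier M"
      using gF k x y n n' FE(1) NE(1) by auto
    have "?g ?c = (\<Oplus>\<^bsub>M\<^esub>i\<in>{..<r}. k x i \<odot>\<^bsub>M\<^esub> b i \<oplus>\<^bsub>M\<^esub> k y i \<odot>\<^bsub>M\<^esub> b i)"
      by (rule M.finsum_cong') (use kr b x y in \<open>auto simp: smult_l_distr\<close>)
    also have "\<dots> = ?g (k x) \<oplus>\<^bsub>M\<^esub> ?g (k y)" by (rule M.finsum_addf) (use kr b x y in auto)
    finally have "?g ?c \<oplus>\<^bsub>M\<^esub> (n \<oplus>\<^bsub>M\<^esub> n') = (?g (k x) \<oplus>\<^bsub>M\<^esub> n) \<oplus>\<^bsub>M\<^esub> (?g (k y) \<oplus>\<^bsub>M\<^esub> n')"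
      using carr by (simp add: M.a_ac)
    also have "\<dots> = x \<oplus>\<^bsub>M\<^esub> y" using n(2) n'(2) by simp
    finally have "k (x \<oplus>\<^bsub>M\<^esub> y) = ?c"
      using x y n n' NE(5) kr by (intro keq[of "x \<oplus>\<^bsub>M\<^esub> y" ?c "n \<oplus>\<^bsub>M\<^esub> n'"]) auto
    then show "k (x \<oplus>\<^bsub>M\<^esub> y) i = k x i \<oplus> k y i" using i by simp
  next
    fix a x assume a: "a \<in> carrier R" and x: "x \<in> carrier M"
    obtain n where n: "n \<in> N" "x = ?g (k x) \<oplus>\<^bsub>M\<^esub> n" using k[OF x] by blast
    let ?c = "\<lambda>i\<in>{..<r}. a \<otimes> k x i"
    have carr: "?g (k x) \<in> carrier M" "n \<in> carrier M" using gF k x n FE(1) NE(1) by auto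
    have "?g ?c = (\<Oplus>\<^bsub>M\<^esub>i\<in>{..<r}. a \<odot>\<^bsub>M\<^esub> (k x i \<odot>\<^bsub>M\<^esub> b i))"
      by (rule M.finsum_cong') (use kr b x a in \<open>auto simp: smult_assoc1\<close>)
    also have "\<dots> = a \<odot>\<^bsub>M\<^esub> ?g (k x)" by (rule finsum_smult_ldistr[symmetric]) (use kr b x a in auto)
    finally have "?g ?c \<oplus>\<^bsub>M\<^esub> a \<odot>\<^bsub>M\<^esub> n = a \<odot>\<^bsub>M\<^esub> (?g (k x) \<oplus>\<^bsub>M\<^esub> n)"
      using carr a by (simp add: smult_r_distr)
    also have "\<dots> = a \<odot>\<^bsub>M\<^esub> x" using n(2) by simp
    finally have "k (a \<odot>\<^bsub>M\<^esub> x) = ?c"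
      using x a n NE(4) kr by (intro keq[of "a \<odot>\<^bsub>M\<^esub> x" ?c "a \<odot>\<^bsub>M\<^esub> n"]) auto
    then show "k (a \<odot>\<^bsub>M\<^esub> x) i = a \<otimes> k x i" using i by simp
  qed
  have dual: "k (b j) i = (if j = i then \<one> else \<zero>)" if "i < r" "j < r" for i j
  proof -
    let ?c = "\<lambda>i\<in>{..<r}. if i = j then \<one> else \<zero>"
    have "?g ?c = ?c j \<odot>\<^bsub>M\<^esub> b j"
      by (rule M.finsum_single_term) (use that b in auto)
    then have "b j = ?g ?c \<oplus>\<^bsub>M\<^esub> \<zero>\<^bsub>M\<^esub>" using that b by simp
    moreover have "\<zero>\<^bsub>M\<^esub> \<in> N" using int by blast
    ultimately have "k (b j) = ?c" using that b by (intro keq[of "b j" ?c "\<zero>\<^bsub>M\<^esub>"]) auto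
    then show ?thesis using that by auto
  qed
  show thesis by (rule that[of b "\<lambda>i m. k m i"]) (fact b func dual)+
qed

text \<open>Gaussian elimination by induction on the set of equations: an unknown with nonzero
  coefficient in equation \<open>h\<close> is solved for and removed from the others, which again
  leaves more unknowns than equations.\<close>

lemma (in field) homogeneous_system:
  assumes "finite G" "finite T" "card G < card T"
    and "\<And>i g. i \<in> T \<Longrightarrow> g \<in> G \<Longrightarrow> M i g \<in> carrier R"
  shows "\<exists>c. (\<forall>i\<in>T. c i \<in> carrier R) \<and> (\<exists>i\<in>T. c i \<noteq> \<zero>) \<and> (\<forall>g\<in>G. (\<Oplus>i\<in>T. c i \<otimes> M i g) = \<zero>)"
  using assms
proof (induction G arbitrary: T M rule: finite_induct)
  case empty
  then have "T \<noteq> {}" by auto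
  then show ?case by (intro exI[of _ "\<lambda>_. \<one>"]) auto
next
  case (insert h G)
  have Mc: "M i g \<in> carrier R" if "i \<in> T" "g \<in> insert h G" for i g using insert that by blast
  show ?case
  proof (cases "\<forall>i\<in>T. M i h = \<zero>")
    case True
    obtain c where c: "\<forall>i\<in>T. c i \<in> carrier R" "\<exists>i\<in>T. c i \<noteq> \<zero>" "\<forall>g\<in>G. (\<Oplus>i\<in>T. c i \<otimes> M i g) = \<zero>"
      using insert.IH[of T M] insert.prems insert.hyps Mc by auto
    moreover have "(\<Oplus>i\<in>T. c i \<otimes> M i h) = \<zero>"
      by (rule finsum_all_zero) (use c True in auto)
    ultimately show ?thesis by auto
  next
    case False
    then obtain j where j: "j \<in> T" "M j h \<noteq> \<zero>" by blast
    let ?T = "T - {j}"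
    have Mj: "M j h \<in> Units R" using j Mc field_Units by auto
    \<comment> \<open>Multipliers of the pivot: subtracting \<open>u i\<close> times the pivot
      coefficients kills the coefficient of unknown \<open>i\<close> in equation
      \<open>h\<close>.\<close>
    define u where "u i = M i h \<otimes> inv (M j h)" for i
    have uc: "u i \<in> carrier R" if "i \<in> T" for i using that Mc Mj by (auto simp: u_def)
    have uh: "u i \<otimes> M j h = M i h" if "i \<in> T" for i
      using that Mc Mj by (simp add: u_def m_assoc Units_closed)
    have "card G < card ?T" using insert j by simp
    then have "\<exists>c. (\<forall>i\<in>?T. c i \<in> carrier R) \<and> (\<exists>i\<in>?T. c i \<noteq> \<zero>) \<and>
        (\<forall>g\<in>G. (\<Oplus>i\<in>?T. c i \<otimes> (M i g \<ominus> u i \<otimes> M j g)) = \<zero>)"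
      by (intro insert.IH) (use insert.prems Mc uc j in auto)
    then obtain c where c': "\<forall>i\<in>?T. c i \<in> carrier R" "\<exists>i\<in>?T. c i \<noteq> \<zero>"
        "\<forall>g\<in>G. (\<Oplus>i\<in>?T. c i \<otimes> (M i g \<ominus> u i \<otimes> M j g)) = \<zero>" by (elim exE conjE)
    have c: "\<And>i. i \<in> ?T \<Longrightarrow> c i \<in> carrier R" "\<exists>i\<in>?T. c i \<noteq> \<zero>"
        "\<And>g. g \<in> G \<Longrightarrow> (\<Oplus>i\<in>?T. c i \<otimes> (M i g \<ominus> u i \<otimes> M j g)) = \<zero>"
      using c' by blast+
    \<comment> \<open>The pivot unknown receives the value \<open>\<ominus> s\<close>. This solves
      equation \<open>h\<close> and undoes, in every other equation, the subtraction made during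
      elimination.\<close>
    define s where "s = (\<Oplus>i\<in>?T. c i \<otimes> u i)"
    have sc: "s \<in> carrier R" unfolding s_def using c uc by (intro finsum_closed) auto
    define c' where "c' i = (if i = j then \<ominus> s else c i)" for i
    have T: "T = insert j ?T" using j by auto
    have split: "(\<Oplus>i\<in>T. c' i \<otimes> M i g) = \<ominus> s \<otimes> M j g \<oplus> (\<Oplus>i\<in>?T. c i \<otimes> M i g)"
      if g: "g \<in> insert h G" for g
    proof -
      have "(\<Oplus>i\<in>insert j ?T. c' i \<otimes> M i g) = c' j \<otimes> M j g \<oplus> (\<Oplus>i\<in>?T. c' i \<otimes> M i g)"
        by (rule finsum_insert) (use insert.prems sc c Mc g j in \<open>auto simp: c'_def\<close>)
      also have "(\<Oplus>i\<in>?T. c' i \<otimes> M i g) = (\<Oplus>i\<in>?T. c i \<otimes> M i g)"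
        by (rule finsum_cong') (use c Mc g in \<open>auto simp: c'_def\<close>)
      finally show ?thesis using T by (simp add: c'_def)
    qed
    have s_mult: "s \<otimes> M j g = (\<Oplus>i\<in>?T. c i \<otimes> u i \<otimes> M j g)" if g: "g \<in> insert h G" for g
      unfolding s_def by (rule finsum_ldistr) (use insert.prems c uc Mc g j in auto)
    have "(\<Oplus>i\<in>T. c' i \<otimes> M i g) = \<zero>" if g: "g \<in> insert h G" for g
    proof -
      have eq: "(\<Oplus>i\<in>?T. c i \<otimes> M i g)
         = (\<Oplus>i\<in>?T. c i \<otimes> (M i g \<ominus> u i \<otimes> M j g)) \<oplus> s \<otimes> M j g"
      proof -
        have "(\<Oplus>i\<in>?T. c i \<otimes> M i g) = (\<Oplus>i\<in>?T. c i \<otimes> (M i g \<ominus> u i \<otimes> M j g) \<oplus> c i \<otimes> u i \<otimes> M j g)"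
        proof (rule finsum_cong')
          fix i assume i: "i \<in> ?T"
          have "c i \<in> carrier R" "M i g \<in> carrier R" "u i \<in> carrier R" "M j g \<in> carrier R"
            using c uc Mc g j i by auto
          then show "c i \<otimes> M i g = c i \<otimes> (M i g \<ominus> u i \<otimes> M j g) \<oplus> c i \<otimes> u i \<otimes> M j g" by algebra
        qed (use c uc Mc g j in auto)
        also have "\<dots> = (\<Oplus>i\<in>?T. c i \<otimes> (M i g \<ominus> u i \<otimes> M j g)) \<oplus> (\<Oplus>i\<in>?T. c i \<otimes> u i \<otimes> M j g)"
          by (rule finsum_addf) (use c uc Mc g j in auto)
        finally show ?thesis using s_mult[OF g] by simp
      qed
      have "(\<Oplus>i\<in>?T. c i \<otimes> (M i g \<ominus> u i \<otimes> M j g)) = \<zero>"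
      proof (cases "g \<in> G")
        case True
        then show ?thesis by (rule c(3))
      next
        case False
        then have "g = h" using g by auto
        then show ?thesis
          using c(1) uh Mc by (intro finsum_all_zero) (auto simp: a_minus_def r_neg)
      qed
      then show ?thesis using split[OF g] eq sc Mc g j by (simp add: l_minus l_neg)
    qed
    moreover have "\<forall>i\<in>T. c' i \<in> carrier R" "\<exists>i\<in>T. c' i \<noteq> \<zero>" using c sc by (auto simp: c'_def)
    ultimately show ?thesis by blast
  qed
qed

section \<open>Bases over the subfield of p-th powers\<close>

lemma (in ring) combine_eq_finsum:
  assumes "length Ks = length Us" "set Ks \<subseteq> carrier R" "set Us \<subseteq> carrier R"
  shows "combine Ks Us = (\<Oplus>i\<in>{..<length Us}. Ks ! i \<otimes> Us ! i)"
  using assms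
proof (induction Ks Us rule: list_induct2)
  case (Cons x xs y ys)
  have c: "xs ! i \<in> carrier R" "ys ! i \<in> carrier R" if "i < length ys" for i
    using Cons that by (auto simp: subset_iff)
  have ins: "{..<length (y # ys)} = insert 0 (Suc ` {..<length ys})"
    by (simp add: lessThan_Suc_eq_insert_0)
  have "(\<Oplus>i\<in>{..<length (y # ys)}. (x # xs) ! i \<otimes> (y # ys) ! i)
     = x \<otimes> y \<oplus> (\<Oplus>i\<in>Suc ` {..<length ys}. (x # xs) ! i \<otimes> (y # ys) ! i)"
    unfolding ins using Cons.prems c by (subst finsum_insert) auto
  also have "(\<Oplus>i\<in>Suc ` {..<length ys}. (x # xs) ! i \<otimes> (y # ys) ! i) = (\<Oplus>i\<in>{..<length ys}. xs ! i \<otimes> ys ! i)"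
    using c by (subst finsum_reindex) auto
  finally show ?case using Cons by simp
qed simp

text \<open>\<open>b\<close> is a basis over the subfield of p-th powers. The coefficients are
  written as p-th powers and their roots serve as coordinates; independence can be stated for the
  roots since Frobenius is injective on a field.\<close>

locale frobenius_field = field R + char_cring R p
  for R :: "('a, 'b) ring_scheme" (structure) and p :: nat +
  fixes N :: nat and b :: "nat \<Rightarrow> 'a"
  assumes b_closed: "\<And>i. i < N \<Longrightarrow> b i \<in> carrier R"
    and b_span: "\<And>x. x \<in> carrier R \<Longrightarrow>
      \<exists>c. (\<forall>i<N. c i \<in> carrier R) \<and> x = (\<Oplus>i\<in>{..<N}. c i [^] p \<otimes> b i)"
    and b_indep: "\<And>c c'. \<lbrakk>\<And>i. i < N \<Longrightarrow> c i \<in> carrier R; \<And>i. i < N \<Longrightarrow> c' i \<in> carrier R;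
      (\<Oplus>i\<in>{..<N}. c i [^] p \<otimes> b i) = (\<Oplus>i\<in>{..<N}. c' i [^] p \<otimes> b i)\<rbrakk>
        \<Longrightarrow> \<forall>i<N. c i = c' i"

lemma (in field) pth_powers_subfield:
  assumes "char_cring R p" shows "subfield (pth_powers p R) R"
proof -
  interpret char_cring R p by fact
  have "(\<lambda>x. x [^] p) \<in> ring_hom R R"
    by (rule ring_hom_memI) (auto simp: nat_pow_distrib frobenius_add)
  then interpret F: ring_hom_ring R R "\<lambda>x. x [^] p"
    by (intro ring_hom_ringI2) (auto simp: ring_axioms)
  show ?thesis
    unfolding pth_powers_def
    using F.img_is_subfield(2)[OF carrier_is_subfield] one_not_zero by simp
qed

text \<open>Frobenius is additive, and a field has no nonzero nilpotents.\<close>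

lemma (in field) pth_power_inj:
  assumes "char_cring R p" "x \<in> carrier R" "y \<in> carrier R" "x [^] p = y [^] p"
  shows "x = y"
proof -
  interpret char_cring R p by fact
  have "(x \<ominus> y) [^] (p ^ 1) = x [^] (p ^ 1) \<oplus> \<ominus> (y [^] (p ^ 1))"
    unfolding a_minus_def using assms by (simp only: frobenius_power_add frobenius_power_uminus a_inv_closed)
  then have "(x \<ominus> y) [^] p = \<zero>" using assms by (simp add: r_neg)
  moreover have "u = \<zero>" if "u [^] n = \<zero>" "u \<in> carrier R" for u and n :: nat
    using that by (induction n) (auto dest: integral)
  ultimately have "x \<ominus> y = \<zero>" using assms by blast
  then show ?thesis using assms by simp
qed

lemma (in field) exists_frobenius_basis:
  assumes char: "char_cring R p" and fin: "finite_dimension (pth_powers p R) (carrier R)"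
  shows "\<exists>b. frobenius_field R p (dim (pth_powers p R) (carrier R)) b"
proof -
  interpret char_cring R p by fact
  let ?F = "pth_powers p R" and ?N = "dim (pth_powers p R) (carrier R)"
  have sub: "subfield ?F R" by (rule pth_powers_subfield[OF char])
  have "dimension ?N ?F (carrier R)" using finite_dimensionE[OF sub fin] by (simp add: over_def)
  then obtain Vs where Vs: "set Vs \<subseteq> carrier R" "independent ?F Vs" "length Vs = ?N" "Span ?F Vs = carrier R"
    using exists_base[OF sub] by blast
  have FR: "?F \<subseteq> carrier R" by (auto simp: pth_powers_def)
  have Vsc: "Vs ! i \<in> carrier R" if "i < ?N" for i using Vs that by auto
  have comb: "combine (map (\<lambda>i. c i [^] p) [0..<?N]) Vs = (\<Oplus>i\<in>{..<?N}. c i [^] p \<otimes> Vs ! i)"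
    if "\<And>i. i < ?N \<Longrightarrow> c i \<in> carrier R" for c
  proof -
    have "combine (map (\<lambda>i. c i [^] p) [0..<?N]) Vs
       = (\<Oplus>i\<in>{..<length Vs}. map (\<lambda>i. c i [^] p) [0..<?N] ! i \<otimes> Vs ! i)"
      by (rule combine_eq_finsum) (use Vs that in auto)
    also have "\<dots> = (\<Oplus>i\<in>{..<?N}. c i [^] p \<otimes> Vs ! i)"
      by (rule finsum_cong') (use Vs(3) Vsc that in auto)
    finally show ?thesis .
  qed
  have uniq: "\<exists>!Ks. set Ks \<subseteq> ?F \<and> length Ks = length Vs \<and> x = combine Ks Vs" if "x \<in> carrier R" for x
    using unique_decomposition[OF sub Vs(2)] that Vs(4) by blast
  have "frobenius_field R p ?N (\<lambda>i. Vs ! i)"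
  proof (intro frobenius_field.intro frobenius_field_axioms.intro field_axioms char)
    show "Vs ! i \<in> carrier R" if "i < ?N" for i using Vs that by auto
  next
    fix x assume "x \<in> carrier R"
    then obtain Ks where Ks: "set Ks \<subseteq> ?F" "length Ks = ?N" "x = combine Ks Vs" using uniq Vs(3) by metis
    have "\<forall>i\<in>{..<?N}. \<exists>c. c \<in> carrier R \<and> Ks ! i = c [^] p"
    proof
      fix i assume "i \<in> {..<?N}"
      then have "Ks ! i \<in> ?F" using Ks by (metis lessThan_iff nth_mem subsetD)
      then show "\<exists>c. c \<in> carrier R \<and> Ks ! i = c [^] p" by (auto simp: pth_powers_def)
    qed
    then obtain c where c: "\<forall>i\<in>{..<?N}. c i \<in> carrier R \<and> Ks ! i = c i [^] p"
      by (rule bchoice[THEN exE])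
    then have "Ks = map (\<lambda>i. c i [^] p) [0..<?N]" using Ks(2) by (auto intro: nth_equalityI)
    then show "\<exists>c. (\<forall>i<?N. c i \<in> carrier R) \<and> x = (\<Oplus>i\<in>{..<?N}. c i [^] p \<otimes> Vs ! i)"
      using comb[of c] c Ks(3) by auto
  next
    fix c c' assume c: "\<And>i. i < ?N \<Longrightarrow> c i \<in> carrier R" and c': "\<And>i. i < ?N \<Longrightarrow> c' i \<in> carrier R"
      and eq: "(\<Oplus>i\<in>{..<?N}. c i [^] p \<otimes> Vs ! i) = (\<Oplus>i\<in>{..<?N}. c' i [^] p \<otimes> Vs ! i)"
    let ?K = "map (\<lambda>i. c i [^] p) [0..<?N]" and ?K' = "map (\<lambda>i. c' i [^] p) [0..<?N]"
    have KF: "set ?K \<subseteq> ?F" "set ?K' \<subseteq> ?F" using c c' by (auto simp: pth_powers_def)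
    have "combine ?K Vs = combine ?K' Vs" using eq comb[OF c] comb[OF c'] by simp
    moreover have "combine ?K Vs \<in> carrier R" using KF FR Vs by (intro combine_in_carrier) auto
    ultimately have "?K = ?K'" using uniq[of "combine ?K Vs"] KF Vs(3) by (metis length_map length_upt diff_zero)
    then have "c i [^] p = c' i [^] p" if "i < ?N" for i using that by (simp add: list_eq_iff_nth_eq)
    then show "\<forall>i<?N. c i = c' i" using pth_power_inj[OF char] c c' by blast
  qed
  then show ?thesis by blast
qed

context frobenius_field
begin

text \<open>Root coordinates: they are additive, and a scalar \<open>a [^] p\<close> comes out as
  \<open>a\<close>. Each coordinate is therefore a functional on the Frobenius pushforward of the
  field.\<close>

definition kap1 :: "'a \<Rightarrow> nat \<Rightarrow> 'a" where
  "kap1 x = (SOME c. (\<forall>i<N. c i \<in> carrier R) \<and> x = (\<Oplus>i\<in>{..<N}. c i [^] p \<otimes> b i))"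

lemma kap1:
  assumes "x \<in> carrier R"
  shows "\<And>i. i < N \<Longrightarrow> kap1 x i \<in> carrier R" "x = (\<Oplus>i\<in>{..<N}. kap1 x i [^] p \<otimes> b i)"
proof -
  have "(\<forall>i<N. kap1 x i \<in> carrier R) \<and> x = (\<Oplus>i\<in>{..<N}. kap1 x i [^] p \<otimes> b i)"
    unfolding kap1_def by (rule someI_ex[OF b_span[OF assms]])
  then show "\<And>i. i < N \<Longrightarrow> kap1 x i \<in> carrier R" "x = (\<Oplus>i\<in>{..<N}. kap1 x i [^] p \<otimes> b i)" by blast+
qed

lemma kap1_eqI:
  assumes "\<And>i. i < N \<Longrightarrow> c i \<in> carrier R" "x = (\<Oplus>i\<in>{..<N}. c i [^] p \<otimes> b i)" "i < N"
  shows "kap1 x i = c i"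
proof -
  have x: "x \<in> carrier R" unfolding assms(2) using assms(1) b_closed by (intro finsum_closed) auto
  have "\<forall>i<N. kap1 x i = c i"
  proof (rule b_indep)
    show "(\<Oplus>i\<in>{..<N}. kap1 x i [^] p \<otimes> b i) = (\<Oplus>i\<in>{..<N}. c i [^] p \<otimes> b i)"
      using kap1(2)[OF x] assms(2) by simp
  qed (use kap1(1)[OF x] assms(1) in auto)
  then show ?thesis using assms(3) by blast
qed

lemma kap1_add:
  assumes "x \<in> carrier R" "y \<in> carrier R" "i < N"
  shows "kap1 (x \<oplus> y) i = kap1 x i \<oplus> kap1 y i"
proof (rule kap1_eqI[OF _ _ assms(3)])
  have "x \<oplus> y = (\<Oplus>i\<in>{..<N}. kap1 x i [^] p \<otimes> b i) \<oplus> (\<Oplus>i\<in>{..<N}. kap1 y i [^] p \<otimes> b i)"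
    using kap1(2)[OF assms(1)] kap1(2)[OF assms(2)] by simp
  also have "\<dots> = (\<Oplus>i\<in>{..<N}. kap1 x i [^] p \<otimes> b i \<oplus> kap1 y i [^] p \<otimes> b i)"
    by (rule finsum_addf[symmetric]) (use kap1 b_closed assms in auto)
  also have "\<dots> = (\<Oplus>i\<in>{..<N}. (kap1 x i \<oplus> kap1 y i) [^] p \<otimes> b i)"
    by (rule finsum_cong') (use kap1(1) b_closed assms in \<open>auto simp: frobenius_add l_distr\<close>)
  finally show "x \<oplus> y = (\<Oplus>i\<in>{..<N}. (kap1 x i \<oplus> kap1 y i) [^] p \<otimes> b i)" .
qed (use kap1(1) assms in auto)

lemma kap1_mult:
  assumes "a \<in> carrier R" "x \<in> carrier R" "i < N"
  shows "kap1 (a [^] p \<otimes> x) i = a \<otimes> kap1 x i"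
proof (rule kap1_eqI[OF _ _ assms(3)])
  have "a [^] p \<otimes> x = a [^] p \<otimes> (\<Oplus>i\<in>{..<N}. kap1 x i [^] p \<otimes> b i)"
    using kap1(2)[OF assms(2)] by simp
  also have "\<dots> = (\<Oplus>i\<in>{..<N}. a [^] p \<otimes> (kap1 x i [^] p \<otimes> b i))"
    by (rule finsum_rdistr) (use kap1(1) b_closed assms in auto)
  also have "\<dots> = (\<Oplus>i\<in>{..<N}. (a \<otimes> kap1 x i) [^] p \<otimes> b i)"
    by (rule finsum_cong') (use kap1(1) b_closed assms in \<open>auto simp: nat_pow_distrib m_assoc\<close>)
  finally show "a [^] p \<otimes> x = (\<Oplus>i\<in>{..<N}. (a \<otimes> kap1 x i) [^] p \<otimes> b i)" .
qed (use kap1(1) assms in auto)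

lemma p_pos: "p > 0"
  using p_prime by (simp add: prime_gt_0_nat)

lemma kap1_basis:
  assumes "i < N" "j < N"
  shows "kap1 (b j) i = (if i = j then \<one> else \<zero>)"
proof (rule kap1_eqI[OF _ _ assms(1)])
  have "(\<Oplus>i\<in>{..<N}. (if i = j then \<one> else \<zero>) [^] p \<otimes> b i) = (if j = j then \<one> else \<zero>) [^] p \<otimes> b j"
    by (rule finsum_single_term) (use assms b_closed p_pos in \<open>auto simp: nat_pow_zero\<close>)
  then show "b j = (\<Oplus>i\<in>{..<N}. (if i = j then \<one> else \<zero>) [^] p \<otimes> b i)"
    using assms b_closed by simp
qed auto

lemma kap1_zero: "i < N \<Longrightarrow> kap1 \<zero> i = \<zero>"
  using kap1_mult[of \<zero> \<zero> i] kap1(1)[of \<zero> i] p_pos by (simp add: nat_pow_zero)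

section \<open>Iterated coordinates over the subfields of p^e-th powers\<close>

fun kap :: "nat list \<Rightarrow> 'a \<Rightarrow> 'a" where
  "kap [] x = x"
| "kap (i # ls) x = kap ls (kap1 x i)"

text \<open>The basis of a tower of fields: the first letter of the word belongs to the top step,
  over the p-th powers, and the basis element of the remaining letters is raised to the p-th power
  to descend one step.\<close>

fun bas :: "nat list \<Rightarrow> 'a" where
  "bas [] = \<one>"
| "bas (i # ls) = bas ls [^] p \<otimes> b i"

definition idx :: "nat \<Rightarrow> nat list set" where
  "idx e = {ls. set ls \<subseteq> {..<N} \<and> length ls = e}"

lemma finite_idx: "finite (idx e)" and card_idx: "card (idx e) = N ^ e"
  unfolding idx_def using finite_lists_length_eq[of "{..<N}" e] card_lists_length_eq[of "{..<N}" e] by simp_all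

lemma idx_Suc: "idx (Suc e) = (\<lambda>(i, ls). i # ls) ` ({..<N} \<times> idx e)"
  by (auto simp: idx_def length_Suc_conv image_iff)

lemma idx_0: "idx 0 = {[]}"
  by (auto simp: idx_def)

lemma bas_closed: "ls \<in> idx e \<Longrightarrow> bas ls \<in> carrier R"
  by (induction ls arbitrary: e) (auto simp: idx_def b_closed)

lemma kap_closed: "ls \<in> idx e \<Longrightarrow> x \<in> carrier R \<Longrightarrow> kap ls x \<in> carrier R"
  by (induction ls arbitrary: e x) (auto simp: idx_def kap1(1))

lemma kap_zero: "ls \<in> idx e \<Longrightarrow> kap ls \<zero> = \<zero>"
  by (induction ls arbitrary: e) (auto simp: idx_def kap1_zero)

lemma kap_add:
  "ls \<in> idx e \<Longrightarrow> x \<in> carrier R \<Longrightarrow> y \<in> carrier R \<Longrightarrow> kap ls (x \<oplus> y) = kap ls x \<oplus> kap ls y"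
  by (induction ls arbitrary: e x y) (auto simp: idx_def kap1_add kap1(1))

lemma pow_p_Suc: "x \<in> carrier R \<Longrightarrow> x [^] (p ^ Suc e) = (x [^] (p ^ e)) [^] p"
  by (simp add: nat_pow_pow mult.commute)

lemma kap_mult:
  "ls \<in> idx e \<Longrightarrow> a \<in> carrier R \<Longrightarrow> x \<in> carrier R \<Longrightarrow> kap ls (a [^] (p ^ e) \<otimes> x) = a \<otimes> kap ls x"
proof (induction ls arbitrary: e x)
  case (Cons i ls)
  then obtain e' where e: "e = Suc e'" and i: "i < N" and ls: "ls \<in> idx e'" by (auto simp: idx_def)
  have "kap (i # ls) (a [^] (p ^ e) \<otimes> x) = kap ls (a [^] (p ^ e') \<otimes> kap1 x i)"
    using Cons.prems i unfolding e pow_p_Suc[OF Cons.prems(2)] by (simp add: kap1_mult)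
  then show ?case using Cons.IH[OF ls Cons.prems(2) kap1(1)[OF Cons.prems(3) i]] by simp
qed (auto simp: idx_def)

lemma kap_bas:
  "ls \<in> idx e \<Longrightarrow> ms \<in> idx e \<Longrightarrow> kap ls (bas ms) = (if ls = ms then \<one> else \<zero>)"
proof (induction ls arbitrary: e ms)
  case (Cons i ls)
  then obtain e' where e: "e = Suc e'" and i: "i < N" and ls: "ls \<in> idx e'" by (auto simp: idx_def)
  then obtain j ms' where ms: "ms = j # ms'" "j < N" "ms' \<in> idx e'"
    using Cons.prems by (cases ms) (auto simp: idx_def)
  have "kap (i # ls) (bas ms) = kap ls (bas ms' \<otimes> (if i = j then \<one> else \<zero>))"
    using kap1_mult[OF bas_closed[OF ms(3)] b_closed[OF ms(2)] i] kap1_basis[OF i ms(2)] by (simp add: ms(1))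
  then show ?case using Cons.IH[OF ls ms(3)] bas_closed[OF ms(3)] kap_zero[OF ls] by (auto simp: ms(1))
qed (auto simp: idx_def)

text \<open>The first coordinates are expanded again by induction, and the p-th power passes through
  the inner sum because Frobenius is additive.\<close>

lemma kap_sum:
  "x \<in> carrier R \<Longrightarrow> x = (\<Oplus>ls\<in>idx e. kap ls x [^] (p ^ e) \<otimes> bas ls)"
proof (induction e arbitrary: x)
  case 0
  then show ?case by (simp add: idx_0)
next
  case (Suc e)
  have frob: "y [^] p = y [^] (p ^ 1)" for y by simp
  have kc: "kap ls (kap1 x i) \<in> carrier R" "bas ls \<in> carrier R" if "i < N" "ls \<in> idx e" for i ls
    using that kap_closed bas_closed kap1(1) Suc.prems by auto
  have summand: "kap1 x i [^] p \<otimes> b i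
     = (\<Oplus>ls\<in>idx e. kap (i # ls) x [^] (p ^ Suc e) \<otimes> bas (i # ls))" if i: "i < N" for i
  proof -
    have pth: "kap1 x i [^] p = (\<Oplus>ls\<in>idx e. kap ls (kap1 x i) [^] (p ^ e) \<otimes> bas ls) [^] p"
      using Suc.IH[OF kap1(1)[OF Suc.prems i]] by simp
    have frobsum: "\<dots> = (\<Oplus>ls\<in>idx e. (kap ls (kap1 x i) [^] (p ^ e) \<otimes> bas ls) [^] p)"
      unfolding frob by (rule frobenius_power_finsum) (use finite_idx kc i in auto)
    have "kap1 x i [^] p \<otimes> b i = (\<Oplus>ls\<in>idx e. (kap ls (kap1 x i) [^] (p ^ e) \<otimes> bas ls) [^] p) \<otimes> b i"
      by (simp only: pth frobsum)
    also have "\<dots> = (\<Oplus>ls\<in>idx e. (kap ls (kap1 x i) [^] (p ^ e) \<otimes> bas ls) [^] p \<otimes> b i)"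
      by (rule finsum_ldistr) (use finite_idx kc i b_closed in auto)
    also have "\<dots> = (\<Oplus>ls\<in>idx e. kap (i # ls) x [^] (p ^ Suc e) \<otimes> bas (i # ls))"
      by (rule finsum_cong')
         (use kc i b_closed in \<open>auto simp: nat_pow_distrib pow_p_Suc m_assoc simp del: power_Suc\<close>)
    finally show ?thesis .
  qed
  have "x = (\<Oplus>i\<in>{..<N}. kap1 x i [^] p \<otimes> b i)" by (rule kap1(2)[OF Suc.prems])
  also have "\<dots> = (\<Oplus>i\<in>{..<N}. \<Oplus>ls\<in>idx e. kap (i # ls) x [^] (p ^ Suc e) \<otimes> bas (i # ls))"
    by (rule finsum_cong') (use summand kc b_closed in \<open>auto intro!: finsum_closed simp del: power_Suc\<close>)
  also have "\<dots> = (\<Oplus>y\<in>{..<N} \<times> idx e. kap (fst y # snd y) x [^] (p ^ Suc e) \<otimes> bas (fst y # snd y))"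
    by (rule finsum_Sigma) (use kc b_closed finite_idx in \<open>auto simp del: power_Suc\<close>)
  also have "\<dots> = (\<Oplus>ls\<in>(\<lambda>(i, ls). i # ls) ` ({..<N} \<times> idx e). kap ls x [^] (p ^ Suc e) \<otimes> bas ls)"
    by (subst finsum_reindex) (use kc b_closed in \<open>auto simp: inj_on_def case_prod_beta simp del: power_Suc\<close>)
  finally show ?case unfolding idx_Suc .
qed

lemma N_pos: "N > 0"
proof (rule ccontr)
  assume "\<not> N > 0"
  then have "\<one> = \<zero>" using kap1(2)[of \<one>] by simp
  then show False using one_not_zero by simp
qed

end

section \<open>Coordinates of power series under Frobenius\<close>

lemma (in cring) pow_Suc_left: "x \<in> carrier R \<Longrightarrow> n > 0 \<Longrightarrow> x [^] (n :: nat) = x [^] (n - 1) \<otimes> x"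
  by (cases n) auto

lemma (in cring) add_minus_cancel:
  "y \<in> carrier R \<Longrightarrow> x \<in> carrier R \<Longrightarrow> y \<oplus> (x \<ominus> y) = x"
  by algebra

locale frobenius_series = field_power_series R I w + frobenius_field R p N b
  for R :: "('a, 'b) ring_scheme" (structure) and I :: "'v set" and w and p N b
begin

lemma P_char: "char_cring P p"
proof -
  interpret h: ring_hom_ring R P "mon 0"
    by (intro ring_hom_ringI2 ring_axioms P.ring_axioms mon_0_ring_hom)
  have "has_characteristic P p"
  proof (rule h.has_characteristic_inj[OF char_p])
    fix x assume x: "x \<in> carrier R" "mon 0 x = \<zero>\<^bsub>P\<^esub>"
    then have "mon 0 x 0 = \<zero>" by simp
    then show "x = \<zero>" by (simp add: coeff_mon)
  qed
  then show ?thesis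
    by (intro char_cring.intro char_cring_axioms.intro P_is_cring p_prime)
qed

sublocale P: char_cring P p by (rule P_char)

definition scale :: "nat \<Rightarrow> ('v \<Rightarrow> nat) \<Rightarrow> 'v \<Rightarrow> nat" where
  "scale q u = (\<lambda>i. q * u i)"

lemma scale_in_E [simp, intro]: "u \<in> E \<Longrightarrow> scale q u \<in> E"
  by (simp add: scale_def exponents_def)

lemma pe_pos: "p ^ e > 0"
  using p_pos by simp

text \<open>Additivity of Frobenius covers finite sums, so \<open>s\<close> is split into its
  monomials with exponent at most \<open>m\<close> and a rest \<open>g\<close>. With one factor
  \<open>g\<close> peeled off, every term of the convolution for g^q at \<open>m\<close> contains a
  coefficient of \<open>g\<close> at an exponent below \<open>m\<close>, so the rest does not
  contribute there.\<close>

lemma coeff_frobenius: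
  assumes s: "s \<in> carrier P" and m: "m \<in> E"
  shows "(s [^]\<^bsub>P\<^esub> (p ^ e)) m
     = (if \<forall>i. p ^ e dvd m i then s (\<lambda>i. m i div p ^ e) [^] (p ^ e) else \<zero>)"
proof -
  let ?q = "p ^ e" and ?K = "{k. k \<le> m}"
  have kE: "k \<in> E" if "k \<le> m" for k using that m le_in_exponents by blast
  have fin: "finite ?K" by (rule fin_le[OF m])
  have mons: "(\<lambda>k. mon k (s k)) \<in> ?K \<rightarrow> carrier P" using s kE by auto
  define T where "T = (\<Oplus>\<^bsub>P\<^esub>k\<in>?K. mon k (s k))"
  have TP: "T \<in> carrier P" unfolding T_def using mons by (rule P.finsum_closed)
  define g where "g = s \<ominus>\<^bsub>P\<^esub> T"
  have gP: "g \<in> carrier P" using s TP by (simp add: g_def)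
  have Tk: "T k = s k" if "k \<le> m" for k
  proof -
    have "T k = (\<Oplus>j\<in>?K. mon j (s j) k)"
      unfolding T_def by (rule coeff_finsum[OF fin mons kE[OF that]])
    also have "\<dots> = mon k (s k) k"
      by (rule finsum_single_term) (use fin that kE s in \<open>auto simp: coeff_mon\<close>)
    finally show ?thesis using kE[OF that] by (simp add: coeff_mon)
  qed
  have gk: "g k = \<zero>" if "k \<le> m" for k
    using Tk[OF that] s TP kE[OF that] by (simp add: g_def a_minus_def r_neg)
  have gq: "(g [^]\<^bsub>P\<^esub> ?q) m = \<zero>"
  proof -
    have "g [^]\<^bsub>P\<^esub> ?q = g [^]\<^bsub>P\<^esub> (?q - 1) \<otimes>\<^bsub>P\<^esub> g" by (rule P.pow_Suc_left[OF gP pe_pos])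
    moreover have "(g [^]\<^bsub>P\<^esub> (?q - 1) \<otimes>\<^bsub>P\<^esub> g) m = \<zero>"
      unfolding coeff_mult[OF m]
    proof (rule finsum_all_zero)
      fix k assume "k \<in> ?K"
      moreover have "m - k \<le> m" by (simp add: le_fun_def fun_diff_def)
      ultimately show "(g [^]\<^bsub>P\<^esub> (?q - 1)) k \<otimes> g (m - k) = \<zero>"
        using gk[of "m - k"] gP kE by simp
    qed
    ultimately show ?thesis by simp
  qed
  have "T \<oplus>\<^bsub>P\<^esub> g = s" unfolding g_def using TP s by (rule P.add_minus_cancel)
  then have sT: "s = T \<oplus>\<^bsub>P\<^esub> g" by simp
  have "s [^]\<^bsub>P\<^esub> ?q = T [^]\<^bsub>P\<^esub> ?q \<oplus>\<^bsub>P\<^esub> g [^]\<^bsub>P\<^esub> ?q"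
    unfolding sT using TP gP by (rule P.frobenius_power_add)
  then have "(s [^]\<^bsub>P\<^esub> ?q) m = (T [^]\<^bsub>P\<^esub> ?q) m" using gq m TP by simp
  also have "T [^]\<^bsub>P\<^esub> ?q = (\<Oplus>\<^bsub>P\<^esub>k\<in>?K. mon k (s k) [^]\<^bsub>P\<^esub> ?q)"
    unfolding T_def by (rule P.frobenius_power_finsum[OF fin mons])
  also have "\<dots> m = (\<Oplus>k\<in>?K. (mon k (s k) [^]\<^bsub>P\<^esub> ?q) m)"
    by (rule coeff_finsum[OF fin _ m]) (use mons in auto)
  also have "\<dots> = (\<Oplus>k\<in>?K. if m = scale ?q k then s k [^] ?q else \<zero>)"
    by (rule finsum_cong') (use s kE m in \<open>auto simp: mon_pow coeff_mon scale_def\<close>)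
  also have "\<dots> = (if \<forall>i. ?q dvd m i then s (\<lambda>i. m i div ?q) [^] ?q else \<zero>)"
  proof (cases "\<forall>i. ?q dvd m i")
    case True
    let ?k = "\<lambda>i. m i div ?q"
    have mk: "m = scale ?q ?k" using True by (auto simp: scale_def)
    have kle: "?k \<le> m" by (simp add: le_fun_def)
    have "(\<Oplus>k\<in>?K. if m = scale ?q k then s k [^] ?q else \<zero>)
      = (if m = scale ?q ?k then s ?k [^] ?q else \<zero>)"
    proof (rule finsum_single_term[OF fin])
      fix j assume "j \<in> ?K" "j \<noteq> ?k"
      moreover have "j = ?k" if "m = scale ?q j" using that p_pos by (simp add: scale_def)
      ultimately have "m \<noteq> scale ?q j" by blast
      then show "(if m = scale ?q j then s j [^] ?q else \<zero>) = \<zero>" by simp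
    qed (use kle s kE[OF kle] in auto)
    then show ?thesis using True mk by simp
  next
    case False
    then have "m \<noteq> scale ?q k" for k by (auto simp: scale_def)
    then have "(\<Oplus>k\<in>?K. if m = scale ?q k then s k [^] ?q else \<zero>) = \<zero>"
      by (intro finsum_all_zero) simp
    then show ?thesis using False by auto
  qed
  finally show ?thesis .
qed

lemma coeff_frobenius_scale:
  assumes "s \<in> carrier P" "u \<in> E"
  shows "(s [^]\<^bsub>P\<^esub> (p ^ e)) (scale (p ^ e) u) = s u [^] (p ^ e)"
  using assms pe_pos[of e] by (simp add: coeff_frobenius) (simp add: scale_def)

section \<open>Coordinates with respect to monomials whose exponents lie in a box\<close>

definition box :: "nat \<Rightarrow> ('v \<Rightarrow> nat) set" where
  "box e = {a \<in> E. \<forall>i. a i < p ^ e}"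

lemma finite_box: "finite (box e)"
proof -
  have "box e \<subseteq> {a. a \<le> (\<lambda>i. if i \<in> I then p ^ e else 0)}"
    by (auto simp: box_def exponents_def le_fun_def less_imp_le)
  moreover have "(\<lambda>i. if i \<in> I then p ^ e else 0) \<in> E" by (simp add: exponents_def)
  ultimately show ?thesis using fin_le finite_subset by blast
qed

lemma box_E: "a \<in> box e \<Longrightarrow> a \<in> E"
  by (simp add: box_def)

text \<open>The entries of \<open>a\<close> are smaller than q and cannot bridge the gap to the next
  multiple of q.\<close>

lemma scale_add_le:
  assumes "a \<in> box e"
  shows "scale (p ^ e) j \<le> scale (p ^ e) u + a \<longleftrightarrow> j \<le> u"
proof -
  have "p ^ e * x \<le> p ^ e * y + a i \<longleftrightarrow> x \<le> y" for x y i
  proof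
    assume "p ^ e * x \<le> p ^ e * y + a i"
    also have "\<dots> < p ^ e * Suc y" using assms by (simp add: box_def)
    finally show "x \<le> y" by (simp del: mult_Suc_right)
  qed (simp add: trans_le_add1)
  then show ?thesis by (simp add: le_fun_def scale_def)
qed

lemma scale_add_div: "a \<in> box e \<Longrightarrow> (\<lambda>i. (scale (p ^ e) u + a) i div p ^ e) = u"
  and scale_add_mod: "a \<in> box e \<Longrightarrow> (\<lambda>i. (scale (p ^ e) u + a) i mod p ^ e) = a"
  using pe_pos[of e] by (auto simp: box_def scale_def fun_eq_iff)

lemma scale_div_mod:
  assumes "m \<in> E"
  shows "m = scale (p ^ e) (\<lambda>i. m i div p ^ e) + (\<lambda>i. m i mod p ^ e)"
    "(\<lambda>i. m i div p ^ e) \<in> E" "(\<lambda>i. m i mod p ^ e) \<in> box e"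
  using assms pe_pos[of e] by (auto simp: scale_def fun_eq_iff exponents_def box_def)

text \<open>Exponents are divided by q with remainder \<open>a\<close>, and \<open>kap\<close> is
  applied to the coefficients. The result is the q-th root of the coefficient of \<open>s\<close> at
  the generator \<open>mon a (bas ls)\<close> of the ring over its q-th powers.\<close>

definition coord :: "nat list \<Rightarrow> nat \<Rightarrow> ('v \<Rightarrow> nat) \<Rightarrow> (('v \<Rightarrow> nat) \<Rightarrow> 'a) \<Rightarrow> (('v \<Rightarrow> nat) \<Rightarrow> 'a)" where
  "coord ls e a s = (\<lambda>u\<in>E. kap ls (s (scale (p ^ e) u + a)))"

lemma coeff_coord: "u \<in> E \<Longrightarrow> coord ls e a s u = kap ls (s (scale (p ^ e) u + a))"
  by (simp add: coord_def)

lemma scale_add_E [intro]: "u \<in> E \<Longrightarrow> a \<in> box e \<Longrightarrow> scale q u + a \<in> E"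
  using box_E by (intro add_in_exponents) auto

lemma coord_closed:
  "ls \<in> idx e \<Longrightarrow> a \<in> box e \<Longrightarrow> s \<in> carrier P \<Longrightarrow> coord ls e a s \<in> carrier P"
  using kap_closed by (auto simp: coord_def P_carrier scale_add_E)

lemma coord_add:
  assumes "ls \<in> idx e" "a \<in> box e" "s \<in> carrier P" "t \<in> carrier P"
  shows "coord ls e a (s \<oplus>\<^bsub>P\<^esub> t) = coord ls e a s \<oplus>\<^bsub>P\<^esub> coord ls e a t"
  by (rule ps_eqI)
     (use assms in \<open>auto simp: coord_closed coeff_coord kap_add[OF assms(1)] scale_add_E\<close>)

lemma kap_finsum:
  assumes "ls \<in> idx e" "finite T" "F \<in> T \<rightarrow> carrier R"
  shows "kap ls (finsum R F T) = (\<Oplus>i\<in>T. kap ls (F i))"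
  using assms(2,3)
proof (induction T rule: finite_induct)
  case (insert x T)
  then have "F x \<in> carrier R" "F \<in> T \<rightarrow> carrier R" by auto
  moreover from this have "(\<lambda>i. kap ls (F i)) \<in> T \<rightarrow> carrier R" "kap ls (F x) \<in> carrier R"
    using kap_closed[OF assms(1)] by auto
  ultimately show ?case using insert by (simp add: kap_add[OF assms(1)] finsum_closed)
qed (simp add: kap_zero[OF assms(1)])

text \<open>The series t^q is supported on multiples of q, so only exponents
  \<open>scale q j\<close> enter the convolution, with \<open>j\<close> at most \<open>u\<close> by
  \<open>scale_add_le\<close>. Thus \<open>coord\<close> is linear on the pushforward.\<close>

lemma coord_frobenius_mult:
  assumes ls: "ls \<in> idx e" and a: "a \<in> box e" and s: "s \<in> carrier P" and t: "t \<in> carrier P"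
  shows "coord ls e a (t [^]\<^bsub>P\<^esub> (p ^ e) \<otimes>\<^bsub>P\<^esub> s) = t \<otimes>\<^bsub>P\<^esub> coord ls e a s"
proof (rule ps_eqI)
  fix u assume u: "u \<in> E"
  let ?q = "p ^ e"
  let ?m = "scale ?q u + a"
  have m: "?m \<in> E" using u a by (rule scale_add_E)
  have jE: "j \<in> E" if "j \<le> u" for j using that u le_in_exponents by blast
  let ?F = "\<lambda>k. (t [^]\<^bsub>P\<^esub> ?q) k \<otimes> s (?m - k)"
  have Fc: "?F k \<in> carrier R" if "k \<le> ?m" for k
    by (rule conv_summand[OF P.nat_pow_closed[OF t] s m that])
  have diff: "?m - scale ?q j = scale ?q (u - j) + a" if "j \<le> u" for j
  proof
    fix i
    have "?q * j i \<le> ?q * u i" using that by (simp add: le_fun_def)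
    then show "(?m - scale ?q j) i = (scale ?q (u - j) + a) i"
      by (simp add: scale_def fun_diff_def right_diff_distrib')
  qed
  have inj: "inj_on (scale ?q) {j. j \<le> u}" using p_pos by (auto simp: inj_on_def scale_def fun_eq_iff)
  have "(t [^]\<^bsub>P\<^esub> ?q \<otimes>\<^bsub>P\<^esub> s) ?m = finsum R ?F {k. k \<le> ?m}" by (rule coeff_mult[OF m])
  also have "\<dots> = finsum R ?F (scale ?q ` {j. j \<le> u})"
  proof (rule add.finprod_mono_neutral_cong_right)
    show "finite {k. k \<le> ?m}" using m by (rule fin_le)
    show "scale ?q ` {j. j \<le> u} \<subseteq> {k. k \<le> ?m}" using scale_add_le[OF a] by auto
    fix k assume "k \<in> {k. k \<le> ?m} - scale ?q ` {j. j \<le> u}"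
    then have k: "k \<le> ?m" "k \<notin> scale ?q ` {j. j \<le> u}" by auto
    have kE: "k \<in> E" using k m le_in_exponents by blast
    have "\<not> (\<forall>i. ?q dvd k i)"
    proof
      assume "\<forall>i. ?q dvd k i"
      then have eq: "k = scale ?q (\<lambda>i. k i div ?q)" by (auto simp: scale_def)
      then have "(\<lambda>i. k i div ?q) \<le> u" using k(1) scale_add_le[OF a] by metis
      then show False using k(2) eq by blast
    qed
    then show "?F k = \<zero>" using coeff_frobenius[OF t kE, of e] s m diff_in_exponents[OF m] by auto
  qed (use Fc in auto)
  also have "\<dots> = (\<Oplus>j\<in>{j. j \<le> u}. ?F (scale ?q j))"
    by (rule finsum_reindex) (use Fc inj scale_add_le[OF a] in auto)
  also have "\<dots> = (\<Oplus>j\<in>{j. j \<le> u}. t j [^] ?q \<otimes> s (scale ?q (u - j) + a))"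
    by (rule finsum_cong')
       (use t s jE u a diff in \<open>auto simp: coeff_frobenius_scale scale_add_E diff_in_exponents\<close>)
  finally have "kap ls ((t [^]\<^bsub>P\<^esub> ?q \<otimes>\<^bsub>P\<^esub> s) ?m)
     = (\<Oplus>j\<in>{j. j \<le> u}. kap ls (t j [^] ?q \<otimes> s (scale ?q (u - j) + a)))"
    using t s jE u a
    by (simp only:) (rule kap_finsum[OF ls fin_le[OF u]], auto simp: scale_add_E diff_in_exponents)
  also have "\<dots> = (\<Oplus>j\<in>{j. j \<le> u}. t j \<otimes> coord ls e a s (u - j))"
    by (rule finsum_cong')
       (use t s jE u a coord_closed[OF ls a s] in
         \<open>auto simp: kap_mult[OF ls] coeff_coord scale_add_E diff_in_exponents intro!: kap_closed[OF ls]\<close>)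
  also have "\<dots> = (t \<otimes>\<^bsub>P\<^esub> coord ls e a s) u" by (rule coeff_mult[OF u, symmetric])
  finally show "coord ls e a (t [^]\<^bsub>P\<^esub> ?q \<otimes>\<^bsub>P\<^esub> s) u = (t \<otimes>\<^bsub>P\<^esub> coord ls e a s) u"
    using u by (simp add: coeff_coord)
qed (use assms in \<open>auto simp: coord_closed\<close>)

text \<open>Division with remainder is unique, so the exponent \<open>c\<close> arises only from
  \<open>u = 0\<close> and \<open>a = c\<close>; with \<open>kap_bas\<close> this is the duality of
  coordinates and generators.\<close>

lemma coord_mon:
  assumes ls: "ls \<in> idx e" and ms: "ms \<in> idx e" and a: "a \<in> box e" and c: "c \<in> box e"
  shows "coord ls e a (mon c (bas ms)) = (if ls = ms \<and> a = c then \<one>\<^bsub>P\<^esub> else \<zero>\<^bsub>P\<^esub>)"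
proof (rule ps_eqI)
  fix u assume u: "u \<in> E"
  have "scale (p ^ e) u + a = c \<longleftrightarrow> u = 0 \<and> a = c"
  proof
    assume eq: "scale (p ^ e) u + a = c"
    have "c = scale (p ^ e) 0 + c" by (simp add: scale_def fun_eq_iff)
    then have "u = (\<lambda>i. (scale (p ^ e) 0 + c) i div p ^ e)" "a = (\<lambda>i. (scale (p ^ e) 0 + c) i mod p ^ e)"
      using scale_add_div[OF a, of u] scale_add_mod[OF a, of u] eq by auto
    then show "u = 0 \<and> a = c" using scale_add_div[OF c] scale_add_mod[OF c] by auto
  qed (auto simp: scale_def fun_eq_iff)
  then show "coord ls e a (mon c (bas ms)) u = (if ls = ms \<and> a = c then \<one>\<^bsub>P\<^esub> else \<zero>\<^bsub>P\<^esub>) u"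
    using u a kap_bas[OF ls ms] kap_zero[OF ls]
    by (auto simp: coeff_coord coeff_mon scale_add_E coeff_one)
qed (use assms bas_closed[OF ms] in \<open>auto simp: coord_closed\<close>)

text \<open>At exponent \<open>m\<close> only the generators whose \<open>a\<close> is
  \<open>m\<close> modulo q contribute, and the identity reduces to \<open>kap_sum\<close> for the
  coefficient \<open>s m\<close>.\<close>

lemma coord_sum:
  assumes s: "s \<in> carrier P"
  shows "s = (\<Oplus>\<^bsub>P\<^esub>x\<in>idx e \<times> box e. coord (fst x) e (snd x) s [^]\<^bsub>P\<^esub> (p ^ e) \<otimes>\<^bsub>P\<^esub> mon (snd x) (bas (fst x)))"
    (is "s = finsum P ?F ?G")
proof (rule ps_eqI)
  have fin: "finite ?G" using finite_idx finite_box by simp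
  have cP: "coord ls e a s \<in> carrier P" "bas ls \<in> carrier R" "a \<in> E" if "ls \<in> idx e" "a \<in> box e" for ls a
    using that coord_closed bas_closed box_E s by auto
  have FP: "?F \<in> ?G \<rightarrow> carrier P" using cP by auto
  show "finsum P ?F ?G \<in> carrier P" using FP by (rule P.finsum_closed)
  fix m assume m: "m \<in> E"
  let ?q = "p ^ e"
  define u where "u = (\<lambda>i. m i div ?q)"
  define a where "a = (\<lambda>i. m i mod ?q)"
  have ua: "m = scale ?q u + a" "u \<in> E" "a \<in> box e"
    using scale_div_mod[OF m] by (auto simp: u_def a_def)
  have val: "?F (ls, c) m = (if c = a then kap ls (s m) [^] ?q \<otimes> bas ls else \<zero>)"
    if ls: "ls \<in> idx e" and c: "c \<in> box e" for ls c
  proof -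
    let ?y = "coord ls e c s [^]\<^bsub>P\<^esub> ?q"
    have yP: "?y \<in> carrier P" using cP ls c by auto
    have "?F (ls, c) m = (mon c (bas ls) \<otimes>\<^bsub>P\<^esub> ?y) m"
      using P.m_comm[OF yP mon_closed[OF cP(2)[OF ls c]]] by simp
    also have "\<dots> = (if c \<le> m then bas ls \<otimes> ?y (m - c) else \<zero>)"
      by (rule coeff_mon_mult) (use cP ls c yP m in auto)
    also have "\<dots> = (if c = a then kap ls (s m) [^] ?q \<otimes> bas ls else \<zero>)"
    proof (cases "c = a")
      case True
      have cm: "c \<le> m" "m - c = scale ?q u"
        unfolding ua(1) True by (auto simp: le_fun_def fun_eq_iff fun_diff_def)
      have "?y (scale ?q u) = coord ls e c s u [^] ?q"
        by (rule coeff_frobenius_scale[OF cP(1)[OF ls c] ua(2)])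
      also have "coord ls e c s u = kap ls (s m)" using ua True by (simp add: coeff_coord)
      finally have y: "?y (scale ?q u) = kap ls (s m) [^] ?q" .
      have "kap ls (s m) \<in> carrier R" by (rule kap_closed[OF ls coeff_closed[OF s m]])
      then have comm: "bas ls \<otimes> kap ls (s m) [^] ?q = kap ls (s m) [^] ?q \<otimes> bas ls"
        using cP(2)[OF ls c] by (intro m_comm nat_pow_closed)
      show ?thesis by (simp only: True[symmetric] cm y comm simp_thms if_True)
    next
      case False
      have "?y (m - c) = \<zero>" if cm: "c \<le> m"
      proof -
        \<comment> \<open>Entries of a box exponent are their own remainders, so divisibility would
          force \<open>c = a\<close>.\<close>
        have "\<not> (\<forall>i. ?q dvd (m - c) i)"
        proof
          assume dvd: "\<forall>i. ?q dvd (m - c) i"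
          have "c i = a i" for i
          proof -
            have "m i = (m - c) i + c i" using cm by (simp add: le_fun_def fun_diff_def)
            then have "m i mod ?q = c i mod ?q" using dvd by (metis dvd_imp_mod_0 mod_add_left_eq add_0)
            then show ?thesis using c by (simp add: a_def box_def)
          qed
          then show False using False by (simp add: fun_eq_iff)
        qed
        then show ?thesis using coeff_frobenius[OF cP(1)[OF ls c] diff_in_exponents[OF m, of c], of e] by auto
      qed
      then show ?thesis using False cP(2)[OF ls c] by simp
    qed
    finally show ?thesis .
  qed
  have kc: "kap ls (s m) \<in> carrier R" "bas ls \<in> carrier R" if "ls \<in> idx e" for ls
    using kap_closed bas_closed s m that by auto
  have "finsum P ?F ?G m = (\<Oplus>x\<in>?G. ?F x m)" by (rule coeff_finsum[OF fin FP m])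
  also have "\<dots> = (\<Oplus>x\<in>?G. if snd x = a then kap (fst x) (s m) [^] ?q \<otimes> bas (fst x) else \<zero>)"
    by (rule finsum_cong') (use val kc in auto)
  also have "\<dots> = (\<Oplus>x\<in>(\<lambda>ls. (ls, a)) ` idx e. if snd x = a then kap (fst x) (s m) [^] ?q \<otimes> bas (fst x) else \<zero>)"
    by (rule add.finprod_mono_neutral_cong_right) (use fin ua kc in auto)
  also have "\<dots> = (\<Oplus>ls\<in>idx e. kap ls (s m) [^] ?q \<otimes> bas ls)"
    by (subst finsum_reindex) (use kc in \<open>auto simp: inj_on_def\<close>)
  also have "\<dots> = s m" using kap_sum[of "s m" e] s m by simp
  finally show "s m = finsum P ?F ?G m" by simp
qed (rule s)

text \<open>As the bounds do not exceed q, they imply the box condition on \<open>I\<close>, and a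
  product of intervals remains to be counted.\<close>

lemma card_box_bounded:
  assumes "\<And>i. i \<in> I \<Longrightarrow> c i \<le> p ^ e"
  shows "card {a \<in> box e. \<forall>i\<in>I. a i < c i} = (\<Prod>i\<in>I. c i)"
proof -
  have "bij_betw (\<lambda>g i. if i \<in> I then g i else 0) (Pi\<^sub>E I (\<lambda>i. {..<c i})) {a \<in> box e. \<forall>i\<in>I. a i < c i}"
  proof (rule bij_betw_byWitness[where f' = "\<lambda>a. restrict a I"])
    show "\<forall>a\<in>Pi\<^sub>E I (\<lambda>i. {..<c i}). restrict (\<lambda>i. if i \<in> I then a i else 0) I = a"
      by (auto simp: fun_eq_iff PiE_def extensional_def)
    show "\<forall>a'\<in>{a \<in> box e. \<forall>i\<in>I. a i < c i}. (\<lambda>i. if i \<in> I then restrict a' I i else 0) = a'"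
      by (auto simp: fun_eq_iff box_def exponents_def)
    show "(\<lambda>g i. if i \<in> I then g i else 0) ` Pi\<^sub>E I (\<lambda>i. {..<c i}) \<subseteq> {a \<in> box e. \<forall>i\<in>I. a i < c i}"
    proof
      fix a assume "a \<in> (\<lambda>g i. if i \<in> I then g i else 0) ` Pi\<^sub>E I (\<lambda>i. {..<c i})"
      then obtain g where g: "g \<in> Pi\<^sub>E I (\<lambda>i. {..<c i})" "a = (\<lambda>i. if i \<in> I then g i else 0)" by blast
      have "g i < c i" if "i \<in> I" for i using g(1) that by auto
      then show "a \<in> {a \<in> box e. \<forall>i\<in>I. a i < c i}"
        using assms p_pos by (auto simp: g(2) box_def exponents_def intro: less_le_trans)
    qed
    show "(\<lambda>a. restrict a I) ` {a \<in> box e. \<forall>i\<in>I. a i < c i} \<subseteq> Pi\<^sub>E I (\<lambda>i. {..<c i})" by auto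
  qed
  then have "card (Pi\<^sub>E I (\<lambda>i. {..<c i})) = card {a \<in> box e. \<forall>i\<in>I. a i < c i}"
    by (rule bij_betw_same_card)
  then show ?thesis by (simp add: card_PiE finI)
qed

end

section \<open>The free rank of the pushforward\<close>

lemma (in cring) nat_pow_minus_one_square:
  "((\<ominus> \<one>) [^] (h :: nat)) \<otimes> ((\<ominus> \<one>) [^] h) = \<one>"
proof -
  have "((\<ominus> \<one>) [^] h) \<otimes> ((\<ominus> \<one>) [^] h) = (\<ominus> \<one> \<otimes> \<ominus> \<one>) [^] h"
    by (rule nat_pow_distrib[symmetric]) auto
  then show ?thesis by (simp add: l_minus)
qed

context quadratic_extension
begin

section \<open>Components and functionals over the quadratic extension\<close>

definition spart :: "'c \<Rightarrow> 'a" where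
  "spart a = (THE s. s \<in> carrier R \<and> (\<exists>t\<in>carrier R. a = el s t))"

definition tpart :: "'c \<Rightarrow> 'a" where
  "tpart a = (THE t. t \<in> carrier R \<and> (\<exists>s\<in>carrier R. a = el s t))"

lemma part_el [simp]:
  assumes "s \<in> carrier R" "t \<in> carrier R"
  shows "spart (el s t) = s" "tpart (el s t) = t"
  unfolding spart_def tpart_def by (rule the_equality, use assms el_inj in auto)+

lemma part_closed [simp, intro]:
  assumes "a \<in> carrier A" shows "spart a \<in> carrier R" "tpart a \<in> carrier R"
  using el_cases[OF assms] part_el by metis+

lemma el_parts: "a \<in> carrier A \<Longrightarrow> el (spart a) (tpart a) = a"
  using el_cases part_el by metis

lemma part_add:
  assumes "a \<in> carrier A" "c \<in> carrier A"
  shows "spart (a \<oplus>\<^bsub>A\<^esub> c) = spart a \<oplus> spart c" "tpart (a \<oplus>\<^bsub>A\<^esub> c) = tpart a \<oplus> tpart c"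
proof -
  have "a \<oplus>\<^bsub>A\<^esub> c = el (spart a \<oplus> spart c) (tpart a \<oplus> tpart c)"
    using assms by (simp flip: el_add add: el_parts)
  then show "spart (a \<oplus>\<^bsub>A\<^esub> c) = spart a \<oplus> spart c" "tpart (a \<oplus>\<^bsub>A\<^esub> c) = tpart a \<oplus> tpart c"
    using assms by auto
qed

lemma part_mult:
  assumes "s \<in> carrier R" "a \<in> carrier A"
  shows "spart (\<iota> s \<otimes>\<^bsub>A\<^esub> a) = s \<otimes> spart a" "tpart (\<iota> s \<otimes>\<^bsub>A\<^esub> a) = s \<otimes> tpart a"
proof -
  have "\<iota> s \<otimes>\<^bsub>A\<^esub> a = el (s \<otimes> spart a) (s \<otimes> tpart a)"
    using assms by (simp flip: iota_mult_el add: el_parts)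
  then show "spart (\<iota> s \<otimes>\<^bsub>A\<^esub> a) = s \<otimes> spart a" "tpart (\<iota> s \<otimes>\<^bsub>A\<^esub> a) = s \<otimes> tpart a"
    using assms by auto
qed

lemma iota_pow: "s \<in> carrier R \<Longrightarrow> \<iota> (s [^] (n :: nat)) = \<iota> s [^]\<^bsub>A\<^esub> n"
  by (induction n) auto

lemma z_odd_pow: "z [^]\<^bsub>A\<^esub> (2 * h + 1) = el \<zero> ((\<ominus> f) [^] (h :: nat))"
proof -
  have "z [^]\<^bsub>A\<^esub> (2 * h) = (z [^]\<^bsub>A\<^esub> (2 :: nat)) [^]\<^bsub>A\<^esub> h"
    using z_closed by (simp add: A.nat_pow_pow)
  also have "z [^]\<^bsub>A\<^esub> (2 :: nat) = \<iota> (\<ominus> f)"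
    using z_closed f_closed z_square by (simp add: numeral_2_eq_2)
  finally have "z [^]\<^bsub>A\<^esub> (2 * h + 1) = \<iota> ((\<ominus> f) [^] h) \<otimes>\<^bsub>A\<^esub> z"
    using f_closed by (simp add: iota_pow)
  then show ?thesis using f_closed z_closed by (simp add: el_def)
qed

lemma z_odd_pow_mult_el:
  fixes h :: nat
  assumes "s \<in> carrier R" "t \<in> carrier R"
  defines "g \<equiv> (\<ominus> f) [^] h"
  shows "z [^]\<^bsub>A\<^esub> (2 * h + 1) \<otimes>\<^bsub>A\<^esub> el s t = el (\<ominus> (f \<otimes> (g \<otimes> t))) (g \<otimes> s)"
proof -
  have g: "g \<in> carrier R" using f_closed by (simp add: g_def)
  show ?thesis unfolding z_odd_pow g_def[symmetric]
    using assms(1,2) g f_closed by (simp add: el_mult a_minus_def)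
qed

lemma (in cring) functional_identity:
  "\<lbrakk>s \<in> carrier R; t \<in> carrier R; u \<in> carrier R; v \<in> carrier R; f \<in> carrier R\<rbrakk> \<Longrightarrow>
     s \<otimes> u \<oplus> t \<otimes> (\<ominus> f \<otimes> v) = s \<otimes> u \<ominus> f \<otimes> (t \<otimes> v)"
  by algebra

text \<open>
  A homomorphism \<open>M \<rightarrow> A\<close> is determined by its \<open>z\<close>-coordinate \<open>\<psi>\<close>, an arbitrary homomorphism of
  modules over the base ring, because \<open>z \<phi>(m) = \<phi>(z m)\<close>.
\<close>

lemma functional_of_base_functional:
  assumes char: "char_cring A p"
    and \<psi>: "\<And>x. x \<in> carrier A \<Longrightarrow> \<psi> x \<in> carrier R"
    and \<psi>add: "\<And>x y. x \<in> carrier A \<Longrightarrow> y \<in> carrier A \<Longrightarrow> \<psi> (x \<oplus>\<^bsub>A\<^esub> y) = \<psi> x \<oplus> \<psi> y"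
    and \<psi>mult: "\<And>s x. s \<in> carrier R \<Longrightarrow> x \<in> carrier A \<Longrightarrow> \<psi> (\<iota> s [^]\<^bsub>A\<^esub> (p ^ e) \<otimes>\<^bsub>A\<^esub> x) = s \<otimes> \<psi> x"
  shows "module_functional A (frobenius_pushforward p e A) (\<lambda>x. el (\<psi> (z [^]\<^bsub>A\<^esub> (p ^ e) \<otimes>\<^bsub>A\<^esub> x)) (\<psi> x))"
  unfolding module_functional_def
proof (intro conjI ballI)
  let ?q = "p ^ e"
  interpret C: char_cring A p by fact
  have zq: "z [^]\<^bsub>A\<^esub> ?q \<in> carrier A" using z_closed by simp
  show "(\<lambda>x. el (\<psi> (z [^]\<^bsub>A\<^esub> ?q \<otimes>\<^bsub>A\<^esub> x)) (\<psi> x)) \<in> carrier (frobenius_pushforward p e A) \<rightarrow> carrier A"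
    using \<psi> zq by auto
  fix x assume "x \<in> carrier (frobenius_pushforward p e A)"
  then have x: "x \<in> carrier A" by simp
  {
    fix y assume "y \<in> carrier (frobenius_pushforward p e A)"
    then show "el (\<psi> (z [^]\<^bsub>A\<^esub> ?q \<otimes>\<^bsub>A\<^esub> (x \<oplus>\<^bsub>frobenius_pushforward p e A\<^esub> y)))
          (\<psi> (x \<oplus>\<^bsub>frobenius_pushforward p e A\<^esub> y))
       = el (\<psi> (z [^]\<^bsub>A\<^esub> ?q \<otimes>\<^bsub>A\<^esub> x)) (\<psi> x) \<oplus>\<^bsub>A\<^esub> el (\<psi> (z [^]\<^bsub>A\<^esub> ?q \<otimes>\<^bsub>A\<^esub> y)) (\<psi> y)"
      using x zq by (simp add: A.r_distr \<psi>add \<psi> el_add)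
  next
    fix a assume a: "a \<in> carrier A"
    obtain s t where st: "s \<in> carrier R" "t \<in> carrier R" "a = el s t" using el_cases[OF a] by blast
    have c: "\<iota> s [^]\<^bsub>A\<^esub> ?q \<in> carrier A" "\<iota> t [^]\<^bsub>A\<^esub> ?q \<in> carrier A" using st by auto
    have aq: "a [^]\<^bsub>A\<^esub> ?q = \<iota> s [^]\<^bsub>A\<^esub> ?q \<oplus>\<^bsub>A\<^esub> \<iota> t [^]\<^bsub>A\<^esub> ?q \<otimes>\<^bsub>A\<^esub> z [^]\<^bsub>A\<^esub> ?q"
      unfolding st(3) el_def using st z_closed by (simp add: C.frobenius_power_add A.nat_pow_distrib)
    \<comment> \<open>The square of z^q is (-f)^q, a q-th power from the base ring, so linearity of
      \<open>\<psi>\<close> over the base suffices.\<close>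
    have zz: "z [^]\<^bsub>A\<^esub> ?q \<otimes>\<^bsub>A\<^esub> z [^]\<^bsub>A\<^esub> ?q = \<iota> (\<ominus> f) [^]\<^bsub>A\<^esub> ?q"
      using z_closed f_closed z_square by (simp flip: A.nat_pow_distrib)
    let ?y = "z [^]\<^bsub>A\<^esub> ?q \<otimes>\<^bsub>A\<^esub> x"
    have y: "?y \<in> carrier A" using x zq by simp
    have 1: "a [^]\<^bsub>A\<^esub> ?q \<otimes>\<^bsub>A\<^esub> x = \<iota> s [^]\<^bsub>A\<^esub> ?q \<otimes>\<^bsub>A\<^esub> x \<oplus>\<^bsub>A\<^esub> \<iota> t [^]\<^bsub>A\<^esub> ?q \<otimes>\<^bsub>A\<^esub> ?y"
      unfolding aq using c zq x by (simp add: A.l_distr A.m_assoc)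
    have 2: "z [^]\<^bsub>A\<^esub> ?q \<otimes>\<^bsub>A\<^esub> (a [^]\<^bsub>A\<^esub> ?q \<otimes>\<^bsub>A\<^esub> x)
       = \<iota> s [^]\<^bsub>A\<^esub> ?q \<otimes>\<^bsub>A\<^esub> ?y \<oplus>\<^bsub>A\<^esub> \<iota> t [^]\<^bsub>A\<^esub> ?q \<otimes>\<^bsub>A\<^esub> (\<iota> (\<ominus> f) [^]\<^bsub>A\<^esub> ?q \<otimes>\<^bsub>A\<^esub> x)"
      unfolding 1 zz[symmetric] using c zq x by (simp add: A.r_distr A.m_ac)
    have fm: "\<ominus> f \<in> carrier R" using f_closed by simp
    have e1: "\<psi> (a [^]\<^bsub>A\<^esub> ?q \<otimes>\<^bsub>A\<^esub> x) = s \<otimes> \<psi> x \<oplus> t \<otimes> \<psi> ?y"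
    proof -
      have m: "\<iota> s [^]\<^bsub>A\<^esub> ?q \<otimes>\<^bsub>A\<^esub> x \<in> carrier A" "\<iota> t [^]\<^bsub>A\<^esub> ?q \<otimes>\<^bsub>A\<^esub> ?y \<in> carrier A"
        using c x y by (blast intro: A.m_closed)+
      show ?thesis unfolding 1 \<psi>add[OF m] \<psi>mult[OF st(1) x] \<psi>mult[OF st(2) y] ..
    qed
    have e2: "\<psi> (z [^]\<^bsub>A\<^esub> ?q \<otimes>\<^bsub>A\<^esub> (a [^]\<^bsub>A\<^esub> ?q \<otimes>\<^bsub>A\<^esub> x)) = s \<otimes> \<psi> ?y \<oplus> t \<otimes> (\<ominus> f \<otimes> \<psi> x)"
    proof -
      have n: "\<iota> (\<ominus> f) [^]\<^bsub>A\<^esub> ?q \<otimes>\<^bsub>A\<^esub> x \<in> carrier A"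
        using x hom.hom_closed[OF fm] by (blast intro: A.m_closed A.nat_pow_closed)
      have m: "\<iota> s [^]\<^bsub>A\<^esub> ?q \<otimes>\<^bsub>A\<^esub> ?y \<in> carrier A"
          "\<iota> t [^]\<^bsub>A\<^esub> ?q \<otimes>\<^bsub>A\<^esub> (\<iota> (\<ominus> f) [^]\<^bsub>A\<^esub> ?q \<otimes>\<^bsub>A\<^esub> x) \<in> carrier A"
        using c y n by (blast intro: A.m_closed)+
      show ?thesis unfolding 2 \<psi>add[OF m] \<psi>mult[OF st(1) y] \<psi>mult[OF st(2) n] \<psi>mult[OF fm x] ..
    qed
    have \<psi>c: "\<psi> x \<in> carrier R" "\<psi> ?y \<in> carrier R" using \<psi> x y by auto
    show "el (\<psi> (z [^]\<^bsub>A\<^esub> ?q \<otimes>\<^bsub>A\<^esub> (a \<odot>\<^bsub>frobenius_pushforward p e A\<^esub> x)))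
          (\<psi> (a \<odot>\<^bsub>frobenius_pushforward p e A\<^esub> x))
       = a \<otimes>\<^bsub>A\<^esub> el (\<psi> ?y) (\<psi> x)"
      unfolding frobenius_pushforward_simps e1 e2
      using st \<psi>c f_closed functional_identity[OF st(1,2) \<psi>c(2,1) f_closed] by (simp add: el_mult)
  }
qed

text \<open>By linearity, \<open>z\<close> times \<phi>(y) equals \<open>x\<close> times \<phi>(y').
  Comparing \<open>z\<close>-coordinates shows that the base part of \<phi>(y) is a multiple of
  \<open>x\<close>.\<close>

lemma functional_in_extend:
  assumes \<phi>: "module_functional A (frobenius_pushforward p e A) \<phi>"
    and m: "ideal m R" and x: "x \<in> m" and y: "y \<in> carrier A" "y' \<in> carrier A"
    and zy: "z [^]\<^bsub>A\<^esub> (p ^ e) \<otimes>\<^bsub>A\<^esub> y = \<iota> x [^]\<^bsub>A\<^esub> (p ^ e) \<otimes>\<^bsub>A\<^esub> y'"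
  shows "\<phi> y \<in> extend m"
proof -
  interpret m: ideal m R by fact
  have xR: "x \<in> carrier R" using x by (rule m.Icarr)
  have \<phi>c: "\<phi> u \<in> carrier A" if "u \<in> carrier A" for u using \<phi> that by (auto simp: module_functional_def)
  have \<phi>m: "\<phi> (a [^]\<^bsub>A\<^esub> (p ^ e) \<otimes>\<^bsub>A\<^esub> u) = a \<otimes>\<^bsub>A\<^esub> \<phi> u" if "a \<in> carrier A" "u \<in> carrier A" for a u
    using \<phi> that by (auto simp: module_functional_def)
  obtain s t where st: "s \<in> carrier R" "t \<in> carrier R" "\<phi> y = el s t" using el_cases[OF \<phi>c[OF y(1)]] by blast
  obtain s' t' where st': "s' \<in> carrier R" "t' \<in> carrier R" "\<phi> y' = el s' t'" using el_cases[OF \<phi>c[OF y(2)]] by blast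
  have "z \<otimes>\<^bsub>A\<^esub> \<phi> y = \<iota> x \<otimes>\<^bsub>A\<^esub> \<phi> y'"
    using \<phi>m[OF z_closed y(1)] \<phi>m[OF hom.hom_closed[OF xR] y(2)] zy by simp
  then have "el (\<ominus> (f \<otimes> t)) s = el (x \<otimes> s') (x \<otimes> t')"
    using st st' xR by (simp add: z_mult_el iota_mult_el)
  then have "s = x \<otimes> t'" using st st' xR f_closed by (simp add: el_inj)
  then have "s \<in> m" using m.I_r_closed[OF x st'(2)] by simp
  then show ?thesis using st m.a_subset by (simp add: el_in_extend)
qed

end

context frobenius_series
begin

lemma coord_zero: "ls \<in> idx e \<Longrightarrow> a \<in> box e \<Longrightarrow> coord ls e a \<zero>\<^bsub>P\<^esub> = \<zero>\<^bsub>P\<^esub>"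
  by (rule ps_eqI) (auto simp: coord_closed coeff_coord scale_add_E kap_zero)

lemma coord_uminus:
  assumes "ls \<in> idx e" "a \<in> box e" "s \<in> carrier P"
  shows "coord ls e a (\<ominus>\<^bsub>P\<^esub> s) = \<ominus>\<^bsub>P\<^esub> coord ls e a s"
proof -
  have "coord ls e a (\<ominus>\<^bsub>P\<^esub> s) \<oplus>\<^bsub>P\<^esub> coord ls e a s = \<zero>\<^bsub>P\<^esub>"
    using assms by (simp flip: coord_add add: P.l_neg coord_zero)
  then show ?thesis using assms by (simp add: P.minus_equality coord_closed)
qed

end

text \<open>A prime \<open>p\<close> above 2 is odd, which makes z^q a power of f times
  \<open>z\<close> up to sign. Positive \<open>d i\<close> on a nonempty \<open>I\<close> puts
  \<open>f\<close> into the maximal ideal.\<close>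

locale hypersurface = frobenius_series R I w p N b + Q: quadratic_extension "power_series_ring R I" A \<iota> z f
  for R :: "('a, 'b) ring_scheme" (structure) and I :: "'v set" and w p N b
    and A :: "('c, 'd) ring_scheme" and \<iota> z f +
  fixes d :: "'v \<Rightarrow> nat"
  assumes f_eq: "f = mon d \<one>" and d_E: "d \<in> E" and d_pos: "\<And>i. i \<in> I \<Longrightarrow> d i > 0"
    and I_ne: "I \<noteq> {}" and p_gt_2: "p > 2"
begin

lemma A_char: "char_cring A p"
proof -
  have "ring_hom_ring P A \<iota>"
    by (intro ring_hom_ringI2 P.ring_axioms Q.A.ring_axioms Q.hom)
  then have "has_characteristic A p"
    by (rule ring_hom_ring.has_characteristic_inj[OF _ P.char_p]) (use Q.iota_inj[of _ "\<zero>\<^bsub>P\<^esub>"] in simp)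
  then show ?thesis
    by (intro char_cring.intro char_cring_axioms.intro Q.A.is_cring p_prime)
qed

sublocale A: char_cring A p by (rule A_char)

sublocale M: module A "frobenius_pushforward p e A" for e by (rule A.frobenius_module)

section \<open>The maximal ideal, signs, and the action of \<open>zq\<close>\<close>

definition maxi :: "(('v \<Rightarrow> nat) \<Rightarrow> 'a) set" where "maxi = var_ideal I"

lemma maxi_iff: "s \<in> maxi \<longleftrightarrow> s \<in> carrier P \<and> s 0 = \<zero>"
proof -
  have "m = 0" if "m \<in> E" "\<forall>i\<in>I. m i = 0" for m using that by (auto simp: exponents_def fun_eq_iff)
  then show ?thesis by (auto simp: maxi_def var_ideal_def)
qed

lemma maxi_prime: "primeideal maxi P"
  unfolding maxi_def by (rule var_ideal_prime)

lemma maxi_ideal: "ideal maxi P"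
  using maxi_prime by (rule primeideal.axioms(1))

definition half :: "nat \<Rightarrow> nat" where "half e = (p ^ e - 1) div 2"

lemma half: "p ^ e = 2 * half e + 1"
proof -
  have "odd p" using p_prime p_gt_2 by (simp add: prime_odd_nat)
  then have "odd (p ^ e)" by simp
  then show ?thesis unfolding half_def by presburger
qed

text \<open>The sign (-1)^h of z^q, kept as a series. It is its own inverse and fixed by Frobenius,
  so it passes through coordinates and can be cancelled.\<close>

definition sgn_h :: "nat \<Rightarrow> ('v \<Rightarrow> nat) \<Rightarrow> 'a" where
  "sgn_h e = (\<ominus>\<^bsub>P\<^esub> \<one>\<^bsub>P\<^esub>) [^]\<^bsub>P\<^esub> half e"

lemma sgn_closed [simp, intro]: "sgn_h e \<in> carrier P"
  by (simp add: sgn_h_def)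

lemma sgn_square: "sgn_h e \<otimes>\<^bsub>P\<^esub> sgn_h e = \<one>\<^bsub>P\<^esub>"
  unfolding sgn_h_def by (rule P.nat_pow_minus_one_square)

lemma sgn_frobenius: "sgn_h e [^]\<^bsub>P\<^esub> (p ^ e) = sgn_h e"
proof -
  have "sgn_h e [^]\<^bsub>P\<^esub> (p ^ e) = ((\<ominus>\<^bsub>P\<^esub> \<one>\<^bsub>P\<^esub>) [^]\<^bsub>P\<^esub> (p ^ e)) [^]\<^bsub>P\<^esub> half e"
    by (simp add: sgn_h_def P.nat_pow_pow mult.commute)
  also have "(\<ominus>\<^bsub>P\<^esub> \<one>\<^bsub>P\<^esub>) [^]\<^bsub>P\<^esub> (p ^ e) = \<ominus>\<^bsub>P\<^esub> \<one>\<^bsub>P\<^esub>"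
    by (simp add: P.frobenius_power_uminus)
  finally show ?thesis by (simp add: sgn_h_def)
qed

lemma coord_sgn:
  "ls \<in> idx e \<Longrightarrow> a \<in> box e \<Longrightarrow> s \<in> carrier P \<Longrightarrow>
     coord ls e a (sgn_h e \<otimes>\<^bsub>P\<^esub> s) = sgn_h e \<otimes>\<^bsub>P\<^esub> coord ls e a s"
  using coord_frobenius_mult[of ls e a s "sgn_h e"] by (simp add: sgn_frobenius)

lemma neg_f_pow: "(\<ominus>\<^bsub>P\<^esub> f) [^]\<^bsub>P\<^esub> half e = sgn_h e \<otimes>\<^bsub>P\<^esub> mon (scale (half e) d) \<one>"
proof -
  have f: "f \<in> carrier P" by (rule Q.f_closed)
  then have "\<ominus>\<^bsub>P\<^esub> f = \<ominus>\<^bsub>P\<^esub> \<one>\<^bsub>P\<^esub> \<otimes>\<^bsub>P\<^esub> f" by (simp add: P.l_minus)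
  then have "(\<ominus>\<^bsub>P\<^esub> f) [^]\<^bsub>P\<^esub> half e = sgn_h e \<otimes>\<^bsub>P\<^esub> f [^]\<^bsub>P\<^esub> half e"
    using f by (simp add: P.nat_pow_distrib sgn_h_def)
  then show ?thesis using d_E by (simp add: f_eq mon_pow scale_def)
qed

abbreviation zq :: "nat \<Rightarrow> 'c" where "zq e \<equiv> z [^]\<^bsub>A\<^esub> (p ^ e)"

definition sh1 :: "nat \<Rightarrow> ('v \<Rightarrow> nat) \<Rightarrow> 'v \<Rightarrow> nat" where
  "sh1 e a = scale (half e) d + a"

definition sh2 :: "nat \<Rightarrow> ('v \<Rightarrow> nat) \<Rightarrow> 'v \<Rightarrow> nat" where
  "sh2 e a = scale (half e + 1) d + a"

lemma sh_E: "a \<in> E \<Longrightarrow> sh1 e a \<in> E" "a \<in> E \<Longrightarrow> sh2 e a \<in> E"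
  using d_E by (auto simp: sh1_def sh2_def intro!: add_in_exponents)

text \<open>With q = 2h + 1, multiplying t z by z^q produces one further factor z^2 = -f; this
  accounts for the extra \<open>d\<close> in the exponent and for the minus sign of the first
  component.\<close>

lemma zq_el:
  assumes "s \<in> carrier P" "t \<in> carrier P"
  shows "zq e \<otimes>\<^bsub>A\<^esub> Q.el s t = Q.el (\<ominus>\<^bsub>P\<^esub> (sgn_h e \<otimes>\<^bsub>P\<^esub> (mon (scale (half e + 1) d) \<one> \<otimes>\<^bsub>P\<^esub> t)))
      (sgn_h e \<otimes>\<^bsub>P\<^esub> (mon (scale (half e) d) \<one> \<otimes>\<^bsub>P\<^esub> s))"
proof -
  have sE: "scale (half e) d \<in> E" using d_E by simp
  have dd: "d + scale (half e) d = scale (half e + 1) d" by (auto simp: scale_def fun_eq_iff)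
  have ff: "f \<otimes>\<^bsub>P\<^esub> mon (scale (half e) d) \<one> = mon (scale (half e + 1) d) \<one>"
    unfolding f_eq using d_E sE dd by (simp add: mon_mult_mon)
  have mc: "mon (scale (half e) d) \<one> \<in> carrier P" by simp
  have "f \<otimes>\<^bsub>P\<^esub> (sgn_h e \<otimes>\<^bsub>P\<^esub> mon (scale (half e) d) \<one> \<otimes>\<^bsub>P\<^esub> t)
      = sgn_h e \<otimes>\<^bsub>P\<^esub> ((f \<otimes>\<^bsub>P\<^esub> mon (scale (half e) d) \<one>) \<otimes>\<^bsub>P\<^esub> t)"
    using Q.f_closed mc assms sgn_closed by (simp add: P.m_ac)
  moreover have "sgn_h e \<otimes>\<^bsub>P\<^esub> mon (scale (half e) d) \<one> \<otimes>\<^bsub>P\<^esub> s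
      = sgn_h e \<otimes>\<^bsub>P\<^esub> (mon (scale (half e) d) \<one> \<otimes>\<^bsub>P\<^esub> s)"
    by (rule P.m_assoc[OF sgn_closed mc assms(1)])
  ultimately show ?thesis
    using Q.z_odd_pow_mult_el[OF assms, of "half e"] unfolding half[symmetric] neg_f_pow ff by simp
qed

lemma zq_el1:
  assumes "a \<in> E" "c \<in> carrier R"
  shows "zq e \<otimes>\<^bsub>A\<^esub> Q.el (mon a c) \<zero>\<^bsub>P\<^esub> = Q.el \<zero>\<^bsub>P\<^esub> (sgn_h e \<otimes>\<^bsub>P\<^esub> mon (sh1 e a) c)"
  using assms d_E by (simp add: zq_el mon_mult_mon sh1_def)

lemma zq_el2:
  assumes "a \<in> E" "c \<in> carrier R"
  shows "zq e \<otimes>\<^bsub>A\<^esub> Q.el \<zero>\<^bsub>P\<^esub> (mon a c) = Q.el (\<ominus>\<^bsub>P\<^esub> (sgn_h e \<otimes>\<^bsub>P\<^esub> mon (sh2 e a) c)) \<zero>\<^bsub>P\<^esub>"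
  using assms d_E by (simp add: zq_el mon_mult_mon sh2_def del: add_Suc add_Suc_right One_nat_def)

text \<open>Natural subtraction truncates, so the set is empty as soon as h d_i reaches q for some
  \<open>i\<close>. By \<open>T1_iff\<close>, membership means that the exponent and its shift both
  lie in the box.\<close>

definition T1 :: "nat \<Rightarrow> ('v \<Rightarrow> nat) set" where
  "T1 e = {a \<in> box e. \<forall>i\<in>I. a i < p ^ e - half e * d i}"

definition T2 :: "nat \<Rightarrow> ('v \<Rightarrow> nat) set" where
  "T2 e = {a \<in> box e. \<forall>i\<in>I. a i < p ^ e - (half e + 1) * d i}"

lemma box_iff: "a \<in> box e \<longleftrightarrow> a \<in> E \<and> (\<forall>i\<in>I. a i < p ^ e)"
  using pe_pos[of e] by (auto simp: box_def exponents_def)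

lemma T1_iff: "a \<in> T1 e \<longleftrightarrow> a \<in> box e \<and> sh1 e a \<in> box e"
  using sh_E(1)[of a e] by (auto simp: T1_def box_iff sh1_def scale_def less_diff_conv add.commute)

lemma T2_iff: "a \<in> T2 e \<longleftrightarrow> a \<in> box e \<and> sh2 e a \<in> box e"
  using sh_E(2)[of a e] by (auto simp: T2_def box_iff sh2_def scale_def less_diff_conv add.commute)

text \<open>As d_i is positive, (2h + 1) d_i is at least q = 2h + 1, while a coincidence of
  exponents would force it below q. This makes each family of functionals vanish on the generators
  of the other.\<close>

lemma sh1_neq: "a \<in> T1 e \<Longrightarrow> c \<in> T2 e \<Longrightarrow> sh1 e a \<noteq> c"
  and sh2_neq: "a \<in> T1 e \<Longrightarrow> c \<in> T2 e \<Longrightarrow> sh2 e c \<noteq> a"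
proof -
  obtain i where i: "i \<in> I" using I_ne by blast
  have "p ^ e * 1 \<le> p ^ e * d i" using d_pos[OF i] by (intro mult_le_mono2) simp
  then have q: "p ^ e \<le> half e * d i + (half e + 1) * d i"
    using half[of e] by (simp add: algebra_simps)
  assume a: "a \<in> T1 e" and c: "c \<in> T2 e"
  have 1: "half e * d i + a i < p ^ e" using a i T1_iff[of a e] by (auto simp: box_iff sh1_def scale_def)
  have 2: "(half e + 1) * d i + c i < p ^ e" using c i T2_iff[of c e] by (auto simp: box_iff sh2_def scale_def)
  show "sh1 e a \<noteq> c"
  proof
    assume "sh1 e a = c"
    then have "c i = half e * d i + a i" by (auto simp: sh1_def scale_def)
    then show False using 2 q by simp
  qed
  show "sh2 e c \<noteq> a"
  proof
    assume "sh2 e c = a"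
    then have "a i = (half e + 1) * d i + c i" by (auto simp: sh2_def scale_def)
    then show False using 1 q by simp
  qed
qed

lemma sh_inj: "sh1 e a = sh1 e c \<longleftrightarrow> a = c" "sh2 e a = sh2 e c \<longleftrightarrow> a = c"
  by (auto simp: sh1_def sh2_def)

text \<open>This is the \<open>z\<close>-coordinate of the functional dual to
  \<open>v1 ls a\<close>. Up to sign, z^q carries \<open>v1 ls a\<close> to
  \<open>mon (sh1 e a) (bas ls)\<close> times \<open>z\<close>, so reading the coordinate at
  \<open>sh1 e a\<close> makes the first component of \<open>\<phi>1\<close> equal to 1 there. The
  factor \<open>sgn_h e\<close> cancels the sign of z^q.\<close>

definition \<psi>1 :: "nat \<Rightarrow> nat list \<Rightarrow> ('v \<Rightarrow> nat) \<Rightarrow> 'c \<Rightarrow> ('v \<Rightarrow> nat) \<Rightarrow> 'a" where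
  "\<psi>1 e ls a x = sgn_h e \<otimes>\<^bsub>P\<^esub> coord ls e (sh1 e a) (Q.tpart x)"

definition \<psi>2 :: "nat \<Rightarrow> nat list \<Rightarrow> ('v \<Rightarrow> nat) \<Rightarrow> 'c \<Rightarrow> ('v \<Rightarrow> nat) \<Rightarrow> 'a" where
  "\<psi>2 e ls a x = \<ominus>\<^bsub>P\<^esub> (sgn_h e \<otimes>\<^bsub>P\<^esub> coord ls e (sh2 e a) (Q.spart x))"

definition \<phi>1 :: "nat \<Rightarrow> nat list \<Rightarrow> ('v \<Rightarrow> nat) \<Rightarrow> 'c \<Rightarrow> 'c" where
  "\<phi>1 e ls a x = Q.el (\<psi>1 e ls a (zq e \<otimes>\<^bsub>A\<^esub> x)) (\<psi>1 e ls a x)"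

definition \<phi>2 :: "nat \<Rightarrow> nat list \<Rightarrow> ('v \<Rightarrow> nat) \<Rightarrow> 'c \<Rightarrow> 'c" where
  "\<phi>2 e ls a x = Q.el (\<psi>2 e ls a (zq e \<otimes>\<^bsub>A\<^esub> x)) (\<psi>2 e ls a x)"

lemma coord_iota_mult:
  assumes "ls \<in> idx e" "a \<in> box e" "s \<in> carrier P" "x \<in> carrier A"
  shows "coord ls e a (Q.spart (\<iota> s [^]\<^bsub>A\<^esub> (p ^ e) \<otimes>\<^bsub>A\<^esub> x)) = s \<otimes>\<^bsub>P\<^esub> coord ls e a (Q.spart x)"
    "coord ls e a (Q.tpart (\<iota> s [^]\<^bsub>A\<^esub> (p ^ e) \<otimes>\<^bsub>A\<^esub> x)) = s \<otimes>\<^bsub>P\<^esub> coord ls e a (Q.tpart x)"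
  by (simp_all only: Q.iota_pow[OF assms(3), symmetric]
      Q.part_mult[OF P.nat_pow_closed[OF assms(3)] assms(4)]
      coord_frobenius_mult[OF assms(1,2) Q.part_closed(1)[OF assms(4)] assms(3)]
      coord_frobenius_mult[OF assms(1,2) Q.part_closed(2)[OF assms(4)] assms(3)])

lemma \<phi>1_functional:
  assumes "ls \<in> idx e" "a \<in> T1 e"
  shows "module_functional A (frobenius_pushforward p e A) (\<phi>1 e ls a)"
proof -
  have sh: "sh1 e a \<in> box e" using assms T1_iff by blast
  have "module_functional A (frobenius_pushforward p e A)
     (\<lambda>x. Q.el (\<psi>1 e ls a (zq e \<otimes>\<^bsub>A\<^esub> x)) (\<psi>1 e ls a x))"
  proof (rule Q.functional_of_base_functional[OF A_char])
    fix x assume x: "x \<in> carrier A"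
    have cx: "coord ls e (sh1 e a) (Q.tpart x) \<in> carrier P"
      using coord_closed[OF assms(1) sh] Q.part_closed(2)[OF x] by blast
    then show "\<psi>1 e ls a x \<in> carrier P" by (simp add: \<psi>1_def)
    show "\<psi>1 e ls a (x \<oplus>\<^bsub>A\<^esub> y) = \<psi>1 e ls a x \<oplus>\<^bsub>P\<^esub> \<psi>1 e ls a y" if y: "y \<in> carrier A" for y
    proof -
      have cy: "coord ls e (sh1 e a) (Q.tpart y) \<in> carrier P"
        using coord_closed[OF assms(1) sh] Q.part_closed(2)[OF y] by blast
      show ?thesis
        unfolding \<psi>1_def Q.part_add[OF x y] coord_add[OF assms(1) sh Q.part_closed(2)[OF x] Q.part_closed(2)[OF y]]
        by (rule P.r_distr[OF cx cy sgn_closed])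
    qed
    show "\<psi>1 e ls a (\<iota> s [^]\<^bsub>A\<^esub> (p ^ e) \<otimes>\<^bsub>A\<^esub> x) = s \<otimes>\<^bsub>P\<^esub> \<psi>1 e ls a x" if s: "s \<in> carrier P" for s
      unfolding \<psi>1_def coord_iota_mult[OF assms(1) sh s x] by (rule P.m_lcomm[OF sgn_closed s cx])
  qed
  then show ?thesis by (simp add: \<phi>1_def[abs_def])
qed

lemma \<phi>2_functional:
  assumes "ls \<in> idx e" "a \<in> T2 e"
  shows "module_functional A (frobenius_pushforward p e A) (\<phi>2 e ls a)"
proof -
  have sh: "sh2 e a \<in> box e" using assms T2_iff by blast
  have "module_functional A (frobenius_pushforward p e A)
     (\<lambda>x. Q.el (\<psi>2 e ls a (zq e \<otimes>\<^bsub>A\<^esub> x)) (\<psi>2 e ls a x))"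
  proof (rule Q.functional_of_base_functional[OF A_char])
    fix x assume x: "x \<in> carrier A"
    have cx: "coord ls e (sh2 e a) (Q.spart x) \<in> carrier P"
      using coord_closed[OF assms(1) sh] Q.part_closed(1)[OF x] by blast
    then show "\<psi>2 e ls a x \<in> carrier P" by (simp add: \<psi>2_def)
    show "\<psi>2 e ls a (x \<oplus>\<^bsub>A\<^esub> y) = \<psi>2 e ls a x \<oplus>\<^bsub>P\<^esub> \<psi>2 e ls a y" if y: "y \<in> carrier A" for y
    proof -
      have cy: "coord ls e (sh2 e a) (Q.spart y) \<in> carrier P"
        using coord_closed[OF assms(1) sh] Q.part_closed(1)[OF y] by blast
      show ?thesis
        unfolding \<psi>2_def Q.part_add[OF x y] coord_add[OF assms(1) sh Q.part_closed(1)[OF x] Q.part_closed(1)[OF y]]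
        using cx cy by (simp add: P.r_distr P.minus_add)
    qed
    show "\<psi>2 e ls a (\<iota> s [^]\<^bsub>A\<^esub> (p ^ e) \<otimes>\<^bsub>A\<^esub> x) = s \<otimes>\<^bsub>P\<^esub> \<psi>2 e ls a x" if s: "s \<in> carrier P" for s
      unfolding \<psi>2_def coord_iota_mult[OF assms(1) sh s x]
      using s cx P.m_lcomm[OF sgn_closed s cx] by (simp add: P.r_minus)
  qed
  then show ?thesis by (simp add: \<phi>2_def[abs_def])
qed

abbreviation v1 :: "nat list \<Rightarrow> ('v \<Rightarrow> nat) \<Rightarrow> 'c" where
  "v1 ls a \<equiv> Q.el (mon a (bas ls)) \<zero>\<^bsub>P\<^esub>"

abbreviation v2 :: "nat list \<Rightarrow> ('v \<Rightarrow> nat) \<Rightarrow> 'c" where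
  "v2 ls a \<equiv> Q.el \<zero>\<^bsub>P\<^esub> (mon a (bas ls))"

lemma sgn_cancel: "sgn_h e \<otimes>\<^bsub>P\<^esub> (sgn_h e \<otimes>\<^bsub>P\<^esub> x) = x" if "x \<in> carrier P"
proof -
  have "sgn_h e \<otimes>\<^bsub>P\<^esub> (sgn_h e \<otimes>\<^bsub>P\<^esub> x) = (sgn_h e \<otimes>\<^bsub>P\<^esub> sgn_h e) \<otimes>\<^bsub>P\<^esub> x"
    by (rule P.m_assoc[symmetric, OF sgn_closed sgn_closed that])
  then show ?thesis using that by (simp only: sgn_square P.l_one)
qed

lemma \<phi>1_v1:
  assumes ls: "ls \<in> idx e" and ms: "ms \<in> idx e" and a: "a \<in> T1 e" and c: "c \<in> T1 e"
  shows "\<phi>1 e ls a (v1 ms c) = (if ms = ls \<and> c = a then \<one>\<^bsub>A\<^esub> else \<zero>\<^bsub>A\<^esub>)"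
proof -
  have sh: "sh1 e a \<in> box e" "sh1 e c \<in> box e" "c \<in> box e" using a c T1_iff by auto
  have bc: "bas ms \<in> carrier R" by (rule bas_closed[OF ms])
  have cE: "c \<in> E" using sh box_E by blast
  have m: "mon (sh1 e c) (bas ms) \<in> carrier P" using bc by simp
  let ?\<delta> = "if ls = ms \<and> sh1 e a = sh1 e c then \<one>\<^bsub>P\<^esub> else \<zero>\<^bsub>P\<^esub>"
  have "\<psi>1 e ls a (zq e \<otimes>\<^bsub>A\<^esub> v1 ms c) = sgn_h e \<otimes>\<^bsub>P\<^esub> (sgn_h e \<otimes>\<^bsub>P\<^esub> ?\<delta>)"
    unfolding zq_el1[OF cE bc] \<psi>1_def
    using m coord_sgn[OF ls sh(1) m] coord_mon[OF ls ms sh(1,2)] by simp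
  also have "\<dots> = ?\<delta>" by (rule sgn_cancel) simp
  finally have 1: "\<psi>1 e ls a (zq e \<otimes>\<^bsub>A\<^esub> v1 ms c) = ?\<delta>" .
  have 2: "\<psi>1 e ls a (v1 ms c) = \<zero>\<^bsub>P\<^esub>"
    unfolding \<psi>1_def using bc coord_zero[OF ls sh(1)] by simp
  show ?thesis unfolding \<phi>1_def 1 2 by (auto simp: sh_inj Q.one_el Q.zero_el)
qed

text \<open>The two components vanish for different reasons: after multiplication by z^q there is no
  \<open>z\<close>-part left, and before it \<open>sh1_neq\<close> separates the exponents.\<close>

lemma \<phi>1_v2:
  assumes ls: "ls \<in> idx e" and ms: "ms \<in> idx e" and a: "a \<in> T1 e" and c: "c \<in> T2 e"
  shows "\<phi>1 e ls a (v2 ms c) = \<zero>\<^bsub>A\<^esub>"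
proof -
  have sh: "sh1 e a \<in> box e" "c \<in> box e" using a c T1_iff T2_iff by auto
  have bc: "bas ms \<in> carrier R" by (rule bas_closed[OF ms])
  have cE: "c \<in> E" using sh box_E by blast
  have m: "mon (sh2 e c) (bas ms) \<in> carrier P" using bc by simp
  have 1: "\<psi>1 e ls a (zq e \<otimes>\<^bsub>A\<^esub> v2 ms c) = \<zero>\<^bsub>P\<^esub>"
    unfolding zq_el2[OF cE bc] \<psi>1_def using m coord_zero[OF ls sh(1)] by simp
  have 2: "\<psi>1 e ls a (v2 ms c) = \<zero>\<^bsub>P\<^esub>"
    unfolding \<psi>1_def using bc coord_mon[OF ls ms sh] sh1_neq[OF a c] by simp
  show ?thesis unfolding \<phi>1_def 1 2 by (simp add: Q.zero_el)
qed

lemma \<phi>2_v2: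
  assumes ls: "ls \<in> idx e" and ms: "ms \<in> idx e" and a: "a \<in> T2 e" and c: "c \<in> T2 e"
  shows "\<phi>2 e ls a (v2 ms c) = (if ms = ls \<and> c = a then \<one>\<^bsub>A\<^esub> else \<zero>\<^bsub>A\<^esub>)"
proof -
  have sh: "sh2 e a \<in> box e" "sh2 e c \<in> box e" "c \<in> box e" using a c T2_iff by auto
  have bc: "bas ms \<in> carrier R" by (rule bas_closed[OF ms])
  have cE: "c \<in> E" using sh box_E by blast
  have m: "mon (sh2 e c) (bas ms) \<in> carrier P" using bc by simp
  let ?\<delta> = "if ls = ms \<and> sh2 e a = sh2 e c then \<one>\<^bsub>P\<^esub> else \<zero>\<^bsub>P\<^esub>"
  have "\<psi>2 e ls a (zq e \<otimes>\<^bsub>A\<^esub> v2 ms c) = \<ominus>\<^bsub>P\<^esub> (sgn_h e \<otimes>\<^bsub>P\<^esub> (\<ominus>\<^bsub>P\<^esub> (sgn_h e \<otimes>\<^bsub>P\<^esub> ?\<delta>)))"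
    unfolding zq_el2[OF cE bc] \<psi>2_def
    using m coord_sgn[OF ls sh(1) m] coord_mon[OF ls ms sh(1,2)] coord_uminus[OF ls sh(1), of "sgn_h e \<otimes>\<^bsub>P\<^esub> mon (sh2 e c) (bas ms)"]
    by simp
  also have "\<dots> = sgn_h e \<otimes>\<^bsub>P\<^esub> (sgn_h e \<otimes>\<^bsub>P\<^esub> ?\<delta>)"
    by (simp add: P.r_minus)
  also have "\<dots> = ?\<delta>" by (rule sgn_cancel) simp
  finally have 1: "\<psi>2 e ls a (zq e \<otimes>\<^bsub>A\<^esub> v2 ms c) = ?\<delta>" .
  have 2: "\<psi>2 e ls a (v2 ms c) = \<zero>\<^bsub>P\<^esub>"
    unfolding \<psi>2_def using bc coord_zero[OF ls sh(1)] by simp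
  show ?thesis unfolding \<phi>2_def 1 2 by (auto simp: sh_inj Q.one_el Q.zero_el)
qed

lemma \<phi>2_v1:
  assumes ls: "ls \<in> idx e" and ms: "ms \<in> idx e" and a: "a \<in> T2 e" and c: "c \<in> T1 e"
  shows "\<phi>2 e ls a (v1 ms c) = \<zero>\<^bsub>A\<^esub>"
proof -
  have sh: "sh2 e a \<in> box e" "c \<in> box e" using a c T1_iff T2_iff by auto
  have bc: "bas ms \<in> carrier R" by (rule bas_closed[OF ms])
  have cE: "c \<in> E" using sh box_E by blast
  have m: "mon (sh1 e c) (bas ms) \<in> carrier P" using bc by simp
  have 1: "\<psi>2 e ls a (zq e \<otimes>\<^bsub>A\<^esub> v1 ms c) = \<zero>\<^bsub>P\<^esub>"
    unfolding zq_el1[OF cE bc] \<psi>2_def using m coord_zero[OF ls sh(1)] by simp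
  have 2: "\<psi>2 e ls a (v1 ms c) = \<zero>\<^bsub>P\<^esub>"
    unfolding \<psi>2_def using bc coord_mon[OF ls ms sh] sh2_neq[OF c a] by simp
  show ?thesis unfolding \<phi>2_def 1 2 by (simp add: Q.zero_el)
qed

definition gidx :: "nat \<Rightarrow> (nat list \<times> ('v \<Rightarrow> nat) + nat list \<times> ('v \<Rightarrow> nat)) set" where
  "gidx e = (idx e \<times> T1 e) <+> (idx e \<times> T2 e)"

lemma finite_T: "finite (T1 e)" "finite (T2 e)"
  using finite_box by (auto simp: T1_def T2_def)

lemma finite_gidx: "finite (gidx e)"
  using finite_idx finite_T by (simp add: gidx_def)

lemma card_gidx:
  "card (gidx e) = N ^ e * ((\<Prod>i\<in>I. p ^ e - half e * d i) + (\<Prod>i\<in>I. p ^ e - (half e + 1) * d i))"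
proof -
  have "card (T1 e) = (\<Prod>i\<in>I. p ^ e - half e * d i)" unfolding T1_def by (rule card_box_bounded) simp
  moreover have "card (T2 e) = (\<Prod>i\<in>I. p ^ e - (half e + 1) * d i)" unfolding T2_def by (rule card_box_bounded) simp
  ultimately show ?thesis
    using finite_idx finite_T by (simp add: gidx_def card_Plus card_cartesian_product card_idx distrib_left)
qed

lemma free_summand_exists: "has_free_summand A (frobenius_pushforward p e A) (card (gidx e))"
proof -
  obtain g where g: "bij_betw g {0..<card (gidx e)} (gidx e)"
    using ex_bij_betw_nat_finite[OF finite_gidx] by blast
  define B where "B x = case_sum (\<lambda>(ls, a). v1 ls a) (\<lambda>(ls, a). v2 ls a) x" for x :: "nat list \<times> ('v \<Rightarrow> nat) + nat list \<times> ('v \<Rightarrow> nat)"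
  define F where "F x = case_sum (\<lambda>(ls, a). \<phi>1 e ls a) (\<lambda>(ls, a). \<phi>2 e ls a) x" for x :: "nat list \<times> ('v \<Rightarrow> nat) + nat list \<times> ('v \<Rightarrow> nat)"
  have B: "B x \<in> carrier A" if "x \<in> gidx e" for x
    using that bas_closed by (auto simp: gidx_def B_def)
  have F: "module_functional A (frobenius_pushforward p e A) (F x)" if "x \<in> gidx e" for x
    using that \<phi>1_functional \<phi>2_functional by (auto simp: gidx_def F_def)
  have FB: "F x (B y) = (if y = x then \<one>\<^bsub>A\<^esub> else \<zero>\<^bsub>A\<^esub>)" if "x \<in> gidx e" "y \<in> gidx e" for x y
    using that \<phi>1_v1 \<phi>1_v2 \<phi>2_v1 \<phi>2_v2 by (auto simp: gidx_def F_def B_def split: if_splits)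
  have gi: "g i \<in> gidx e" if "i < card (gidx e)" for i using g that by (auto simp: bij_betw_def)
  have ginj: "g i = g j \<longleftrightarrow> i = j" if "i < card (gidx e)" "j < card (gidx e)" for i j
    using g that by (auto simp: bij_betw_def inj_on_def)
  show ?thesis
    by (rule M.has_free_summandI[where b = "\<lambda>i. B (g i)" and \<phi> = "\<lambda>i. F (g i)"])
       (use gi ginj B F FB in auto)
qed

text \<open>\<open>coord_sum\<close> applied to both parts. It exhibits finitely many generators of
  the pushforward, with scalars already from the base ring.\<close>

lemma A_decomposition:
  assumes x: "x \<in> carrier A"
  shows "x = (\<Oplus>\<^bsub>A\<^esub>y\<in>idx e \<times> box e. \<iota> (coord (fst y) e (snd y) (Q.spart x)) [^]\<^bsub>A\<^esub> (p ^ e) \<otimes>\<^bsub>A\<^esub> v1 (fst y) (snd y))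
     \<oplus>\<^bsub>A\<^esub> (\<Oplus>\<^bsub>A\<^esub>y\<in>idx e \<times> box e. \<iota> (coord (fst y) e (snd y) (Q.tpart x)) [^]\<^bsub>A\<^esub> (p ^ e) \<otimes>\<^bsub>A\<^esub> v2 (fst y) (snd y))"
proof -
  let ?G = "idx e \<times> box e"
  have fin: "finite ?G" using finite_idx finite_box by simp
  have cP: "coord (fst y) e (snd y) s \<in> carrier P" "mon (snd y) (bas (fst y)) \<in> carrier P"
    if "y \<in> ?G" "s \<in> carrier P" for y s
    using that coord_closed bas_closed by auto
  have iota: "\<iota> s = (\<Oplus>\<^bsub>A\<^esub>y\<in>?G. \<iota> (coord (fst y) e (snd y) s) [^]\<^bsub>A\<^esub> (p ^ e) \<otimes>\<^bsub>A\<^esub> \<iota> (mon (snd y) (bas (fst y))))"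
    if s: "s \<in> carrier P" for s
  proof -
    have "\<iota> s = \<iota> (\<Oplus>\<^bsub>P\<^esub>y\<in>?G. coord (fst y) e (snd y) s [^]\<^bsub>P\<^esub> (p ^ e) \<otimes>\<^bsub>P\<^esub> mon (snd y) (bas (fst y)))"
      using coord_sum[OF s, of e] by simp
    also have "\<dots> = (\<Oplus>\<^bsub>A\<^esub>y\<in>?G. \<iota> (coord (fst y) e (snd y) s [^]\<^bsub>P\<^esub> (p ^ e) \<otimes>\<^bsub>P\<^esub> mon (snd y) (bas (fst y))))"
      using cP s by (subst Q.hom.hom_finsum) (auto simp: comp_def)
    also have "\<dots> = (\<Oplus>\<^bsub>A\<^esub>y\<in>?G. \<iota> (coord (fst y) e (snd y) s) [^]\<^bsub>A\<^esub> (p ^ e) \<otimes>\<^bsub>A\<^esub> \<iota> (mon (snd y) (bas (fst y))))"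
      by (rule Q.A.finsum_cong') (use cP[OF _ s] in \<open>auto simp: Q.iota_pow\<close>)
    finally show ?thesis .
  qed
  have parts: "Q.spart x \<in> carrier P" "Q.tpart x \<in> carrier P" using x by auto
  have "x = \<iota> (Q.spart x) \<oplus>\<^bsub>A\<^esub> \<iota> (Q.tpart x) \<otimes>\<^bsub>A\<^esub> z" using Q.el_parts[OF x] by (simp add: Q.el_def)
  also have "\<iota> (Q.tpart x) \<otimes>\<^bsub>A\<^esub> z
     = (\<Oplus>\<^bsub>A\<^esub>y\<in>?G. \<iota> (coord (fst y) e (snd y) (Q.tpart x)) [^]\<^bsub>A\<^esub> (p ^ e) \<otimes>\<^bsub>A\<^esub> \<iota> (mon (snd y) (bas (fst y))) \<otimes>\<^bsub>A\<^esub> z)"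
    by (subst iota[OF parts(2)], rule Q.A.finsum_ldistr) (use fin cP parts Q.z_closed in auto)
  also have "\<dots> = (\<Oplus>\<^bsub>A\<^esub>y\<in>?G. \<iota> (coord (fst y) e (snd y) (Q.tpart x)) [^]\<^bsub>A\<^esub> (p ^ e) \<otimes>\<^bsub>A\<^esub> v2 (fst y) (snd y))"
    by (rule Q.A.finsum_cong') (use cP[OF _ parts(2)] Q.z_closed in \<open>auto simp: Q.el_def Q.A.m_assoc\<close>)
  also have "\<iota> (Q.spart x) = (\<Oplus>\<^bsub>A\<^esub>y\<in>?G. \<iota> (coord (fst y) e (snd y) (Q.spart x)) [^]\<^bsub>A\<^esub> (p ^ e) \<otimes>\<^bsub>A\<^esub> v1 (fst y) (snd y))"
    by (subst iota[OF parts(1)], rule Q.A.finsum_cong') (use cP[OF _ parts(1)] in \<open>auto simp: Q.iota_el\<close>)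
  finally show ?thesis .
qed

lemma v_closed: "ls \<in> idx e \<Longrightarrow> v1 ls a \<in> carrier A" "ls \<in> idx e \<Longrightarrow> v2 ls a \<in> carrier A"
  using bas_closed by auto

section \<open>The upper bound for the free rank\<close>

lemma unit_vector_E: "i \<in> I \<Longrightarrow> (\<lambda>j. if j = i then n else 0) \<in> E"
  by (auto simp: exponents_def)

lemma var_in_maxi: "i \<in> I \<Longrightarrow> mon (\<lambda>j. if j = i then 1 else 0) \<one> \<in> maxi"
  by (auto simp: maxi_iff coeff_mon fun_eq_iff)

text \<open>An exponent of at least q at \<open>i\<close> allows the q-th power of the variable to
  be split off; as a scalar on the pushforward this acts as the variable itself.\<close>

lemma mon_split:
  assumes m: "m \<in> E" and i: "i \<in> I" "p ^ e \<le> m i" and c: "c \<in> carrier R"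
  shows "mon m c = mon (\<lambda>j. if j = i then 1 else 0) \<one> [^]\<^bsub>P\<^esub> (p ^ e)
     \<otimes>\<^bsub>P\<^esub> mon (m - (\<lambda>j. if j = i then p ^ e else 0)) c"
proof -
  let ?u = "\<lambda>j. if j = i then p ^ e else 0"
  have pw: "mon (\<lambda>j. if j = i then 1 else 0) \<one> [^]\<^bsub>P\<^esub> (p ^ e) = mon ?u \<one>"
    using mon_pow[OF one_closed unit_vector_E[OF i(1)], of 1 "p ^ e"]
    by (simp add: if_distrib[of "\<lambda>x. p ^ e * x"] cong: if_cong)
  have "?u \<le> m" using i by (auto simp: le_fun_def)
  then have "m = ?u + (m - ?u)" by (rule fun_le_diff_add_nat[symmetric])
  then have "mon m c = mon (?u + (m - ?u)) (\<one> \<otimes> c)" using c by simp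
  also have "\<dots> = mon ?u \<one> \<otimes>\<^bsub>P\<^esub> mon (m - ?u) c"
    using c by (intro mon_mult_mon[symmetric] unit_vector_E i(1) diff_in_exponents m) auto
  finally show ?thesis unfolding pw .
qed

lemma functional_v1_in_maximal:
  assumes \<phi>: "module_functional A (frobenius_pushforward p e A) \<phi>"
    and ls: "ls \<in> idx e" and a: "a \<in> box e" "a \<notin> T1 e"
  shows "\<phi> (v1 ls a) \<in> Q.extend maxi"
proof -
  have bc: "bas ls \<in> carrier R" by (rule bas_closed[OF ls])
  have aE: "a \<in> E" using a box_E by blast
  have sE: "sh1 e a \<in> E" by (rule sh_E(1)[OF aE])
  \<comment> \<open>The generator lies in the box but its shift does not, so some variable overflows
    and its q-th power splits off.\<close>
  obtain i where i: "i \<in> I" "p ^ e \<le> sh1 e a i"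
    using a T1_iff[of a e] sE by (auto simp: box_iff not_less)
  let ?x = "mon (\<lambda>j. if j = i then 1 else 0) \<one>"
  let ?r = "mon (sh1 e a - (\<lambda>j. if j = i then p ^ e else 0)) (bas ls)"
  have c: "?x \<in> carrier P" "?r \<in> carrier P" using bc by auto
  have xq: "?x [^]\<^bsub>P\<^esub> (p ^ e) \<in> carrier P" using c(1) by (rule P.nat_pow_closed)
  show ?thesis
  proof (rule Q.functional_in_extend[OF \<phi> maxi_ideal var_in_maxi[OF i(1)]])
    show "v1 ls a \<in> carrier A" using bc by simp
    show "Q.el \<zero>\<^bsub>P\<^esub> (sgn_h e \<otimes>\<^bsub>P\<^esub> ?r) \<in> carrier A" using c by (intro Q.el_closed P.m_closed sgn_closed) auto
    have "zq e \<otimes>\<^bsub>A\<^esub> v1 ls a = Q.el \<zero>\<^bsub>P\<^esub> (sgn_h e \<otimes>\<^bsub>P\<^esub> (?x [^]\<^bsub>P\<^esub> (p ^ e) \<otimes>\<^bsub>P\<^esub> ?r))"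
      unfolding zq_el1[OF aE bc] mon_split[OF sE i bc] ..
    also have "sgn_h e \<otimes>\<^bsub>P\<^esub> (?x [^]\<^bsub>P\<^esub> (p ^ e) \<otimes>\<^bsub>P\<^esub> ?r) = ?x [^]\<^bsub>P\<^esub> (p ^ e) \<otimes>\<^bsub>P\<^esub> (sgn_h e \<otimes>\<^bsub>P\<^esub> ?r)"
      by (rule P.m_lcomm[OF sgn_closed xq c(2)])
    also have "Q.el \<zero>\<^bsub>P\<^esub> \<dots> = \<iota> (?x [^]\<^bsub>P\<^esub> (p ^ e)) \<otimes>\<^bsub>A\<^esub> Q.el \<zero>\<^bsub>P\<^esub> (sgn_h e \<otimes>\<^bsub>P\<^esub> ?r)"
      using Q.iota_mult_el[OF xq P.zero_closed P.m_closed[OF sgn_closed c(2)], of e] P.r_null[OF xq] by simp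
    also have "\<iota> (?x [^]\<^bsub>P\<^esub> (p ^ e)) = \<iota> ?x [^]\<^bsub>A\<^esub> (p ^ e)" by (rule Q.iota_pow[OF c(1)])
    finally show "zq e \<otimes>\<^bsub>A\<^esub> v1 ls a = \<iota> ?x [^]\<^bsub>A\<^esub> (p ^ e) \<otimes>\<^bsub>A\<^esub> Q.el \<zero>\<^bsub>P\<^esub> (sgn_h e \<otimes>\<^bsub>P\<^esub> ?r)" .
  qed
qed

lemma functional_v2_in_maximal:
  assumes \<phi>: "module_functional A (frobenius_pushforward p e A) \<phi>"
    and ls: "ls \<in> idx e" and a: "a \<in> box e" "a \<notin> T2 e"
  shows "\<phi> (v2 ls a) \<in> Q.extend maxi"
proof -
  have bc: "bas ls \<in> carrier R" by (rule bas_closed[OF ls])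
  have aE: "a \<in> E" using a box_E by blast
  have sE: "sh2 e a \<in> E" by (rule sh_E(2)[OF aE])
  obtain i where i: "i \<in> I" "p ^ e \<le> sh2 e a i"
    using a T2_iff[of a e] sE by (auto simp: box_iff not_less)
  let ?x = "mon (\<lambda>j. if j = i then 1 else 0) \<one>"
  let ?r = "mon (sh2 e a - (\<lambda>j. if j = i then p ^ e else 0)) (bas ls)"
  let ?y = "\<ominus>\<^bsub>P\<^esub> (sgn_h e \<otimes>\<^bsub>P\<^esub> ?r)"
  have c: "?x \<in> carrier P" "?r \<in> carrier P" using bc by auto
  have yc: "?y \<in> carrier P" using P.m_closed[OF sgn_closed c(2)] by (rule P.a_inv_closed)
  have xq: "?x [^]\<^bsub>P\<^esub> (p ^ e) \<in> carrier P" using c(1) by (rule P.nat_pow_closed)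
  show ?thesis
  proof (rule Q.functional_in_extend[OF \<phi> maxi_ideal var_in_maxi[OF i(1)]])
    show "v2 ls a \<in> carrier A" using bc by simp
    show "Q.el ?y \<zero>\<^bsub>P\<^esub> \<in> carrier A" using yc by (intro Q.el_closed) auto
    have "zq e \<otimes>\<^bsub>A\<^esub> v2 ls a = Q.el (\<ominus>\<^bsub>P\<^esub> (sgn_h e \<otimes>\<^bsub>P\<^esub> (?x [^]\<^bsub>P\<^esub> (p ^ e) \<otimes>\<^bsub>P\<^esub> ?r))) \<zero>\<^bsub>P\<^esub>"
      unfolding zq_el2[OF aE bc] mon_split[OF sE i bc] ..
    also have "\<ominus>\<^bsub>P\<^esub> (sgn_h e \<otimes>\<^bsub>P\<^esub> (?x [^]\<^bsub>P\<^esub> (p ^ e) \<otimes>\<^bsub>P\<^esub> ?r)) = ?x [^]\<^bsub>P\<^esub> (p ^ e) \<otimes>\<^bsub>P\<^esub> ?y"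
      unfolding P.m_lcomm[OF sgn_closed xq c(2)]
      by (rule P.r_minus[OF xq P.m_closed[OF sgn_closed c(2)], symmetric])
    also have "Q.el \<dots> \<zero>\<^bsub>P\<^esub> = \<iota> (?x [^]\<^bsub>P\<^esub> (p ^ e)) \<otimes>\<^bsub>A\<^esub> Q.el ?y \<zero>\<^bsub>P\<^esub>"
      using Q.iota_mult_el[OF xq yc P.zero_closed] P.r_null[OF xq] by simp
    also have "\<iota> (?x [^]\<^bsub>P\<^esub> (p ^ e)) = \<iota> ?x [^]\<^bsub>A\<^esub> (p ^ e)" by (rule Q.iota_pow[OF c(1)])
    finally show "zq e \<otimes>\<^bsub>A\<^esub> v2 ls a = \<iota> ?x [^]\<^bsub>A\<^esub> (p ^ e) \<otimes>\<^bsub>A\<^esub> Q.el ?y \<zero>\<^bsub>P\<^esub>" .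
  qed
qed

lemma f_in_maxi: "f \<in> maxi"
proof -
  obtain i where "i \<in> I" "d i > 0" using I_ne d_pos by blast
  then have "0 \<noteq> d" by (metis less_irrefl zero_fun_apply)
  then show ?thesis using Q.f_closed by (simp add: maxi_iff f_eq coeff_mon)
qed

lemma maximal_ideal: "ideal (Q.extend maxi) A"
  by (rule Q.extend_ideal[OF maxi_ideal f_in_maxi])

text \<open>
  The residues \<open>\<rho> \<gamma>\<close> detect the elements that some functional maps outside the maximal ideal, so
  there are at most \<open>card (gidx e)\<close> independent ones.
\<close>

definition \<rho> :: "nat \<Rightarrow> nat list \<times> ('v \<Rightarrow> nat) + nat list \<times> ('v \<Rightarrow> nat) \<Rightarrow> 'c \<Rightarrow> 'a" where
  "\<rho> e \<gamma> x = (case \<gamma> of Inl (ls, a) \<Rightarrow> coord ls e a (Q.spart x) 0 | Inr (ls, a) \<Rightarrow> coord ls e a (Q.tpart x) 0)"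

text \<open>In the decomposition of \<open>x\<close>, a term indexed by \<open>gidx e\<close> has a
  coefficient without constant term by hypothesis, and every other generator is sent into the
  maximal ideal by any functional.\<close>

lemma functional_in_maximal:
  assumes \<phi>: "module_functional A (frobenius_pushforward p e A) \<phi>" and x: "x \<in> carrier A"
    and \<rho>0: "\<And>\<gamma>. \<gamma> \<in> gidx e \<Longrightarrow> \<rho> e \<gamma> x = \<zero>"
  shows "\<phi> x \<in> Q.extend maxi"
proof -
  interpret mx: ideal "Q.extend maxi" A by (rule maximal_ideal)
  let ?G = "idx e \<times> box e"
  have fin: "finite ?G" using finite_idx finite_box by simp
  have parts: "Q.spart x \<in> carrier P" "Q.tpart x \<in> carrier P" using x by auto
  define F1 where "F1 y = \<iota> (coord (fst y) e (snd y) (Q.spart x)) [^]\<^bsub>A\<^esub> (p ^ e) \<otimes>\<^bsub>A\<^esub> v1 (fst y) (snd y)" for y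
  define F2 where "F2 y = \<iota> (coord (fst y) e (snd y) (Q.tpart x)) [^]\<^bsub>A\<^esub> (p ^ e) \<otimes>\<^bsub>A\<^esub> v2 (fst y) (snd y)" for y
  have F1c: "F1 \<in> ?G \<rightarrow> carrier A" and F2c: "F2 \<in> ?G \<rightarrow> carrier A"
    using coord_closed parts v_closed by (auto simp: F1_def F2_def)
  have \<phi>c: "\<phi> u \<in> carrier A" if "u \<in> carrier A" for u using \<phi> that by (auto simp: module_functional_def)
  have \<phi>m: "\<phi> (a [^]\<^bsub>A\<^esub> (p ^ e) \<otimes>\<^bsub>A\<^esub> u) = a \<otimes>\<^bsub>A\<^esub> \<phi> u" if "a \<in> carrier A" "u \<in> carrier A" for a u
    using \<phi> that by (auto simp: module_functional_def)
  have \<phi>a: "\<phi> (u \<oplus>\<^bsub>A\<^esub> v) = \<phi> u \<oplus>\<^bsub>A\<^esub> \<phi> v" if "u \<in> carrier A" "v \<in> carrier A" for u v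
    using \<phi> that by (auto simp: module_functional_def)
  have sum_in: "finsum A F T \<in> Q.extend maxi"
    if "finite T" "\<And>y. y \<in> T \<Longrightarrow> F y \<in> Q.extend maxi" for F and T :: "(nat list \<times> ('v \<Rightarrow> nat)) set"
    using that
  proof (induction T rule: finite_induct)
    case (insert y T)
    then have "F y \<in> carrier A" "F \<in> T \<rightarrow> carrier A" using mx.Icarr by auto
    then show ?case using insert mx.ideal_simps(1) by simp
  qed simp
  have \<iota>max: "\<iota> s \<in> Q.extend maxi" if "s \<in> maxi" for s
    using that maxi_iff by (auto simp: Q.iota_el Q.extend_def)
  have 1: "\<phi> (F1 y) \<in> Q.extend maxi" if y: "y \<in> ?G" for y
  proof -
    obtain ls a where la: "y = (ls, a)" "ls \<in> idx e" "a \<in> box e" using y by auto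
    let ?s = "coord ls e a (Q.spart x)"
    have sP: "?s \<in> carrier P" by (rule coord_closed[OF la(2,3) parts(1)])
    have eq: "\<phi> (F1 y) = \<iota> ?s \<otimes>\<^bsub>A\<^esub> \<phi> (v1 ls a)"
      unfolding F1_def la(1) fst_conv snd_conv by (rule \<phi>m[OF Q.hom.hom_closed[OF sP] v_closed(1)[OF la(2)]])
    show ?thesis
    proof (cases "a \<in> T1 e")
      case True
      then have "Inl (ls, a) \<in> gidx e" using la unfolding gidx_def by (intro InlI) simp
      then have "?s 0 = \<zero>" using \<rho>0[of "Inl (ls, a)"] by (simp add: \<rho>_def)
      then have "\<iota> ?s \<in> Q.extend maxi" using sP by (intro \<iota>max) (simp add: maxi_iff)
      then show ?thesis unfolding eq by (rule mx.I_r_closed[OF _ \<phi>c[OF v_closed(1)[OF la(2)]]])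
    next
      case False
      show ?thesis unfolding eq
        by (rule mx.I_l_closed[OF functional_v1_in_maximal[OF \<phi> la(2,3) False] Q.hom.hom_closed[OF sP]])
    qed
  qed
  have 2: "\<phi> (F2 y) \<in> Q.extend maxi" if y: "y \<in> ?G" for y
  proof -
    obtain ls a where la: "y = (ls, a)" "ls \<in> idx e" "a \<in> box e" using y by auto
    let ?s = "coord ls e a (Q.tpart x)"
    have sP: "?s \<in> carrier P" by (rule coord_closed[OF la(2,3) parts(2)])
    have eq: "\<phi> (F2 y) = \<iota> ?s \<otimes>\<^bsub>A\<^esub> \<phi> (v2 ls a)"
      unfolding F2_def la(1) fst_conv snd_conv by (rule \<phi>m[OF Q.hom.hom_closed[OF sP] v_closed(2)[OF la(2)]])
    show ?thesis
    proof (cases "a \<in> T2 e")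
      case True
      then have "Inr (ls, a) \<in> gidx e" using la unfolding gidx_def by (intro InrI) simp
      then have "?s 0 = \<zero>" using \<rho>0[of "Inr (ls, a)"] by (simp add: \<rho>_def)
      then have "\<iota> ?s \<in> Q.extend maxi" using sP by (intro \<iota>max) (simp add: maxi_iff)
      then show ?thesis unfolding eq by (rule mx.I_r_closed[OF _ \<phi>c[OF v_closed(2)[OF la(2)]]])
    next
      case False
      show ?thesis unfolding eq
        by (rule mx.I_l_closed[OF functional_v2_in_maximal[OF \<phi> la(2,3) False] Q.hom.hom_closed[OF sP]])
    qed
  qed
  have "x = finsum A F1 ?G \<oplus>\<^bsub>A\<^esub> finsum A F2 ?G"
    unfolding F1_def F2_def by (rule A_decomposition[OF x])
  then have "\<phi> x = \<phi> (finsum A F1 ?G \<oplus>\<^bsub>A\<^esub> finsum A F2 ?G)" by simp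
  also have "\<dots> = \<phi> (finsum A F1 ?G) \<oplus>\<^bsub>A\<^esub> \<phi> (finsum A F2 ?G)"
    by (rule \<phi>a[OF Q.A.finsum_closed[OF F1c] Q.A.finsum_closed[OF F2c]])
  also have "\<phi> (finsum A F1 ?G) = (\<Oplus>\<^bsub>A\<^esub>y\<in>?G. \<phi> (F1 y))"
    using M.functional_finsum[OF \<phi> fin, of F1] F1c by simp
  also have "\<phi> (finsum A F2 ?G) = (\<Oplus>\<^bsub>A\<^esub>y\<in>?G. \<phi> (F2 y))"
    using M.functional_finsum[OF \<phi> fin, of F2] F2c by simp
  finally show ?thesis using sum_in[OF fin 1] sum_in[OF fin 2] mx.ideal_simps(1) by simp
qed

lemma \<rho>_closed: "\<gamma> \<in> gidx e \<Longrightarrow> x \<in> carrier A \<Longrightarrow> \<rho> e \<gamma> x \<in> carrier R"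
  using coord_closed by (auto simp: gidx_def \<rho>_def T1_def T2_def)

lemma \<rho>_add:
  assumes "\<gamma> \<in> gidx e" "x \<in> carrier A" "y \<in> carrier A"
  shows "\<rho> e \<gamma> (x \<oplus>\<^bsub>A\<^esub> y) = \<rho> e \<gamma> x \<oplus> \<rho> e \<gamma> y"
  using assms by (auto simp: gidx_def \<rho>_def T1_def T2_def Q.part_add coord_add)

lemma \<rho>_mult:
  assumes "\<gamma> \<in> gidx e" "x \<in> carrier A" "c \<in> carrier R"
  shows "\<rho> e \<gamma> (\<iota> (mon 0 c) [^]\<^bsub>A\<^esub> (p ^ e) \<otimes>\<^bsub>A\<^esub> x) = c \<otimes> \<rho> e \<gamma> x"
  using assms
  by (auto simp: gidx_def \<rho>_def T1_def T2_def coord_iota_mult coeff_mon_mult coord_closed)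

lemma \<rho>_finsum:
  assumes "\<gamma> \<in> gidx e" "finite T" "F \<in> T \<rightarrow> carrier A"
  shows "\<rho> e \<gamma> (finsum A F T) = (\<Oplus>i\<in>T. \<rho> e \<gamma> (F i))"
  using assms(2,3)
proof (induction T rule: finite_induct)
  case empty
  have "\<rho> e \<gamma> \<zero>\<^bsub>A\<^esub> = \<zero>"
    using assms(1) by (auto simp: gidx_def \<rho>_def T1_def T2_def Q.zero_el coord_zero)
  then show ?case by simp
next
  case (insert x T)
  then have "F x \<in> carrier A" "F \<in> T \<rightarrow> carrier A" by auto
  moreover from this have "(\<lambda>i. \<rho> e \<gamma> (F i)) \<in> T \<rightarrow> carrier R" using \<rho>_closed[OF assms(1)] by auto
  ultimately show ?case using insert \<rho>_closed[OF assms(1)] by (simp add: \<rho>_add[OF assms(1)])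
qed

text \<open>With more dual pairs than indices, some nontrivial combination has all residues zero.
  Every functional sends it into the maximal ideal, but the dual functional at a nonzero coefficient
  returns that coefficient, a unit.\<close>

lemma free_summand_bound:
  assumes "has_free_summand A (frobenius_pushforward p e A) r"
  shows "r \<le> card (gidx e)"
proof (rule ccontr)
  assume "\<not> r \<le> card (gidx e)"
  then have r: "card (gidx e) < card {..<r}" by simp
  obtain v \<phi> where v: "\<And>i. i < r \<Longrightarrow> v i \<in> carrier (frobenius_pushforward p e A)"
    and \<phi>: "\<And>i. i < r \<Longrightarrow> module_functional A (frobenius_pushforward p e A) (\<phi> i)"
    and dual: "\<And>i j. i < r \<Longrightarrow> j < r \<Longrightarrow> \<phi> i (v j) = (if j = i then \<one>\<^bsub>A\<^esub> else \<zero>\<^bsub>A\<^esub>)"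
    using M.has_free_summandE[OF assms] by blast
  have vA: "v i \<in> carrier A" if "i < r" for i using v[OF that] by simp
  have "\<exists>c. (\<forall>i\<in>{..<r}. c i \<in> carrier R) \<and> (\<exists>i\<in>{..<r}. c i \<noteq> \<zero>) \<and>
     (\<forall>\<gamma>\<in>gidx e. (\<Oplus>i\<in>{..<r}. c i \<otimes> \<rho> e \<gamma> (v i)) = \<zero>)"
    by (rule homogeneous_system[OF finite_gidx _ r]) (use \<rho>_closed vA in auto)
  then obtain c where c: "\<And>i. i < r \<Longrightarrow> c i \<in> carrier R" and ne: "\<exists>i\<in>{..<r}. c i \<noteq> \<zero>"
    and sol: "\<And>\<gamma>. \<gamma> \<in> gidx e \<Longrightarrow> (\<Oplus>i\<in>{..<r}. c i \<otimes> \<rho> e \<gamma> (v i)) = \<zero>" by auto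
  obtain j where j: "j < r" "c j \<noteq> \<zero>" using ne by auto
  define k where "k i = \<iota> (mon 0 (c i))" for i
  have k: "k i \<in> carrier A" if "i < r" for i using c[OF that] by (simp add: k_def)
  \<comment> \<open>Scalars act on the pushforward through their q-th powers, and
    \<open>\<rho>_mult\<close> gives back the plain coefficient \<open>c i\<close>; so the system
    solved above is linear over the field.\<close>
  define x where "x = (\<Oplus>\<^bsub>A\<^esub>i\<in>{..<r}. k i [^]\<^bsub>A\<^esub> (p ^ e) \<otimes>\<^bsub>A\<^esub> v i)"
  have terms: "(\<lambda>i. k i [^]\<^bsub>A\<^esub> (p ^ e) \<otimes>\<^bsub>A\<^esub> v i) \<in> {..<r} \<rightarrow> carrier A" using k vA by auto
  have x: "x \<in> carrier A" unfolding x_def using terms by (rule Q.A.finsum_closed)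
  have "\<phi> j x \<in> Q.extend maxi"
  proof (rule functional_in_maximal[OF \<phi>[OF j(1)] x])
    fix \<gamma> assume \<gamma>: "\<gamma> \<in> gidx e"
    have "\<rho> e \<gamma> x = (\<Oplus>i\<in>{..<r}. \<rho> e \<gamma> (k i [^]\<^bsub>A\<^esub> (p ^ e) \<otimes>\<^bsub>A\<^esub> v i))"
      unfolding x_def by (rule \<rho>_finsum[OF \<gamma> _ terms]) simp
    also have "\<dots> = (\<Oplus>i\<in>{..<r}. c i \<otimes> \<rho> e \<gamma> (v i))"
      by (rule finsum_cong') (use \<rho>_mult[OF \<gamma>] \<rho>_closed[OF \<gamma>] vA c in \<open>auto simp: k_def\<close>)
    finally show "\<rho> e \<gamma> x = \<zero>" using sol[OF \<gamma>] by simp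
  qed
  moreover have "\<phi> j x = k j"
    using M.functional_combination[OF \<phi>[OF j(1)], of "{..<r}" v k j] v k j dual by (auto simp: x_def)
  ultimately have "Q.el (mon 0 (c j)) \<zero>\<^bsub>P\<^esub> \<in> Q.extend maxi" using c[OF j(1)] by (simp add: k_def Q.iota_el)
  then have "mon 0 (c j) \<in> maxi"
    using Q.el_in_extend[of maxi "mon 0 (c j)" "\<zero>\<^bsub>P\<^esub>"] maxi_iff c[OF j(1)] by auto
  then show False using j by (simp add: maxi_iff coeff_mon)
qed

theorem max_free_rank_eq:
  "max_free_rank A (frobenius_pushforward p e A)
     = N ^ e * ((\<Prod>i\<in>I. p ^ e - half e * d i) + (\<Prod>i\<in>I. p ^ e - (half e + 1) * d i))"
  unfolding max_free_rank_def card_gidx[symmetric]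
  by (rule Greatest_equality) (auto intro: free_summand_exists free_summand_bound)

text \<open>The generators of \<open>A_decomposition\<close> for \<open>e = 1\<close> are finitely
  many and lie over the box of side \<open>p\<close>.\<close>

lemma A_F_finite: "F_finite p A"
  unfolding F_finite_def finitely_generated_module_def
proof (intro exI conjI allI impI)
  let ?M = "frobenius_pushforward p 1 A"
  let ?G = "idx 1 \<times> box 1"
  have finG: "finite ?G" using finite_idx finite_box by simp
  let ?B = "(\<lambda>y. v1 (fst y) (snd y)) ` ?G \<union> (\<lambda>y. v2 (fst y) (snd y)) ` ?G"
  show "finite ?B" using finG by simp
  show "?B \<subseteq> carrier ?M" using v_closed by auto
  fix H assume "submodule H A ?M \<and> ?B \<subseteq> H"
  then have H: "submodule H A ?M" and BH: "?B \<subseteq> H" by auto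
  note HE = M.submoduleE[OF H]
  have HA: "H \<subseteq> carrier A" using HE(1) by simp
  have add: "x \<oplus>\<^bsub>A\<^esub> y \<in> H" if "x \<in> H" "y \<in> H" for x y using HE(5)[OF that] by simp
  have smult: "a [^]\<^bsub>A\<^esub> (p ^ 1) \<otimes>\<^bsub>A\<^esub> x \<in> H" if "a \<in> carrier A" "x \<in> H" for a x
    using HE(4)[OF that] by simp
  have zero: "\<zero>\<^bsub>A\<^esub> \<in> H"
    using subgroup.one_closed[OF submodule.axioms(1)[OF H]] by simp
  have sum: "finsum A F T \<in> H" if "finite T" "\<And>y. y \<in> T \<Longrightarrow> F y \<in> H" for F and T :: "(nat list \<times> ('v \<Rightarrow> nat)) set"
    using that
  proof (induction T rule: finite_induct)
    case (insert y T)
    then have "F y \<in> carrier A" "F \<in> T \<rightarrow> carrier A" using HA by blast+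
    moreover have "F y \<in> H" "finsum A F T \<in> H" using insert by blast+
    ultimately show ?case using insert.hyps add by simp
  qed (simp add: zero)
  have "carrier A \<subseteq> H"
  proof
    fix x assume x: "x \<in> carrier A"
    have parts: "Q.spart x \<in> carrier P" "Q.tpart x \<in> carrier P" using x by auto
    have 1: "(\<Oplus>\<^bsub>A\<^esub>y\<in>?G. \<iota> (coord (fst y) 1 (snd y) (Q.spart x)) [^]\<^bsub>A\<^esub> (p ^ 1) \<otimes>\<^bsub>A\<^esub> v1 (fst y) (snd y)) \<in> H"
    proof (rule sum[OF finG], rule smult)
      fix y assume y: "y \<in> ?G"
      then show "\<iota> (coord (fst y) 1 (snd y) (Q.spart x)) \<in> carrier A" using coord_closed parts by auto
      show "v1 (fst y) (snd y) \<in> H" using y BH by blast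
    qed
    have 2: "(\<Oplus>\<^bsub>A\<^esub>y\<in>?G. \<iota> (coord (fst y) 1 (snd y) (Q.tpart x)) [^]\<^bsub>A\<^esub> (p ^ 1) \<otimes>\<^bsub>A\<^esub> v2 (fst y) (snd y)) \<in> H"
    proof (rule sum[OF finG], rule smult)
      fix y assume y: "y \<in> ?G"
      then show "\<iota> (coord (fst y) 1 (snd y) (Q.tpart x)) \<in> carrier A" using coord_closed parts by auto
      show "v2 (fst y) (snd y) \<in> H" using y BH by blast
    qed
    show "x \<in> H" by (subst A_decomposition[OF x, of 1], rule add[OF 1 2])
  qed
  then show "H = carrier ?M" using HA by auto
qed

end

section \<open>Dimension, residue field and signature\<close>

context hypersurface
begin

lemma maximalideal_iff: "maximalideal J A \<longleftrightarrow> J = Q.extend maxi"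
  by (rule Q.A_local[OF maxi_prime f_in_maxi]) (auto simp: unit_iff maxi_iff)

lemma A_local_ring: "F_finite_local_ring p A"
proof (intro F_finite_local_ring.intro F_finite_local_ring_axioms.intro)
  show "noetherian_ring A" by (rule Q.A_noetherian[OF P_noetherian])
  show "\<exists>!\<mm>. maximalideal \<mm> A" by (simp add: maximalideal_iff)
qed (fact Q.A.is_cring p_prime A.char_p A_F_finite)+

lemma prime_chain_le:
  assumes "\<And>i. i \<le> l \<Longrightarrow> primeideal (\<P> i) A" "\<And>i. i < l \<Longrightarrow> \<P> i \<subset> \<P> (Suc i)"
  shows "l \<le> card I"
proof (rule prime_chain_length_le[where Q = "\<lambda>i. Q.contr (\<P> i)"])
  show "primeideal (Q.contr (\<P> i)) P" if "i \<le> l" for i by (rule Q.contr_prime[OF assms(1)[OF that]])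
  show "Q.contr (\<P> i) \<subset> Q.contr (\<P> (Suc i))" if "i < l" for i
    by (rule Q.contr_strict) (use assms that in auto)
qed

section \<open>The Krull dimension of \<open>A\<close>\<close>

lemma var_ideal_mono: "Z \<subseteq> Z' \<Longrightarrow> var_ideal Z \<subseteq> var_ideal Z'"
  by (auto simp: var_ideal_def)

lemma var_in_var_ideal:
  "i \<in> I \<Longrightarrow> mon (\<lambda>j. if j = i then 1 else 0) \<one> \<in> var_ideal Z \<longleftrightarrow> i \<in> Z"
proof
  let ?u = "\<lambda>j. if j = i then 1 else (0 :: nat)"
  assume i: "i \<in> I" and x: "mon ?u \<one> \<in> var_ideal Z"
  have "mon ?u \<one> ?u \<noteq> \<zero>" using unit_vector_E[OF i] by (simp add: coeff_mon)
  moreover have "\<forall>m\<in>E. (\<forall>j\<in>Z. m j = 0) \<longrightarrow> mon ?u \<one> m = \<zero>" using x by (simp add: var_ideal_def)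
  then have "(\<forall>j\<in>Z. ?u j = 0) \<longrightarrow> mon ?u \<one> ?u = \<zero>" by (rule bspec[OF _ unit_vector_E[OF i]])
  ultimately have "\<not> (\<forall>j\<in>Z. ?u j = 0)" by blast
  then show "i \<in> Z" by (auto split: if_splits)
qed (auto simp: var_ideal_def coeff_mon)

lemma f_in_var_ideal: "i \<in> I \<Longrightarrow> i \<in> Z \<Longrightarrow> f \<in> var_ideal Z"
  using Q.f_closed d_pos[of i] by (auto simp: f_eq var_ideal_def coeff_mon)

text \<open>The variable ideals of growing sets \<open>Z i\<close> extend to primes of
  \<open>A\<close> once they contain \<open>f\<close>, that is from \<open>i = 1\<close> on. A prime
  with zero contraction is put at the bottom, so no step of the chain is lost.\<close>

lemma prime_chain_exists:
  "\<exists>\<P>. (\<forall>i\<le>card I. primeideal (\<P> i) A) \<and> (\<forall>i<card I. \<P> i \<subset> \<P> (Suc i))"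
proof -
  let ?n = "card I"
  obtain g where g: "bij_betw g {0..<?n} I" using ex_bij_betw_nat_finite[OF finI] by blast
  have gI: "g i \<in> I" if "i < ?n" for i using g that by (auto simp: bij_betw_def)
  define Z where "Z i = g ` {0..<i}" for i
  have gZ: "g i \<notin> Z i" if "i < ?n" for i
  proof
    assume "g i \<in> Z i"
    then obtain x where x: "x < i" "g i = g x" by (auto simp: Z_def)
    then have "i = x" using g that by (auto simp: bij_betw_def dest: inj_onD)
    then show False using x by simp
  qed
  obtain p0 where p0: "primeideal p0 A" "Q.contr p0 = {\<zero>\<^bsub>P\<^esub>}"
    using Q.exists_prime_contr_zero[OF P_domain Q.A_noetherian[OF P_noetherian]] by blast
  define \<P> where "\<P> i = (if i = 0 then p0 else Q.extend (var_ideal (Z i)))" for i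
  have fZ: "f \<in> var_ideal (Z i)" if "0 < i" "i \<le> ?n" for i
    using that gI[of 0] by (intro f_in_var_ideal[of "g 0"]) (auto simp: Z_def)
  have sub: "var_ideal Z' \<subseteq> carrier P" for Z' by (auto simp: var_ideal_def)
  have prime: "primeideal (\<P> i) A" if "i \<le> ?n" for i
    using p0(1) that fZ[of i] Q.extend_prime[OF var_ideal_prime] by (auto simp: \<P>_def)
  have "\<P> i \<subset> \<P> (Suc i)" if i: "i < ?n" for i
  proof -
    let ?x = "mon (\<lambda>j. if j = g i then 1 else 0) \<one>"
    have x: "?x \<in> var_ideal (Z (Suc i))" "?x \<notin> var_ideal (Z i)"
      using var_in_var_ideal[OF gI[OF i]] gZ[OF i] by (auto simp: Z_def)
    have xP: "?x \<in> carrier P" by simp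
    have \<iota>x: "\<iota> ?x \<in> \<P> (Suc i)" using x(1) xP sub by (simp add: \<P>_def Q.iota_el Q.el_in_extend)
    show ?thesis
    proof (cases "i = 0")
      case True
      have "p0 \<subseteq> Q.extend (var_ideal (Z (Suc i)))"
        using Q.contr_zero_subset_extend[OF primeideal.axioms(1)[OF p0(1)] p0(2) var_ideal_prime fZ[of "Suc i"]] i
        by simp
      moreover have "\<iota> ?x \<notin> p0"
      proof
        assume "\<iota> ?x \<in> p0"
        then have "?x \<in> Q.contr p0" using xP by (simp add: Q.contr_def)
        then have "?x = \<zero>\<^bsub>P\<^esub>" using p0(2) by simp
        then have "?x \<in> var_ideal (Z i)" by (simp add: var_ideal_def)
        then show False using x(2) by simp
      qed
      ultimately show ?thesis using \<iota>x True by (auto simp: \<P>_def)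
    next
      case False
      have "var_ideal (Z i) \<subseteq> var_ideal (Z (Suc i))" by (rule var_ideal_mono) (auto simp: Z_def)
      then have "\<P> i \<subseteq> \<P> (Suc i)" using False by (auto simp: \<P>_def Q.extend_def)
      moreover have "\<iota> ?x \<notin> \<P> i" using False x(2) xP sub by (simp add: \<P>_def Q.iota_el Q.el_in_extend)
      ultimately show ?thesis using \<iota>x by auto
    qed
  qed
  then show ?thesis using prime by blast
qed

lemma krull_dim_A: "krull_dim A = enat (card I)"
  unfolding krull_dim_def
proof (rule antisym)
  let ?L = "{enat l |l. \<exists>\<P>. (\<forall>i\<le>l. primeideal (\<P> i) A) \<and> (\<forall>i<l. \<P> i \<subset> \<P> (Suc i))}"
  show "Sup ?L \<le> enat (card I)"
  proof (rule Sup_least)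
    fix x assume "x \<in> ?L"
    then obtain l \<P> where x: "x = enat l"
      and \<P>: "\<forall>i\<le>l. primeideal (\<P> i) A" "\<forall>i<l. \<P> i \<subset> \<P> (Suc i)" by blast
    have "l \<le> card I" by (rule prime_chain_le[of l \<P>]) (use \<P> in auto)
    then show "x \<le> enat (card I)" by (simp add: x)
  qed
  show "enat (card I) \<le> Sup ?L"
    by (rule Sup_upper) (use prime_chain_exists in blast)
qed

text \<open>The constants map isomorphically onto the residue field. This isomorphism carries p-th
  powers onto p-th powers, so the dimension is transported.\<close>

lemma F_alpha_A:
  assumes dim: "dimension N (pth_powers p R) (carrier R)"
  shows "F_alpha p A = log (real p) (real N)"
proof -
  let ?M = "Q.extend maxi"
  interpret M: ideal ?M A by (rule maximal_ideal)
  have "maximalideal ?M A" by (simp add: maximalideal_iff)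
  define k where "k = A Quot ?M"
  have res: "residue_field A = k" unfolding residue_field_def maximalideal_iff k_def by simp
  define h where "h c = ?M +>\<^bsub>A\<^esub> \<iota> (mon 0 c)" for c
  have "\<iota> \<circ> mon 0 \<in> ring_hom R A" by (rule ring_hom_trans[OF mon_0_ring_hom Q.hom])
  moreover have "(\<lambda>x. ?M +>\<^bsub>A\<^esub> x) \<in> ring_hom A k" unfolding k_def by (rule M.rcos_ring_hom)
  ultimately have "(\<lambda>x. ?M +>\<^bsub>A\<^esub> x) \<circ> (\<iota> \<circ> mon 0) \<in> ring_hom R k" by (rule ring_hom_trans)
  moreover have "(\<lambda>x. ?M +>\<^bsub>A\<^esub> x) \<circ> (\<iota> \<circ> mon 0) = h" by (auto simp: h_def)
  ultimately have hom: "h \<in> ring_hom R k" by simp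
  have ringk: "ring k" unfolding k_def by (rule M.quotient_is_ring)
  interpret h: ring_hom_ring R k h by (intro ring_hom_ringI2 ring_axioms ringk hom)
  have \<iota>c: "\<iota> (mon 0 c) \<in> carrier A" if "c \<in> carrier R" for c using that by simp
  have ker: "c = \<zero>" if c: "c \<in> carrier R" "h c = \<zero>\<^bsub>k\<^esub>" for c
  proof -
    have "?M +>\<^bsub>A\<^esub> \<iota> (mon 0 c) = ?M" using c(2) by (simp add: h_def k_def FactRing_def)
    then have "\<iota> (mon 0 c) \<in> ?M" by (rule M.rcos_const_imp_mem[OF \<iota>c[OF c(1)]])
    then have "mon 0 c \<in> maxi"
      using Q.el_in_extend[of maxi "mon 0 c" "\<zero>\<^bsub>P\<^esub>"] maxi_iff c(1) by (auto simp: Q.iota_el)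
    then show ?thesis by (simp add: maxi_iff coeff_mon)
  qed
  have inj: "inj_on h (carrier R)"
  proof (rule h.trivial_ker_imp_inj)
    show "a_kernel R k h = {\<zero>}"
    proof
      show "a_kernel R k h \<subseteq> {\<zero>}"
      proof
        fix c assume "c \<in> a_kernel R k h"
        then have "c \<in> carrier R" "h c = \<zero>\<^bsub>k\<^esub>" unfolding a_kernel_def' by blast+
        then have "c = \<zero>" by (rule ker)
        then show "c \<in> {\<zero>}" by (simp only: singleton_iff)
      qed
      show "{\<zero>} \<subseteq> a_kernel R k h" unfolding a_kernel_def' using zero_closed h.hom_zero by blast
    qed
  qed
  have surj: "h ` carrier R = carrier k"
  proof
    show "h ` carrier R \<subseteq> carrier k" by auto
    show "carrier k \<subseteq> h ` carrier R"
    proof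
      fix y assume "y \<in> carrier k"
      then obtain a where a: "a \<in> carrier A" "y = ?M +>\<^bsub>A\<^esub> a"
        by (auto simp: k_def FactRing_def A_RCOSETS_def')
      obtain s t where st: "s \<in> carrier P" "t \<in> carrier P" "a = Q.el s t" using Q.el_cases[OF a(1)] by blast
      \<comment> \<open>The constant term of the base part represents \<open>a\<close> modulo the
        maximal ideal, since the variables and \<open>z\<close> all lie in it.\<close>
      have s0: "s 0 \<in> carrier R" using st by simp
      have "a \<ominus>\<^bsub>A\<^esub> \<iota> (mon 0 (s 0)) = Q.el (s \<ominus>\<^bsub>P\<^esub> mon 0 (s 0)) (t \<ominus>\<^bsub>P\<^esub> \<zero>\<^bsub>P\<^esub>)"
        using st s0 by (simp add: Q.iota_el Q.el_minus)
      moreover have "s \<ominus>\<^bsub>P\<^esub> mon 0 (s 0) \<in> maxi"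
        using st s0 by (simp add: maxi_iff coeff_mon a_minus_def r_neg)
      moreover from this have "Q.el (s \<ominus>\<^bsub>P\<^esub> mon 0 (s 0)) (t \<ominus>\<^bsub>P\<^esub> \<zero>\<^bsub>P\<^esub>) \<in> ?M"
        using P.minus_closed[OF st(2) P.zero_closed] unfolding Q.extend_def by blast
      ultimately have "a \<ominus>\<^bsub>A\<^esub> \<iota> (mon 0 (s 0)) \<in> ?M" by simp
      then have "?M +>\<^bsub>A\<^esub> a = ?M +>\<^bsub>A\<^esub> \<iota> (mon 0 (s 0))"
        using Q.A.quotient_eq_iff_same_a_r_cos[OF maximal_ideal a(1) \<iota>c[OF s0]] by simp
      then show "y \<in> h ` carrier R" using s0 a by (auto simp: h_def)
    qed
  qed
  have pow: "h (x [^] n) = h x [^]\<^bsub>k\<^esub> n" if "x \<in> carrier R" for x and n :: nat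
    using that by (induction n) auto
  have pp: "pth_powers p k = h ` pth_powers p R"
    unfolding pth_powers_def surj[symmetric] image_image using pow by (auto simp: image_iff)
  have sub: "subfield (pth_powers p R) R" by (rule pth_powers_subfield) unfold_locales
  have ne: "\<one>\<^bsub>k\<^esub> \<noteq> \<zero>\<^bsub>k\<^esub>" using ker[OF one_closed] one_not_zero by auto
  have subk: "subfield (pth_powers p k) k" unfolding pp by (rule h.img_is_subfield(2)[OF sub ne])
  have "ring.dimension k N (pth_powers p k) (carrier k)"
    unfolding pp surj[symmetric] by (rule h.inj_hom_dimension[OF sub ne inj dim])
  then have "ring.dim k (pth_powers p k) (carrier k) = N"
    using ring.dimI[OF ringk subk] by (simp add: over_def)
  then show ?thesis unfolding F_alpha_def res by (simp add: Let_def)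
qed

text \<open>The power of p with exponent e log_p N is N^e and cancels the same factor of the rank;
  the remaining power of q is distributed over the factors of each product.\<close>

lemma signature_ratio:
  assumes dim: "dimension N (pth_powers p R) (carrier R)"
  shows "real (max_free_rank A (frobenius_pushforward p e A))
       / real p powr (real e * (real (card I) + F_alpha p A))
     = (\<Prod>i\<in>I. real (p ^ e - half e * d i) / real (p ^ e)) + (\<Prod>i\<in>I. real (p ^ e - (half e + 1) * d i) / real (p ^ e))"
proof -
  have N: "real N > 0" using N_pos by simp
  have p: "real p > 1" using p_gt_2 by simp
  have "real p powr (real e * (real (card I) + F_alpha p A))
      = real p powr (real (e * card I)) * (real p powr (log (real p) (real N))) powr (real e)"
    by (simp add: F_alpha_A[OF dim] distrib_left powr_add powr_powr mult.commute)
  also have "real p powr (real (e * card I)) = (real (p ^ e)) ^ card I"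
    using powr_realpow[of "real p" "e * card I"] p by (simp add: power_mult)
  also have "(real p powr (log (real p) (real N))) powr (real e) = real N ^ e"
    using N p by (simp add: powr_realpow)
  finally have den: "real p powr (real e * (real (card I) + F_alpha p A)) = (real (p ^ e)) ^ card I * real N ^ e" .
  have cancel: "c * (x + y) / (u * c) = x / u + y / u" if "c \<noteq> 0" for c x y u :: real
    using that by (simp add: add_divide_distrib)
  have "real N ^ e \<noteq> 0" using N by simp
  then show ?thesis
    unfolding max_free_rank_eq den of_nat_mult of_nat_add of_nat_prod prod_dividef prod_constant
      of_nat_power[of N e] by (rule cancel)
qed

text \<open>The truncated differences are h + 1 and h, so each factor differs from 1/2 by 1/(2q),
  and each of the two products tends to 2^(-n).\<close>

theorem signature_one:
  assumes dim: "dimension N (pth_powers p R) (carrier R)" and d1: "\<And>i. i \<in> I \<Longrightarrow> d i = 1"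
  shows "has_F_signature p A (1 / 2 ^ (card I - 1))"
proof -
  let ?q = "\<lambda>e. real (p ^ e)"
  let ?n = "card I"
  have q0: "?q e > 0" for e using pe_pos[of e] by (simp del: of_nat_power)
  have h: "real (half e) = (?q e - 1) / 2" for e using half[of e] by (simp del: of_nat_power)
  have lim: "(\<lambda>e. 1 / ?q e) \<longlonglongrightarrow> 0"
  proof -
    have "(\<lambda>e. (1 / real p) ^ e) \<longlonglongrightarrow> 0" using p_gt_2 by (intro LIMSEQ_power_zero) simp
    then show ?thesis by (simp add: power_one_over)
  qed
  have half_up: "(x + 1) / 2 / x = 1 / 2 + (1 / x) / 2" and half_down: "(x - 1) / 2 / x = 1 / 2 - (1 / x) / 2"
    if "x > 0" for x :: real using that by (simp_all add: field_simps)
  have "real (p ^ e - half e * 1) / ?q e = 1 / 2 + (1 / ?q e) / 2" for e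
  proof -
    have "p ^ e - half e * 1 = half e + 1" using half[of e] by simp
    then have "real (p ^ e - half e * 1) = (?q e + 1) / 2" using h[of e] by (simp add: field_simps del: of_nat_power)
    then show ?thesis by (simp only: half_up[OF q0])
  qed
  moreover have "real (p ^ e - (half e + 1) * 1) / ?q e = 1 / 2 - (1 / ?q e) / 2" for e
  proof -
    have "p ^ e - (half e + 1) * 1 = half e" using half[of e] by simp
    then have "real (p ^ e - (half e + 1) * 1) = (?q e - 1) / 2" using h[of e] by (simp only:)
    then show ?thesis by (simp only: half_down[OF q0])
  qed
  ultimately have ratio: "real (max_free_rank A (frobenius_pushforward p e A))
       / real p powr (real e * (real ?n + F_alpha p A))
     = (1 / 2 + (1 / ?q e) / 2) ^ ?n + (1 / 2 - (1 / ?q e) / 2) ^ ?n" for e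
    unfolding signature_ratio[OF dim] using d1 by simp
  have "(\<lambda>e. (1 / 2 + (1 / ?q e) / 2) ^ ?n + (1 / 2 - (1 / ?q e) / 2) ^ ?n)
      \<longlonglongrightarrow> (1 / 2 + 0 / 2) ^ ?n + (1 / 2 - 0 / 2) ^ ?n"
    by (intro tendsto_intros lim) auto
  moreover have "(1 / 2 + 0 / 2 :: real) ^ ?n + (1 / 2 - 0 / 2) ^ ?n = 1 / 2 ^ (?n - 1)"
  proof -
    obtain n where n: "?n = Suc n" using I_ne finI by (metis card_gt_0_iff gr0_conv_Suc)
    show ?thesis unfolding n by (simp add: power_one_over)
  qed
  ultimately have "(\<lambda>e. real (max_free_rank A (frobenius_pushforward p e A))
       / real p powr (real e * (real ?n + F_alpha p A))) \<longlonglongrightarrow> 1 / 2 ^ (?n - 1)"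
    unfolding ratio by simp
  then show ?thesis unfolding has_F_signature_def using A_local_ring krull_dim_A by blast
qed

text \<open>Since 2h = q - 1, an exponent of at least 2 leaves at most one admissible value for that
  variable. The other factors are at most 1, so both products are at most 1/q.\<close>

theorem signature_zero:
  assumes dim: "dimension N (pth_powers p R) (carrier R)" and d2: "i0 \<in> I" "d i0 \<ge> 2"
  shows "has_F_signature p A 0"
proof -
  let ?q = "\<lambda>e. real (p ^ e)"
  let ?n = "card I"
  have q0: "?q e > 0" for e using pe_pos[of e] by (simp del: of_nat_power)
  have lim: "(\<lambda>e. 2 / ?q e) \<longlonglongrightarrow> 0"
  proof -
    have "(\<lambda>e. 2 * (1 / real p) ^ e) \<longlonglongrightarrow> 2 * 0"
      using p_gt_2 by (intro tendsto_mult_left LIMSEQ_power_zero) simp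
    then show ?thesis by (simp add: power_one_over)
  qed
  have bound: "(\<Prod>i\<in>I. real (p ^ e - c * d i) / ?q e) \<le> 1 / ?q e" if c: "half e \<le> c" for e c
  proof -
    have f01: "0 \<le> real (p ^ e - c * d i) / ?q e" "real (p ^ e - c * d i) / ?q e \<le> 1" for i
    proof -
      show "0 \<le> real (p ^ e - c * d i) / ?q e" by simp
      have "real (p ^ e - c * d i) \<le> ?q e" unfolding of_nat_le_iff by simp
      then show "real (p ^ e - c * d i) / ?q e \<le> 1" using q0[of e] by (simp del: of_nat_power)
    qed
    have "half e * 2 \<le> c * d i0" using c d2 by (intro mult_le_mono) auto
    then have "p ^ e - c * d i0 \<le> 1" using half[of e] by linarith
    then have i0: "real (p ^ e - c * d i0) / ?q e \<le> 1 / ?q e"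
      using q0[of e] by (intro divide_right_mono) auto
    have "(\<Prod>i\<in>I. real (p ^ e - c * d i) / ?q e)
       = real (p ^ e - c * d i0) / ?q e * (\<Prod>i\<in>I - {i0}. real (p ^ e - c * d i) / ?q e)"
      by (rule prod.remove[OF finI d2(1)])
    also have "\<dots> \<le> 1 / ?q e * 1"
      using f01 i0 q0[of e]
      by (intro mult_mono prod_le_1 prod_nonneg) (auto simp del: of_nat_power)
    finally show ?thesis by simp
  qed
  let ?r = "\<lambda>e. real (max_free_rank A (frobenius_pushforward p e A))
       / real p powr (real e * (real ?n + F_alpha p A))"
  have "?r \<longlonglongrightarrow> 0"
  proof (rule tendsto_sandwich[OF _ _ tendsto_const lim])
    show "\<forall>\<^sub>F e in sequentially. 0 \<le> ?r e" by simp
    have "?r e \<le> 2 / ?q e" for e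
      unfolding signature_ratio[OF dim] using bound[of e "half e"] bound[of e "half e + 1"] by simp
    then show "\<forall>\<^sub>F e in sequentially. ?r e \<le> 2 / ?q e" by simp
  qed
  then show ?thesis unfolding has_F_signature_def using A_local_ring krull_dim_A by blast
qed

end

section \<open>The hypersurface as a quadratic extension\<close>

text \<open>
  The coefficients \<open>q\<^sub>k\<close> of the quotient in the division of \<open>G = \<Sum> G\<^sub>k z\<^sup>k\<close> by \<open>z\<^sup>2 + f\<close>, for a
  monomial \<open>f\<close> with exponent \<open>d\<close>: they satisfy \<open>q\<^sub>k = G\<^sub>k\<^sub>+\<^sub>2 - f q\<^sub>k\<^sub>+\<^sub>2\<close>, and this recursion
  terminates on each coefficient because multiplication by \<open>f\<close> shifts by \<open>d\<close>.
\<close>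

function quot_coeff :: "('a, 'b) ring_scheme \<Rightarrow> ('v \<Rightarrow> nat) \<Rightarrow> 'v \<Rightarrow> (nat \<Rightarrow> ('v \<Rightarrow> nat) \<Rightarrow> 'a)
    \<Rightarrow> nat \<Rightarrow> ('v \<Rightarrow> nat) \<Rightarrow> 'a" where
  "quot_coeff R d i G k m = G (k + 2) m \<ominus>\<^bsub>R\<^esub>
     (if d \<le> m \<and> 0 < d i then quot_coeff R d i G (k + 2) (m - d) else \<zero>\<^bsub>R\<^esub>)"
  by pat_completeness auto

termination
\<comment> \<open>The guard \<open>0 < d i\<close> in the equation makes the exponent at
  \<open>i\<close> drop strictly, for every choice of \<open>d\<close>.\<close>
proof (relation "measure (\<lambda>(R, d, i, G, k, m). m i)")
  fix R :: "('a, 'b) ring_scheme" and d m :: "'v \<Rightarrow> nat" and i :: 'v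
    and G :: "nat \<Rightarrow> ('v \<Rightarrow> nat) \<Rightarrow> 'a" and k :: nat
  assume "d \<le> m \<and> 0 < d i"
  then have "d i \<le> m i" "0 < d i" by (auto simp: le_fun_def)
  then show "((R, d, i, G, k + 2, m - d), (R, d, i, G, k, m)) \<in> measure (\<lambda>(R, d, i, G, k, m). m i)"
    by (simp add: fun_diff_def)
qed simp

declare quot_coeff.simps [simp del]

context power_series
begin

lemma quot_coeff_closed:
  assumes "\<And>k m. m \<in> E \<Longrightarrow> G k m \<in> carrier R"
  shows "m \<in> E \<Longrightarrow> quot_coeff R d i G k m \<in> carrier R"
proof (induction "m i" arbitrary: k m rule: less_induct)
  case less
  have "quot_coeff R d i G (k + 2) (m - d) \<in> carrier R" if "d \<le> m" "0 < d i"
  proof (rule less.hyps)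
    have "d i \<le> m i" using that by (simp add: le_fun_def)
    then show "(m - d) i < m i" using that by (simp add: fun_diff_def)
    show "m - d \<in> E" using less.prems by (rule diff_in_exponents)
  qed
  then show ?case
    by (subst quot_coeff.simps) (use assms less.prems in auto)
qed

text \<open>The exponent of z^k: the outer series ring has a single variable, with index 0.\<close>

definition zexp :: "nat \<Rightarrow> nat \<Rightarrow> nat" where "zexp k = (\<lambda>i. if i = 0 then k else 0)"

lemma zexp_simps [simp]: "zexp 0 = 0" "zexp k 0 = k" "zexp k \<in> exponents {0}" "zexp j = zexp k \<longleftrightarrow> j = k"
  by (auto simp: zexp_def fun_eq_iff exponents_def)

lemma zexp_eq_0_iff [simp]: "zexp k = 0 \<longleftrightarrow> k = 0"
  using zexp_simps(4)[of k 0] by (simp del: zexp_simps(4))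

lemma exponents_zexp: "m \<in> exponents {0} \<Longrightarrow> m = zexp (m 0)"
  by (auto simp: zexp_def fun_eq_iff exponents_def)

lemma zexp_le [simp]: "zexp j \<le> zexp k \<longleftrightarrow> j \<le> k"
  by (auto simp: zexp_def le_fun_def)

lemma zexp_diff [simp]: "zexp k - zexp j = zexp (k - j)"
  by (auto simp: zexp_def fun_eq_iff fun_diff_def)

text \<open>Freeness on 1 and \<open>z\<close> is division with remainder by z^2 + f. Each use of f
  lowers the exponent at \<open>i\<close>, so every coefficient of the quotient comes from a finite
  recursion; the same descent forces q = 0 in a relation s + t z = (z^2 + f) q.\<close>

theorem hypersurface_quadratic_extension:
  fixes d i
  assumes d: "d \<in> E" "i \<in> I" "d i > 0"
  defines "Sz \<equiv> power_series_ring P {0 :: nat}"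
  defines "J \<equiv> PIdl\<^bsub>Sz\<^esub> (ps_const P {0} (mon d \<one>) \<oplus>\<^bsub>Sz\<^esub> ps_var P {0} 0 [^]\<^bsub>Sz\<^esub> (2 :: nat))"
  shows "quadratic_extension P (Sz Quot J) (\<lambda>s. J +>\<^bsub>Sz\<^esub> ps_const P {0} s) (J +>\<^bsub>Sz\<^esub> ps_var P {0} 0) (mon d \<one>)"
proof -
  interpret Z: power_series P "{0 :: nat}"
    by (intro power_series.intro power_series_axioms.intro P_is_cring) simp
  have SzP: "Sz = power_series_ring P {0}" by (simp add: Sz_def)
  interpret Sz: cring Sz unfolding SzP by (rule Z.P_is_cring)
  let ?f = "mon d \<one>"
  have f: "?f \<in> carrier P" by simp
  have const: "ps_const P {0} = Z.mon 0" by (rule ext) (rule Z.ps_const_eq_mon)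
  have var: "ps_var P {0} 0 = Z.mon (zexp 1) \<one>\<^bsub>P\<^esub>"
    unfolding Z.ps_var_eq_mon zexp_def ..
  have monc: "Z.mon a s \<in> carrier Sz" if "s \<in> carrier P" for a s using that by (simp add: SzP)
  define g where "g = Z.mon 0 ?f \<oplus>\<^bsub>Sz\<^esub> Z.mon (zexp 2) \<one>\<^bsub>P\<^esub>"
  have gc: "g \<in> carrier Sz" unfolding g_def using f by (intro Sz.a_closed monc) auto
  have var2: "Z.mon (zexp 1) \<one>\<^bsub>P\<^esub> \<otimes>\<^bsub>Sz\<^esub> Z.mon (zexp 1) \<one>\<^bsub>P\<^esub> = Z.mon (zexp 2) \<one>\<^bsub>P\<^esub>"
  proof -
    have "zexp 1 + zexp 1 = zexp 2" by (auto simp: zexp_def fun_eq_iff)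
    moreover have "Z.mon (zexp 1) \<one>\<^bsub>P\<^esub> \<otimes>\<^bsub>Sz\<^esub> Z.mon (zexp 1) \<one>\<^bsub>P\<^esub>
       = Z.mon (zexp 1 + zexp 1) (\<one>\<^bsub>P\<^esub> \<otimes>\<^bsub>P\<^esub> \<one>\<^bsub>P\<^esub>)"
      unfolding SzP by (intro Z.mon_mult_mon P.one_closed zexp_simps(3))
    ultimately show ?thesis by (simp only: P.r_one[OF P.one_closed])
  qed
  have J: "J = PIdl\<^bsub>Sz\<^esub> g"
    unfolding J_def const var g_def
    using var2 monc[of "\<one>\<^bsub>P\<^esub>" "zexp 1"] by (simp add: numeral_2_eq_2)
  interpret J: ideal J Sz unfolding J by (rule Sz.cgenideal_ideal[OF gc])
  have gJ: "g \<in> J" unfolding J by (rule Sz.cgenideal_self[OF gc])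
  let ?A = "Sz Quot J"
  interpret A: cring ?A by (rule J.quotient_is_cring[OF Sz.is_cring])
  interpret pi: ring_hom_ring Sz ?A "(+>\<^bsub>Sz\<^esub>) J" by (rule J.rcos_ring_hom_ring)
  let ?\<iota> = "\<lambda>s. J +>\<^bsub>Sz\<^esub> Z.mon 0 s" and ?z = "J +>\<^bsub>Sz\<^esub> Z.mon (zexp 1) \<one>\<^bsub>P\<^esub>"
  have zero: "\<zero>\<^bsub>?A\<^esub> = J" unfolding FactRing_def by (rule ring.select_convs(1))
  have el: "?\<iota> s \<oplus>\<^bsub>?A\<^esub> ?\<iota> t \<otimes>\<^bsub>?A\<^esub> ?z = J +>\<^bsub>Sz\<^esub> (Z.mon 0 s \<oplus>\<^bsub>Sz\<^esub> Z.mon (zexp 1) t)"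
    if "s \<in> carrier P" "t \<in> carrier P" for s t
  proof -
    have "Z.mon 0 t \<otimes>\<^bsub>Sz\<^esub> Z.mon (zexp 1) \<one>\<^bsub>P\<^esub> = Z.mon (zexp 1) t"
      unfolding SzP using Z.mon_mult_mon[OF that(2) P.one_closed zero_in_exponents zexp_simps(3)[of 1]] that
      by (simp only: add_0 P.r_one)
    moreover have "J +>\<^bsub>Sz\<^esub> (Z.mon 0 t \<otimes>\<^bsub>Sz\<^esub> Z.mon (zexp 1) \<one>\<^bsub>P\<^esub>) = ?\<iota> t \<otimes>\<^bsub>?A\<^esub> ?z"
      using that by (intro pi.hom_mult monc) auto
    moreover have "J +>\<^bsub>Sz\<^esub> (Z.mon 0 s \<oplus>\<^bsub>Sz\<^esub> Z.mon (zexp 1) t) = ?\<iota> s \<oplus>\<^bsub>?A\<^esub> (J +>\<^bsub>Sz\<^esub> Z.mon (zexp 1) t)"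
      using that by (intro pi.hom_add monc) auto
    ultimately show ?thesis by simp
  qed
  have elc: "Z.mon 0 s \<oplus>\<^bsub>Sz\<^esub> Z.mon (zexp 1) t \<in> carrier Sz" if "s \<in> carrier P" "t \<in> carrier P" for s t
    using that by (intro Sz.a_closed monc)
  have el_coeff: "(Z.mon 0 s \<oplus>\<^bsub>Sz\<^esub> Z.mon (zexp 1) t) (zexp k)
     = (if k = 0 then s else if k = 1 then t else \<zero>\<^bsub>P\<^esub>)" if "s \<in> carrier P" "t \<in> carrier P" for s t k
    using that by (simp add: SzP Z.coeff_mon)
  have g_coeff: "(g \<otimes>\<^bsub>Sz\<^esub> q) (zexp k) = ?f \<otimes>\<^bsub>P\<^esub> q (zexp k) \<oplus>\<^bsub>P\<^esub> (if 2 \<le> k then q (zexp (k - 2)) else \<zero>\<^bsub>P\<^esub>)"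
    if q: "q \<in> carrier Sz" for q k
  proof -
    have qZ: "q \<in> carrier (power_series_ring P {0})" using q by (simp add: SzP)
    have "g \<otimes>\<^bsub>Sz\<^esub> q = Z.mon 0 ?f \<otimes>\<^bsub>Sz\<^esub> q \<oplus>\<^bsub>Sz\<^esub> Z.mon (zexp 2) \<one>\<^bsub>P\<^esub> \<otimes>\<^bsub>Sz\<^esub> q"
      unfolding g_def using q f by (intro Sz.l_distr monc) auto
    then have "(g \<otimes>\<^bsub>Sz\<^esub> q) (zexp k) = (Z.mon 0 ?f \<otimes>\<^bsub>Sz\<^esub> q) (zexp k) \<oplus>\<^bsub>P\<^esub> (Z.mon (zexp 2) \<one>\<^bsub>P\<^esub> \<otimes>\<^bsub>Sz\<^esub> q) (zexp k)"
      by (simp add: SzP)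
    also have "(Z.mon 0 ?f \<otimes>\<^bsub>Sz\<^esub> q) (zexp k) = ?f \<otimes>\<^bsub>P\<^esub> q (zexp k)"
      unfolding SzP using f qZ by (simp add: Z.coeff_mon_mult)
    also have "(Z.mon (zexp 2) \<one>\<^bsub>P\<^esub> \<otimes>\<^bsub>Sz\<^esub> q) (zexp k) = (if 2 \<le> k then q (zexp (k - 2)) else \<zero>\<^bsub>P\<^esub>)"
      unfolding SzP using qZ by (simp add: Z.coeff_mon_mult)
    finally show ?thesis .
  qed
  have qc: "q (zexp k) \<in> carrier P" if "q \<in> carrier Sz" for q k
    using Z.coeff_closed[of q "zexp k"] that by (simp add: SzP)
  have eqI: "x = y" if "x \<in> carrier Sz" "y \<in> carrier Sz" "\<And>k. x (zexp k) = y (zexp k)" for x y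
  proof (rule Z.ps_eqI)
    fix m :: "nat \<Rightarrow> nat" assume "m \<in> exponents {0}"
    then have "m = zexp (m 0)" by (rule exponents_zexp)
    then show "x m = y m" using that(3)[of "m 0"] by simp
  qed (use that in \<open>auto simp: SzP\<close>)
  show ?thesis
    unfolding const var
  proof (intro quadratic_extension.intro quadratic_extension_axioms.intro P_is_cring A.is_cring f)
    show "?\<iota> \<in> ring_hom P ?A"
    proof -
      have "(\<lambda>x. J +>\<^bsub>Sz\<^esub> x) \<circ> Z.mon 0 \<in> ring_hom P ?A"
        using Z.mon_0_ring_hom J.rcos_ring_hom unfolding SzP by (rule ring_hom_trans)
      then show ?thesis by (simp add: comp_def)
    qed
    show "?z \<in> carrier ?A" by (rule pi.hom_closed[OF monc[OF P.one_closed]])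
    have zc: "?z \<otimes>\<^bsub>?A\<^esub> ?z \<in> carrier ?A" "?\<iota> ?f \<in> carrier ?A"
      using pi.hom_closed[OF monc[OF P.one_closed]] pi.hom_closed[OF monc[OF f]] by auto
    have "?z \<otimes>\<^bsub>?A\<^esub> ?z = J +>\<^bsub>Sz\<^esub> Z.mon (zexp 2) \<one>\<^bsub>P\<^esub>"
      unfolding var2[symmetric] by (rule pi.hom_mult[symmetric]) (auto intro: monc)
    then have "?\<iota> ?f \<oplus>\<^bsub>?A\<^esub> ?z \<otimes>\<^bsub>?A\<^esub> ?z = J +>\<^bsub>Sz\<^esub> g"
      unfolding g_def by (simp only: pi.hom_add[OF monc[OF f] monc[OF P.one_closed], of 0 "zexp 2"])
    also have "\<dots> = \<zero>\<^bsub>?A\<^esub>" unfolding zero by (rule Sz.a_rcos_zero[OF J.is_ideal gJ])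
    finally have "?z \<otimes>\<^bsub>?A\<^esub> ?z \<oplus>\<^bsub>?A\<^esub> ?\<iota> ?f = \<zero>\<^bsub>?A\<^esub>" unfolding A.a_comm[OF zc] .
    then show "?z \<otimes>\<^bsub>?A\<^esub> ?z = \<ominus>\<^bsub>?A\<^esub> ?\<iota> ?f" by (rule A.minus_equality[OF _ zc(2,1), symmetric])
  next
    fix a assume "a \<in> carrier ?A"
    then have "a \<in> a_rcosets\<^bsub>Sz\<^esub> J" unfolding FactRing_def by (simp only: partial_object.select_convs(1))
    then obtain G where G: "G \<in> carrier Sz" "a = J +>\<^bsub>Sz\<^esub> G"
      unfolding A_RCOSETS_def' by blast
    have Gc: "G (zexp k) m \<in> carrier R" if "m \<in> E" for k m using qc[OF G(1)] that by blast
    define Q where "Q k = (\<lambda>m\<in>E. quot_coeff R d i (\<lambda>k. G (zexp k)) k m)" for k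
    have QP: "Q k \<in> carrier P" for k
      using quot_coeff_closed[of "\<lambda>k. G (zexp k)"] Gc by (auto simp: Q_def P_carrier)
    define q where "q = (\<lambda>m\<in>exponents {0 :: nat}. Q (m 0))"
    have q: "q \<in> carrier Sz" using QP by (auto simp: q_def SzP Z.P_carrier)
    have qk: "q (zexp k) = Q k" for k by (simp add: q_def)
    have rec: "?f \<otimes>\<^bsub>P\<^esub> Q (k + 2) \<oplus>\<^bsub>P\<^esub> Q k = G (zexp (k + 2))" for k
    proof (rule ps_eqI)
      fix m assume m: "m \<in> E"
      have md: "m - d \<in> E" using m by (rule diff_in_exponents)
      have "Q k m = G (zexp (k + 2)) m \<ominus> (if d \<le> m then Q (k + 2) (m - d) else \<zero>)"
        using quot_coeff.simps[of R d i "\<lambda>k. G (zexp k)" k m] m md d by (simp add: Q_def)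
      moreover have "(?f \<otimes>\<^bsub>P\<^esub> Q (k + 2)) m = (if d \<le> m then Q (k + 2) (m - d) else \<zero>)"
        using QP d m md by (simp add: coeff_mon_mult)
      ultimately show "(?f \<otimes>\<^bsub>P\<^esub> Q (k + 2) \<oplus>\<^bsub>P\<^esub> Q k) m = G (zexp (k + 2)) m"
        using m md QP Gc[OF m] by (auto simp: add_minus_cancel)
    qed (intro P.a_closed P.m_closed QP f qc[OF G(1)])+
    \<comment> \<open>Below z^2 the product of z^2 + f with the quotient receives contributions from
      f alone, so subtracting them gives the remainder.\<close>
    define s where "s = G (zexp 0) \<ominus>\<^bsub>P\<^esub> ?f \<otimes>\<^bsub>P\<^esub> Q 0"
    define t where "t = G (zexp 1) \<ominus>\<^bsub>P\<^esub> ?f \<otimes>\<^bsub>P\<^esub> Q 1"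
    have st: "s \<in> carrier P" "t \<in> carrier P" 
      unfolding s_def t_def by (intro P.minus_closed qc[OF G(1)] P.m_closed[OF f QP])+
    let ?e = "Z.mon 0 s \<oplus>\<^bsub>Sz\<^esub> Z.mon (zexp 1) t"
    have Geq: "G = g \<otimes>\<^bsub>Sz\<^esub> q \<oplus>\<^bsub>Sz\<^esub> ?e"
    proof (rule eqI[OF G(1)])
      show "g \<otimes>\<^bsub>Sz\<^esub> q \<oplus>\<^bsub>Sz\<^esub> ?e \<in> carrier Sz" using q gc elc[OF st] by auto
      fix k
      have fq: "?f \<otimes>\<^bsub>P\<^esub> Q k \<in> carrier P" for k using QP f by simp
      have "(g \<otimes>\<^bsub>Sz\<^esub> q \<oplus>\<^bsub>Sz\<^esub> ?e) (zexp k) = (g \<otimes>\<^bsub>Sz\<^esub> q) (zexp k) \<oplus>\<^bsub>P\<^esub> ?e (zexp k)"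
        by (simp add: SzP)
      also have "\<dots> = ?f \<otimes>\<^bsub>P\<^esub> Q k \<oplus>\<^bsub>P\<^esub> (if 2 \<le> k then Q (k - 2) else \<zero>\<^bsub>P\<^esub>)
          \<oplus>\<^bsub>P\<^esub> (if k = 0 then s else if k = 1 then t else \<zero>\<^bsub>P\<^esub>)"
        unfolding g_coeff[OF q] el_coeff[OF st] qk ..
      also have "\<dots> = G (zexp k)"
      proof -
        consider "k = 0" | "k = 1" | j where "k = j + 2"
          by (metis One_nat_def add_2_eq_Suc' not0_implies_Suc)
        then show ?thesis
        proof cases
          case 1
          then show ?thesis
            using P.add_minus_cancel[OF fq[of 0] qc[OF G(1), of 0]] fq[of 0] by (simp add: s_def)
        next
          case 2
          then show ?thesis
            using P.add_minus_cancel[OF fq[of 1] qc[OF G(1), of 1]] fq[of 1] by (simp add: t_def)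
        next
          case 3
          then show ?thesis using rec[of j] qc[OF G(1)] by simp
        qed
      qed
      finally show "G (zexp k) = (g \<otimes>\<^bsub>Sz\<^esub> q \<oplus>\<^bsub>Sz\<^esub> ?e) (zexp k)" by simp
    qed
    have "g \<otimes>\<^bsub>Sz\<^esub> q \<in> J" by (rule J.I_r_closed[OF gJ q])
    moreover have "G \<ominus>\<^bsub>Sz\<^esub> ?e = g \<otimes>\<^bsub>Sz\<^esub> q"
    proof -
      have "g \<otimes>\<^bsub>Sz\<^esub> q \<oplus>\<^bsub>Sz\<^esub> ?e \<ominus>\<^bsub>Sz\<^esub> ?e = g \<otimes>\<^bsub>Sz\<^esub> q"
        unfolding a_minus_def using elc[OF st] q gc by (simp add: Sz.a_assoc Sz.r_neg)
      then show ?thesis using Geq by simp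
    qed
    ultimately have "J +>\<^bsub>Sz\<^esub> G = J +>\<^bsub>Sz\<^esub> ?e"
      using Sz.quotient_eq_iff_same_a_r_cos[OF J.is_ideal G(1) elc[OF st]] by simp
    then show "\<exists>s\<in>carrier P. \<exists>t\<in>carrier P. a = ?\<iota> s \<oplus>\<^bsub>?A\<^esub> ?\<iota> t \<otimes>\<^bsub>?A\<^esub> ?z"
      using el[OF st] st G(2) by auto
  next
    fix s t assume s: "s \<in> carrier P" and t: "t \<in> carrier P"
      and "?\<iota> s \<oplus>\<^bsub>?A\<^esub> ?\<iota> t \<otimes>\<^bsub>?A\<^esub> ?z = \<zero>\<^bsub>?A\<^esub>"
    then have "J +>\<^bsub>Sz\<^esub> (Z.mon 0 s \<oplus>\<^bsub>Sz\<^esub> Z.mon (zexp 1) t) = J" using el[OF s t] zero by simp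
    then have "Z.mon 0 s \<oplus>\<^bsub>Sz\<^esub> Z.mon (zexp 1) t \<in> J" by (rule J.rcos_const_imp_mem[OF elc[OF s t]])
    then obtain q where q: "q \<in> carrier Sz" "Z.mon 0 s \<oplus>\<^bsub>Sz\<^esub> Z.mon (zexp 1) t = q \<otimes>\<^bsub>Sz\<^esub> g"
      unfolding J cgenideal_def by auto
    then have eq: "Z.mon 0 s \<oplus>\<^bsub>Sz\<^esub> Z.mon (zexp 1) t = g \<otimes>\<^bsub>Sz\<^esub> q" using Sz.m_comm[OF q(1) gc] by simp
    have coeff: "?f \<otimes>\<^bsub>P\<^esub> q (zexp k) \<oplus>\<^bsub>P\<^esub> (if 2 \<le> k then q (zexp (k - 2)) else \<zero>\<^bsub>P\<^esub>)
        = (if k = 0 then s else if k = 1 then t else \<zero>\<^bsub>P\<^esub>)" for k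
      using g_coeff[OF q(1), of k] el_coeff[OF s t, of k] eq by simp
    \<comment> \<open>From z^2 on the left side s + t z has no terms, so q_k = -f q_(k+2). The step
      lowers the exponent at \<open>i\<close> and raises \<open>k\<close>, hence the induction is on
      \<open>m i\<close> with \<open>k\<close> arbitrary.\<close>
    have "q (zexp k) m = \<zero>" if "m \<in> E" for k m
      using that
    proof (induction "m i" arbitrary: k m rule: less_induct)
      case less
      have md: "m - d \<in> E" using less.prems by (rule diff_in_exponents)
      have "?f \<otimes>\<^bsub>P\<^esub> q (zexp (k + 2)) \<oplus>\<^bsub>P\<^esub> q (zexp k) = \<zero>\<^bsub>P\<^esub>" using coeff[of "k + 2"] by simp
      then have "(?f \<otimes>\<^bsub>P\<^esub> q (zexp (k + 2)) \<oplus>\<^bsub>P\<^esub> q (zexp k)) m = \<zero>" using less.prems by simp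
      moreover have "(?f \<otimes>\<^bsub>P\<^esub> q (zexp (k + 2))) m = \<zero>"
      proof (cases "d \<le> m")
        case True
        then have "d i \<le> m i" by (simp add: le_fun_def)
        then have "(m - d) i < m i" using d by (simp add: fun_diff_def)
        then have "q (zexp (k + 2)) (m - d) = \<zero>" using less.hyps md by blast
        then show ?thesis using qc[OF q(1)] d less.prems by (simp add: coeff_mon_mult)
      qed (use qc[OF q(1)] d less.prems in \<open>simp add: coeff_mon_mult\<close>)
      ultimately show ?case using less.prems qc[OF q(1)] by simp
    qed
    then have q0: "q (zexp k) = \<zero>\<^bsub>P\<^esub>" for k by (intro ps_eqI qc[OF q(1)]) auto
    have fz: "?f \<otimes>\<^bsub>P\<^esub> \<zero>\<^bsub>P\<^esub> \<oplus>\<^bsub>P\<^esub> \<zero>\<^bsub>P\<^esub> = \<zero>\<^bsub>P\<^esub>" using f by simp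
    have "s = \<zero>\<^bsub>P\<^esub>" using coeff[of 0] unfolding q0 if_cancel fz by simp
    moreover have "t = \<zero>\<^bsub>P\<^esub>" using coeff[of 1] unfolding q0 if_cancel fz by simp
    ultimately show "s = \<zero>\<^bsub>P\<^esub> \<and> t = \<zero>\<^bsub>P\<^esub>" ..
  qed
qed

end

theorem theorem6p11:
  fixes K :: "('a, 'b) ring_scheme" and p n :: nat and d :: "nat \<Rightarrow> nat"
    and S :: "((nat \<Rightarrow> nat) \<Rightarrow> 'a) ring"
    and Sz :: "((nat \<Rightarrow> nat) \<Rightarrow> ((nat \<Rightarrow> nat) \<Rightarrow> 'a)) ring"
  assumes "field K"
    and "Factorial_Ring.prime p" and "p > 2" and "has_characteristic K p"
    and "ring.finite_dimension K (pth_powers p K) (carrier K)"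
    and "n \<ge> 1"
    and "\<And>j. j \<in> {1..n} \<Longrightarrow> d j > 0"
    and "S = power_series_ring K {1..n}"
    and "f = (\<Otimes>\<^bsub>S\<^esub>j\<in>{1..n}. ps_var K {1..n} j [^]\<^bsub>S\<^esub> d j)"
    and "Sz = power_series_ring S {0}"
    and "z = ps_var S {0} 0"
    and "A = Sz Quot (PIdl\<^bsub>Sz\<^esub> (ps_const S {0} f \<oplus>\<^bsub>Sz\<^esub> z [^]\<^bsub>Sz\<^esub> (2::nat)))"
  shows "((\<forall>j\<in>{1..n}. d j = 1) \<longrightarrow> has_F_signature p A (1 / 2 ^ (n - 1))) \<and>
         (Max (d ` {1..n}) \<ge> 2 \<longrightarrow> has_F_signature p A 0)"
proof -
  let ?I = "{1..n}"
  interpret K: field K by fact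
  interpret ps: power_series K ?I
    by (intro power_series.intro power_series_axioms.intro K.is_cring) simp
  have char: "char_cring K p"
    by (intro char_cring.intro char_cring_axioms.intro K.is_cring assms(2,4))
  let ?N = "ring.dim K (pth_powers p K) (carrier K)"
  obtain b where b: "frobenius_field K p ?N b"
    using K.exists_frobenius_basis[OF char assms(5)] by blast
  have dim: "ring.dimension K ?N (pth_powers p K) (carrier K)"
    using K.finite_dimensionE[OF K.pth_powers_subfield[OF char] assms(5)] by (simp add: over_def)
  \<comment> \<open>The infinitude of the primes supplies distinct weights for the
    variables.\<close>
  obtain w :: "nat \<Rightarrow> nat" where w: "inj w" "range w \<subseteq> {q. Factorial_Ring.prime q}"
    using infinite_countable_subset[OF primes_infinite] by blast
  \<comment> \<open>\<open>d\<close> is arbitrary off the index set, whereas an exponent vector has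
    to vanish there.\<close>
  define D where "D i = (if i \<in> ?I then d i else 0)" for i
  have DE: "D \<in> exponents ?I" by (auto simp: D_def exponents_def)
  have Dpos: "D i > 0" if "i \<in> ?I" for i using assms(7)[OF that] that by (simp add: D_def)
  have uE: "(\<lambda>i. if i = j then 1 else 0) \<in> exponents ?I" if "j \<in> ?I" for j
    using that by (auto simp: exponents_def)
  have "ps_var K ?I j [^]\<^bsub>S\<^esub> d j = ps.mon (\<lambda>i. if i = j then d j else 0) \<one>\<^bsub>K\<^esub>" if "j \<in> ?I" for j
    unfolding assms(8) ps.ps_var_eq_mon using ps.mon_pow[OF K.one_closed uE[OF that], of "d j"]
    by (simp add: if_distrib[of "\<lambda>x. d j * x"] cong: if_cong)
  then have "f = (\<Otimes>\<^bsub>S\<^esub>j\<in>?I. ps.mon (\<lambda>i. if i = j then d j else 0) \<one>\<^bsub>K\<^esub>)"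
    unfolding assms(9) assms(8)
    by (intro ps.P.finprod_cong' refl funcsetI ps.mon_closed K.one_closed)
  also have "\<dots> = ps.mon (\<lambda>i. \<Sum>j\<in>?I. if i = j then d j else 0) \<one>\<^bsub>K\<^esub>"
    unfolding assms(8) by (rule ps.mon_finprod) (auto simp: exponents_def)
  also have "(\<lambda>i. \<Sum>j\<in>?I. if i = j then d j else 0) = D" by (auto simp: D_def fun_eq_iff)
  finally have f: "f = ps.mon D \<one>\<^bsub>K\<^esub>" .
  have I1: "1 \<in> ?I" using assms(6) by simp
  have "quadratic_extension ps.P A
      (\<lambda>s. (PIdl\<^bsub>Sz\<^esub> (ps_const S {0} f \<oplus>\<^bsub>Sz\<^esub> z [^]\<^bsub>Sz\<^esub> (2::nat))) +>\<^bsub>Sz\<^esub> ps_const S {0} s)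
      ((PIdl\<^bsub>Sz\<^esub> (ps_const S {0} f \<oplus>\<^bsub>Sz\<^esub> z [^]\<^bsub>Sz\<^esub> (2::nat))) +>\<^bsub>Sz\<^esub> z) f"
    unfolding assms(12) unfolding assms(11,10) unfolding assms(8) f
    by (rule ps.hypersurface_quadratic_extension[OF DE I1 Dpos[OF I1]])
  then interpret hypersurface K ?I w p ?N b A
      "\<lambda>s. (PIdl\<^bsub>Sz\<^esub> (ps_const S {0} f \<oplus>\<^bsub>Sz\<^esub> z [^]\<^bsub>Sz\<^esub> (2::nat))) +>\<^bsub>Sz\<^esub> ps_const S {0} s"
      "(PIdl\<^bsub>Sz\<^esub> (ps_const S {0} f \<oplus>\<^bsub>Sz\<^esub> z [^]\<^bsub>Sz\<^esub> (2::nat))) +>\<^bsub>Sz\<^esub> z" f D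
    using w b Dpos DE f assms(3) I1
    by (intro hypersurface.intro hypersurface_axioms.intro frobenius_series.intro
        field_power_series.intro field_power_series_axioms.intro ps.power_series_axioms assms(1))
      (auto intro: inj_on_subset)
  show ?thesis
  proof (intro conjI impI)
    assume "\<forall>j\<in>?I. d j = 1"
    then have "has_F_signature p A (1 / 2 ^ (card ?I - 1))"
      by (intro signature_one[OF dim]) (simp add: D_def)
    then show "has_F_signature p A (1 / 2 ^ (n - 1))" by simp
  next
    assume "Max (d ` ?I) \<ge> 2"
    moreover have "Max (d ` ?I) \<in> d ` ?I" using I1 by (intro Max_in) auto
    ultimately obtain j where j: "j \<in> ?I" "d j \<ge> 2" by auto
    then show "has_F_signature p A 0"
      by (intro signature_zero[OF dim, of j]) (simp_all add: D_def)
  qed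
qed

end
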